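(* Let $\mathcal B\subset\mathscr B(G)$ be a von Neumann algebra acting non-degenerately on a Hilbert space $G$, with commutant $\mathcal B'\subset\mathscr B(G)$. Consider triples $(H,\rho,\rho')$ consisting of a Hilbert space $H$, a normal unital representation $\rho$ of $\mathcal B$ on $H$ and a normal unital representation $\rho'$ of $\mathcal B'$ on $H$ such that $\rho(b)\rho'(b')=\rho'(b')\rho(b)$ for all $b\in\mathcal B$, $b'\in\mathcal B'$. There are one-to-one correspondences (equivalences) $$E\;\longleftrightarrow\;(H,\rho,\rho')\;\longleftrightarrow\;E'$$ between von Neumann $\mathcal B$-$\mathcal B$-modules $E$ (with bounded $\mathcal B$-$\mathcal B$-bilinear mappings as morphisms), such triples (with bounded operators intertwining both representations as morphisms) and von Neumann $\mathcal B'$-$\mathcal B'$-modules $E'$ (with bounded $\mathcal B'$-$\mathcal B'$-bilinear mappings as morphisms). They are given as follows. (1) A von Neumann $\mathcal B$-$\mathcal B$-module $E$ is sent to $H=E\odot G$ with $\rho(b)(x\odot g)=bx\odot g$ and $\rho'(b')(x\odot g)=x\odot b'g$. Conversely, $(H,\rho,\rho')$ is sent to $$C_{\mathcal B'}(\mathscr B(G,H))=\{x\in\mathscr B(G,H):\rho'(b')x=xb'\ \text{for all } b'\in\mathcal B'\},$$ with inner product $\langle x,y\rangle=x^*y\in\mathcal B$, right action $(x,b)\mapsto xb$ and left action $(b,x)\mapsto\rho(b)x$. (2) Symmetrically, $(H,\rho,\rho')$ is sent to the von Neumann $\mathcal B'$-$\mathcal B'$-module $$E'=C_{\mathcal B}(\mathscr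 B(G,H))=\{x'\in\mathscr B(G,H):\rho(b)x'=x'b\ \text{for all } b\in\mathcal B\},$$ with inner product $\langle x',y'\rangle=x'^*y'\in\mathcal B'$, right action $(x',b')\mapsto x'b'$ and left action $(b',x')\mapsto\rho'(b')x'$. Conversely, a von Neumann $\mathcal B'$-$\mathcal B'$-module is sent to its tensor product over $\mathcal B'$ with $G$, with the representations $\rho'(b')(x'\odot g)=b'x'\odot g$ and $\rho(b)(x'\odot g)=x'\odot bg$.
   Context: All representations act non-degenerately. Let $\mathcal B\subset\mathscr B(G)$ be a von Neumann algebra. For a (right) Hilbert $\mathcal B$-module $E$, the Hilbert space $H=E\odot G$ is the (interior) tensor product over $\mathcal B$, with inner product $\langle x\odot g,y\odot h\rangle=\langle g,\langle x,y\rangle h\rangle$. Each $x\in E$ is identified with the operator $L_x\in\mathscr B(G,H)$, $L_xg=x\odot g$, so that $\langle x,y\rangle=L_x^*L_y$, $L_{xb}=L_xb$ and $E\subset\mathscr B(G,H)$. $E$ is a von Neumann $\mathcal B$-module if it is strongly closed in $\mathscr B(G,H)$. $\mathscr B^a(E)$ denotes the algebra of adjointable mappings on $E$; it acts faithfully on $H$ by $\pi(a)(x\odot g)=ax\odot g$. For a von Neumann algebra $\mathcal A$, a von Neumann $\mathcal A$-$\mathcal B$-module is a von Neumann $\mathcal B$-module $E$ with a left action of $\mathcal A$, given by a unital $*$-homomorphism $\mathcal A\to\mathscr B^a(E)$, such that the composition $\mathcal A\to\mathscr B^a(E)\to\mathscr B(H)$ is normal. Von Neumann modules over $\mathcal B'\subset\mathscr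 B(G)$ are defined in the same way with $\mathcal B'$ in place of $\mathcal B$. Modules are always regarded as concrete operator spaces through the identification $x=L_x$. The module $E'$ is called the commutant of $E$. *)

theory Defs
  imports "HOL-Analysis.Analysis" "HOL-Library.Function_Algebras"
begin

section \<open>Complex vector spaces\<close>

class scaleC =
  fixes scaleC :: "complex \<Rightarrow> 'a \<Rightarrow> 'a"  (infixr "*\<^sub>C" 75)

class complex_vector = scaleC + ab_group_add +
  assumes scaleC_add_right: "a *\<^sub>C (x + y) = a *\<^sub>C x + a *\<^sub>C y"
    and scaleC_add_left: "(a + b) *\<^sub>C x = a *\<^sub>C x + b *\<^sub>C x"
    and scaleC_scaleC: "a *\<^sub>C b *\<^sub>C x = (a * b) *\<^sub>C x"
    and scaleC_one: "1 *\<^sub>C x = x"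

global_interpretation complex_vector: vector_space "scaleC :: complex \<Rightarrow> 'a \<Rightarrow> 'a::complex_vector"
  by unfold_locales (fact scaleC_add_right scaleC_add_left scaleC_scaleC scaleC_one)+

instantiation complex :: complex_vector
begin
definition scaleC_complex :: "complex \<Rightarrow> complex \<Rightarrow> complex" where
  "scaleC_complex c z = c * z"
instance
  by standard (simp_all add: scaleC_complex_def algebra_simps)
end

instantiation "fun" :: (type, complex_vector) complex_vector
begin
definition scaleC_fun :: "complex \<Rightarrow> ('a \<Rightarrow> 'b) \<Rightarrow> 'a \<Rightarrow> 'b" where
  "scaleC_fun c f = (\<lambda>x. c *\<^sub>C f x)"
instance
  by standard
    (simp_all add: scaleC_fun_def fun_eq_iff scaleC_add_right scaleC_add_left scaleC_scaleC scaleC_one)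
end


section \<open>Hilbert spaces and bounded operators\<close>

text \<open>
  Hilbert spaces are linear subspaces of an ambient complex vector space, with an inner product
  of their own.  Working with carriers rather than types is needed because the tensor product
  \<open>E \<odot> G\<close> depends on the module \<open>E\<close>.  Inner products are linear in the second argument.
\<close>

record 'a hilbert =
  hset :: "'a set"
  hip :: "'a \<Rightarrow> 'a \<Rightarrow> complex"

definition hnorm :: "'a hilbert \<Rightarrow> 'a \<Rightarrow> real" where
  "hnorm H x = sqrt (Re (hip H x x))"

text \<open>The value off the carrier is fixed so that the locale \<^locale>\<open>Metric_space\<close> applies.\<close>

definition hdist :: "'a::ab_group_add hilbert \<Rightarrow> 'a \<Rightarrow> 'a \<Rightarrow> real" where
  "hdist H x y = (if x \<in> hset H \<and> y \<in> hset H then hnorm H (x - y) else 0)"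

definition htop :: "'a::ab_group_add hilbert \<Rightarrow> 'a topology" where
  "htop H = Metric_space.mtopology (hset H) (hdist H)"

definition is_hilbert :: "'a::complex_vector hilbert \<Rightarrow> bool" where
  "is_hilbert H \<longleftrightarrow>
     complex_vector.subspace (hset H) \<and>
     (\<forall>x\<in>hset H. \<forall>y\<in>hset H. \<forall>z\<in>hset H. hip H x (y + z) = hip H x y + hip H x z) \<and>
     (\<forall>x\<in>hset H. \<forall>y\<in>hset H. \<forall>c. hip H x (c *\<^sub>C y) = c * hip H x y) \<and>
     (\<forall>x\<in>hset H. \<forall>y\<in>hset H. hip H y x = cnj (hip H x y)) \<and>
     (\<forall>x\<in>hset H. hip H x x \<in> \<real>\<^sub>\<ge>\<^sub>0) \<and>
     (\<forall>x\<in>hset H. hip H x x = 0 \<longrightarrow> x = 0) \<and>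
     Metric_space.mcomplete (hset H) (hdist H)"

text \<open>
  Maps between carriers are represented by total functions that vanish off the domain.  In this way
  equality of maps is equality of functions, and the maps form a linear subspace of the function type.
\<close>

definition lin_maps :: "'a::complex_vector set \<Rightarrow> 'b::complex_vector set \<Rightarrow> ('a \<Rightarrow> 'b) set" where
  "lin_maps S T = {f. (\<forall>x. x \<notin> S \<longrightarrow> f x = 0) \<and> f ` S \<subseteq> T \<and>
     (\<forall>x\<in>S. \<forall>y\<in>S. f (x + y) = f x + f y) \<and> (\<forall>x\<in>S. \<forall>c. f (c *\<^sub>C x) = c *\<^sub>C f x)}"

definition id_on :: "'a::zero set \<Rightarrow> 'a \<Rightarrow> 'a" where
  "id_on S = (\<lambda>x. if x \<in> S then x else 0)"

definition bop :: "'a::complex_vector hilbert \<Rightarrow> 'b::complex_vector hilbert \<Rightarrow> ('a \<Rightarrow> 'b) set" where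
  "bop G H = {T \<in> lin_maps (hset G) (hset H). \<exists>K. \<forall>x\<in>hset G. hnorm H (T x) \<le> K * hnorm G x}"

definition opnorm :: "'a::complex_vector hilbert \<Rightarrow> 'b::complex_vector hilbert \<Rightarrow> ('a \<Rightarrow> 'b) \<Rightarrow> real" where
  "opnorm G H T = Sup {hnorm H (T x) |x. x \<in> hset G \<and> hnorm G x \<le> 1}"

definition adj :: "'a::complex_vector hilbert \<Rightarrow> 'b::complex_vector hilbert \<Rightarrow> ('a \<Rightarrow> 'b) \<Rightarrow> 'b \<Rightarrow> 'a" where
  "adj G H T = (THE S. S \<in> bop H G \<and> (\<forall>x\<in>hset G. \<forall>y\<in>hset H. hip G (S y) x = hip H y (T x)))"

definition unitary_op :: "'a::complex_vector hilbert \<Rightarrow> 'b::complex_vector hilbert \<Rightarrow> ('a \<Rightarrow> 'b) \<Rightarrow> bool" where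
  "unitary_op G H U \<longleftrightarrow> U \<in> bop G H \<and> bij_betw U (hset G) (hset H) \<and>
     (\<forall>x\<in>hset G. \<forall>y\<in>hset G. hip H (U x) (U y) = hip G x y)"

text \<open>
  The strong operator topology is the topology of pointwise norm convergence, as in
  \<^const>\<open>strong_operator_topology\<close>.  The \<open>\<sigma>\<close>-weak topology is the initial topology for the functionals
  \<open>T \<mapsto> \<Sum>n. \<langle>h\<^sub>n, T k\<^sub>n\<rangle>\<close> with square-summable \<open>h\<close> and \<open>k\<close>.
\<close>

definition strong_top :: "'a::complex_vector hilbert \<Rightarrow> 'b::complex_vector hilbert \<Rightarrow> ('a \<Rightarrow> 'b) topology" where
  "strong_top G H = pullback_topology (bop G H) (\<lambda>T. restrict T (hset G))
     (product_topology (\<lambda>_. htop H) (hset G))"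

definition square_summable :: "'a hilbert \<Rightarrow> (nat \<Rightarrow> 'a) \<Rightarrow> bool" where
  "square_summable H h \<longleftrightarrow> range h \<subseteq> hset H \<and> summable (\<lambda>n. (hnorm H (h n))\<^sup>2)"

definition sigma_weak_top :: "'a::complex_vector hilbert \<Rightarrow> ('a \<Rightarrow> 'a) topology" where
  "sigma_weak_top H = topology_generated_by
     {{T \<in> bop H H. (\<Sum>n. hip H (h n) (T (k n))) \<in> U} |h k U.
        square_summable H h \<and> square_summable H k \<and> open U}"


section \<open>Von Neumann algebras and their representations\<close>

definition von_neumann_algebra :: "'g::complex_vector hilbert \<Rightarrow> ('g \<Rightarrow> 'g) set \<Rightarrow> bool" where
  "von_neumann_algebra G B \<longleftrightarrow>
     complex_vector.subspace B \<and> B \<subseteq> bop G G \<and>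
     (\<forall>a\<in>B. \<forall>b\<in>B. a \<circ> b \<in> B) \<and> (\<forall>a\<in>B. adj G G a \<in> B) \<and>
     closedin (strong_top G G) B"

definition nondegenerate :: "'g::complex_vector hilbert \<Rightarrow> ('g \<Rightarrow> 'g) set \<Rightarrow> bool" where
  "nondegenerate G B \<longleftrightarrow>
     htop G closure_of complex_vector.span {b g |b g. b \<in> B \<and> g \<in> hset G} = hset G"

definition commutant :: "'g::complex_vector hilbert \<Rightarrow> ('g \<Rightarrow> 'g) set \<Rightarrow> ('g \<Rightarrow> 'g) set" where
  "commutant G B = {T \<in> bop G G. \<forall>b\<in>B. T \<circ> b = b \<circ> T}"

definition normal_map :: "'k::complex_vector hilbert \<Rightarrow> ('k \<Rightarrow> 'k) set \<Rightarrow> 'h::complex_vector hilbert \<Rightarrow>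
    (('k \<Rightarrow> 'k) \<Rightarrow> 'h \<Rightarrow> 'h) \<Rightarrow> bool" where
  "normal_map K A H \<pi> \<longleftrightarrow> continuous_map (subtopology (sigma_weak_top K) A) (sigma_weak_top H) \<pi>"

definition normal_unital_rep :: "'k::complex_vector hilbert \<Rightarrow> ('k \<Rightarrow> 'k) set \<Rightarrow> 'h::complex_vector hilbert \<Rightarrow>
    (('k \<Rightarrow> 'k) \<Rightarrow> 'h \<Rightarrow> 'h) \<Rightarrow> bool" where
  "normal_unital_rep K A H \<pi> \<longleftrightarrow>
     (\<forall>a\<in>A. \<pi> a \<in> bop H H) \<and>
     (\<forall>a\<in>A. \<forall>b\<in>A. \<pi> (a + b) = \<pi> a + \<pi> b) \<and>
     (\<forall>a\<in>A. \<forall>c. \<pi> (c *\<^sub>C a) = c *\<^sub>C \<pi> a) \<and>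
     (\<forall>a\<in>A. \<forall>b\<in>A. \<pi> (a \<circ> b) = \<pi> a \<circ> \<pi> b) \<and>
     (\<forall>a\<in>A. \<pi> (adj K K a) = adj H H (\<pi> a)) \<and>
     \<pi> (id_on (hset K)) = id_on (hset H) \<and>
     normal_map K A H \<pi>"


section \<open>Hilbert modules and the interior tensor product\<close>

text \<open>
  In \<open>bimodule\<close> the left action is by operators on a Hilbert space with vectors in \<open>'k\<close>; the right
  action and the inner product refer to operators on a Hilbert space with vectors in \<open>'g\<close>.
\<close>

record ('e, 'g) hmodule =
  mset :: "'e set"
  mip :: "'e \<Rightarrow> 'e \<Rightarrow> 'g \<Rightarrow> 'g"
  ract :: "'e \<Rightarrow> ('g \<Rightarrow> 'g) \<Rightarrow> 'e"

record ('e, 'g, 'k) bimodule = "('e, 'g) hmodule" +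
  lact :: "('k \<Rightarrow> 'k) \<Rightarrow> 'e \<Rightarrow> 'e"

definition mnorm :: "'g::complex_vector hilbert \<Rightarrow> ('e, 'g, 'z) hmodule_scheme \<Rightarrow> 'e \<Rightarrow> real" where
  "mnorm G E x = sqrt (opnorm G G (mip E x x))"

definition mdist :: "'g::complex_vector hilbert \<Rightarrow> ('e::ab_group_add, 'g, 'z) hmodule_scheme \<Rightarrow> 'e \<Rightarrow> 'e \<Rightarrow> real" where
  "mdist G E x y = (if x \<in> mset E \<and> y \<in> mset E then mnorm G E (x - y) else 0)"

definition hilbert_module :: "'g::complex_vector hilbert \<Rightarrow> ('g \<Rightarrow> 'g) set \<Rightarrow>
    ('e::complex_vector, 'g, 'z) hmodule_scheme \<Rightarrow> bool" where
  "hilbert_module G B E \<longleftrightarrow>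
     complex_vector.subspace (mset E) \<and>
     (\<forall>x\<in>mset E. \<forall>b\<in>B. ract E x b \<in> mset E) \<and>
     (\<forall>x\<in>mset E. \<forall>y\<in>mset E. \<forall>b\<in>B. ract E (x + y) b = ract E x b + ract E y b) \<and>
     (\<forall>x\<in>mset E. \<forall>a\<in>B. \<forall>b\<in>B. ract E x (a + b) = ract E x a + ract E x b) \<and>
     (\<forall>x\<in>mset E. \<forall>b\<in>B. \<forall>c. ract E (c *\<^sub>C x) b = c *\<^sub>C ract E x b \<and>
                            ract E x (c *\<^sub>C b) = c *\<^sub>C ract E x b) \<and>
     (\<forall>x\<in>mset E. \<forall>a\<in>B. \<forall>b\<in>B. ract E (ract E x a) b = ract E x (a \<circ> b)) \<and>
     (\<forall>x\<in>mset E. \<forall>y\<in>mset E. mip E x y \<in> B) \<and>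
     (\<forall>x\<in>mset E. \<forall>y\<in>mset E. \<forall>z\<in>mset E. mip E x (y + z) = mip E x y + mip E x z) \<and>
     (\<forall>x\<in>mset E. \<forall>y\<in>mset E. \<forall>c. mip E x (c *\<^sub>C y) = c *\<^sub>C mip E x y) \<and>
     (\<forall>x\<in>mset E. \<forall>y\<in>mset E. \<forall>b\<in>B. mip E x (ract E y b) = mip E x y \<circ> b) \<and>
     (\<forall>x\<in>mset E. \<forall>y\<in>mset E. mip E y x = adj G G (mip E x y)) \<and>
     (\<forall>x\<in>mset E. \<forall>g\<in>hset G. hip G g (mip E x x g) \<in> \<real>\<^sub>\<ge>\<^sub>0) \<and>
     (\<forall>x\<in>mset E. mip E x x = 0 \<longrightarrow> x = 0) \<and>
     Metric_space.mcomplete (mset E) (mdist G E)"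

text \<open>
  An interior tensor product of \<open>E\<close> and \<open>G\<close>.  The inner product formula makes \<open>t\<close> bilinear and balanced
  over \<open>B\<close>, and together with totality it determines \<open>(H, t)\<close> up to a unique unitary.
\<close>

definition is_interior_tensor :: "'g::complex_vector hilbert \<Rightarrow> ('e::complex_vector, 'g, 'z) hmodule_scheme \<Rightarrow>
    'h::complex_vector hilbert \<Rightarrow> ('e \<Rightarrow> 'g \<Rightarrow> 'h) \<Rightarrow> bool" where
  "is_interior_tensor G E H t \<longleftrightarrow>
     is_hilbert H \<and>
     (\<forall>x\<in>mset E. \<forall>g\<in>hset G. t x g \<in> hset H) \<and>
     (\<forall>x\<in>mset E. \<forall>y\<in>mset E. \<forall>g\<in>hset G. \<forall>h\<in>hset G.
        hip H (t x g) (t y h) = hip G g (mip E x y h)) \<and>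
     htop H closure_of complex_vector.span {t x g |x g. x \<in> mset E \<and> g \<in> hset G} = hset H"

text \<open>
  \<open>E \<odot> G\<close> is a fixed choice of such a pair.  The type \<open>'e \<times> 'g \<Rightarrow> complex\<close> is large enough:
  it contains the completion of the space spanned by the functions
  \<open>x \<odot> g = (\<lambda>(y, h). \<langle>h, \<langle>y, x\<rangle> g\<rangle>)\<close>.
\<close>

definition interior_tensor :: "'g::complex_vector hilbert \<Rightarrow> ('e::complex_vector, 'g, 'z) hmodule_scheme \<Rightarrow>
    ('e \<times> 'g \<Rightarrow> complex) hilbert \<times> ('e \<Rightarrow> 'g \<Rightarrow> 'e \<times> 'g \<Rightarrow> complex)" where
  "interior_tensor G E = (SOME (H, t). is_interior_tensor G E H t)"

definition tspace :: "'g::complex_vector hilbert \<Rightarrow> ('e::complex_vector, 'g, 'z) hmodule_scheme \<Rightarrow>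
    ('e \<times> 'g \<Rightarrow> complex) hilbert" where
  "tspace G E = fst (interior_tensor G E)"

definition tens :: "'g::complex_vector hilbert \<Rightarrow> ('e::complex_vector, 'g, 'z) hmodule_scheme \<Rightarrow>
    'e \<Rightarrow> 'g \<Rightarrow> 'e \<times> 'g \<Rightarrow> complex" where
  "tens G E = snd (interior_tensor G E)"

text \<open>The operator \<open>L\<^sub>x : g \<mapsto> x \<odot> g\<close>, and the embedding \<open>x \<mapsto> L\<^sub>x\<close> of \<open>E\<close> into \<open>\<B>(G, E \<odot> G)\<close>.\<close>

definition Lop :: "'g::complex_vector hilbert \<Rightarrow> ('e::complex_vector, 'g, 'z) hmodule_scheme \<Rightarrow>
    'e \<Rightarrow> 'g \<Rightarrow> 'e \<times> 'g \<Rightarrow> complex" where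
  "Lop G E x = (\<lambda>g. if g \<in> hset G then tens G E x g else 0)"

definition Lmap :: "'g::complex_vector hilbert \<Rightarrow> ('e::complex_vector, 'g, 'z) hmodule_scheme \<Rightarrow>
    'e \<Rightarrow> 'g \<Rightarrow> 'e \<times> 'g \<Rightarrow> complex" where
  "Lmap G E = (\<lambda>x. if x \<in> mset E then Lop G E x else 0)"

text \<open>The operators \<open>a \<odot> id\<close> and \<open>id \<odot> c\<close>; the case \<open>E\<^sub>1 = E\<^sub>2\<close> of the former is the representation \<open>\<pi>\<close>
  of the adjointable operators.\<close>

definition tens_left :: "'g::complex_vector hilbert \<Rightarrow> ('e::complex_vector, 'g, 'z) hmodule_scheme \<Rightarrow>
    ('f::complex_vector, 'g, 'y) hmodule_scheme \<Rightarrow> ('e \<Rightarrow> 'f) \<Rightarrow> ('e \<times> 'g \<Rightarrow> complex) \<Rightarrow> 'f \<times> 'g \<Rightarrow> complex" where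
  "tens_left G E1 E2 a = (THE T. T \<in> bop (tspace G E1) (tspace G E2) \<and>
     (\<forall>x\<in>mset E1. \<forall>g\<in>hset G. T (tens G E1 x g) = tens G E2 (a x) g))"

definition tens_right :: "'g::complex_vector hilbert \<Rightarrow> ('e::complex_vector, 'g, 'z) hmodule_scheme \<Rightarrow>
    ('g \<Rightarrow> 'g) \<Rightarrow> ('e \<times> 'g \<Rightarrow> complex) \<Rightarrow> 'e \<times> 'g \<Rightarrow> complex" where
  "tens_right G E c = (THE T. T \<in> bop (tspace G E) (tspace G E) \<and>
     (\<forall>x\<in>mset E. \<forall>g\<in>hset G. T (tens G E x g) = tens G E x (c g)))"


section \<open>Von Neumann modules\<close>

definition von_neumann_module :: "'g::complex_vector hilbert \<Rightarrow> ('g \<Rightarrow> 'g) set \<Rightarrow>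
    ('e::complex_vector, 'g, 'z) hmodule_scheme \<Rightarrow> bool" where
  "von_neumann_module G B E \<longleftrightarrow>
     hilbert_module G B E \<and> closedin (strong_top G (tspace G E)) (Lop G E ` mset E)"

text \<open>The second conjunct says that \<open>a\<close> acts by an adjointable operator whose adjoint is the action of \<open>a\<^sup>*\<close>;
  (complex and right) linearity of the action of \<open>a\<close> is a consequence.\<close>

definition unital_left_action :: "'k::complex_vector hilbert \<Rightarrow> ('k \<Rightarrow> 'k) set \<Rightarrow>
    ('e::complex_vector, 'g, 'k) bimodule \<Rightarrow> bool" where
  "unital_left_action K A E \<longleftrightarrow>
     (\<forall>a\<in>A. \<forall>x\<in>mset E. lact E a x \<in> mset E) \<and>
     (\<forall>a\<in>A. \<forall>x\<in>mset E. \<forall>y\<in>mset E. mip E x (lact E a y) = mip E (lact E (adj K K a) x) y) \<and>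
     (\<forall>a\<in>A. \<forall>b\<in>A. \<forall>x\<in>mset E. lact E (a + b) x = lact E a x + lact E b x) \<and>
     (\<forall>a\<in>A. \<forall>c. \<forall>x\<in>mset E. lact E (c *\<^sub>C a) x = c *\<^sub>C lact E a x) \<and>
     (\<forall>a\<in>A. \<forall>b\<in>A. \<forall>x\<in>mset E. lact E (a \<circ> b) x = lact E a (lact E b x)) \<and>
     (\<forall>x\<in>mset E. lact E (id_on (hset K)) x = x)"

definition von_neumann_bimodule :: "'k::complex_vector hilbert \<Rightarrow> ('k \<Rightarrow> 'k) set \<Rightarrow>
    'g::complex_vector hilbert \<Rightarrow> ('g \<Rightarrow> 'g) set \<Rightarrow> ('e::complex_vector, 'g, 'k) bimodule \<Rightarrow> bool" where
  "von_neumann_bimodule K A G B E \<longleftrightarrow>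
     von_neumann_module G B E \<and> unital_left_action K A E \<and>
     normal_map K A (tspace G E) (\<lambda>a. tens_left G E E (lact E a))"

definition bilinear_maps :: "('k \<Rightarrow> 'k) set \<Rightarrow> 'g::complex_vector hilbert \<Rightarrow> ('g \<Rightarrow> 'g) set \<Rightarrow>
    ('e::complex_vector, 'g, 'k) bimodule \<Rightarrow> ('f::complex_vector, 'g, 'k) bimodule \<Rightarrow> ('e \<Rightarrow> 'f) set" where
  "bilinear_maps A G B E1 E2 = {f \<in> lin_maps (mset E1) (mset E2).
     (\<forall>x\<in>mset E1. \<forall>b\<in>B. f (ract E1 x b) = ract E2 (f x) b) \<and>
     (\<forall>x\<in>mset E1. \<forall>a\<in>A. f (lact E1 a x) = lact E2 a (f x)) \<and>
     (\<exists>K. \<forall>x\<in>mset E1. mnorm G E2 (f x) \<le> K * mnorm G E1 x)}"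

definition bimodule_iso :: "('k \<Rightarrow> 'k) set \<Rightarrow> 'g::complex_vector hilbert \<Rightarrow> ('g \<Rightarrow> 'g) set \<Rightarrow>
    ('e::complex_vector, 'g, 'k) bimodule \<Rightarrow> ('f::complex_vector, 'g, 'k) bimodule \<Rightarrow> ('e \<Rightarrow> 'f) \<Rightarrow> bool" where
  "bimodule_iso A G B E1 E2 f \<longleftrightarrow>
     f \<in> bilinear_maps A G B E1 E2 \<and> bij_betw f (mset E1) (mset E2) \<and>
     (\<forall>x\<in>mset E1. \<forall>y\<in>mset E1. mip E2 (f x) (f y) = mip E1 x y)"


section \<open>Commuting pairs of representations\<close>

record ('g, 'h) triple =
  sp :: "'h hilbert"
  rho :: "('g \<Rightarrow> 'g) \<Rightarrow> 'h \<Rightarrow> 'h"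
  rho' :: "('g \<Rightarrow> 'g) \<Rightarrow> 'h \<Rightarrow> 'h"

definition is_triple :: "'g::complex_vector hilbert \<Rightarrow> ('g \<Rightarrow> 'g) set \<Rightarrow> ('g, 'h::complex_vector) triple \<Rightarrow> bool" where
  "is_triple G B T \<longleftrightarrow>
     is_hilbert (sp T) \<and>
     normal_unital_rep G B (sp T) (rho T) \<and>
     normal_unital_rep G (commutant G B) (sp T) (rho' T) \<and>
     (\<forall>b\<in>B. \<forall>b'\<in>commutant G B. rho T b \<circ> rho' T b' = rho' T b' \<circ> rho T b)"

definition triple_maps :: "'g::complex_vector hilbert \<Rightarrow> ('g \<Rightarrow> 'g) set \<Rightarrow>
    ('g, 'h::complex_vector) triple \<Rightarrow> ('g, 'i::complex_vector) triple \<Rightarrow> ('h \<Rightarrow> 'i) set" where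
  "triple_maps G B T1 T2 = {U \<in> bop (sp T1) (sp T2).
     (\<forall>b\<in>B. U \<circ> rho T1 b = rho T2 b \<circ> U) \<and>
     (\<forall>b'\<in>commutant G B. U \<circ> rho' T1 b' = rho' T2 b' \<circ> U)}"

definition triple_iso :: "'g::complex_vector hilbert \<Rightarrow> ('g \<Rightarrow> 'g) set \<Rightarrow>
    ('g, 'h::complex_vector) triple \<Rightarrow> ('g, 'i::complex_vector) triple \<Rightarrow> ('h \<Rightarrow> 'i) \<Rightarrow> bool" where
  "triple_iso G B T1 T2 U \<longleftrightarrow> U \<in> triple_maps G B T1 T2 \<and> unitary_op (sp T1) (sp T2) U"


section \<open>The functors\<close>

text \<open>On morphisms, the functors from modules to triples are \<open>a \<mapsto> a \<odot> id\<close> (\<^const>\<open>tens_left\<close>), and those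
  from triples to modules are composition \<open>x \<mapsto> U \<circ> x\<close> (\<open>post_comp\<close>).\<close>

definition triple_of_module :: "'g::complex_vector hilbert \<Rightarrow> ('e::complex_vector, 'g, 'g) bimodule \<Rightarrow>
    ('g, 'e \<times> 'g \<Rightarrow> complex) triple" where
  "triple_of_module G E =
     \<lparr>sp = tspace G E, rho = (\<lambda>b. tens_left G E E (lact E b)), rho' = tens_right G E\<rparr>"

definition triple_of_module' :: "'g::complex_vector hilbert \<Rightarrow> ('e::complex_vector, 'g, 'g) bimodule \<Rightarrow>
    ('g, 'e \<times> 'g \<Rightarrow> complex) triple" where
  "triple_of_module' G E' =
     \<lparr>sp = tspace G E', rho = tens_right G E', rho' = (\<lambda>b'. tens_left G E' E' (lact E' b'))\<rparr>"

definition intertwiners :: "'g::complex_vector hilbert \<Rightarrow> ('g \<Rightarrow> 'g) set \<Rightarrow> 'h::complex_vector hilbert \<Rightarrow>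
    (('g \<Rightarrow> 'g) \<Rightarrow> 'h \<Rightarrow> 'h) \<Rightarrow> ('g \<Rightarrow> 'h) set" where
  "intertwiners G A H \<pi> = {x \<in> bop G H. \<forall>a\<in>A. \<pi> a \<circ> x = x \<circ> a}"

definition module_of_triple :: "'g::complex_vector hilbert \<Rightarrow> ('g \<Rightarrow> 'g) set \<Rightarrow> ('g, 'h::complex_vector) triple \<Rightarrow>
    ('g \<Rightarrow> 'h, 'g, 'g) bimodule" where
  "module_of_triple G B T =
     \<lparr>mset = intertwiners G (commutant G B) (sp T) (rho' T),
      mip = (\<lambda>x y. adj G (sp T) x \<circ> y),
      ract = (\<lambda>x b. x \<circ> b),
      lact = (\<lambda>b x. rho T b \<circ> x)\<rparr>"

definition module'_of_triple :: "'g::complex_vector hilbert \<Rightarrow> ('g \<Rightarrow> 'g) set \<Rightarrow> ('g, 'h::complex_vector) triple \<Rightarrow>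
    ('g \<Rightarrow> 'h, 'g, 'g) bimodule" where
  "module'_of_triple G B T =
     \<lparr>mset = intertwiners G B (sp T) (rho T),
      mip = (\<lambda>x y. adj G (sp T) x \<circ> y),
      ract = (\<lambda>x b'. x \<circ> b'),
      lact = (\<lambda>b' x. rho' T b' \<circ> x)\<rparr>"

definition post_comp :: "('g \<Rightarrow> 'h) set \<Rightarrow> ('h \<Rightarrow> 'i::zero) \<Rightarrow> ('g \<Rightarrow> 'h) \<Rightarrow> 'g \<Rightarrow> 'i" where
  "post_comp M U = (\<lambda>x. if x \<in> M then U \<circ> x else 0)"

text \<open>The evaluation \<open>M \<odot> G \<rightarrow> H\<close>, \<open>x \<odot> g \<mapsto> x g\<close>, for a module \<open>M\<close> of operators from \<open>G\<close> to \<open>H\<close>.\<close>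

definition evalop :: "'g::complex_vector hilbert \<Rightarrow> ('g \<Rightarrow> 'h, 'g, 'z) hmodule_scheme \<Rightarrow> 'h::complex_vector hilbert \<Rightarrow>
    (('g \<Rightarrow> 'h) \<times> 'g \<Rightarrow> complex) \<Rightarrow> 'h" where
  "evalop G M H = (THE U. U \<in> bop (tspace G M) H \<and>
     (\<forall>x\<in>mset M. \<forall>g\<in>hset G. U (tens G M x g) = x g))"

end

theory Submission
  imports Defs
begin

text \<open>
  A module \<open>E\<close> sits in \<open>\<B>(G, E \<odot> G)\<close> through \<open>x \<mapsto> L\<^sub>x\<close>, and every \<open>L\<^sub>x\<close> intertwines the action of the
  commutant \<open>B'\<close> on \<open>G\<close> with \<open>id \<odot> b'\<close> on \<open>E \<odot> G\<close>.  The theorem amounts to three facts: there are no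
  other intertwiners, so that \<open>E\<close> is recovered from its triple; for an arbitrary triple the intertwiners
  have total range in \<open>H\<close>, so that \<open>H\<close> is recovered from its module; and \<open>b' \<mapsto> id \<odot> b'\<close> is normal, so
  that a module does give a triple.  Morphisms then correspond because an operator on \<open>E \<odot> G\<close> is determined
  by its values on elementary tensors.  The statements about \<open>B'\<close>-\<open>B'\<close>-modules are those about \<open>B\<close>-\<open>B\<close>-modules
  for the algebra \<open>B'\<close>, since \<open>B'' = B\<close> and \<open>(H, \<rho>', \<rho>)\<close> is a triple over \<open>B'\<close> exactly if \<open>(H, \<rho>, \<rho>')\<close> is
  one over \<open>B\<close>.

  \<^item> No other intertwiners (\<open>density\<close>, \<open>intertwiner_in_module\<close>).  The proof of the bicommutant theorem works for a
    right \<open>B\<close>-invariant space \<open>M\<close> of operators from \<open>G\<close> to \<open>H\<close> with \<open>M G\<close> total in \<open>H\<close>: on finitely many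
    vectors, an intertwiner is approximated by elements of \<open>M\<close>, because the projection onto the closure of
    \<open>B (g\<^sub>1, \<dots>, g\<^sub>n)\<close> is a matrix over \<open>B'\<close>.  The case \<open>M = B\<close> is the bicommutant theorem itself.  The case of
    a module also yields the polar decomposition \<open>x = v |x|\<close>, from which it follows that a bounded right linear
    map \<open>a\<close> satisfies \<open>\<parallel>a x \<odot> g\<parallel> \<le> \<parallel>a\<parallel> \<parallel>x \<odot> g\<parallel>\<close>, and so that \<open>a \<odot> id\<close> exists (\<open>bounded_module_map\<close>,
    \<open>tens_left_exists\<close>).

  \<^item> Totality (\<open>intertwiners_total\<close>).  For a normal representation \<open>r\<close> and a vector \<open>\<xi>\<close>, \<open>\<sigma>\<close>-weak continuity of
    \<open>b \<mapsto> \<langle>\<xi>, r b \<xi>\<rangle>\<close> at \<open>0\<close> provides a vector \<open>w\<close> in a multiple of \<open>G\<close> with \<open>\<parallel>r b \<xi>\<parallel> \<le> \<parallel>b w\<parallel>\<close> for all \<open>b\<close>.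
    Hence \<open>b w \<mapsto> r b \<xi>\<close> extends to an intertwiner that maps \<open>w\<close> to \<open>\<xi>\<close>, and its restrictions to the single
    copies of \<open>G\<close> are intertwiners out of \<open>G\<close> whose ranges together span a space with \<open>\<xi>\<close> in its closure.

  \<^item> Normality (\<open>vector_state\<close>).  A functional \<open>b' \<mapsto> \<langle>h, (id \<odot> b') h\<rangle>\<close> is a countable sum of functionals
    \<open>b' \<mapsto> \<langle>u, b' u\<rangle>\<close> with \<open>u\<close> in \<open>G\<close>.  A Gram-Schmidt process along \<open>B'\<close>-invariant subspaces reduces this to
    vectors \<open>h = (1 - P) (x \<odot> g)\<close> with \<open>P\<close> a projection that commutes with the action of \<open>B'\<close>.  For these,
    \<open>L\<^sub>x\<^sup>* (1 - P) L\<^sub>x\<close> is a positive element of \<open>B'' = B\<close>, and \<open>u\<close> is the value of its square root at \<open>g\<close>.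

  The tensor product itself is the Kolmogorov decomposition (\<open>kernel_space_exists\<close>) of the kernel
  \<open>\<langle>g, \<langle>x, y\<rangle> h\<rangle>\<close>, which is positive by \<open>kernel_positive\<close>.  Square roots in \<open>B\<close> and \<open>B'\<close>, which also serve to bound the
  operators \<open>b \<odot> id\<close> and \<open>id \<odot> b'\<close>, come from an iteration (\<open>square_root\<close>).
\<close>

section \<open>Semi-inner products\<close>

lemma scaleC_fun_apply [simp]: "(c *\<^sub>C f) x = c *\<^sub>C f x"
  by (simp add: scaleC_fun_def)

lemma nonneg_complex_eq: "z \<in> \<real>\<^sub>\<ge>\<^sub>0 \<Longrightarrow> z = complex_of_real (Re z)"
  by (simp add: complex_eq_iff complex_nonneg_Reals_iff)

lemma nonneg_complex_Re: "z \<in> \<real>\<^sub>\<ge>\<^sub>0 \<Longrightarrow> 0 \<le> Re z"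
  by (simp add: complex_nonneg_Reals_iff)

definition qnorm :: "('a \<Rightarrow> 'a \<Rightarrow> complex) \<Rightarrow> 'a \<Rightarrow> real" where
  "qnorm q x = sqrt (Re (q x x))"

lemma hnorm_eq_qnorm: "hnorm H = qnorm (hip H)"
  by (rule ext) (simp add: hnorm_def qnorm_def)

text \<open>
  The form may be degenerate: besides Hilbert spaces, the instances are the pre-Hilbert space of a kernel
  and the forms \<open>\<langle>x, A y\<rangle>\<close> with \<open>A\<close> positive.
\<close>

locale semi_inner =
  fixes S :: "'a::complex_vector set" and q :: "'a \<Rightarrow> 'a \<Rightarrow> complex"
  assumes subspace: "complex_vector.subspace S"
    and add_right: "x \<in> S \<Longrightarrow> y \<in> S \<Longrightarrow> z \<in> S \<Longrightarrow> q x (y + z) = q x y + q x z"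
    and scale_right: "x \<in> S \<Longrightarrow> y \<in> S \<Longrightarrow> q x (c *\<^sub>C y) = c * q x y"
    and herm: "x \<in> S \<Longrightarrow> y \<in> S \<Longrightarrow> q y x = cnj (q x y)"
    and pos: "x \<in> S \<Longrightarrow> q x x \<in> \<real>\<^sub>\<ge>\<^sub>0"
begin

lemma zero_mem [simp]: "0 \<in> S" by (rule complex_vector.subspace_0[OF subspace])
lemma add_mem [simp]: "x \<in> S \<Longrightarrow> y \<in> S \<Longrightarrow> x + y \<in> S"
  by (rule complex_vector.subspace_add[OF subspace])
lemma diff_mem [simp]: "x \<in> S \<Longrightarrow> y \<in> S \<Longrightarrow> x - y \<in> S"
  by (rule complex_vector.subspace_diff[OF subspace])
lemma scale_mem [simp]: "x \<in> S \<Longrightarrow> c *\<^sub>C x \<in> S"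
  by (rule complex_vector.subspace_scale[OF subspace])
lemma neg_mem [simp]: "x \<in> S \<Longrightarrow> - x \<in> S"
  by (rule complex_vector.subspace_neg[OF subspace])
lemma sum_mem [simp]: "(\<And>i. i \<in> I \<Longrightarrow> f i \<in> S) \<Longrightarrow> sum f I \<in> S"
  by (rule complex_vector.subspace_sum[OF subspace])

lemma add_left: "x \<in> S \<Longrightarrow> y \<in> S \<Longrightarrow> z \<in> S \<Longrightarrow> q (x + y) z = q x z + q y z"
  using herm[of z "x + y"] herm[of z x] herm[of z y] by (simp add: add_right)
lemma scale_left: "x \<in> S \<Longrightarrow> y \<in> S \<Longrightarrow> q (c *\<^sub>C x) y = cnj c * q x y"
  using herm[of y "c *\<^sub>C x"] herm[of y x] by (simp add: scale_right)
lemma zero_right [simp]: "x \<in> S \<Longrightarrow> q x 0 = 0"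
  using scale_right[of x 0 0] by simp
lemma zero_left [simp]: "x \<in> S \<Longrightarrow> q 0 x = 0"
  using scale_left[of 0 x 0] by simp
lemma neg_right: "x \<in> S \<Longrightarrow> y \<in> S \<Longrightarrow> q x (- y) = - q x y"
  using scale_right[of x y "-1"] by (simp add: complex_vector.scale_minus_left)
lemma neg_left: "x \<in> S \<Longrightarrow> y \<in> S \<Longrightarrow> q (- x) y = - q x y"
  using scale_left[of x y "-1"] by (simp add: complex_vector.scale_minus_left)
lemma diff_right: "x \<in> S \<Longrightarrow> y \<in> S \<Longrightarrow> z \<in> S \<Longrightarrow> q x (y - z) = q x y - q x z"
  using add_right[of x y "- z"] by (simp add: neg_right)
lemma diff_left: "x \<in> S \<Longrightarrow> y \<in> S \<Longrightarrow> z \<in> S \<Longrightarrow> q (x - y) z = q x z - q y z"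
  using add_left[of x "- y" z] by (simp add: neg_left)
lemma sum_right: "x \<in> S \<Longrightarrow> (\<And>i. i \<in> I \<Longrightarrow> f i \<in> S) \<Longrightarrow> q x (sum f I) = (\<Sum>i\<in>I. q x (f i))"
  by (induction I rule: infinite_finite_induct) (auto simp: add_right)
lemma sum_left: "x \<in> S \<Longrightarrow> (\<And>i. i \<in> I \<Longrightarrow> f i \<in> S) \<Longrightarrow> q (sum f I) x = (\<Sum>i\<in>I. q (f i) x)"
  by (induction I rule: infinite_finite_induct) (auto simp: add_left)

lemmas bilin = add_left add_right diff_left diff_right scale_left scale_right neg_left neg_right

lemma Re_nonneg [simp]: "x \<in> S \<Longrightarrow> 0 \<le> Re (q x x)"
  using pos by (rule nonneg_complex_Re)
lemma norm_nonneg [simp]: "x \<in> S \<Longrightarrow> 0 \<le> qnorm q x"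
  by (simp add: qnorm_def)
lemma norm_sq: "x \<in> S \<Longrightarrow> (qnorm q x)\<^sup>2 = Re (q x x)"
  by (simp add: qnorm_def)
lemma self_eq: "x \<in> S \<Longrightarrow> q x x = complex_of_real ((qnorm q x)\<^sup>2)"
  using pos nonneg_complex_eq by (simp add: norm_sq)
lemma norm_zero [simp]: "qnorm q 0 = 0"
  by (simp add: qnorm_def)

lemma norm_add_sq: "x \<in> S \<Longrightarrow> y \<in> S \<Longrightarrow>
    (qnorm q (x + y))\<^sup>2 = (qnorm q x)\<^sup>2 + 2 * Re (q x y) + (qnorm q y)\<^sup>2"
  using herm[of x y] by (simp add: norm_sq bilin)
lemma norm_diff_sq: "x \<in> S \<Longrightarrow> y \<in> S \<Longrightarrow>
    (qnorm q (x - y))\<^sup>2 = (qnorm q x)\<^sup>2 - 2 * Re (q x y) + (qnorm q y)\<^sup>2"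
  using herm[of x y] by (simp add: norm_sq bilin)
lemma norm_scale: "x \<in> S \<Longrightarrow> qnorm q (c *\<^sub>C x) = cmod c * qnorm q x"
proof -
  assume x: "x \<in> S"
  have "q (c *\<^sub>C x) (c *\<^sub>C x) = (cnj c * c) * q x x" using x by (simp add: bilin)
  also have "cnj c * c = complex_of_real ((cmod c)\<^sup>2)"
    by (metis complex_norm_square mult.commute)
  finally have "Re (q (c *\<^sub>C x) (c *\<^sub>C x)) = (cmod c)\<^sup>2 * Re (q x x)" by simp
  then show ?thesis by (simp add: qnorm_def real_sqrt_mult)
qed
lemma norm_minus: "x \<in> S \<Longrightarrow> qnorm q (- x) = qnorm q x"
  using norm_scale[of x "-1"] by (simp add: complex_vector.scale_minus_left)
lemma norm_commute: "x \<in> S \<Longrightarrow> y \<in> S \<Longrightarrow> qnorm q (x - y) = qnorm q (y - x)"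
  using norm_minus[of "x - y"] by simp

lemma cauchy_schwarz:
  assumes x: "x \<in> S" and y: "y \<in> S"
  shows "cmod (q x y) \<le> qnorm q x * qnorm q y"
proof -
  let ?c = "cmod (q x y)" and ?a = "(qnorm q x)\<^sup>2" and ?b = "(qnorm q y)\<^sup>2"
  \<comment> \<open>The vector is compared with real multiples of \<open>cnj (q x y) y\<close>, for which the cross term is real.\<close>
  have ineq: "0 \<le> ?a - 2 * t * ?c\<^sup>2 + t\<^sup>2 * ?c\<^sup>2 * ?b" for t
  proof -
    let ?l = "complex_of_real t * cnj (q x y)"
    have "(qnorm q (x - ?l *\<^sub>C y))\<^sup>2 = ?a - 2 * Re (?l * q x y) + (cmod ?l * qnorm q y)\<^sup>2"
      using x y by (simp add: norm_diff_sq norm_scale scale_right)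
    also have "?l * q x y = complex_of_real (t * ?c\<^sup>2)"
      using complex_norm_square[of "q x y"] by (simp del: of_real_power add: mult.assoc mult.commute[of "cnj _"])
    also have "(cmod ?l * qnorm q y)\<^sup>2 = t\<^sup>2 * ?c\<^sup>2 * ?b"
      by (simp add: norm_mult power_mult_distrib)
    finally show ?thesis by (metis Re_complex_of_real mult.assoc zero_le_power2)
  qed
  have "?c\<^sup>2 \<le> ?a * ?b"
  proof (cases "?b = 0")
    case True
    have "?c\<^sup>2 = 0"
    proof (rule ccontr)
      assume "?c\<^sup>2 \<noteq> 0"
      then have "2 * ((?a + 1) / (2 * ?c\<^sup>2)) * ?c\<^sup>2 = ?a + 1" by simp
      then show False using ineq[of "(?a + 1) / (2 * ?c\<^sup>2)"] True by simp
    qed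
    then show ?thesis by simp
  next
    case False
    then have b: "?b > 0" by simp
    have "(1 / ?b)\<^sup>2 * ?c\<^sup>2 * ?b = ?c\<^sup>2 / ?b" using b by (simp add: power2_eq_square)
    then have "?c\<^sup>2 / ?b \<le> ?a" using ineq[of "1 / ?b"] by simp
    then show ?thesis using b by (simp add: divide_le_eq)
  qed
  then have "?c\<^sup>2 \<le> (qnorm q x * qnorm q y)\<^sup>2" by (simp add: power_mult_distrib)
  then show ?thesis using x y by (intro power2_le_imp_le[OF _ mult_nonneg_nonneg]) auto
qed

lemma norm_triangle: 
  assumes x: "x \<in> S" and y: "y \<in> S"
  shows "qnorm q (x + y) \<le> qnorm q x + qnorm q y"
proof -
  have "Re (q x y) \<le> qnorm q x * qnorm q y"
    using cauchy_schwarz[OF x y] complex_Re_le_cmod order_trans by blast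
  then have "(qnorm q (x + y))\<^sup>2 \<le> (qnorm q x + qnorm q y)\<^sup>2"
    using x y by (simp add: norm_add_sq power2_sum)
  then show ?thesis using x y by (intro power2_le_imp_le[OF _ add_nonneg_nonneg]) auto
qed
lemma norm_triangle_diff: "x \<in> S \<Longrightarrow> y \<in> S \<Longrightarrow> qnorm q (x - y) \<le> qnorm q x + qnorm q y"
  using norm_triangle[of x "- y"] by (simp add: norm_minus)
lemma norm_triangle3: "x \<in> S \<Longrightarrow> y \<in> S \<Longrightarrow> z \<in> S \<Longrightarrow>
    qnorm q (x - z) \<le> qnorm q (x - y) + qnorm q (y - z)"
  using norm_triangle[of "x - y" "y - z"] by simp
lemma norm_reverse: 
  assumes "x \<in> S" "y \<in> S" shows "\<bar>qnorm q x - qnorm q y\<bar> \<le> qnorm q (x - y)"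
  using norm_triangle[of "x - y" y] norm_triangle[of "y - x" x] norm_commute[of x y] assms
  by (simp add: abs_le_iff)
lemma parallelogram: "x \<in> S \<Longrightarrow> y \<in> S \<Longrightarrow>
    (qnorm q (x + y))\<^sup>2 + (qnorm q (x - y))\<^sup>2 = 2 * (qnorm q x)\<^sup>2 + 2 * (qnorm q y)\<^sup>2"
  by (simp add: norm_add_sq norm_diff_sq)

lemma inner_diff_bound:
  assumes "x \<in> S" "y \<in> S" "x' \<in> S" "y' \<in> S"
  shows "cmod (q x y - q x' y') \<le> qnorm q (x - x') * qnorm q y + qnorm q x' * qnorm q (y - y')"
proof -
  have "q x y - q x' y' = q (x - x') y + q x' (y - y')" using assms by (simp add: bilin)
  then show ?thesis
    using cauchy_schwarz[of "x - x'" y] cauchy_schwarz[of x' "y - y'"] assms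
      norm_triangle_ineq[of "q (x - x') y" "q x' (y - y')"] by simp
qed

end

locale hilb =
  fixes H :: "'a::complex_vector hilbert"
  assumes hilbert: "is_hilbert H"

sublocale hilb \<subseteq> semi_inner "hset H" "hip H" rewrites "qnorm (hip H) = hnorm H"
proof -
  show "semi_inner (hset H) (hip H)"
  proof (rule semi_inner.intro)
    note h = hilbert[unfolded is_hilbert_def]
    show "complex_vector.subspace (hset H)" using h by (rule conjunct1)
    show "hip H x (y + z) = hip H x y + hip H x z" if "x \<in> hset H" "y \<in> hset H" "z \<in> hset H" for x y z
      using conjunct1[OF conjunct2[OF h]] that by blast
    show "hip H x (c *\<^sub>C y) = c * hip H x y" if "x \<in> hset H" "y \<in> hset H" for x y c
      using conjunct1[OF conjunct2[OF conjunct2[OF h]]] that by blast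
    show "hip H y x = cnj (hip H x y)" if "x \<in> hset H" "y \<in> hset H" for x y
      using conjunct1[OF conjunct2[OF conjunct2[OF conjunct2[OF h]]]] that by blast
    show "hip H x x \<in> \<real>\<^sub>\<ge>\<^sub>0" if "x \<in> hset H" for x
      using conjunct1[OF conjunct2[OF conjunct2[OF conjunct2[OF conjunct2[OF h]]]]] that by blast
  qed
qed (simp add: hnorm_eq_qnorm)

section \<open>Limits and closures in Hilbert spaces\<close>

definition hlim :: "'a::complex_vector hilbert \<Rightarrow> (nat \<Rightarrow> 'a) \<Rightarrow> 'a \<Rightarrow> bool" where
  "hlim H s l \<longleftrightarrow> (\<forall>n. s n \<in> hset H) \<and> l \<in> hset H \<and> (\<lambda>n. hnorm H (s n - l)) \<longlonglongrightarrow> 0"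

definition hcl :: "'a::complex_vector hilbert \<Rightarrow> 'a set \<Rightarrow> 'a set" where
  "hcl H C = {l. \<exists>s. (\<forall>n. s n \<in> C) \<and> hlim H s l}"

lemma is_hilbert_metric:
  assumes "semi_inner (hset H) (hip H)" and "\<And>x. x \<in> hset H \<Longrightarrow> hip H x x = 0 \<Longrightarrow> x = 0"
  shows "Metric_space (hset H) (hdist H)"
proof -
  interpret semi_inner "hset H" "hip H" rewrites "qnorm (hip H) = hnorm H"
    by (fact assms(1)) (simp add: hnorm_eq_qnorm)
  show ?thesis
  proof
    fix x y
    show "0 \<le> hdist H x y" by (simp add: hdist_def)
    show "hdist H x y = hdist H y x" by (simp add: hdist_def norm_commute)
  next
    fix x y assume xy: "x \<in> hset H" "y \<in> hset H"
    have "x - y = 0" if "hnorm H (x - y) = 0"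
      using assms(2)[of "x - y"] self_eq[of "x - y"] that xy by simp
    then show "hdist H x y = 0 \<longleftrightarrow> x = y" using xy by (auto simp: hdist_def)
  next
    fix x y z assume "x \<in> hset H" "y \<in> hset H" "z \<in> hset H"
    then show "hdist H x z \<le> hdist H x y + hdist H y z"
      by (simp add: hdist_def norm_triangle3)
  qed
qed

context hilb
begin

lemma definite: "x \<in> hset H \<Longrightarrow> hip H x x = 0 \<Longrightarrow> x = 0"
  using conjunct1[OF conjunct2[OF conjunct2[OF conjunct2[OF conjunct2[OF conjunct2[OF hilbert[unfolded is_hilbert_def]]]]]]] by blast
lemma norm_eq_zero: "x \<in> hset H \<Longrightarrow> hnorm H x = 0 \<longleftrightarrow> x = 0"
  using definite[of x] self_eq[of x] by auto
lemma metric: "Metric_space (hset H) (hdist H)"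
  by (rule is_hilbert_metric[OF semi_inner_axioms]) (rule definite)

lemma complete:
  assumes s: "\<And>n. s n \<in> hset H"
    and c: "\<And>e. e > 0 \<Longrightarrow> \<exists>N. \<forall>m\<ge>N. \<forall>n\<ge>N. hnorm H (s m - s n) < e"
  obtains l where "hlim H s l"
proof -
  interpret M: Metric_space "hset H" "hdist H" by (rule metric)
  have "M.MCauchy s" unfolding M.MCauchy_def
  proof (intro conjI allI impI)
    show "range s \<subseteq> hset H" using s by auto
    fix e :: real assume "e > 0"
    then obtain N where "\<forall>m\<ge>N. \<forall>n\<ge>N. hnorm H (s m - s n) < e" using c by blast
    then show "\<exists>N. \<forall>n n'. N \<le> n \<longrightarrow> N \<le> n' \<longrightarrow> hdist H (s n) (s n') < e"
      using s by (auto simp: hdist_def)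
  qed
  moreover have "M.mcomplete" by (rule conjunct2[OF conjunct2[OF conjunct2[OF conjunct2[OF conjunct2[OF conjunct2[OF hilbert[unfolded is_hilbert_def]]]]]]])
  ultimately obtain l where "limitin M.mtopology s l sequentially"
    unfolding M.mcomplete_def by blast
  then have l: "l \<in> hset H" "(\<lambda>n. hdist H (s n) l) \<longlonglongrightarrow> 0"
    by (auto simp: M.limitin_metric_dist_null)
  then have "hlim H s l" using s by (simp add: hlim_def hdist_def)
  then show thesis by (rule that)
qed

lemma closure_eq_hcl:
  assumes C: "C \<subseteq> hset H" shows "htop H closure_of C = hcl H C"
proof -
  interpret M: Metric_space "hset H" "hdist H" by (rule metric)
  have "x \<in> hcl H C" if x: "x \<in> hset H" and r: "\<And>r. r > 0 \<Longrightarrow> \<exists>y\<in>C. hdist H x y < r" for x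
  proof -
    have "\<exists>y\<in>C. hdist H x y < 1 / real (Suc n)" for n by (rule r) simp
    then obtain s where s: "\<And>n. s n \<in> C" "\<And>n. hdist H x (s n) < 1 / real (Suc n)" by metis
    have e: "hdist H x (s n) = hnorm H (s n - x)" for n
      using s(1)[of n] x C by (simp add: hdist_def norm_commute subsetD)
    have "(\<lambda>n. hnorm H (s n - x)) \<longlonglongrightarrow> 0"
    proof (rule tendsto_sandwich[OF _ _ tendsto_const LIMSEQ_inverse_real_of_nat])
      show "\<forall>\<^sub>F n in sequentially. 0 \<le> hnorm H (s n - x)"
        using s(1) x C by (intro always_eventually allI norm_nonneg diff_mem) auto
      show "\<forall>\<^sub>F n in sequentially. hnorm H (s n - x) \<le> inverse (real (Suc n))"
        using s(2) by (auto intro!: always_eventually less_imp_le simp: e[symmetric] inverse_eq_divide)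
    qed
    then show ?thesis using s(1) x C by (auto simp: hcl_def hlim_def)
  qed
  moreover have "\<exists>y\<in>C. hdist H x y < r" if x: "x \<in> hcl H C" and r: "r > 0" for x r
  proof -
    obtain s where s: "\<And>n. s n \<in> C" "hlim H s x" using x unfolding hcl_def by blast
    then obtain n where "hnorm H (s n - x) < r"
      using r unfolding hlim_def by (metis (no_types, lifting) LIMSEQ_iff abs_ge_self diff_zero le_refl order_le_less_trans real_norm_def)
    then show ?thesis using s C by (intro bexI[of _ "s n"]) (auto simp: hdist_def hlim_def norm_commute)
  qed
  moreover have "hcl H C \<subseteq> hset H" by (auto simp: hcl_def hlim_def)
  ultimately have "x \<in> hcl H C \<longleftrightarrow> x \<in> hset H \<and> (\<forall>r>0. \<exists>y\<in>C. hdist H x y < r)" for x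
    by blast
  then show ?thesis using C unfolding htop_def M.metric_closure_of M.in_mball by fastforce
qed

lemma hlim_mem: "hlim H s l \<Longrightarrow> s n \<in> hset H" "hlim H s l \<Longrightarrow> l \<in> hset H"
  by (auto simp: hlim_def)
lemma hlimI: "(\<And>n. s n \<in> hset H) \<Longrightarrow> l \<in> hset H \<Longrightarrow> (\<And>n. hnorm H (s n - l) \<le> f n) \<Longrightarrow> f \<longlonglongrightarrow> 0 \<Longrightarrow> hlim H s l"
  unfolding hlim_def by (auto intro!: Lim_null_comparison[OF always_eventually, of _ f])
lemma hlim_const: "x \<in> hset H \<Longrightarrow> hlim H (\<lambda>_. x) x"
  by (simp add: hlim_def)
lemma hlim_add: 
  assumes "hlim H s l" "hlim H t m" shows "hlim H (\<lambda>n. s n + t n) (l + m)"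
proof -
  note mem = hlim_mem[OF assms(1)] hlim_mem[OF assms(2)]
  have "hnorm H (s n + t n - (l + m)) \<le> hnorm H (s n - l) + hnorm H (t n - m)" for n
    using norm_triangle[of "s n - l" "t n - m"] mem by (simp add: algebra_simps)
  moreover have "(\<lambda>n. hnorm H (s n - l) + hnorm H (t n - m)) \<longlonglongrightarrow> 0"
    using tendsto_add[of "\<lambda>n. hnorm H (s n - l)" 0 _ "\<lambda>n. hnorm H (t n - m)" 0] assms by (simp add: hlim_def)
  ultimately show ?thesis using mem by (intro hlimI) auto
qed
lemma hlim_scale: "hlim H s l \<Longrightarrow> hlim H (\<lambda>n. c *\<^sub>C s n) (c *\<^sub>C l)"
  using norm_scale[of _ c] tendsto_mult_right_zero[of "\<lambda>n. hnorm H (s n - l)" sequentially "cmod c"]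
  by (auto simp: hlim_def complex_vector.scale_right_diff_distrib[symmetric])
lemma hlim_diff: "hlim H s l \<Longrightarrow> hlim H t m \<Longrightarrow> hlim H (\<lambda>n. s n - t n) (l - m)"
  using hlim_add[of s l "\<lambda>n. (-1) *\<^sub>C t n" "(-1) *\<^sub>C m"] hlim_scale[of t m "-1"]
  by (simp add: complex_vector.scale_minus_left)
lemma hlim_norm:
  assumes "hlim H s l" shows "(\<lambda>n. hnorm H (s n)) \<longlonglongrightarrow> hnorm H l"
proof -
  have "(\<lambda>n. hnorm H (s n) - hnorm H l) \<longlonglongrightarrow> 0"
  proof (rule Lim_null_comparison[OF always_eventually])
    show "\<forall>n. norm (hnorm H (s n) - hnorm H l) \<le> hnorm H (s n - l)"
      using norm_reverse[OF hlim_mem[OF assms]] by simp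
    show "(\<lambda>n. hnorm H (s n - l)) \<longlonglongrightarrow> 0" using assms by (simp add: hlim_def)
  qed
  then show ?thesis by (rule LIM_zero_cancel)
qed
lemma hlim_unique:
  assumes "hlim H s l" "hlim H s m" shows "l = m"
proof -
  have "(\<lambda>n. hnorm H (s n - s n)) \<longlonglongrightarrow> hnorm H (l - m)"
    by (rule hlim_norm[OF hlim_diff[OF assms]])
  then have "hnorm H (l - m) = 0" by (simp add: LIMSEQ_const_iff)
  then show ?thesis using norm_eq_zero[of "l - m"] assms by (simp add: hlim_def)
qed
lemma hlim_ip:
  assumes "hlim H s l" "hlim H t m" shows "(\<lambda>n. hip H (s n) (t n)) \<longlonglongrightarrow> hip H l m"
proof -
  note mem = hlim_mem[OF assms(1)] hlim_mem[OF assms(2)]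
  have "(\<lambda>n. hnorm H (s n - l) * hnorm H (t n) + hnorm H l * hnorm H (t n - m)) \<longlonglongrightarrow> 0 * hnorm H m + hnorm H l * 0"
    by (intro tendsto_intros hlim_norm assms) (use assms in \<open>auto simp: hlim_def\<close>)
  then have *: "(\<lambda>n. hnorm H (s n - l) * hnorm H (t n) + hnorm H l * hnorm H (t n - m)) \<longlonglongrightarrow> 0" by simp
  have "(\<lambda>n. hip H (s n) (t n) - hip H l m) \<longlonglongrightarrow> 0"
    by (rule Lim_null_comparison[OF always_eventually *]) (use inner_diff_bound[OF mem(1) mem(3) mem(2) mem(4)] in auto)
  then show ?thesis by (rule LIM_zero_cancel)
qed
lemma hlim_ip_right: "hlim H s l \<Longrightarrow> x \<in> hset H \<Longrightarrow> (\<lambda>n. hip H x (s n)) \<longlonglongrightarrow> hip H x l"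
  using hlim_ip[OF hlim_const] .
lemma hlim_ip_left: "hlim H s l \<Longrightarrow> x \<in> hset H \<Longrightarrow> (\<lambda>n. hip H (s n) x) \<longlonglongrightarrow> hip H l x"
  using hlim_ip[OF _ hlim_const] .

lemma hcl_mem: "x \<in> hcl H C \<Longrightarrow> x \<in> hset H"
  by (auto simp: hcl_def hlim_def)
lemma hcl_self: "C \<subseteq> hset H \<Longrightarrow> x \<in> C \<Longrightarrow> x \<in> hcl H C"
  unfolding hcl_def by (auto intro!: exI[of _ "\<lambda>_. x"] hlim_const)
lemma hcl_mono: "C \<subseteq> D \<Longrightarrow> hcl H C \<subseteq> hcl H D"
  unfolding hcl_def by blast
lemma hcl_iff:
  assumes "C \<subseteq> hset H"
  shows "x \<in> hcl H C \<longleftrightarrow> x \<in> hset H \<and> (\<forall>e>0. \<exists>y\<in>C. hnorm H (y - x) < e)"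
proof -
  interpret M: Metric_space "hset H" "hdist H" by (rule metric)
  have "x \<in> hcl H C \<longleftrightarrow> x \<in> hset H \<and> (\<forall>e>0. \<exists>y\<in>C. y \<in> hset H \<and> hdist H x y < e)"
    unfolding closure_eq_hcl[OF assms, symmetric] htop_def M.metric_closure_of M.in_mball by auto
  also have "\<dots> \<longleftrightarrow> x \<in> hset H \<and> (\<forall>e>0. \<exists>y\<in>C. hnorm H (y - x) < e)"
  proof (rule conj_cong[OF refl], intro all_cong bex_cong refl)
    fix e :: real and y assume "x \<in> hset H" "y \<in> C"
    then show "(y \<in> hset H \<and> hdist H x y < e) = (hnorm H (y - x) < e)"
      using assms norm_commute[of x y] by (auto simp: hdist_def)
  qed
  finally show ?thesis .
qed
lemma hcl_hcl:
  assumes C: "C \<subseteq> hset H" shows "hcl H (hcl H C) = hcl H C"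
proof -
  have sub: "hcl H C \<subseteq> hset H" using hcl_mem by blast
  have "\<exists>y\<in>C. hnorm H (y - x) < e" if x: "x \<in> hcl H (hcl H C)" and e: "e > 0" for x e
  proof -
    obtain z where z: "z \<in> hcl H C" "hnorm H (z - x) < e / 2" 
      using x e unfolding hcl_iff[OF sub] by (meson half_gt_zero)
    obtain y where y: "y \<in> C" "hnorm H (y - z) < e / 2"
      using z e unfolding hcl_iff[OF C] by (meson half_gt_zero)
    have "hnorm H (y - x) \<le> hnorm H (y - z) + hnorm H (z - x)"
      using norm_triangle3[of y z x] y z x C hcl_mem by blast
    then show ?thesis using y z by (intro bexI[of _ y]) auto
  qed
  then show ?thesis using hcl_self[OF sub] hcl_mem by (auto simp: hcl_iff[OF C])
qed
lemma hcl_subspace: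
  assumes C: "complex_vector.subspace C" "C \<subseteq> hset H" shows "complex_vector.subspace (hcl H C)"
proof (rule complex_vector.subspaceI)
  show "0 \<in> hcl H C" by (rule hcl_self[OF C(2) complex_vector.subspace_0[OF C(1)]])
next
  fix x y assume "x \<in> hcl H C" "y \<in> hcl H C"
  then obtain s t where "\<And>n. s n \<in> C" "hlim H s x" "\<And>n. t n \<in> C" "hlim H t y" unfolding hcl_def by blast
  then show "x + y \<in> hcl H C" using hlim_add complex_vector.subspace_add[OF C(1)] unfolding hcl_def
    by (auto intro!: exI[of _ "\<lambda>n. s n + t n"])
next
  fix x c assume "x \<in> hcl H C"
  then obtain s where "\<And>n. s n \<in> C" "hlim H s x" unfolding hcl_def by blast
  then show "c *\<^sub>C x \<in> hcl H C" using hlim_scale complex_vector.subspace_scale[OF C(1)] unfolding hcl_def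
    by (auto intro!: exI[of _ "\<lambda>n. c *\<^sub>C s n"])
qed

lemma perp_zero: 
  assumes "hcl H C = hset H" "C \<subseteq> hset H" "x \<in> hset H" "\<And>c. c \<in> C \<Longrightarrow> hip H c x = 0" shows "x = 0"
proof -
  obtain s where s: "\<And>n. s n \<in> C" "hlim H s x" using assms unfolding hcl_def by blast
  have "(\<lambda>n. hip H (s n) x) \<longlonglongrightarrow> hip H x x" using hlim_ip_left[OF s(2) assms(3)] .
  then have "hip H x x = 0" using assms(4)[OF s(1)] by (simp add: LIMSEQ_const_iff)
  then show ?thesis using definite assms by blast
qed

lemma perp_span: 
  assumes "X \<subseteq> hset H" "y \<in> hset H" "\<And>x. x \<in> X \<Longrightarrow> hip H x y = 0" "z \<in> complex_vector.span X"
  shows "hip H z y = 0"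
proof -
  have "z \<in> {z \<in> hset H. hip H z y = 0}"
    by (rule complex_vector.span_subspace_induct[OF assms(4)])
      (use assms in \<open>auto intro!: complex_vector.subspaceI simp: bilin\<close>)
  then show ?thesis by simp
qed
lemma span_mem: "X \<subseteq> hset H \<Longrightarrow> complex_vector.span X \<subseteq> hset H"
  by (rule complex_vector.span_minimal[OF _ subspace])

lemma perp_hcl:
  assumes "C \<subseteq> hset H" "y \<in> hset H" "\<And>x. x \<in> C \<Longrightarrow> hip H x y = 0" "z \<in> hcl H C"
  shows "hip H z y = 0"
proof -
  obtain s where s: "\<And>n. s n \<in> C" "hlim H s z" using assms unfolding hcl_def by blast
  have "(\<lambda>n. hip H (s n) y) \<longlonglongrightarrow> hip H z y" using hlim_ip_left[OF s(2) assms(2)] .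
  then show ?thesis using assms(3)[OF s(1)] by (simp add: LIMSEQ_const_iff)
qed

end

lemma bop_mem: "T \<in> bop G H \<Longrightarrow> x \<in> hset G \<Longrightarrow> T x \<in> hset H"
  unfolding bop_def lin_maps_def by blast
lemma bop_out: "T \<in> bop G H \<Longrightarrow> x \<notin> hset G \<Longrightarrow> T x = 0"
  unfolding bop_def lin_maps_def by blast
section \<open>Bounded operators, projections and adjoints\<close>

lemma bop_add: "T \<in> bop G H \<Longrightarrow> x \<in> hset G \<Longrightarrow> y \<in> hset G \<Longrightarrow> T (x + y) = T x + T y"
  unfolding bop_def lin_maps_def by blast
lemma bop_scale: "T \<in> bop G H \<Longrightarrow> x \<in> hset G \<Longrightarrow> T (c *\<^sub>C x) = c *\<^sub>C T x"
  unfolding bop_def lin_maps_def by blast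
lemma bop_zero: "T \<in> bop G H \<Longrightarrow> T 0 = 0"
  using bop_scale[of T G H 0 0] bop_out[of T G H 0] by (cases "0 \<in> hset G") auto
lemma bop_eqI: "S \<in> bop G H \<Longrightarrow> T \<in> bop G H \<Longrightarrow> (\<And>x. x \<in> hset G \<Longrightarrow> S x = T x) \<Longrightarrow> S = T"
  by (rule ext) (metis bop_out)
lemma bopI:
  assumes "\<And>x. x \<notin> hset G \<Longrightarrow> T x = 0" "\<And>x. x \<in> hset G \<Longrightarrow> T x \<in> hset H"
    "\<And>x y. x \<in> hset G \<Longrightarrow> y \<in> hset G \<Longrightarrow> T (x + y) = T x + T y"
    "\<And>x c. x \<in> hset G \<Longrightarrow> T (c *\<^sub>C x) = c *\<^sub>C T x"
    "\<And>x. x \<in> hset G \<Longrightarrow> hnorm H (T x) \<le> K * hnorm G x"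
  shows "T \<in> bop G H"
  using assms unfolding bop_def lin_maps_def by blast

lemma bop_bound_raw: "T \<in> bop G H \<Longrightarrow> \<exists>K. \<forall>x\<in>hset G. hnorm H (T x) \<le> K * hnorm G x"
  unfolding bop_def by blast

context hilb
begin

lemma bop_diff: "T \<in> bop H K \<Longrightarrow> x \<in> hset H \<Longrightarrow> y \<in> hset H \<Longrightarrow> T (x - y) = T x - T y"
  using bop_add[of T H K "x - y" y] by simp
lemma bop_sum: "T \<in> bop H K \<Longrightarrow> (\<And>i. i \<in> I \<Longrightarrow> f i \<in> hset H) \<Longrightarrow> T (sum f I) = (\<Sum>i\<in>I. T (f i))"
  by (induction I rule: infinite_finite_induct) (auto simp: bop_zero bop_add)
lemma bop_bound:
  assumes "T \<in> bop H K"
  obtains k where "k \<ge> 0" "\<And>x. x \<in> hset H \<Longrightarrow> hnorm K (T x) \<le> k * hnorm H x"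
proof -
  obtain k where k: "\<And>x. x \<in> hset H \<Longrightarrow> hnorm K (T x) \<le> k * hnorm H x"
    using bop_bound_raw[OF assms] by blast
  have "hnorm K (T x) \<le> max k 0 * hnorm H x" if "x \<in> hset H" for x
    using k[OF that] mult_right_mono[of k "max k 0" "hnorm H x"] norm_nonneg[OF that] by linarith
  then show thesis using that[of "max k 0"] by simp
qed

lemma id_on_bop: "id_on (hset H) \<in> bop H H"
  by (rule bopI[where K = 1]) (auto simp: id_on_def)

definition closed_subspace :: "'a set \<Rightarrow> bool" where
  "closed_subspace C \<longleftrightarrow> complex_vector.subspace C \<and> C \<subseteq> hset H \<and> hcl H C \<subseteq> C"

lemma closed_subspace_hcl: "complex_vector.subspace C \<Longrightarrow> C \<subseteq> hset H \<Longrightarrow> closed_subspace (hcl H C)"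
  unfolding closed_subspace_def using hcl_subspace hcl_mem hcl_hcl by blast

text \<open>
  The parallelogram law makes every minimizing sequence for the distance from \<open>x\<close> to \<open>C\<close> a Cauchy sequence.
\<close>

lemma projection_exists:
  assumes C: "closed_subspace C" and x: "x \<in> hset H"
  shows "\<exists>p\<in>C. \<forall>c\<in>C. hip H c (x - p) = 0"
proof -
  have sub: "complex_vector.subspace C" and CH: "C \<subseteq> hset H" and cl: "hcl H C \<subseteq> C"
    using C by (auto simp: closed_subspace_def)
  note C0 = complex_vector.subspace_0[OF sub] and Ca = complex_vector.subspace_add[OF sub]
    and Cs = complex_vector.subspace_scale[OF sub]
  define d where "d = (INF c\<in>C. hnorm H (x - c))"
  have bdd: "bdd_below ((\<lambda>c. hnorm H (x - c)) ` C)"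
    by (rule bdd_belowI2[of _ 0]) (use x CH in auto)
  have dle: "d \<le> hnorm H (x - c)" if "c \<in> C" for c
    unfolding d_def by (rule cINF_lower[OF bdd that])
  have d0: "0 \<le> d" unfolding d_def by (rule cINF_greatest) (use C0 x CH in auto)
  have "\<exists>c\<in>C. hnorm H (x - c) < d + 1 / real (Suc n)" for n
  proof (rule ccontr)
    assume "\<not> ?thesis"
    then have "d + 1 / real (Suc n) \<le> d" 
      unfolding d_def using C0 by (intro cINF_greatest) (auto simp: d_def not_less)
    then show False by simp
  qed
  then obtain s where s: "\<And>n. s n \<in> C" "\<And>n. hnorm H (x - s n) < d + 1 / real (Suc n)" by metis
  have sH: "s n \<in> hset H" for n using s(1) CH by blast
  define f where "f N = 4 * (2 * d * (1 / real (Suc N)) + (1 / real (Suc N))\<^sup>2)" for N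
  have flim: "f \<longlonglongrightarrow> 0"
  proof -
    have "(\<lambda>N. 1 / real (Suc N)) \<longlonglongrightarrow> 0" using LIMSEQ_inverse_real_of_nat by (simp add: inverse_eq_divide)
    then have "f \<longlonglongrightarrow> 4 * (2 * d * 0 + 0\<^sup>2)" unfolding f_def by (intro tendsto_intros)
    then show ?thesis by simp
  qed
  have est: "(hnorm H (s m - s n))\<^sup>2 \<le> f N" if "m \<ge> N" "n \<ge> N" for m n N
  proof -
    let ?r = "d + 1 / real (Suc N)"
    have sm: "hnorm H (x - s k) \<le> ?r" if "k \<ge> N" for k
    proof -
      have "1 / real (Suc k) \<le> 1 / real (Suc N)" using that by (simp add: frac_le)
      then show ?thesis using s(2)[of k] by linarith
    qed
    have mid: "(1/2) *\<^sub>C (s m + s n) \<in> C" using s(1) Ca Cs by blast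
    have e: "(x - s m) + (x - s n) = 2 *\<^sub>C (x - (1/2) *\<^sub>C (s m + s n))"
      by (simp add: complex_vector.scale_right_diff_distrib scaleC_one)
        (metis add_diff_add one_add_one scaleC_add_left scaleC_one)
    have "2 * d \<le> hnorm H ((x - s m) + (x - s n))"
      unfolding e using dle[OF mid] x mid CH by (subst norm_scale) auto
    then have "(2 * d)\<^sup>2 \<le> (hnorm H ((x - s m) + (x - s n)))\<^sup>2" using d0 by (intro power_mono) auto
    moreover have "(hnorm H ((x - s m) + (x - s n)))\<^sup>2 + (hnorm H (s n - s m))\<^sup>2
        = 2 * (hnorm H (x - s m))\<^sup>2 + 2 * (hnorm H (x - s n))\<^sup>2"
      using parallelogram[of "x - s m" "x - s n"] x sH by simp
    moreover have "(hnorm H (x - s m))\<^sup>2 \<le> ?r\<^sup>2" "(hnorm H (x - s n))\<^sup>2 \<le> ?r\<^sup>2"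
      using sm that x sH by (auto intro!: power_mono)
    moreover have "4 * ?r\<^sup>2 = 4 * d\<^sup>2 + f N" unfolding f_def by (simp add: power2_sum)
    moreover have "(2 * d)\<^sup>2 = 4 * d\<^sup>2" by simp
    ultimately show ?thesis unfolding norm_commute[OF sH sH, of m n] by linarith
  qed
  have "\<exists>N. \<forall>m\<ge>N. \<forall>n\<ge>N. hnorm H (s m - s n) < e" if e: "e > 0" for e
  proof -
    have "e\<^sup>2 > 0" using e by simp
    then obtain N where "f N < e\<^sup>2" using flim by (metis (no_types, lifting) LIMSEQ_iff abs_ge_self diff_zero le_refl order_le_less_trans real_norm_def)
    then have "hnorm H (s m - s n) < e" if "m \<ge> N" "n \<ge> N" for m n
      using est[OF that] e by (meson less_eq_real_def order_le_less_trans power_less_imp_less_base)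
    then show ?thesis by blast
  qed
  then obtain p where p: "hlim H s p" using complete[of s] sH by blast
  then have pC: "p \<in> C" using s(1) cl unfolding hcl_def by blast
  have pH: "p \<in> hset H" using pC CH by blast
  have "(\<lambda>n. hnorm H (x - s n)) \<longlonglongrightarrow> hnorm H (x - p)"
    by (rule hlim_norm[OF hlim_diff[OF hlim_const[OF x] p]])
  moreover have "(\<lambda>n. d + 1 / real (Suc n)) \<longlonglongrightarrow> d + 0"
    using LIMSEQ_inverse_real_of_nat by (intro tendsto_intros) (simp add: inverse_eq_divide)
  ultimately have dp: "hnorm H (x - p) \<le> d"
    using s(2) by (intro LIMSEQ_le[of _ "hnorm H (x - p)" _ d]) (auto intro: less_imp_le)
  have "hip H c (x - p) = 0" if c: "c \<in> C" for c
  proof (rule ccontr)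
    let ?z = "x - p" 
    let ?a = "hip H ?z c"
    assume "hip H c (x - p) \<noteq> 0"
    then have a: "?a \<noteq> 0" using herm[of ?z c] c CH x pH by auto
    have cH: "c \<in> hset H" using c CH by blast
    let ?b = "(hnorm H c)\<^sup>2"
    let ?t = "1 / (?b + 1)"
    let ?l = "complex_of_real ?t * cnj ?a"
    have "p + ?l *\<^sub>C c \<in> C" using pC c Ca Cs by blast
    then have "hnorm H ?z \<le> hnorm H (?z - ?l *\<^sub>C c)"
      using dle[of "p + ?l *\<^sub>C c"] dp by (simp add: algebra_simps)
    then have "(hnorm H ?z)\<^sup>2 \<le> (hnorm H (?z - ?l *\<^sub>C c))\<^sup>2" using x pH by (intro power_mono) auto
    also have "\<dots> = (hnorm H ?z)\<^sup>2 - 2 * Re (?l * ?a) + (cmod ?l * hnorm H c)\<^sup>2"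
      using x pH cH by (simp add: norm_diff_sq norm_scale scale_right)
    also have "?l * ?a = complex_of_real (?t * (cmod ?a)\<^sup>2)"
      using complex_norm_square[of ?a] by (simp del: of_real_power add: mult.assoc mult.commute[of "cnj _"])
    also have "(cmod ?l * hnorm H c)\<^sup>2 = ?t\<^sup>2 * (cmod ?a)\<^sup>2 * ?b"
      by (simp add: norm_mult power_mult_distrib norm_divide power_divide flip: of_real_add)
    finally have "2 * ?t * (cmod ?a)\<^sup>2 \<le> ?t * (cmod ?a)\<^sup>2 * (?t * ?b)"
      by (simp only: Re_complex_of_real) (simp add: power2_eq_square algebra_simps)
    moreover have b: "?b \<ge> 0" "?t > 0" by (auto simp: add_nonneg_pos)
    moreover have "?t * ?b < 1" using b by (simp add: divide_less_eq add_nonneg_pos)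
    moreover have "?t * (cmod ?a)\<^sup>2 > 0" using a b by simp
    ultimately have "?t * (cmod ?a)\<^sup>2 * 2 \<le> ?t * (cmod ?a)\<^sup>2 * 1"
      using mult_left_mono[of "?t * ?b" 1 "?t * (cmod ?a)\<^sup>2"] by linarith
    moreover have "u * 2 \<le> u * 1 \<Longrightarrow> u > 0 \<Longrightarrow> False" for u :: real by simp
    ultimately show False using \<open>?t * (cmod ?a)\<^sup>2 > 0\<close> by blast
  qed
  then show ?thesis using pC by blast
qed

definition proj :: "'a set \<Rightarrow> 'a \<Rightarrow> 'a" where
  "proj C x = (if x \<in> hset H then SOME p. p \<in> C \<and> (\<forall>c\<in>C. hip H c (x - p) = 0) else 0)"

lemma proj_props:
  assumes C: "closed_subspace C" and x: "x \<in> hset H"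
  shows proj_mem: "proj C x \<in> C" and proj_perp: "\<And>c. c \<in> C \<Longrightarrow> hip H c (x - proj C x) = 0"
    and proj_in: "proj C x \<in> hset H"
proof -
  have "proj C x \<in> C \<and> (\<forall>c\<in>C. hip H c (x - proj C x) = 0)"
    using projection_exists[OF assms] x unfolding proj_def by (simp only: if_True) (rule someI_ex, blast)
  then show "proj C x \<in> C" "\<And>c. c \<in> C \<Longrightarrow> hip H c (x - proj C x) = 0" by auto
  then show "proj C x \<in> hset H" using C by (auto simp: closed_subspace_def)
qed

lemma proj_eqI:
  assumes C: "closed_subspace C" and x: "x \<in> hset H" and p: "p \<in> C" "\<And>c. c \<in> C \<Longrightarrow> hip H c (x - p) = 0"
  shows "proj C x = p"
proof -
  let ?d = "proj C x - p"
  have d: "?d \<in> C" using C p proj_mem[OF C x] complex_vector.subspace_diff unfolding closed_subspace_def by blast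
  have pH: "p \<in> hset H" using p C by (auto simp: closed_subspace_def)
  have dH: "?d \<in> hset H" using pH proj_in[OF C x] by simp
  have "hip H ?d ?d = hip H ?d (x - p) - hip H ?d (x - proj C x)"
    using pH dH x proj_in[OF C x] by (simp add: bilin)
  then have "hip H ?d ?d = 0" using p(2)[OF d] proj_perp[OF C x d] by simp
  then show ?thesis using definite[OF dH] by simp
qed

lemma proj_id: "closed_subspace C \<Longrightarrow> x \<in> C \<Longrightarrow> proj C x = x"
  by (rule proj_eqI) (auto simp: closed_subspace_def)
lemma proj_zero: "closed_subspace C \<Longrightarrow> x \<in> hset H \<Longrightarrow> (\<And>c. c \<in> C \<Longrightarrow> hip H c x = 0) \<Longrightarrow> proj C x = 0"
  by (rule proj_eqI) (auto simp: closed_subspace_def complex_vector.subspace_0)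

lemma proj_ip:
  assumes C: "closed_subspace C" and x: "x \<in> hset H" and y: "y \<in> hset H"
  shows "hip H (proj C x) y = hip H x (proj C y)"
proof -
  let ?p = "proj C x" and ?q = "proj C y"
  note mem = proj_in[OF C x] proj_in[OF C y]
  have "hip H ?p (y - ?q) = 0" "hip H ?q (x - ?p) = 0"
    using proj_perp[OF C y proj_mem[OF C x]] proj_perp[OF C x proj_mem[OF C y]] by auto
  then have "hip H ?p (y - ?q) = 0" "hip H (x - ?p) ?q = 0"
    using herm[of ?q "x - ?p"] x mem by auto
  then show ?thesis using x y mem by (simp add: bilin)
qed

lemma proj_norm_sq:
  assumes C: "closed_subspace C" and x: "x \<in> hset H"
  shows "(hnorm H x)\<^sup>2 = (hnorm H (proj C x))\<^sup>2 + (hnorm H (x - proj C x))\<^sup>2"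
  using norm_add_sq[of "proj C x" "x - proj C x"] proj_in[OF C x] proj_perp[OF C x proj_mem[OF C x]] x
  by simp

lemma proj_norm:
  assumes C: "closed_subspace C" and x: "x \<in> hset H" shows "hnorm H (proj C x) \<le> hnorm H x"
proof -
  have "(hnorm H (proj C x))\<^sup>2 \<le> (hnorm H x)\<^sup>2" using proj_norm_sq[OF assms] by simp
  then show ?thesis using norm_nonneg[OF x] by (rule power2_le_imp_le)
qed

lemma proj_bop:
  assumes C: "closed_subspace C" shows "proj C \<in> bop H H"
proof (rule bopI[where K = 1])
  have sub: "complex_vector.subspace C" using C by (simp add: closed_subspace_def)
  fix x y c assume x: "x \<in> hset H" 
  show "proj C (c *\<^sub>C x) = c *\<^sub>C proj C x"
  proof (rule proj_eqI[OF C])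
    show "c *\<^sub>C proj C x \<in> C" by (rule complex_vector.subspace_scale[OF sub proj_mem[OF C x]])
    fix a assume a: "a \<in> C"
    show "hip H a (c *\<^sub>C x - c *\<^sub>C proj C x) = 0"
      using proj_perp[OF C x a] a C x proj_in[OF C x]
      by (auto simp: complex_vector.scale_right_diff_distrib[symmetric] scale_right closed_subspace_def subset_iff)
  qed (use x in auto)
  show "hnorm H (proj C x) \<le> 1 * hnorm H x" using proj_norm[OF C x] by simp
  show "proj C x \<in> hset H" by (rule proj_in[OF C x])
  assume y: "y \<in> hset H"
  show "proj C (x + y) = proj C x + proj C y"
  proof (rule proj_eqI[OF C])
    show "proj C x + proj C y \<in> C"
      by (rule complex_vector.subspace_add[OF sub proj_mem[OF C x] proj_mem[OF C y]])
    fix a assume a: "a \<in> C"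
    have "x + y - (proj C x + proj C y) = (x - proj C x) + (y - proj C y)" by simp
    then show "hip H a (x + y - (proj C x + proj C y)) = 0"
      using proj_perp[OF C x a] proj_perp[OF C y a] a C x y proj_in[OF C x] proj_in[OF C y]
      by (simp only:) (auto simp: add_right closed_subspace_def subset_iff simp del: add_diff_eq)
  qed (use x y in auto)
qed (simp add: proj_def)

text \<open>
  A projection commutes with an operator that leaves its range invariant together with its adjoint \<open>S\<close>.
\<close>

lemma proj_commute:
  assumes C: "closed_subspace C" and T: "T \<in> bop H H" and S: "S \<in> bop H H"
    and TS: "\<And>x y. x \<in> hset H \<Longrightarrow> y \<in> hset H \<Longrightarrow> hip H (S x) y = hip H x (T y)"
    and TC: "\<And>x. x \<in> C \<Longrightarrow> T x \<in> C" and SC: "\<And>x. x \<in> C \<Longrightarrow> S x \<in> C" and x: "x \<in> hset H"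
  shows "proj C (T x) = T (proj C x)"
proof (rule proj_eqI[OF C])
  show "T (proj C x) \<in> C" by (rule TC[OF proj_mem[OF C x]])
  fix c assume c: "c \<in> C"
  have "hip H c (T (x - proj C x)) = hip H (S c) (x - proj C x)"
    using TS[of c "x - proj C x"] c C x proj_in[OF C x] by (auto simp: closed_subspace_def)
  then show "hip H c (T x - T (proj C x)) = 0"
    using proj_perp[OF C x SC[OF c]] bop_diff[OF T x proj_in[OF C x]] by simp
qed (rule bop_mem[OF T x])

text \<open>
  The representing vector is a multiple of the component orthogonal to the kernel of \<open>f\<close>.
\<close>

lemma riesz:
  assumes add: "\<And>x y. x \<in> hset H \<Longrightarrow> y \<in> hset H \<Longrightarrow> f (x + y) = f x + f y"
    and scale: "\<And>c x. x \<in> hset H \<Longrightarrow> f (c *\<^sub>C x) = c * f x"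
    and bound: "\<And>x. x \<in> hset H \<Longrightarrow> cmod (f x) \<le> K * hnorm H x"
  shows "\<exists>z\<in>hset H. \<forall>x\<in>hset H. f x = hip H z x"
proof (cases "\<forall>x\<in>hset H. f x = 0")
  case True then show ?thesis by (intro bexI[of _ 0]) auto
next
  case False
  then obtain x0 where x0: "x0 \<in> hset H" "f x0 \<noteq> 0" by blast
  have f0: "f 0 = 0" using scale[of 0 0] by simp
  have diff: "f (x - y) = f x - f y" if "x \<in> hset H" "y \<in> hset H" for x y
    using add[of "x - y" y] that by simp
  define N where "N = {x \<in> hset H. f x = 0}"
  have N: "closed_subspace N" unfolding closed_subspace_def
  proof (intro conjI subsetI)
    show "complex_vector.subspace N"
      unfolding N_def by (rule complex_vector.subspaceI) (auto simp: f0 add scale)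
    fix l assume "l \<in> hcl H N"
    then obtain s where s: "\<And>n. s n \<in> N" "hlim H s l" unfolding hcl_def by blast
    note mem = hlim_mem[OF s(2)]
    have "cmod (f l) \<le> K * hnorm H (s n - l)" for n
      using bound[of "s n - l"] s(1)[of n] mem diff[of "s n" l] by (simp add: N_def)
    moreover have "(\<lambda>n. K * hnorm H (s n - l)) \<longlonglongrightarrow> 0"
      using s(2) by (auto simp: hlim_def intro: tendsto_mult_right_zero)
    ultimately have "cmod (f l) \<le> 0" by (intro LIMSEQ_le_const[of _ 0]) auto
    then show "l \<in> N" using mem by (simp add: N_def)
  qed (auto simp: N_def)
  define w where "w = x0 - proj N x0"
  have w: "w \<in> hset H" unfolding w_def using x0 proj_in[OF N] by simp
  have fw: "f w = f x0" unfolding w_def using diff[OF x0(1) proj_in[OF N x0(1)]] proj_mem[OF N x0(1)] by (simp add: N_def)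
  have w0: "hip H w w \<noteq> 0" using definite[OF w] fw x0 f0 by auto
  define z where "z = cnj (f w / hip H w w) *\<^sub>C w"
  have "f x = hip H z x" if x: "x \<in> hset H" for x
  proof -
    let ?y = "f w *\<^sub>C x - f x *\<^sub>C w"
    have "?y \<in> N" using x w by (simp add: N_def diff scale)
    then have "hip H ?y w = 0" using proj_perp[OF N x0(1)] unfolding w_def by blast
    then have "hip H w ?y = 0" using herm[of w ?y] x w by simp
    then have "f w * hip H w x = f x * hip H w w" using x w by (simp add: bilin)
    then show ?thesis using w0 w x unfolding z_def by (simp add: scale_left field_simps)
  qed
  moreover have "z \<in> hset H" unfolding z_def using w by simp
  ultimately show ?thesis by blast
qed

end

lemma linear_image_subspace:
  assumes V: "complex_vector.subspace V"
    and add: "\<And>v w. v \<in> V \<Longrightarrow> w \<in> V \<Longrightarrow> A (v + w) = A v + A w"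
    and scale: "\<And>v c. v \<in> V \<Longrightarrow> A (c *\<^sub>C v) = c *\<^sub>C A v"
  shows "complex_vector.subspace (A ` V)"
proof (rule complex_vector.subspaceI)
  have "0 *\<^sub>C A 0 = A 0" using scale[OF complex_vector.subspace_0[OF V], of 0] by simp
  then show "0 \<in> A ` V" using complex_vector.subspace_0[OF V] by (auto intro!: image_eqI[of _ _ 0])
  show "x + y \<in> A ` V" if "x \<in> A ` V" "y \<in> A ` V" for x y
    using that complex_vector.subspace_add[OF V] by (auto simp: add[symmetric])
  show "c *\<^sub>C x \<in> A ` V" if "x \<in> A ` V" for c x
    using that complex_vector.subspace_scale[OF V] by (auto simp: scale[symmetric])
qed

locale hilb2 = G: hilb G + H: hilb H for G :: "'g::complex_vector hilbert" and H :: "'h::complex_vector hilbert"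
begin

lemma bop_hlim:
  assumes T: "T \<in> bop G H" and s: "hlim G s l" shows "hlim H (\<lambda>n. T (s n)) (T l)"
proof -
  note mem = G.hlim_mem[OF s]
  obtain k where k: "k \<ge> 0" "\<And>x. x \<in> hset G \<Longrightarrow> hnorm H (T x) \<le> k * hnorm G x" using G.bop_bound[OF T] by blast
  show ?thesis
  proof (rule H.hlimI)
    show "hnorm H (T (s n) - T l) \<le> k * hnorm G (s n - l)" for n
      using k(2)[of "s n - l"] G.bop_diff[OF T mem(1) mem(2)] mem by simp
    show "(\<lambda>n. k * hnorm G (s n - l)) \<longlonglongrightarrow> 0" using s by (auto simp: hlim_def intro: tendsto_mult_right_zero)
  qed (use bop_mem[OF T] mem in auto)
qed

lemma bop_agree_hcl:
  assumes T: "T \<in> bop G H" "S \<in> bop G H" and C: "\<And>x. x \<in> C \<Longrightarrow> T x = S x" and x: "x \<in> hcl G C"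
  shows "T x = S x"
proof -
  obtain s where s: "\<And>n. s n \<in> C" "hlim G s x" using x unfolding hcl_def by blast
  have "hlim H (\<lambda>n. T (s n)) (T x)" "hlim H (\<lambda>n. T (s n)) (S x)"
    using bop_hlim[OF T(1) s(2)] bop_hlim[OF T(2) s(2)] C[OF s(1)] by auto
  then show ?thesis by (rule H.hlim_unique)
qed

lemma bop_agree_span:
  assumes T: "T \<in> bop G H" "S \<in> bop G H" and X: "X \<subseteq> hset G" "\<And>x. x \<in> X \<Longrightarrow> T x = S x"
    and x: "x \<in> complex_vector.span X"
  shows "T x = S x"
proof -
  have "x \<in> {x \<in> hset G. T x = S x}"
    by (rule complex_vector.span_subspace_induct[OF x])
      (use T X in \<open>auto intro!: complex_vector.subspaceI simp: bop_add bop_scale bop_zero\<close>)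
  then show ?thesis by simp
qed

lemma bop_agree_total:
  assumes T: "T \<in> bop G H" "S \<in> bop G H" and X: "X \<subseteq> hset G" "\<And>x. x \<in> X \<Longrightarrow> T x = S x"
    and d: "hcl G (complex_vector.span X) = hset G"
  shows "T = S"
  by (rule bop_eqI[OF T]) (use bop_agree_hcl[OF T] bop_agree_span[OF T X] d in blast)

lemma bop_subspace: "complex_vector.subspace (bop G H)"
proof (rule complex_vector.subspaceI)
  show "0 \<in> bop G H" by (rule bopI[where K = 0]) auto
next
  fix S T assume S: "S \<in> bop G H" and T: "T \<in> bop G H"
  obtain k where k: "k \<ge> 0" "\<And>x. x \<in> hset G \<Longrightarrow> hnorm H (T x) \<le> k * hnorm G x" using G.bop_bound[OF T] by blast
  obtain l where l: "l \<ge> 0" "\<And>x. x \<in> hset G \<Longrightarrow> hnorm H (S x) \<le> l * hnorm G x" using G.bop_bound[OF S] by blast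
  show "S + T \<in> bop G H"
  proof (rule bopI[where K = "l + k"])
    fix x assume x: "x \<in> hset G"
    have "hnorm H ((S + T) x) \<le> hnorm H (S x) + hnorm H (T x)"
      using H.norm_triangle bop_mem[OF S x] bop_mem[OF T x] by simp
    then show "hnorm H ((S + T) x) \<le> (l + k) * hnorm G x"
      using k(2)[OF x] l(2)[OF x] by (simp add: algebra_simps)
  qed (auto simp: bop_mem[OF S] bop_mem[OF T] bop_out[OF S] bop_out[OF T] bop_add[OF S] bop_add[OF T]
        bop_scale[OF S] bop_scale[OF T] scaleC_add_right)
next
  fix c T assume T: "T \<in> bop G H"
  obtain k where k: "k \<ge> 0" "\<And>x. x \<in> hset G \<Longrightarrow> hnorm H (T x) \<le> k * hnorm G x" using G.bop_bound[OF T] by blast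
  show "c *\<^sub>C T \<in> bop G H"
  proof (rule bopI[where K = "cmod c * k"])
    fix x assume x: "x \<in> hset G"
    show "hnorm H ((c *\<^sub>C T) x) \<le> cmod c * k * hnorm G x"
      using mult_left_mono[OF k(2)[OF x], of "cmod c"] bop_mem[OF T x] by (simp add: H.norm_scale mult.assoc)
  qed (auto simp: bop_mem[OF T] bop_out[OF T] bop_add[OF T] bop_scale[OF T] scaleC_add_right scaleC_scaleC mult.commute)
qed

lemma adj_ex1:
  assumes T: "T \<in> bop G H"
  shows "\<exists>!S. S \<in> bop H G \<and> (\<forall>x\<in>hset G. \<forall>y\<in>hset H. hip G (S y) x = hip H y (T x))"
proof -
  obtain k where k: "k \<ge> 0" "\<And>x. x \<in> hset G \<Longrightarrow> hnorm H (T x) \<le> k * hnorm G x" using G.bop_bound[OF T] by blast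
  have "\<exists>z\<in>hset G. \<forall>x\<in>hset G. hip H y (T x) = hip G z x" if y: "y \<in> hset H" for y
  proof (rule G.riesz[where K = "hnorm H y * k"])
    fix x assume x: "x \<in> hset G"
    show "cmod (hip H y (T x)) \<le> hnorm H y * k * hnorm G x"
      using H.cauchy_schwarz[OF y bop_mem[OF T x]] mult_left_mono[OF k(2)[OF x] H.norm_nonneg[OF y]]
      by (simp add: mult.assoc)
  qed (auto simp: bop_add[OF T] bop_scale[OF T] H.bilin y bop_mem[OF T])
  then obtain S0 where S0: "\<And>y. y \<in> hset H \<Longrightarrow> S0 y \<in> hset G"
    "\<And>x y. x \<in> hset G \<Longrightarrow> y \<in> hset H \<Longrightarrow> hip G (S0 y) x = hip H y (T x)" by metis
  have uniq: "u = v" if "u \<in> hset G" "v \<in> hset G" "\<And>x. x \<in> hset G \<Longrightarrow> hip G u x = hip G v x" for u v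
    using G.definite[of "u - v"] that(3)[of "u - v"] that by (simp add: G.bilin)
  define S where "S y = (if y \<in> hset H then S0 y else 0)" for y
  have S: "S y \<in> hset G" "\<And>x. x \<in> hset G \<Longrightarrow> hip G (S y) x = hip H y (T x)" if "y \<in> hset H" for y
    using S0 that by (auto simp: S_def)
  have "S \<in> bop H G"
  proof (rule bopI[where K = k])
    fix y assume y: "y \<in> hset H"
    have "(hnorm G (S y))\<^sup>2 = Re (hip H y (T (S y)))"
      using S[OF y] by (simp add: G.norm_sq)
    also have "\<dots> \<le> hnorm H y * (k * hnorm G (S y))"
      using H.cauchy_schwarz[OF y bop_mem[OF T S(1)[OF y]]] complex_Re_le_cmod[of "hip H y (T (S y))"]
        mult_left_mono[OF k(2)[OF S(1)[OF y]] H.norm_nonneg[OF y]] by linarith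
    finally have e: "hnorm G (S y) * hnorm G (S y) \<le> (k * hnorm H y) * hnorm G (S y)"
      by (simp add: power2_eq_square mult_ac)
    show "hnorm G (S y) \<le> k * hnorm H y"
      by (cases "hnorm G (S y) = 0")
        (use e k y G.norm_nonneg[OF S(1)[OF y]] in \<open>auto simp: mult_le_cancel_right\<close>)
    show "S (c *\<^sub>C y) = c *\<^sub>C S y" for c
      by (rule uniq) (use y S in \<open>auto simp: G.bilin H.bilin bop_mem[OF T]\<close>)
    show "S (y + z) = S y + S z" if "z \<in> hset H" for z
      by (rule uniq) (use y S that in \<open>auto simp: G.bilin H.bilin bop_mem[OF T]\<close>)
  qed (auto simp: S_def S0)
  then show ?thesis
  proof (rule ex1I[of _ S, OF conjI])
    show "\<forall>x\<in>hset G. \<forall>y\<in>hset H. hip G (S y) x = hip H y (T x)" using S(2) by blast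
    fix R assume R: "R \<in> bop H G \<and> (\<forall>x\<in>hset G. \<forall>y\<in>hset H. hip G (R y) x = hip H y (T x))"
    show "R = S"
    proof (rule bop_eqI[OF conjunct1[OF R] \<open>S \<in> bop H G\<close>])
      fix y assume y: "y \<in> hset H"
      show "R y = S y"
        by (rule uniq[OF bop_mem[OF conjunct1[OF R] y] S(1)[OF y]]) (use R S(2)[OF y] y in simp)
    qed
  qed
qed

lemma adj_bop [simp]: "T \<in> bop G H \<Longrightarrow> adj G H T \<in> bop H G"
  unfolding adj_def by (rule conjunct1[OF theI'[OF adj_ex1]])
lemma adj_ip:
  assumes "T \<in> bop G H" "x \<in> hset G" "y \<in> hset H" shows "hip G (adj G H T y) x = hip H y (T x)"
  using conjunct2[OF theI'[OF adj_ex1[OF assms(1)]]] assms(2,3) unfolding adj_def by blast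
lemma adj_mem: "T \<in> bop G H \<Longrightarrow> y \<in> hset H \<Longrightarrow> adj G H T y \<in> hset G"
  using bop_mem[OF adj_bop] .
lemma adj_ip': "T \<in> bop G H \<Longrightarrow> x \<in> hset G \<Longrightarrow> y \<in> hset H \<Longrightarrow> hip G x (adj G H T y) = hip H (T x) y"
  using G.herm[of "adj G H T y" x] H.herm[of y "T x"] adj_ip[of T x y] by (simp add: adj_mem bop_mem)
lemma adj_eqI:
  assumes "T \<in> bop G H" "S \<in> bop H G"
    "\<And>x y. x \<in> hset G \<Longrightarrow> y \<in> hset H \<Longrightarrow> hip G (S y) x = hip H y (T x)"
  shows "adj G H T = S"
  unfolding adj_def by (rule the1_equality[OF adj_ex1[OF assms(1)]]) (use assms in blast)

lemma adj_adj:
  assumes "T \<in> bop G H" shows "adj H G (adj G H T) = T"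
proof -
  interpret HG: hilb2 H G ..
  show ?thesis by (rule HG.adj_eqI) (use assms adj_ip' in auto)
qed

text \<open>
  Most operators below are prescribed by values \<open>F v\<close> at vectors \<open>A v\<close>, where \<open>A\<close> is usually not injective; the
  norm estimate makes \<open>A v \<mapsto> F v\<close> well defined and extends it to the closure of \<open>A ` V\<close>.  Letting \<open>T\<close> vanish on
  the orthogonal complement makes it unique, which is what \<open>extension_commute\<close> exploits.
\<close>

lemma extension:
  fixes A :: "'v::complex_vector \<Rightarrow> 'g" and F :: "'v \<Rightarrow> 'h"
  assumes V: "complex_vector.subspace V"
    and A: "\<And>v. v \<in> V \<Longrightarrow> A v \<in> hset G" "\<And>v w. v \<in> V \<Longrightarrow> w \<in> V \<Longrightarrow> A (v + w) = A v + A w"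
      "\<And>v c. v \<in> V \<Longrightarrow> A (c *\<^sub>C v) = c *\<^sub>C A v"
    and F: "\<And>v. v \<in> V \<Longrightarrow> F v \<in> hset H" "\<And>v w. v \<in> V \<Longrightarrow> w \<in> V \<Longrightarrow> F (v + w) = F v + F w"
      "\<And>v c. v \<in> V \<Longrightarrow> F (c *\<^sub>C v) = c *\<^sub>C F v"
    and bound: "\<And>v. v \<in> V \<Longrightarrow> hnorm H (F v) \<le> K * hnorm G (A v)" and K: "K \<ge> 0"
  obtains T where "T \<in> bop G H" "\<And>v. v \<in> V \<Longrightarrow> T (A v) = F v"
    "\<And>x. x \<in> hset G \<Longrightarrow> (\<And>v. v \<in> V \<Longrightarrow> hip G (A v) x = 0) \<Longrightarrow> T x = 0"
    "\<And>x. x \<in> hset G \<Longrightarrow> hnorm H (T x) \<le> K * hnorm G x"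
proof -
  note Va = complex_vector.subspace_add[OF V] and Vs = complex_vector.subspace_scale[OF V]
    and V0 = complex_vector.subspace_0[OF V] and Vd = complex_vector.subspace_diff[OF V]
  have Ad: "A (v - w) = A v - A w" if "v \<in> V" "w \<in> V" for v w
    using A(2)[of "v - w" w] Vd that by simp
  have Fd: "F (v - w) = F v - F w" if "v \<in> V" "w \<in> V" for v w
    using F(2)[of "v - w" w] Vd that by simp
  define D where "D = A ` V"
  define C where "C = hcl G D"
  have DG: "D \<subseteq> hset G" using A(1) by (auto simp: D_def)
  have D: "complex_vector.subspace D" unfolding D_def by (rule linear_image_subspace[OF V A(2,3)])
  have C: "G.closed_subspace C" unfolding C_def by (rule G.closed_subspace_hcl[OF D DG])
  \<comment> \<open>The graph of the extension.  Working with the relation avoids choosing preimages under \<open>A\<close>.\<close>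
  define R where "R x l \<longleftrightarrow> (\<exists>v. (\<forall>n. v n \<in> V) \<and> hlim G (\<lambda>n. A (v n)) x \<and> hlim H (\<lambda>n. F (v n)) l)" for x l
  have Rn: "hnorm H l \<le> K * hnorm G x" if R: "R x l" for x l
  proof -
    obtain v where v: "\<And>n. v n \<in> V" "hlim G (\<lambda>n. A (v n)) x" "hlim H (\<lambda>n. F (v n)) l" using R unfolding R_def by blast
    show ?thesis
      by (rule LIMSEQ_le[OF H.hlim_norm[OF v(3)] tendsto_mult_left[OF G.hlim_norm[OF v(2)]]])
        (use bound v(1) in auto)
  qed
  have Ra: "R (x + y) (l + m)" if R: "R x l" "R y m" for x y l m
  proof -
    obtain v w where v: "\<And>n. v n \<in> V" "hlim G (\<lambda>n. A (v n)) x" "hlim H (\<lambda>n. F (v n)) l"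
      and w: "\<And>n. w n \<in> V" "hlim G (\<lambda>n. A (w n)) y" "hlim H (\<lambda>n. F (w n)) m" using R unfolding R_def by blast
    show ?thesis unfolding R_def
      using G.hlim_add[OF v(2) w(2)] H.hlim_add[OF v(3) w(3)] v(1) w(1) Va
      by (intro exI[of _ "\<lambda>n. v n + w n"]) (simp add: A F)
  qed
  have Rs: "R (c *\<^sub>C x) (c *\<^sub>C l)" if R: "R x l" for x l c
  proof -
    obtain v where v: "\<And>n. v n \<in> V" "hlim G (\<lambda>n. A (v n)) x" "hlim H (\<lambda>n. F (v n)) l" using R unfolding R_def by blast
    show ?thesis unfolding R_def
      using G.hlim_scale[OF v(2)] H.hlim_scale[OF v(3)] v(1) Vs
      by (intro exI[of _ "\<lambda>n. c *\<^sub>C v n"]) (simp add: A F)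
  qed
  have Rmem: "x \<in> hset G" "l \<in> hset H" if "R x l" for x l using that unfolding R_def hlim_def by auto
  have Ru: "l = m" if R: "R x l" "R x m" for x l m
  proof -
    have "R (x + (-1) *\<^sub>C x) (l + (-1) *\<^sub>C m)" by (rule Ra[OF R(1) Rs[OF R(2)]])
    then have "R 0 (l - m)" by (simp add: complex_vector.scale_minus_left)
    then have "hnorm H (l - m) \<le> 0" using Rn by force
    then have "hnorm H (l - m) = 0" 
      using H.norm_nonneg[OF H.diff_mem[OF Rmem(2)[OF R(1)] Rmem(2)[OF R(2)]]] by linarith
    then show ?thesis using H.norm_eq_zero[of "l - m"] Rmem(2)[OF R(1)] Rmem(2)[OF R(2)] by simp
  qed
  have Re: "\<exists>l. R x l" if x: "x \<in> C" for x
  proof -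
    obtain s where s: "\<And>n. s n \<in> D" "hlim G s x" using x unfolding C_def hcl_def by blast
    have "\<forall>n. \<exists>v\<in>V. s n = A v" using s(1) unfolding D_def by blast
    then obtain v where v: "\<And>n. v n \<in> V" "\<And>n. s n = A (v n)" by metis
    obtain l where "hlim H (\<lambda>n. F (v n)) l"
    proof (rule H.complete)
      fix e :: real assume e: "e > 0"
      define r where "r = e / (2 * (K + 1))"
      have r: "r > 0" using e K by (simp add: r_def)
      obtain N where N: "\<And>n. n \<ge> N \<Longrightarrow> hnorm G (s n - x) < r"
        using s(2) r unfolding hlim_def LIMSEQ_iff by (metis abs_ge_self diff_zero order_le_less_trans real_norm_def)
      have "hnorm H (F (v m) - F (v n)) < e" if "m \<ge> N" "n \<ge> N" for m n
      proof -
        note mem = G.hlim_mem[OF s(2)]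
        have "hnorm G (s m - s n) \<le> hnorm G (s m - x) + hnorm G (s n - x)"
          using G.norm_triangle3[of "s m" x "s n"] G.norm_commute[of x "s n"] mem by simp
        also have "\<dots> < 2 * r" using N[OF that(1)] N[OF that(2)] by simp
        finally have "K * hnorm G (s m - s n) \<le> K * (2 * r)" using K by (simp add: mult_left_mono)
        also have "\<dots> < e" using e K by (simp add: r_def field_simps)
        finally show ?thesis using bound[of "v m - v n"] v Vd by (simp add: Ad Fd)
      qed
      then show "\<exists>N. \<forall>m\<ge>N. \<forall>n\<ge>N. hnorm H (F (v m) - F (v n)) < e" by blast
    qed (use F(1) v(1) in blast)
    moreover have "hlim G (\<lambda>n. A (v n)) x" using s(2) by (simp flip: v(2))
    ultimately show ?thesis unfolding R_def using v(1) by blast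
  qed
  define T where "T x = (if x \<in> hset G then THE l. R (G.proj C x) l else 0)" for x
  have TR: "R (G.proj C x) (T x)" if x: "x \<in> hset G" for x
  proof -
    have "\<exists>!l. R (G.proj C x) l" using Re[OF G.proj_mem[OF C x]] Ru by blast
    then show ?thesis using x theI'[of "R (G.proj C x)"] by (simp add: T_def)
  qed
  have P: "G.proj C \<in> bop G G" by (rule G.proj_bop[OF C])
  show thesis
  proof
    show nb: "hnorm H (T x) \<le> K * hnorm G x" if "x \<in> hset G" for x
      using Rn[OF TR[OF that]] mult_left_mono[OF G.proj_norm[OF C that] K] by linarith
    show "T \<in> bop G H"
    proof (rule bopI[where K = K])
      fix x assume x: "x \<in> hset G"
      show "T x \<in> hset H" using Rmem TR[OF x] by blast
      show "hnorm H (T x) \<le> K * hnorm G x" by (rule nb[OF x])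
      show "T (c *\<^sub>C x) = c *\<^sub>C T x" for c
        using Ru[OF TR Rs[OF TR[OF x], of c, folded bop_scale[OF P x]]] x by simp
      show "T (x + y) = T x + T y" if y: "y \<in> hset G" for y
        using Ru[OF TR Ra[OF TR[OF x] TR[OF y], folded bop_add[OF P x y]]] x y by simp
    qed (simp add: T_def)
    show "T (A v) = F v" if v: "v \<in> V" for v
    proof (rule Ru[OF TR[OF A(1)[OF v]]])
      have "A v \<in> C" unfolding C_def by (rule G.hcl_self[OF DG]) (use v in \<open>simp add: D_def\<close>)
      then show "R (G.proj C (A v)) (F v)" unfolding G.proj_id[OF C \<open>A v \<in> C\<close>] R_def
        using v A(1) F(1) by (intro exI[of _ "\<lambda>_. v"]) (auto intro: G.hlim_const H.hlim_const)
    qed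
    show "T x = 0" if x: "x \<in> hset G" and p: "\<And>v. v \<in> V \<Longrightarrow> hip G (A v) x = 0" for x
    proof -
      have "hip G c x = 0" if "c \<in> C" for c
        using G.perp_hcl[OF DG x _ that[unfolded C_def]] p by (auto simp: D_def)
      then have "G.proj C x = 0" by (rule G.proj_zero[OF C x])
      then have "hnorm H (T x) \<le> 0" using Rn[OF TR[OF x]] by simp
      then show ?thesis using H.norm_eq_zero H.norm_nonneg Rmem TR[OF x] by (metis antisym)
    qed
  qed
qed

text \<open>
  Invariance of \<open>A ` V\<close> under the adjoint of \<open>SG\<close> means that \<open>SG\<close> preserves the orthogonal complement of
  \<open>A ` V\<close>, where \<open>T\<close> vanishes.
\<close>

lemma extension_commute:
  fixes A :: "'v::complex_vector \<Rightarrow> 'g"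
  assumes V: "complex_vector.subspace V" 
    and A: "\<And>v. v \<in> V \<Longrightarrow> A v \<in> hset G" "\<And>v w. v \<in> V \<Longrightarrow> w \<in> V \<Longrightarrow> A (v + w) = A v + A w"
      "\<And>v c. v \<in> V \<Longrightarrow> A (c *\<^sub>C v) = c *\<^sub>C A v"
    and T: "T \<in> bop G H" "\<And>x. x \<in> hset G \<Longrightarrow> (\<And>v. v \<in> V \<Longrightarrow> hip G (A v) x = 0) \<Longrightarrow> T x = 0"
    and SG: "SG \<in> bop G G" and SH: "SH \<in> bop H H"
    and inv: "\<And>v. v \<in> V \<Longrightarrow> T (SG (A v)) = SH (T (A v))" "\<And>v. v \<in> V \<Longrightarrow> adj G G SG (A v) \<in> A ` V"
  shows "T \<circ> SG = SH \<circ> T"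
proof
  fix x
  interpret GG: hilb2 G G ..
  define D where "D = A ` V"
  have DG: "D \<subseteq> hset G" using A(1) by (auto simp: D_def)
  have D: "complex_vector.subspace D" unfolding D_def by (rule linear_image_subspace[OF V A(2,3)])
  have C: "G.closed_subspace (hcl G D)" by (rule G.closed_subspace_hcl[OF D DG])
  show "(T \<circ> SG) x = (SH \<circ> T) x"
  proof (cases "x \<in> hset G")
    case False
    then show ?thesis using bop_out[OF SG False] bop_out[OF T(1) False] bop_zero[OF T(1)] bop_zero[OF SH] by simp
  next
    case x: True
    define p where "p = G.proj (hcl G D) x"
    define z where "z = x - p"
    have p: "p \<in> hcl G D" "p \<in> hset G" unfolding p_def by (rule G.proj_mem[OF C x], rule G.proj_in[OF C x])
    have z: "z \<in> hset G" using x p by (simp add: z_def)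
    have zp: "hip G d z = 0" if "d \<in> D" for d
      using G.proj_perp[OF C x] G.hcl_self[OF DG that] by (simp add: z_def p_def)
    obtain s where s: "\<And>n. s n \<in> D" "hlim G s p" using p(1) unfolding hcl_def by blast
    have "T (SG (s n)) = SH (T (s n))" for n using s(1)[of n] inv(1) unfolding D_def by auto
    moreover have "hlim H (\<lambda>n. T (SG (s n))) (T (SG p))" by (rule bop_hlim[OF T(1) GG.bop_hlim[OF SG s(2)]])
    moreover have "hlim H (\<lambda>n. SH (T (s n))) (SH (T p))"
      by (rule hilb2.bop_hlim[OF _ SH bop_hlim[OF T(1) s(2)]]) unfold_locales
    ultimately have 1: "T (SG p) = SH (T p)" using H.hlim_unique by auto
    have "T z = 0" by (rule T(2)[OF z]) (use zp in \<open>auto simp: D_def\<close>)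
    moreover have "T (SG z) = 0"
    proof (rule T(2)[OF bop_mem[OF SG z]])
      fix v assume v: "v \<in> V"
      have "hip G (A v) (SG z) = hip G (adj G G SG (A v)) z" using GG.adj_ip[OF SG z A(1)[OF v]] by simp
      then show "hip G (A v) (SG z) = 0" using zp inv(2)[OF v] by (simp add: D_def)
    qed
    moreover have "T (SG x) = T (SG p) + T (SG z)" "T x = T p + T z"
      using bop_add[OF SG p(2) z] bop_add[OF T(1) bop_mem[OF SG p(2)] bop_mem[OF SG z]] bop_add[OF T(1) p(2) z]
      by (simp_all add: z_def)
    ultimately show ?thesis using 1 by simp
  qed
qed

end

lemma is_hilbertI:
  assumes semi: "semi_inner (hset H) (hip H)"
    and definite: "\<And>x. x \<in> hset H \<Longrightarrow> hip H x x = 0 \<Longrightarrow> x = 0"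
    and complete: "\<And>s. (\<And>n. s n \<in> hset H) \<Longrightarrow>
      (\<And>e. e > 0 \<Longrightarrow> \<exists>N. \<forall>m\<ge>N. \<forall>n\<ge>N. hnorm H (s m - s n) < e) \<Longrightarrow>
      \<exists>l\<in>hset H. (\<lambda>n. hnorm H (s n - l)) \<longlonglongrightarrow> 0"
  shows "is_hilbert H"
proof -
  interpret semi_inner "hset H" "hip H" by (rule semi)
  interpret M: Metric_space "hset H" "hdist H" by (rule is_hilbert_metric[OF assms(1,2)])
  have "M.mcomplete" unfolding M.mcomplete_def
  proof (intro allI impI)
    fix s assume s: "M.MCauchy s"
    then have mem: "s n \<in> hset H" for n unfolding M.MCauchy_def by blast
    have "\<exists>l\<in>hset H. (\<lambda>n. hnorm H (s n - l)) \<longlonglongrightarrow> 0"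
    proof (rule complete[OF mem])
      fix e :: real assume "e > 0"
      then obtain N where "\<forall>n n'. N \<le> n \<longrightarrow> N \<le> n' \<longrightarrow> hdist H (s n) (s n') < e"
        using s unfolding M.MCauchy_def by blast
      then show "\<exists>N. \<forall>m\<ge>N. \<forall>n\<ge>N. hnorm H (s m - s n) < e" using mem by (auto simp: hdist_def)
    qed
    then obtain l where "l \<in> hset H" "(\<lambda>n. hnorm H (s n - l)) \<longlonglongrightarrow> 0" by blast
    then have "limitin M.mtopology s l sequentially"
      using mem by (simp add: M.limitin_metric_dist_null hdist_def)
    then show "\<exists>x. limitin M.mtopology s x sequentially" by blast
  qed
  then show ?thesis unfolding is_hilbert_def
    by (intro conjI ballI allI impI subspace add_right scale_right herm pos definite)
qed

lemma (in hilb) total_if_perp: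
  assumes X: "X \<subseteq> hset H" and p: "\<And>z. z \<in> hset H \<Longrightarrow> (\<And>x. x \<in> X \<Longrightarrow> hip H x z = 0) \<Longrightarrow> z = 0"
  shows "hcl H (complex_vector.span X) = hset H"
proof -
  let ?D = "complex_vector.span X"
  have DH: "?D \<subseteq> hset H" by (rule span_mem[OF X])
  have C: "closed_subspace (hcl H ?D)" by (rule closed_subspace_hcl[OF complex_vector.subspace_span DH])
  have "z \<in> hcl H ?D" if z: "z \<in> hset H" for z
  proof -
    have "z - proj (hcl H ?D) z = 0"
    proof (rule p)
      show "z - proj (hcl H ?D) z \<in> hset H" using z proj_in[OF C z] by simp
      show "hip H x (z - proj (hcl H ?D) z) = 0" if "x \<in> X" for x
        by (rule proj_perp[OF C z hcl_self[OF DH complex_vector.span_base[OF that]]])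
    qed
    then show ?thesis using proj_mem[OF C z] by simp
  qed
  then show ?thesis using hcl_mem by blast
qed

lemma LIMSEQ_real_less: "(s::nat\<Rightarrow>real) \<longlonglongrightarrow> 0 \<Longrightarrow> e > 0 \<Longrightarrow> \<exists>N. \<forall>n\<ge>N. s n < e"
  unfolding LIMSEQ_iff by (metis abs_ge_self diff_zero order_le_less_trans real_norm_def)

section \<open>Free vector spaces\<close>

definition fsupp :: "'p set \<Rightarrow> ('p \<Rightarrow> complex) set" where
  "fsupp P = {c. finite {p. c p \<noteq> 0} \<and> {p. c p \<noteq> 0} \<subseteq> P}"

definition lincomb :: "('p \<Rightarrow> 'v::complex_vector) \<Rightarrow> ('p \<Rightarrow> complex) \<Rightarrow> 'v" where
  "lincomb e c = (\<Sum>p | c p \<noteq> 0. c p *\<^sub>C e p)"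

definition single :: "'p \<Rightarrow> 'p \<Rightarrow> complex" where
  "single p = (\<lambda>q. if q = p then 1 else 0)"

lemma fsupp_subspace: "complex_vector.subspace (fsupp P)"
proof (rule complex_vector.subspaceI)
  show "0 \<in> fsupp P" by (simp add: fsupp_def)
next
  fix c d :: "'a \<Rightarrow> complex" assume cd: "c \<in> fsupp P" "d \<in> fsupp P"
  have sub: "{p. (c + d) p \<noteq> 0} \<subseteq> {p. c p \<noteq> 0} \<union> {p. d p \<noteq> 0}" by auto
  then show "c + d \<in> fsupp P" using cd finite_subset[OF sub] unfolding fsupp_def by blast
next
  fix a and c :: "'a \<Rightarrow> complex" assume c: "c \<in> fsupp P"
  have sub: "{p. (a *\<^sub>C c) p \<noteq> 0} \<subseteq> {p. c p \<noteq> 0}" by (auto simp: scaleC_complex_def)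
  then show "a *\<^sub>C c \<in> fsupp P" using c finite_subset[OF sub] unfolding fsupp_def by blast
qed

lemma single_fsupp: "p \<in> P \<Longrightarrow> single p \<in> fsupp P"
  by (auto simp: fsupp_def single_def)

lemma lincomb_superset: "finite F \<Longrightarrow> {p. c p \<noteq> 0} \<subseteq> F \<Longrightarrow> lincomb e c = (\<Sum>p\<in>F. c p *\<^sub>C e p)"
  unfolding lincomb_def by (rule sum.mono_neutral_left) auto

lemma lincomb_add:
  assumes "c \<in> fsupp P" "d \<in> fsupp P" shows "lincomb e (c + d) = lincomb e c + lincomb e d"
proof -
  let ?F = "{p. c p \<noteq> 0} \<union> {p. d p \<noteq> 0}"
  have F: "finite ?F" using assms by (auto simp: fsupp_def)
  show ?thesis
    unfolding lincomb_superset[OF F, of c, simplified] lincomb_superset[OF F, of d, simplified]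
    by (subst lincomb_superset[OF F]) (auto simp: scaleC_add_left sum.distrib)
qed

lemma lincomb_scale:
  assumes "c \<in> fsupp P" shows "lincomb e (a *\<^sub>C c) = a *\<^sub>C lincomb e c"
proof -
  have F: "finite {p. c p \<noteq> 0}" using assms by (auto simp: fsupp_def)
  show ?thesis
    by (subst lincomb_superset[OF F])
      (auto simp: lincomb_def scaleC_complex_def scaleC_scaleC complex_vector.scale_sum_right)
qed

lemma lincomb_single [simp]: "lincomb e (single p) = e p"
proof -
  have "{q. single p q \<noteq> 0} = {p}" by (auto simp: single_def)
  then show ?thesis by (simp add: lincomb_def single_def scaleC_one)
qed

lemma lincomb_span: "lincomb e ` fsupp P = complex_vector.span (e ` P)"
proof
  have "lincomb e c \<in> complex_vector.span (e ` P)" if "c \<in> fsupp P" for c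
    unfolding lincomb_def
    by (rule complex_vector.span_sum, rule complex_vector.span_scale, rule complex_vector.span_base)
      (use that in \<open>auto simp: fsupp_def\<close>)
  then show "lincomb e ` fsupp P \<subseteq> complex_vector.span (e ` P)" by blast
  show "complex_vector.span (e ` P) \<subseteq> lincomb e ` fsupp P"
  proof (rule complex_vector.span_minimal)
    show "e ` P \<subseteq> lincomb e ` fsupp P" using lincomb_single single_fsupp by (metis image_eqI image_subsetI)
    show "complex_vector.subspace (lincomb e ` fsupp P)"
      by (rule linear_image_subspace[OF fsupp_subspace]) (simp_all add: lincomb_add lincomb_scale)
  qed
qed

section \<open>Cauchy sequences in semi-inner product spaces\<close>

context semi_inner
begin

definition qcauchy :: "(nat \<Rightarrow> 'a) \<Rightarrow> bool" where
  "qcauchy s \<longleftrightarrow> (\<forall>n. s n \<in> S) \<and> (\<forall>e>0. \<exists>N. \<forall>m\<ge>N. \<forall>n\<ge>N. qnorm q (s m - s n) < e)"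

lemma qcauchy_mem: "qcauchy s \<Longrightarrow> s n \<in> S"
  by (simp add: qcauchy_def)

lemma qcauchy_const: "x \<in> S \<Longrightarrow> qcauchy (\<lambda>_. x)"
  by (simp add: qcauchy_def)

lemma qcauchy_add:
  assumes s: "qcauchy s" and t: "qcauchy t" shows "qcauchy (\<lambda>n. s n + t n)"
  unfolding qcauchy_def
proof (intro conjI allI impI)
  note mem = qcauchy_mem[OF s] qcauchy_mem[OF t]
  show "s n + t n \<in> S" for n using mem by simp
  fix e :: real assume e: "e > 0"
  then obtain M N where M: "\<And>m n. m \<ge> M \<Longrightarrow> n \<ge> M \<Longrightarrow> qnorm q (s m - s n) < e / 2"
    and N: "\<And>m n. m \<ge> N \<Longrightarrow> n \<ge> N \<Longrightarrow> qnorm q (t m - t n) < e / 2"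
    using s t unfolding qcauchy_def by (meson half_gt_zero)
  have "qnorm q (s m + t m - (s n + t n)) < e" if "m \<ge> max M N" "n \<ge> max M N" for m n
  proof -
    have eq: "s m + t m - (s n + t n) = (s m - s n) + (t m - t n)" by simp
    have "qnorm q (s m + t m - (s n + t n)) \<le> qnorm q (s m - s n) + qnorm q (t m - t n)"
      unfolding eq using norm_triangle[of "s m - s n" "t m - t n"] mem by simp
    then show ?thesis using M[of m n] N[of m n] that by simp
  qed
  then show "\<exists>N. \<forall>m\<ge>N. \<forall>n\<ge>N. qnorm q (s m + t m - (s n + t n)) < e" by blast
qed

lemma qcauchy_scale:
  assumes s: "qcauchy s" shows "qcauchy (\<lambda>n. c *\<^sub>C s n)"
  unfolding qcauchy_def
proof (intro conjI allI impI)
  note mem = qcauchy_mem[OF s]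
  show "c *\<^sub>C s n \<in> S" for n using mem by simp
  fix e :: real assume e: "e > 0"
  then have "e / (cmod c + 1) > 0" by (simp add: add_nonneg_pos)
  then obtain N where N: "\<And>m n. m \<ge> N \<Longrightarrow> n \<ge> N \<Longrightarrow> qnorm q (s m - s n) < e / (cmod c + 1)"
    using s unfolding qcauchy_def by meson
  have "qnorm q (c *\<^sub>C s m - c *\<^sub>C s n) < e" if "m \<ge> N" "n \<ge> N" for m n
  proof -
    have "qnorm q (c *\<^sub>C s m - c *\<^sub>C s n) = cmod c * qnorm q (s m - s n)"
      using mem by (simp add: norm_scale flip: complex_vector.scale_right_diff_distrib)
    also have "\<dots> \<le> cmod c * (e / (cmod c + 1))"
      by (rule mult_left_mono[OF less_imp_le[OF N[OF that]]]) simp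
    also have "\<dots> < e"
      using e pos_divide_less_eq[of "cmod c + 1" "cmod c * e" e] add_nonneg_pos[of "cmod c" 1] by (simp add: algebra_simps)
    finally show ?thesis .
  qed
  then show "\<exists>N. \<forall>m\<ge>N. \<forall>n\<ge>N. qnorm q (c *\<^sub>C s m - c *\<^sub>C s n) < e" by blast
qed

lemma qcauchy_diff: "qcauchy s \<Longrightarrow> qcauchy t \<Longrightarrow> qcauchy (\<lambda>n. s n - t n)"
  using qcauchy_add[OF _ qcauchy_scale[of t "-1"], of s] by (simp add: complex_vector.scale_minus_left)

lemma qcauchy_bounded:
  assumes s: "qcauchy s" obtains B where "B > 0" "\<And>n. qnorm q (s n) \<le> B"
proof -
  note mem = qcauchy_mem[OF s]
  obtain N where N: "\<And>m n. m \<ge> N \<Longrightarrow> n \<ge> N \<Longrightarrow> qnorm q (s m - s n) < 1"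
    using s unfolding qcauchy_def by (meson zero_less_one)
  define B where "B = (\<Sum>n\<le>N. qnorm q (s n)) + 1"
  have part: "qnorm q (s n) \<le> (\<Sum>n\<le>N. qnorm q (s n))" if "n \<le> N" for n
    using that mem by (intro member_le_sum) auto
  have "qnorm q (s n) \<le> B" for n
  proof (cases "n \<le> N")
    case True then show ?thesis using part unfolding B_def by fastforce
  next
    case False
    have "qnorm q (s n) \<le> qnorm q (s n - s N) + qnorm q (s N)"
      using norm_triangle[of "s n - s N" "s N"] mem by simp
    then show ?thesis using N[of n N] False part[of N] by (simp add: B_def)
  qed
  moreover have "B > 0" unfolding B_def using mem by (simp add: add_nonneg_pos sum_nonneg)
  ultimately show thesis using that by blast
qed

lemma qcauchy_convergent:
  assumes s: "qcauchy s" and t: "qcauchy t" shows "convergent (\<lambda>n. q (s n) (t n))"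
proof -
  note mem = qcauchy_mem[OF s] qcauchy_mem[OF t]
  obtain A where A: "A > 0" "\<And>n. qnorm q (s n) \<le> A" using qcauchy_bounded[OF s] by blast
  obtain B where B: "B > 0" "\<And>n. qnorm q (t n) \<le> B" using qcauchy_bounded[OF t] by blast
  have "Cauchy (\<lambda>n. q (s n) (t n))" unfolding Cauchy_def dist_norm
  proof (intro allI impI)
    fix e :: real assume e: "e > 0"
    have "e / (2 * B) > 0" "e / (2 * A) > 0" using e A B by auto
    then obtain M N where M: "\<And>m n. m \<ge> M \<Longrightarrow> n \<ge> M \<Longrightarrow> qnorm q (s m - s n) < e / (2 * B)"
      and N: "\<And>m n. m \<ge> N \<Longrightarrow> n \<ge> N \<Longrightarrow> qnorm q (t m - t n) < e / (2 * A)"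
      using s t unfolding qcauchy_def by meson
    have "cmod (q (s m) (t m) - q (s n) (t n)) < e" if "m \<ge> max M N" "n \<ge> max M N" for m n
    proof -
      have "qnorm q (s m - s n) * qnorm q (t m) \<le> qnorm q (s m - s n) * B"
        using B mem by (intro mult_left_mono) auto
      also have "\<dots> < e / (2 * B) * B" using M[of m n] that B by (intro mult_strict_right_mono) auto
      finally have 1: "qnorm q (s m - s n) * qnorm q (t m) < e / 2" using B by simp
      have "qnorm q (s n) * qnorm q (t m - t n) \<le> A * qnorm q (t m - t n)"
        using A mem by (intro mult_right_mono) auto
      also have "\<dots> < A * (e / (2 * A))" using N[of m n] that A by (intro mult_strict_left_mono) auto
      finally have 2: "qnorm q (s n) * qnorm q (t m - t n) < e / 2" using A by simp
      show ?thesis using inner_diff_bound[OF mem(1) mem(2) mem(1) mem(2), of m m n n] 1 2 by linarith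
    qed
    then show "\<exists>M. \<forall>m\<ge>M. \<forall>n\<ge>M. cmod (q (s m) (t m) - q (s n) (t n)) < e" by blast
  qed
  then show ?thesis by (rule Cauchy_convergent)
qed

text \<open>
  In a completion, a vector orthogonal to a dense subspace is zero.  Here is the same in terms of a
  Cauchy sequence that represents the vector.
\<close>

lemma qcauchy_null:
  assumes s: "qcauchy s" and w: "\<And>v. v \<in> S \<Longrightarrow> (\<lambda>n. q v (s n)) \<longlonglongrightarrow> 0"
  shows "(\<lambda>n. qnorm q (s n)) \<longlonglongrightarrow> 0"
proof -
  note mem = qcauchy_mem[OF s]
  obtain B where B: "B > 0" "\<And>n. qnorm q (s n) \<le> B" using qcauchy_bounded[OF s] by blast
  have "(\<lambda>n. (qnorm q (s n))\<^sup>2) \<longlonglongrightarrow> 0"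
  proof (rule LIMSEQ_I)
    fix e :: real assume e: "e > 0"
    then have "e / (2 * B) > 0" using B by simp
    then obtain N where N: "\<And>m n. m \<ge> N \<Longrightarrow> n \<ge> N \<Longrightarrow> qnorm q (s m - s n) < e / (2 * B)"
      using s unfolding qcauchy_def by meson
    obtain M where M: "\<And>n. n \<ge> M \<Longrightarrow> cmod (q (s N) (s n)) < e / 2"
      using w[OF mem[of N]] e unfolding LIMSEQ_iff by (metis diff_zero half_gt_zero)
    have "(qnorm q (s n))\<^sup>2 < e" if "n \<ge> max M N" for n
    proof -
      have "q (s n) (s n) = q (s n - s N) (s n) + q (s N) (s n)" using mem by (simp add: bilin)
      then have "(qnorm q (s n))\<^sup>2 = Re (q (s n - s N) (s n)) + Re (q (s N) (s n))"
        using mem by (simp add: norm_sq)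
      also have "\<dots> \<le> cmod (q (s n - s N) (s n)) + cmod (q (s N) (s n))"
        by (intro add_mono complex_Re_le_cmod)
      also have "\<dots> \<le> qnorm q (s n - s N) * qnorm q (s n) + cmod (q (s N) (s n))"
        using cauchy_schwarz mem by simp
      also have "qnorm q (s n - s N) * qnorm q (s n) \<le> e / (2 * B) * B"
        using N[of n N] that B mem less_imp_le[OF \<open>e / (2 * B) > 0\<close>] by (intro mult_mono) auto
      also have "e / (2 * B) * B + cmod (q (s N) (s n)) < e" using M[of n] that B by simp
      finally show ?thesis by simp
    qed
    then show "\<exists>no. \<forall>n\<ge>no. norm ((qnorm q (s n))\<^sup>2 - 0) < e" by (auto intro!: exI[of _ "max M N"])
  qed
  then have "(\<lambda>n. sqrt ((qnorm q (s n))\<^sup>2)) \<longlonglongrightarrow> sqrt 0" by (rule tendsto_real_sqrt)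
  then show ?thesis by (simp add: abs_of_nonneg[OF norm_nonneg[OF mem]])
qed

end

section \<open>The Hilbert space of a positive definite kernel\<close>

locale psd_kernel =
  fixes P :: "'p set" and K :: "'p \<Rightarrow> 'p \<Rightarrow> complex"
  assumes herm: "p \<in> P \<Longrightarrow> r \<in> P \<Longrightarrow> K r p = cnj (K p r)"
    and psd: "finite I \<Longrightarrow> I \<subseteq> P \<Longrightarrow> (\<Sum>p\<in>I. \<Sum>r\<in>I. cnj (c p) * c r * K p r) \<in> \<real>\<^sub>\<ge>\<^sub>0"
begin

definition ev :: "('p \<Rightarrow> complex) \<Rightarrow> 'p \<Rightarrow> complex" where
  "ev d p = (if p \<in> P then \<Sum>r | d r \<noteq> 0. d r * K p r else 0)"

definition Q :: "('p \<Rightarrow> complex) \<Rightarrow> ('p \<Rightarrow> complex) \<Rightarrow> complex" where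
  "Q c d = (\<Sum>p | c p \<noteq> 0. cnj (c p) * ev d p)"

lemma ev_superset:
  assumes "finite F" "{p. d p \<noteq> 0} \<subseteq> F" "p \<in> P" shows "ev d p = (\<Sum>r\<in>F. d r * K p r)"
proof -
  have "(\<Sum>r | d r \<noteq> 0. d r * K p r) = (\<Sum>r\<in>F. d r * K p r)"
    by (rule sum.mono_neutral_left) (use assms in auto)
  then show ?thesis using assms by (simp add: ev_def)
qed

lemma Q_superset:
  assumes F: "finite F" "F \<subseteq> P" "{p. c p \<noteq> 0} \<subseteq> F" "{p. d p \<noteq> 0} \<subseteq> F"
  shows "Q c d = (\<Sum>p\<in>F. \<Sum>r\<in>F. cnj (c p) * d r * K p r)"
proof -
  have "Q c d = (\<Sum>p\<in>F. cnj (c p) * ev d p)"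
    unfolding Q_def by (rule sum.mono_neutral_left) (use F in auto)
  also have "\<dots> = (\<Sum>p\<in>F. \<Sum>r\<in>F. cnj (c p) * d r * K p r)"
  proof (rule sum.cong[OF refl])
    fix p assume "p \<in> F"
    then have "ev d p = (\<Sum>r\<in>F. d r * K p r)" using ev_superset[OF F(1) F(4)] F by blast
    then show "cnj (c p) * ev d p = (\<Sum>r\<in>F. cnj (c p) * d r * K p r)"
      by (simp add: sum_distrib_left mult.assoc)
  qed
  finally show ?thesis .
qed

lemma ev_add: "c \<in> fsupp P \<Longrightarrow> d \<in> fsupp P \<Longrightarrow> ev (c + d) p = ev c p + ev d p"
proof (cases "p \<in> P")
  case True
  assume cd: "c \<in> fsupp P" "d \<in> fsupp P"
  let ?F = "{p. c p \<noteq> 0} \<union> {p. d p \<noteq> 0}"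
  have F: "finite ?F" using cd by (auto simp: fsupp_def)
  have "ev (c + d) p = (\<Sum>r\<in>?F. (c + d) r * K p r)" by (rule ev_superset[OF F _ True]) auto
  moreover have "ev c p = (\<Sum>r\<in>?F. c r * K p r)" by (rule ev_superset[OF F _ True]) auto
  moreover have "ev d p = (\<Sum>r\<in>?F. d r * K p r)" by (rule ev_superset[OF F _ True]) auto
  ultimately show ?thesis by (simp add: algebra_simps sum.distrib)
qed (simp add: ev_def)

lemma ev_scale: "c \<in> fsupp P \<Longrightarrow> ev (a *\<^sub>C c) p = a * ev c p"
proof (cases "p \<in> P")
  case True
  assume c: "c \<in> fsupp P"
  then have F: "finite {p. c p \<noteq> 0}" by (auto simp: fsupp_def)
  have "ev (a *\<^sub>C c) p = (\<Sum>r | c r \<noteq> 0. (a *\<^sub>C c) r * K p r)"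
    by (rule ev_superset[OF F _ True]) (auto simp: scaleC_complex_def)
  then show ?thesis using True by (simp add: ev_def scaleC_complex_def sum_distrib_left mult.assoc)
qed (simp add: ev_def)

sublocale semi_inner "fsupp P" Q
proof
  show "complex_vector.subspace (fsupp P)" by (rule fsupp_subspace)
next
  fix c d e :: "'p \<Rightarrow> complex" and a
  assume c: "c \<in> fsupp P"
  show "Q c c \<in> \<real>\<^sub>\<ge>\<^sub>0" 
    using psd[of "{p. c p \<noteq> 0}" c] Q_superset[of "{p. c p \<noteq> 0}" c c] c by (simp add: fsupp_def)
  assume d: "d \<in> fsupp P"
  show "Q c (a *\<^sub>C d) = a * Q c d"
    by (simp add: Q_def ev_scale[OF d] sum_distrib_left mult.left_commute)
  show "Q d c = cnj (Q c d)"
  proof -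
    let ?F = "{p. c p \<noteq> 0} \<union> {p. d p \<noteq> 0}"
    have F: "finite ?F" "?F \<subseteq> P" using c d by (auto simp: fsupp_def)
    have "Q d c = (\<Sum>p\<in>?F. \<Sum>r\<in>?F. cnj (d p) * c r * K p r)" by (rule Q_superset[OF F]) auto
    also have "\<dots> = (\<Sum>r\<in>?F. \<Sum>p\<in>?F. cnj (d p) * c r * K p r)" by (rule sum.swap)
    also have "\<dots> = (\<Sum>r\<in>?F. \<Sum>p\<in>?F. cnj (cnj (c r) * d p * K r p))"
    proof (intro sum.cong refl)
      fix r p assume "r \<in> ?F" "p \<in> ?F"
      then have "K p r = cnj (K r p)" using F herm by blast
      then show "cnj (d p) * c r * K p r = cnj (cnj (c r) * d p * K r p)" by simp
    qed
    also have "\<dots> = cnj (Q c d)" 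
      by (subst Q_superset[OF F]) (auto simp: cnj_sum)
    finally show ?thesis .
  qed
  assume e: "e \<in> fsupp P"
  show "Q c (d + e) = Q c d + Q c e"
    by (simp add: Q_def ev_add[OF d e] distrib_left sum.distrib)
qed

lemma Q_single: "p \<in> P \<Longrightarrow> Q (single p) d = ev d p"
proof -
  have "{r. single p r \<noteq> 0} = {p}" by (auto simp: single_def)
  then show ?thesis by (simp add: Q_def single_def)
qed

text \<open>
  The completion of the space of coefficient functions is realized on functions on \<open>P\<close>: the class of a Cauchy
  sequence \<open>s\<close> is recorded by the limits of the inner products of \<open>s n\<close> with the generators \<open>single p\<close>.  By
  \<open>limfun_eq_null\<close> these limits determine the class, and they need no type beyond \<open>'p \<Rightarrow> complex\<close>.
\<close>

definition limfun :: "(nat \<Rightarrow> 'p \<Rightarrow> complex) \<Rightarrow> 'p \<Rightarrow> complex" where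
  "limfun s p = lim (\<lambda>n. ev (s n) p)"

definition rep :: "('p \<Rightarrow> complex) \<Rightarrow> nat \<Rightarrow> 'p \<Rightarrow> complex" where
  "rep f = (SOME s. qcauchy s \<and> limfun s = f)"

definition kspace :: "('p \<Rightarrow> complex) hilbert" where
  "kspace = \<lparr>hset = limfun ` Collect qcauchy, hip = (\<lambda>f g. lim (\<lambda>n. Q (rep f n) (rep g n)))\<rparr>"

lemma ev_tendsto: 
  assumes s: "qcauchy s" shows "(\<lambda>n. ev (s n) p) \<longlonglongrightarrow> limfun s p"
proof (cases "p \<in> P")
  case True
  have "convergent (\<lambda>n. Q (single p) (s n))"
    by (rule qcauchy_convergent[OF qcauchy_const[OF single_fsupp[OF True]] s])
  then show ?thesis by (simp add: Q_single[OF True] limfun_def convergent_LIMSEQ_iff)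
qed (simp add: ev_def limfun_def)

lemma Q_tendsto_zero:
  assumes "\<And>p. p \<in> P \<Longrightarrow> (\<lambda>n. ev (s n) p) \<longlonglongrightarrow> 0" "v \<in> fsupp P"
  shows "(\<lambda>n. Q v (s n)) \<longlonglongrightarrow> 0"
proof -
  have "(\<lambda>n. \<Sum>p | v p \<noteq> 0. cnj (v p) * ev (s n) p) \<longlonglongrightarrow> (\<Sum>p | v p \<noteq> 0. 0)"
    using assms by (intro tendsto_sum tendsto_mult_right_zero) (auto simp: fsupp_def)
  then show ?thesis by (simp add: Q_def)
qed

text \<open>
  Since the generators span the coefficient functions, a Cauchy sequence whose inner products with all generators tend to
  \<open>0\<close> is weakly null; \<open>qcauchy_null\<close> applies.
\<close>

lemma limfun_eq_null:
  assumes s: "qcauchy s" and t: "qcauchy t" and e: "limfun s = limfun t"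
  shows "(\<lambda>n. qnorm Q (s n - t n)) \<longlonglongrightarrow> 0"
proof (rule qcauchy_null[OF qcauchy_diff[OF s t]])
  fix v assume v: "v \<in> fsupp P"
  show "(\<lambda>n. Q v (s n - t n)) \<longlonglongrightarrow> 0"
  proof (rule Q_tendsto_zero[OF _ v])
    fix p
    have "(\<lambda>n. ev (s n) p - ev (t n) p) \<longlonglongrightarrow> limfun s p - limfun t p"
      by (intro tendsto_diff ev_tendsto s t)
    moreover have "ev (s n - t n) p = ev (s n) p - ev (t n) p" for n
      using ev_add[of "s n - t n" "t n" p] qcauchy_mem[OF s] qcauchy_mem[OF t] by simp
    ultimately show "(\<lambda>n. ev (s n - t n) p) \<longlonglongrightarrow> 0" by (simp add: e)
  qed
qed

lemma rep: assumes "qcauchy s" shows "qcauchy (rep (limfun s))" "limfun (rep (limfun s)) = limfun s"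
  using someI[of "\<lambda>r. qcauchy r \<and> limfun r = limfun s" s] assms unfolding rep_def by auto

lemma kspace_ip:
  assumes s: "qcauchy s" and t: "qcauchy t"
  shows "(\<lambda>n. Q (s n) (t n)) \<longlonglongrightarrow> hip kspace (limfun s) (limfun t)"
proof -
  let ?s = "rep (limfun s)" and ?t = "rep (limfun t)"
  note rs = rep[OF s] and rt = rep[OF t]
  note mem = qcauchy_mem[OF s] qcauchy_mem[OF t] qcauchy_mem[OF rs(1)] qcauchy_mem[OF rt(1)]
  have 1: "(\<lambda>n. Q (?s n) (?t n)) \<longlonglongrightarrow> hip kspace (limfun s) (limfun t)"
    using qcauchy_convergent[OF rs(1) rt(1)] by (simp add: kspace_def convergent_LIMSEQ_iff)
  obtain A where A: "A > 0" "\<And>n. qnorm Q (?s n) \<le> A" using qcauchy_bounded[OF rs(1)] by blast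
  obtain B where B: "B > 0" "\<And>n. qnorm Q (t n) \<le> B" using qcauchy_bounded[OF t] by blast
  have null: "(\<lambda>n. qnorm Q (s n - ?s n) * B + A * qnorm Q (t n - ?t n)) \<longlonglongrightarrow> 0 * B + A * 0"
    by (intro tendsto_intros limfun_eq_null s t rs rt) (simp_all add: rs rt)
  have "(\<lambda>n. Q (s n) (t n) - Q (?s n) (?t n)) \<longlonglongrightarrow> 0"
  proof (rule Lim_null_comparison[OF always_eventually[OF allI]])
    fix n
    have "qnorm Q (s n - ?s n) * qnorm Q (t n) \<le> qnorm Q (s n - ?s n) * B"
      using B mem by (intro mult_left_mono) auto
    moreover have "qnorm Q (?s n) * qnorm Q (t n - ?t n) \<le> A * qnorm Q (t n - ?t n)"
      using A mem by (intro mult_right_mono) auto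
    ultimately show "norm (Q (s n) (t n) - Q (?s n) (?t n)) \<le> qnorm Q (s n - ?s n) * B + A * qnorm Q (t n - ?t n)"
      using inner_diff_bound[OF mem, of n n n n] by linarith
    show "(\<lambda>n. qnorm Q (s n - ?s n) * B + A * qnorm Q (t n - ?t n)) \<longlonglongrightarrow> 0" using null by simp
  qed
  from tendsto_add[OF this 1] show ?thesis by simp
qed

lemma kspace_mem: "f \<in> hset kspace \<longleftrightarrow> (\<exists>s. qcauchy s \<and> f = limfun s)"
  by (auto simp: kspace_def)

lemma limfun_add: 
  assumes "qcauchy s" "qcauchy t" shows "limfun s + limfun t = limfun (\<lambda>n. s n + t n)"
proof
  fix p
  have "(\<lambda>n. ev (s n) p + ev (t n) p) \<longlonglongrightarrow> limfun s p + limfun t p"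
    by (intro tendsto_add ev_tendsto assms)
  then have "(\<lambda>n. ev (s n + t n) p) \<longlonglongrightarrow> limfun s p + limfun t p"
    using qcauchy_mem[OF assms(1)] qcauchy_mem[OF assms(2)] by (simp add: ev_add)
  then show "(limfun s + limfun t) p = limfun (\<lambda>n. s n + t n) p"
    using LIMSEQ_unique[OF _ ev_tendsto[OF qcauchy_add[OF assms]]] by simp
qed

lemma limfun_scale: 
  assumes "qcauchy s" shows "c *\<^sub>C limfun s = limfun (\<lambda>n. c *\<^sub>C s n)"
proof
  fix p
  have "(\<lambda>n. c * ev (s n) p) \<longlonglongrightarrow> c * limfun s p"
    by (intro tendsto_mult_left ev_tendsto assms)
  then have "(\<lambda>n. ev (c *\<^sub>C s n) p) \<longlonglongrightarrow> c * limfun s p"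
    using qcauchy_mem[OF assms] by (simp add: ev_scale)
  then show "(c *\<^sub>C limfun s) p = limfun (\<lambda>n. c *\<^sub>C s n) p"
    using LIMSEQ_unique[OF _ ev_tendsto[OF qcauchy_scale[OF assms]]] by (simp add: scaleC_complex_def)
qed

lemma limfun_diff: 
  assumes "qcauchy s" "qcauchy t" shows "limfun s - limfun t = limfun (\<lambda>n. s n - t n)"
proof -
  have "limfun s + (-1) *\<^sub>C limfun t = limfun (\<lambda>n. s n + (-1) *\<^sub>C t n)"
    unfolding limfun_scale[OF assms(2)] by (rule limfun_add[OF assms(1) qcauchy_scale[OF assms(2)]])
  then show ?thesis by (simp add: complex_vector.scale_minus_left)
qed

lemma kspace_semi: "semi_inner (hset kspace) (hip kspace)"
proof
  show "complex_vector.subspace (hset kspace)"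
  proof (rule complex_vector.subspaceI)
    have "limfun (\<lambda>_. 0) = 0" by (rule ext) (simp add: limfun_def ev_def)
    then show "0 \<in> hset kspace" using kspace_mem qcauchy_const[OF zero_mem] by metis
    show "f + g \<in> hset kspace" if "f \<in> hset kspace" "g \<in> hset kspace" for f g
      using that limfun_add qcauchy_add unfolding kspace_mem by metis
    show "c *\<^sub>C f \<in> hset kspace" if "f \<in> hset kspace" for c f
      using that limfun_scale qcauchy_scale unfolding kspace_mem by metis
  qed
next
  fix f g h :: "'p \<Rightarrow> complex" and c assume "f \<in> hset kspace"
  then obtain s where s: "qcauchy s" "f = limfun s" unfolding kspace_mem by blast
  have "closed (\<real>\<^sub>\<ge>\<^sub>0 :: complex set)" by (rule closed_nonneg_Reals_complex)
  then show "hip kspace f f \<in> \<real>\<^sub>\<ge>\<^sub>0"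
    using closed_sequentially[OF _ _ kspace_ip[OF s(1) s(1)]] pos[OF qcauchy_mem[OF s(1)]] s(2) by blast
  assume "g \<in> hset kspace"
  then obtain t where t: "qcauchy t" "g = limfun t" unfolding kspace_mem by blast
  note mem = qcauchy_mem[OF s(1)] qcauchy_mem[OF t(1)]
  show "hip kspace f (c *\<^sub>C g) = c * hip kspace f g"
  proof (rule LIMSEQ_unique)
    show "(\<lambda>n. Q (s n) (c *\<^sub>C t n)) \<longlonglongrightarrow> hip kspace f (c *\<^sub>C g)"
      using kspace_ip[OF s(1) qcauchy_scale[OF t(1)]] s t by (simp add: limfun_scale)
    have "(\<lambda>n. c * Q (s n) (t n)) \<longlonglongrightarrow> c * hip kspace f g"
      using kspace_ip[OF s(1) t(1)] s t by (intro tendsto_mult_left) simp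
    then show "(\<lambda>n. Q (s n) (c *\<^sub>C t n)) \<longlonglongrightarrow> c * hip kspace f g" using mem by (simp add: scale_right)
  qed
  show "hip kspace g f = cnj (hip kspace f g)"
  proof (rule LIMSEQ_unique)
    show "(\<lambda>n. Q (t n) (s n)) \<longlonglongrightarrow> hip kspace g f" using kspace_ip[OF t(1) s(1)] s t by simp
    have "(\<lambda>n. cnj (Q (s n) (t n))) \<longlonglongrightarrow> cnj (hip kspace f g)"
      using kspace_ip[OF s(1) t(1)] s t by (intro tendsto_cnj) simp
    moreover have "cnj (Q (s n) (t n)) = Q (t n) (s n)" for n using semi_inner_axioms mem semi_inner.herm by metis
    ultimately show "(\<lambda>n. Q (t n) (s n)) \<longlonglongrightarrow> cnj (hip kspace f g)" by simp
  qed
  assume "h \<in> hset kspace"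
  then obtain r where r: "qcauchy r" "h = limfun r" unfolding kspace_mem by blast
  show "hip kspace f (g + h) = hip kspace f g + hip kspace f h"
  proof (rule LIMSEQ_unique)
    show "(\<lambda>n. Q (s n) (t n + r n)) \<longlonglongrightarrow> hip kspace f (g + h)"
      using kspace_ip[OF s(1) qcauchy_add[OF t(1) r(1)]] s t r by (simp add: limfun_add)
    have "(\<lambda>n. Q (s n) (t n) + Q (s n) (r n)) \<longlonglongrightarrow> hip kspace f g + hip kspace f h"
      using kspace_ip[OF s(1) t(1)] kspace_ip[OF s(1) r(1)] s t r by (intro tendsto_add) simp_all
    then show "(\<lambda>n. Q (s n) (t n + r n)) \<longlonglongrightarrow> hip kspace f g + hip kspace f h"
      using mem qcauchy_mem[OF r(1)] by (simp add: add_right)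
  qed
qed

lemma kspace_norm:
  assumes s: "qcauchy s" shows "(\<lambda>n. qnorm Q (s n)) \<longlonglongrightarrow> hnorm kspace (limfun s)"
  unfolding qnorm_def hnorm_def by (intro tendsto_real_sqrt tendsto_Re kspace_ip s)

lemma kspace_definite:
  assumes "f \<in> hset kspace" "hip kspace f f = 0" shows "f = 0"
proof -
  obtain s where s: "qcauchy s" "f = limfun s" using assms(1) unfolding kspace_mem by blast
  have "hnorm kspace f = 0" by (simp add: hnorm_def assms)
  then have null: "(\<lambda>n. qnorm Q (s n)) \<longlonglongrightarrow> 0" using kspace_norm[OF s(1)] s by simp
  have "limfun s p = 0" for p
  proof (cases "p \<in> P")
    case True
    have "(\<lambda>n. Q (single p) (s n)) \<longlonglongrightarrow> 0"
    proof (rule Lim_null_comparison[OF always_eventually[OF allI]])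
      show "norm (Q (single p) (s n)) \<le> qnorm Q (single p) * qnorm Q (s n)" for n
        by (rule cauchy_schwarz[OF single_fsupp[OF True] qcauchy_mem[OF s(1)]])
      show "(\<lambda>n. qnorm Q (single p) * qnorm Q (s n)) \<longlonglongrightarrow> 0" by (rule tendsto_mult_right_zero[OF null])
    qed
    then show ?thesis using LIMSEQ_unique[OF ev_tendsto[OF s(1), of p]] by (simp add: Q_single[OF True])
  qed (simp add: limfun_def ev_def)
  then show ?thesis using s by (auto simp: fun_eq_iff)
qed

abbreviation "emb c \<equiv> limfun (\<lambda>_. c)"

lemma approx:
  assumes s: "qcauchy s" and e: "e > 0"
  shows "\<exists>N. \<forall>m\<ge>N. hnorm kspace (limfun s - emb (s m)) \<le> e"
proof -
  obtain N where N: "\<And>m n. m \<ge> N \<Longrightarrow> n \<ge> N \<Longrightarrow> qnorm Q (s m - s n) < e"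
    using s e unfolding qcauchy_def by meson
  have "hnorm kspace (limfun s - emb (s m)) \<le> e" if m: "m \<ge> N" for m
  proof -
    have c: "qcauchy (\<lambda>_. s m)" by (rule qcauchy_const[OF qcauchy_mem[OF s]])
    have lim: "(\<lambda>n. qnorm Q (s n - s m)) \<longlonglongrightarrow> hnorm kspace (limfun s - emb (s m))"
      unfolding limfun_diff[OF s c] by (rule kspace_norm[OF qcauchy_diff[OF s c]])
    show ?thesis by (rule LIMSEQ_le_const2[OF lim]) (use N[OF _ m] in \<open>meson less_imp_le\<close>)
  qed
  then show ?thesis by blast
qed

lemma kspace_hilbert: "is_hilbert kspace"
proof (rule is_hilbertI[OF kspace_semi kspace_definite])
  interpret k: semi_inner "hset kspace" "hip kspace" rewrites "qnorm (hip kspace) = hnorm kspace"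
    by (fact kspace_semi) (simp add: hnorm_eq_qnorm)
  fix f :: "nat \<Rightarrow> 'p \<Rightarrow> complex" assume f: "\<And>n. f n \<in> hset kspace"
    and cau: "\<And>e. e > 0 \<Longrightarrow> \<exists>N. \<forall>m\<ge>N. \<forall>n\<ge>N. hnorm kspace (f m - f n) < e"
  have "\<exists>c\<in>fsupp P. hnorm kspace (f n - emb c) \<le> 1 / real (Suc n)" for n
  proof -
    obtain s where s: "qcauchy s" "f n = limfun s" using f[of n] unfolding kspace_mem by blast
    obtain N where "hnorm kspace (limfun s - emb (s N)) \<le> 1 / real (Suc n)"
      using approx[OF s(1), of "1 / real (Suc n)"] by auto
    then show ?thesis using s qcauchy_mem[OF s(1)] by auto
  qed
  then obtain c where c: "\<And>n. c n \<in> fsupp P" "\<And>n. hnorm kspace (f n - emb (c n)) \<le> 1 / real (Suc n)" by metis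
  have qc: "qcauchy (\<lambda>_. c n)" for n by (rule qcauchy_const[OF c(1)])
  have em: "emb (c n) \<in> hset kspace" for n unfolding kspace_mem using qc by blast
  have nd: "qnorm Q (c m - c n) = hnorm kspace (emb (c m) - emb (c n))" for m n
    using kspace_norm[OF qcauchy_diff[OF qc qc]] unfolding limfun_diff[OF qc qc] by (simp add: LIMSEQ_const_iff)
  have "qcauchy c" unfolding qcauchy_def
  proof (intro conjI allI impI)
    fix e :: real assume e: "e > 0"
    then obtain N where N: "\<And>m n. m \<ge> N \<Longrightarrow> n \<ge> N \<Longrightarrow> hnorm kspace (f m - f n) < e / 3"
      using cau[of "e / 3"] by auto
    obtain M where M: "1 / real (Suc M) < e / 3" using e nat_approx_posE[of "e / 3"] by auto
    have "qnorm Q (c m - c n) < e" if mn: "m \<ge> max M N" "n \<ge> max M N" for m n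
    proof -
      have sm: "hnorm kspace (f k - emb (c k)) < e / 3" if "k \<ge> M" for k
      proof -
        have "1 / real (Suc k) \<le> 1 / real (Suc M)" using that by (simp add: frac_le)
        then show ?thesis using c(2)[of k] M by linarith
      qed
      have "hnorm kspace (emb (c m) - emb (c n)) \<le> hnorm kspace (emb (c m) - f m) + hnorm kspace (f m - emb (c n))"
        using k.norm_triangle3 em f by blast
      moreover have "hnorm kspace (f m - emb (c n)) \<le> hnorm kspace (f m - f n) + hnorm kspace (f n - emb (c n))"
        using k.norm_triangle3 em f by blast
      moreover have "m \<ge> M" "n \<ge> M" "m \<ge> N" "n \<ge> N" using mn by auto
      ultimately show ?thesis
        unfolding nd using sm[of m] sm[of n] N[of m n] k.norm_commute[OF f em, of m m] by linarith
    qed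
    then show "\<exists>N. \<forall>m\<ge>N. \<forall>n\<ge>N. qnorm Q (c m - c n) < e" by blast
  qed (rule c(1))
  have lm: "limfun c \<in> hset kspace" unfolding kspace_mem using \<open>qcauchy c\<close> by blast
  have "(\<lambda>n. hnorm kspace (f n - limfun c)) \<longlonglongrightarrow> 0"
  proof (rule LIMSEQ_I)
    fix e :: real assume e: "e > 0"
    then obtain N where N: "\<And>m. m \<ge> N \<Longrightarrow> hnorm kspace (limfun c - emb (c m)) \<le> e / 3"
      using approx[OF \<open>qcauchy c\<close>, of "e / 3"] by auto
    obtain M where M: "1 / real (Suc M) < e / 3" using e nat_approx_posE[of "e / 3"] by auto
    have "hnorm kspace (f n - limfun c) < e" if "n \<ge> max M N" for n
    proof -
      have "1 / real (Suc n) \<le> 1 / real (Suc M)" using that by (simp add: frac_le)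
      moreover have "hnorm kspace (f n - limfun c) \<le> hnorm kspace (f n - emb (c n)) + hnorm kspace (emb (c n) - limfun c)"
        using k.norm_triangle3 em f lm by blast
      ultimately show ?thesis using c(2)[of n] M N[of n] that k.norm_commute[OF em lm, of n] e by simp
    qed
    then show "\<exists>no. \<forall>n\<ge>no. norm (hnorm kspace (f n - limfun c) - 0) < e" using f lm by (auto intro!: exI[of _ "max M N"])
  qed
  then show "\<exists>l\<in>hset kspace. (\<lambda>n. hnorm kspace (f n - l)) \<longlonglongrightarrow> 0" using lm by blast
qed

lemma emb_single_mem: "p \<in> P \<Longrightarrow> emb (single p) \<in> hset kspace"
  unfolding kspace_mem using qcauchy_const[OF single_fsupp] by (intro exI[of _ "\<lambda>_. single p"]) simp

lemma emb_single_ip: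
  assumes "p \<in> P" "r \<in> P" shows "hip kspace (emb (single p)) (emb (single r)) = K p r"
proof -
  have "Q (single p) (single r) = hip kspace (emb (single p)) (emb (single r))"
    using kspace_ip[OF qcauchy_const[OF single_fsupp[OF assms(1)]] qcauchy_const[OF single_fsupp[OF assms(2)]]]
    by (simp add: LIMSEQ_const_iff)
  moreover have "ev (single r) p = K p r"
    using ev_superset[of "{r}" "single r" p] assms by (auto simp: single_def)
  ultimately show ?thesis using assms by (simp add: Q_single)
qed

lemma kspace_total: "hcl kspace (complex_vector.span ((\<lambda>p. emb (single p)) ` P)) = hset kspace"
proof -
  interpret k: hilb kspace by standard (rule kspace_hilbert)
  let ?X = "(\<lambda>p. emb (single p)) ` P"
  have X: "?X \<subseteq> hset kspace" using emb_single_mem by auto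
  show ?thesis
  proof (rule k.total_if_perp[OF X])
    fix z assume z: "z \<in> hset kspace" and p: "\<And>x. x \<in> ?X \<Longrightarrow> hip kspace x z = 0"
    obtain s where s: "qcauchy s" "z = limfun s" using z unfolding kspace_mem by blast
    have "limfun s p = 0" for p
    proof (cases "p \<in> P")
      case True
      have "(\<lambda>n. Q (single p) (s n)) \<longlonglongrightarrow> hip kspace (emb (single p)) z"
        using kspace_ip[OF qcauchy_const[OF single_fsupp[OF True]] s(1)] s(2) by simp
      then show ?thesis using LIMSEQ_unique[OF ev_tendsto[OF s(1), of p]] p True by (simp add: Q_single[OF True])
    qed (simp add: limfun_def ev_def)
    then show "z = 0" using s by (auto simp: fun_eq_iff)
  qed
qed

text \<open>
  The Kolmogorov decomposition of a positive definite kernel.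
\<close>

lemma kernel_space_exists:
  "\<exists>(H :: ('p \<Rightarrow> complex) hilbert) k. is_hilbert H \<and> (\<forall>p\<in>P. k p \<in> hset H) \<and>
     (\<forall>p\<in>P. \<forall>r\<in>P. hip H (k p) (k r) = K p r) \<and> hcl H (complex_vector.span (k ` P)) = hset H"
  by (rule exI[of _ kspace], rule exI[of _ "\<lambda>p. emb (single p)"])
    (intro conjI ballI kspace_hilbert emb_single_ip kspace_total emb_single_mem)

end

section \<open>Hilbert sums\<close>

definition hsum :: "'i set \<Rightarrow> 'a::complex_vector hilbert \<Rightarrow> ('i \<Rightarrow> 'a) hilbert" where
  "hsum I H = \<lparr>hset = {f. (\<forall>i. f i \<in> hset H) \<and> (\<forall>i. i \<notin> I \<longrightarrow> f i = 0) \<and> (\<lambda>i. (hnorm H (f i))\<^sup>2) summable_on I},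
     hip = (\<lambda>f g. \<Sum>\<^sub>\<infinity>i\<in>I. hip H (f i) (g i))\<rparr>"

definition inj_at :: "'i \<Rightarrow> 'a::zero \<Rightarrow> 'i \<Rightarrow> 'a" where
  "inj_at j x = (\<lambda>i. if i = j then x else 0)"

context hilb
begin

lemma hsum_mem: "f \<in> hset (hsum I H) \<longleftrightarrow>
    (\<forall>i. f i \<in> hset H) \<and> (\<forall>i. i \<notin> I \<longrightarrow> f i = 0) \<and> (\<lambda>i. (hnorm H (f i))\<^sup>2) summable_on I"
  by (simp add: hsum_def)

lemma hsum_comp: "f \<in> hset (hsum I H) \<Longrightarrow> f i \<in> hset H"
  by (simp add: hsum_mem)

lemma hsum_ip: "hip (hsum I H) f g = (\<Sum>\<^sub>\<infinity>i\<in>I. hip H (f i) (g i))"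
  by (simp add: hsum_def)

lemma hsum_ip_summable:
  assumes f: "f \<in> hset (hsum I H)" and g: "g \<in> hset (hsum I H)"
  shows "(\<lambda>i. hip H (f i) (g i)) summable_on I"
proof (rule Infinite_Sum.abs_summable_summable, rule summable_on_comparison_test)
  show "(\<lambda>i. (hnorm H (f i))\<^sup>2 + (hnorm H (g i))\<^sup>2) summable_on I"
    using f g by (intro summable_on_add) (auto simp: hsum_mem)
  fix i
  have "cmod (hip H (f i) (g i)) \<le> hnorm H (f i) * hnorm H (g i)"
    by (rule cauchy_schwarz[OF hsum_comp[OF f] hsum_comp[OF g]])
  also have "\<dots> \<le> (hnorm H (f i))\<^sup>2 + (hnorm H (g i))\<^sup>2"
    using sum_squares_bound[of "hnorm H (f i)" "hnorm H (g i)"] zero_le_power2[of "hnorm H (f i)"]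
      zero_le_power2[of "hnorm H (g i)"] mult_nonneg_nonneg[OF norm_nonneg norm_nonneg, OF hsum_comp[OF f, of i] hsum_comp[OF g, of i]] by linarith
  finally show "norm (hip H (f i) (g i)) \<le> (hnorm H (f i))\<^sup>2 + (hnorm H (g i))\<^sup>2" .
qed simp

lemma hsum_self: "f \<in> hset (hsum I H) \<Longrightarrow>
    hip (hsum I H) f f = complex_of_real (\<Sum>\<^sub>\<infinity>i\<in>I. (hnorm H (f i))\<^sup>2)"
proof -
  assume f: "f \<in> hset (hsum I H)"
  have "hip (hsum I H) f f = (\<Sum>\<^sub>\<infinity>i\<in>I. complex_of_real ((hnorm H (f i))\<^sup>2))"
    unfolding hsum_ip by (rule infsum_cong) (rule self_eq[OF hsum_comp[OF f]])
  also have "\<dots> = complex_of_real (\<Sum>\<^sub>\<infinity>i\<in>I. (hnorm H (f i))\<^sup>2)"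
    by (rule infsumI, rule has_sum_of_real, rule has_sum_infsum) (use f in \<open>simp add: hsum_mem\<close>)
  finally show ?thesis .
qed

lemma hsum_semi: "semi_inner (hset (hsum I H)) (hip (hsum I H))"
proof
  show "complex_vector.subspace (hset (hsum I H))"
  proof (rule complex_vector.subspaceI)
    show "0 \<in> hset (hsum I H)" by (simp add: hsum_mem)
    fix f g c assume f: "f \<in> hset (hsum I H)"
    have "(\<lambda>i. (cmod c)\<^sup>2 * (hnorm H (f i))\<^sup>2) summable_on I"
      using f by (intro summable_on_cmult_right) (simp add: hsum_mem)
    then show "c *\<^sub>C f \<in> hset (hsum I H)"
      using f by (simp add: hsum_mem norm_scale power_mult_distrib)
    assume g: "g \<in> hset (hsum I H)"
    have sb: "(\<lambda>i. 2 * (hnorm H (f i))\<^sup>2 + 2 * (hnorm H (g i))\<^sup>2) summable_on I"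
      using f g by (intro summable_on_add summable_on_cmult_right) (auto simp: hsum_mem)
    have "(\<lambda>i. (hnorm H (f i + g i))\<^sup>2) summable_on I"
    proof (rule summable_on_comparison_test[OF sb])
      show "(hnorm H (f i + g i))\<^sup>2 \<le> 2 * (hnorm H (f i))\<^sup>2 + 2 * (hnorm H (g i))\<^sup>2" for i
        using parallelogram[OF hsum_comp[OF f] hsum_comp[OF g], of i i] by (smt (verit) zero_le_power2)
    qed simp
    then show "f + g \<in> hset (hsum I H)" using f g by (simp add: hsum_mem)
  qed
next
  fix f g h c assume f: "f \<in> hset (hsum I H)"
  show "hip (hsum I H) f f \<in> \<real>\<^sub>\<ge>\<^sub>0"
    unfolding hsum_self[OF f] by (simp add: infsum_nonneg)
  assume g: "g \<in> hset (hsum I H)"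
  note c = hsum_comp[OF f] hsum_comp[OF g]
  show "hip (hsum I H) f (c *\<^sub>C g) = c * hip (hsum I H) f g"
    using c by (simp add: hsum_ip scale_right infsum_cmult_right')
  show "hip (hsum I H) g f = cnj (hip (hsum I H) f g)"
    unfolding hsum_ip infsum_cnj[symmetric] by (rule infsum_cong) (use c herm in blast)
  assume h: "h \<in> hset (hsum I H)"
  show "hip (hsum I H) f (g + h) = hip (hsum I H) f g + hip (hsum I H) f h"
    using c hsum_comp[OF h] infsum_add[OF hsum_ip_summable[OF f g] hsum_ip_summable[OF f h]]
    by (simp add: hsum_ip add_right)
qed

lemma hsum_norm_sq: 
  assumes "f \<in> hset (hsum I H)" shows "(hnorm (hsum I H) f)\<^sup>2 = (\<Sum>\<^sub>\<infinity>i\<in>I. (hnorm H (f i))\<^sup>2)"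
  unfolding hnorm_def[of "hsum I H"] hsum_self[OF assms] by (simp add: infsum_nonneg)

lemma hsum_finite_le:
  assumes f: "f \<in> hset (hsum I H)" and F: "finite F" "F \<subseteq> I"
  shows "(\<Sum>i\<in>F. (hnorm H (f i))\<^sup>2) \<le> (hnorm (hsum I H) f)\<^sup>2"
  unfolding hsum_norm_sq[OF f] by (rule finite_sum_le_infsum) (use f F in \<open>auto simp: hsum_mem\<close>)

lemma hsum_comp_le: 
  assumes f: "f \<in> hset (hsum I H)" shows "hnorm H (f i) \<le> hnorm (hsum I H) f"
proof (cases "i \<in> I")
  case True
  have "(hnorm H (f i))\<^sup>2 \<le> (hnorm (hsum I H) f)\<^sup>2" using hsum_finite_le[OF f, of "{i}"] True by simp
  moreover have "0 \<le> hnorm (hsum I H) f" by (simp add: hnorm_def hsum_self[OF f] infsum_nonneg)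
  ultimately show ?thesis by (rule power2_le_imp_le)
next
  case False
  have "0 \<le> hnorm (hsum I H) f" by (simp add: hnorm_def hsum_self[OF f] infsum_nonneg)
  then show ?thesis using f False by (simp add: hsum_mem)
qed

lemma hsum_hilbert: "is_hilbert (hsum (I :: 'i set) H)"
proof (rule is_hilbertI[OF hsum_semi])
  interpret k: semi_inner "hset (hsum I H)" "hip (hsum I H)" rewrites "qnorm (hip (hsum I H)) = hnorm (hsum I H)"
    by (fact hsum_semi) (simp add: hnorm_eq_qnorm)
  show "f = 0" if f: "f \<in> hset (hsum I H)" "hip (hsum I H) f f = 0" for f
  proof
    fix i
    have "hnorm (hsum I H) f = 0" by (simp add: hnorm_def f(2))
    then have "hnorm H (f i) = 0" using hsum_comp_le[OF f(1), of i] norm_nonneg[OF hsum_comp[OF f(1)]] by (metis antisym)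
    then show "f i = 0 i" using norm_eq_zero[OF hsum_comp[OF f(1)]] by simp
  qed
  fix s :: "nat \<Rightarrow> 'i \<Rightarrow> 'a" assume s: "\<And>n. s n \<in> hset (hsum I H)"
    and cau: "\<And>e. e > 0 \<Longrightarrow> \<exists>N. \<forall>m\<ge>N. \<forall>n\<ge>N. hnorm (hsum I H) (s m - s n) < e"
  have "\<exists>l. hlim H (\<lambda>n. s n i) l" for i
  proof -
    have c: "\<exists>N. \<forall>m\<ge>N. \<forall>n\<ge>N. hnorm H (s m i - s n i) < e" if "e > 0" for e
    proof -
      obtain N where N: "\<forall>m\<ge>N. \<forall>n\<ge>N. hnorm (hsum I H) (s m - s n) < e" using cau \<open>e > 0\<close> by blast
      have "hnorm H (s m i - s n i) \<le> hnorm (hsum I H) (s m - s n)" for m n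
        using hsum_comp_le[OF k.diff_mem[OF s s], of m n i] by simp
      then show ?thesis using N by (meson order_le_less_trans)
    qed
    show ?thesis by (rule complete[of "\<lambda>n. s n i", OF hsum_comp[OF s] c]) blast+
  qed
  then obtain l where l: "\<And>i. hlim H (\<lambda>n. s n i) (l i)" by metis
  have l0: "l i = 0" if "i \<notin> I" for i
  proof -
    have "s n i = 0" for n using s that by (simp add: hsum_mem)
    then show ?thesis using l[of i] hlim_unique hlim_const[OF zero_mem] by auto
  qed
  have key: "s m - l \<in> hset (hsum I H) \<and> (hnorm (hsum I H) (s m - l))\<^sup>2 \<le> e\<^sup>2" 
    if N: "\<forall>m\<ge>N. \<forall>n\<ge>N. hnorm (hsum I H) (s m - s n) < e" and m: "m \<ge> N" for N m e
  proof -
    have fin: "(\<Sum>i\<in>F. (hnorm H (s m i - l i))\<^sup>2) \<le> e\<^sup>2" if F: "finite F" "F \<subseteq> I" for F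
    proof (rule LIMSEQ_le_const2)
      show "(\<lambda>n. \<Sum>i\<in>F. (hnorm H (s m i - s n i))\<^sup>2) \<longlonglongrightarrow> (\<Sum>i\<in>F. (hnorm H (s m i - l i))\<^sup>2)"
        by (intro tendsto_sum tendsto_power hlim_norm hlim_diff hlim_const l hsum_comp[OF s])
      have "(\<Sum>i\<in>F. (hnorm H (s m i - s n i))\<^sup>2) \<le> e\<^sup>2" if n: "n \<ge> N" for n
      proof -
        have "(\<Sum>i\<in>F. (hnorm H (s m i - s n i))\<^sup>2) \<le> (hnorm (hsum I H) (s m - s n))\<^sup>2"
          using hsum_finite_le[OF k.diff_mem[OF s s] F, of m n] by simp
        also have "\<dots> \<le> e\<^sup>2" using N m n k.norm_nonneg[OF k.diff_mem[OF s s], of m n] by (intro power_mono) (auto intro: less_imp_le)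
        finally show ?thesis .
      qed
      then show "\<exists>N. \<forall>n\<ge>N. (\<Sum>i\<in>F. (hnorm H (s m i - s n i))\<^sup>2) \<le> e\<^sup>2" by blast
    qed
    have sm: "(\<lambda>i. (hnorm H (s m i - l i))\<^sup>2) summable_on I"
      by (rule nonneg_bdd_above_summable_on) (use fin in \<open>auto intro!: bdd_aboveI[of _ "e\<^sup>2"]\<close>)
    have "s m - l \<in> hset (hsum I H)"
      using sm l l0 s[of m] by (simp add: hsum_mem hlim_def)
    moreover from this have "(hnorm (hsum I H) (s m - l))\<^sup>2 \<le> e\<^sup>2"
      unfolding hsum_norm_sq[OF \<open>s m - l \<in> _\<close>] using fin sm by (intro infsum_le_finite_sums) auto
    ultimately show ?thesis by blast
  qed
  obtain N where "\<forall>m\<ge>N. \<forall>n\<ge>N. hnorm (hsum I H) (s m - s n) < 1" using cau[of 1] by auto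
  from key[OF this] have "s N - l \<in> hset (hsum I H)" by blast
  then have lm: "l \<in> hset (hsum I H)" using k.diff_mem[OF s[of N]] by fastforce
  have "(\<lambda>n. hnorm (hsum I H) (s n - l)) \<longlonglongrightarrow> 0"
  proof (rule LIMSEQ_I)
    fix e :: real assume e: "e > 0"
    obtain N where N: "\<forall>m\<ge>N. \<forall>n\<ge>N. hnorm (hsum I H) (s m - s n) < e / 2" using cau[of "e / 2"] e by auto
    have "hnorm (hsum I H) (s n - l) \<le> e / 2" if "n \<ge> N" for n
      by (rule power2_le_imp_le) (use key[OF N that] e in auto)
    then have "hnorm (hsum I H) (s n - l) < e" if "n \<ge> N" for n using that e by fastforce
    then show "\<exists>no. \<forall>n\<ge>no. norm (hnorm (hsum I H) (s n - l) - 0) < e"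
      using k.norm_nonneg[OF k.diff_mem[OF s lm]] by auto
  qed
  then show "\<exists>l\<in>hset (hsum I H). (\<lambda>n. hnorm (hsum I H) (s n - l)) \<longlonglongrightarrow> 0" using lm by blast
qed

lemma hsum_hilb: "hilb (hsum I H)"
  by (rule hilb.intro[OF hsum_hilbert])

lemma at_norm: "(hnorm H (inj_at j x i))\<^sup>2 = (if i = j then (hnorm H x)\<^sup>2 else 0)"
  by (simp add: inj_at_def)

lemma at_mem: assumes "x \<in> hset H" "j \<in> I" shows "inj_at j x \<in> hset (hsum I H)"
proof -
  have "(\<lambda>i. if i = j then (hnorm H x)\<^sup>2 else 0) summable_on {j}" by (rule summable_on_finite) simp
  then have "(\<lambda>i. if i = j then (hnorm H x)\<^sup>2 else 0) summable_on I"
    by (rule summable_on_cong_neutral[THEN iffD1, rotated -1]) (use assms in auto)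
  then show ?thesis unfolding hsum_mem at_norm using assms by (auto simp: inj_at_def)
qed

lemma infsum_at:
  assumes "j \<in> I" "\<And>i. i \<in> I \<Longrightarrow> i \<noteq> j \<Longrightarrow> f i = 0" shows "(\<Sum>\<^sub>\<infinity>i\<in>I. f i) = (f j :: complex)"
proof -
  have "(\<Sum>\<^sub>\<infinity>i\<in>I. f i) = (\<Sum>\<^sub>\<infinity>i\<in>{j}. f i)" by (rule infsum_cong_neutral) (use assms in auto)
  then show ?thesis by simp
qed

lemma at_ip:
  assumes "x \<in> hset H" "j \<in> I" "f \<in> hset (hsum I H)"
  shows "hip (hsum I H) (inj_at j x) f = hip H x (f j)" "hip (hsum I H) f (inj_at j x) = hip H (f j) x"
  unfolding hsum_ip by (subst infsum_at[OF assms(2)]; use assms hsum_comp[OF assms(3)] in \<open>simp add: inj_at_def\<close>)+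

lemma at_hnorm: assumes "x \<in> hset H" "j \<in> I" shows "hnorm (hsum I H) (inj_at j x) = hnorm H x"
  using at_ip(1)[OF assms at_mem[OF assms]] by (simp add: hnorm_def inj_at_def)

lemma at_bop: assumes "j \<in> I" shows "(\<lambda>x. if x \<in> hset H then inj_at j x else 0) \<in> bop H (hsum I H)"
  by (rule bopI[where K = 1])
    (use assms in \<open>simp_all add: at_mem at_hnorm\<close>, auto simp: inj_at_def fun_eq_iff)

lemma at_total: "hcl (hsum I H) (complex_vector.span {inj_at j x |j x. j \<in> I \<and> x \<in> hset H}) = hset (hsum I H)"
proof (rule hilb.total_if_perp[OF hsum_hilb])
  show "{inj_at j x |j x. j \<in> I \<and> x \<in> hset H} \<subseteq> hset (hsum I H)" using at_mem by auto
  fix z assume z: "z \<in> hset (hsum I H)"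
    and p: "\<And>x. x \<in> {inj_at j x |j x. j \<in> I \<and> x \<in> hset H} \<Longrightarrow> hip (hsum I H) x z = 0"
  show "z = 0"
  proof
    fix i show "z i = 0 i"
    proof (cases "i \<in> I")
      case True
      have "hip (hsum I H) (inj_at i (z i)) z = 0" by (rule p) (use True hsum_comp[OF z] in blast)
      then show ?thesis using definite[OF hsum_comp[OF z]] at_ip(1)[OF hsum_comp[OF z] True z] by simp
    next
      case False then show ?thesis using z by (simp add: hsum_mem)
    qed
  qed
qed

lemma hsum_finite_mem: 
  assumes "finite I" shows "f \<in> hset (hsum I H) \<longleftrightarrow> (\<forall>i. f i \<in> hset H) \<and> (\<forall>i. i \<notin> I \<longrightarrow> f i = 0)"
  using assms by (simp add: hsum_mem)

lemma at_decomp: 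
  assumes "finite I" "f \<in> hset (hsum I H)" shows "f = (\<Sum>j\<in>I. inj_at j (f j))"
proof
  fix i
  have "(\<Sum>j\<in>I. inj_at j (f j)) i = (\<Sum>j\<in>I. if i = j then f j else 0)"
    by (induction I rule: infinite_finite_induct) (auto simp: inj_at_def)
  also have "\<dots> = f i" using assms by (auto simp: hsum_mem)
  finally show "f i = (\<Sum>j\<in>I. inj_at j (f j)) i" by simp
qed

definition amp :: "'i set \<Rightarrow> ('a \<Rightarrow> 'a) \<Rightarrow> ('i \<Rightarrow> 'a) \<Rightarrow> 'i \<Rightarrow> 'a" where
  "amp I T = (\<lambda>f. if f \<in> hset (hsum I H) then (\<lambda>i. T (f i)) else 0)"

lemma amp_mem:
  assumes T: "T \<in> bop H H" and f: "f \<in> hset (hsum I H)"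
    and k: "k \<ge> 0" "\<And>x. x \<in> hset H \<Longrightarrow> hnorm H (T x) \<le> k * hnorm H x"
  shows "(\<lambda>i. T (f i)) \<in> hset (hsum I H)" "hnorm (hsum I H) (\<lambda>i. T (f i)) \<le> k * hnorm (hsum I H) f"
proof -
  have le: "(hnorm H (T (f i)))\<^sup>2 \<le> k\<^sup>2 * (hnorm H (f i))\<^sup>2" for i
    using power_mono[OF k(2)[OF hsum_comp[OF f]] norm_nonneg[OF bop_mem[OF T hsum_comp[OF f]]], of i 2]
    by (simp add: power_mult_distrib)
  have sm: "(\<lambda>i. k\<^sup>2 * (hnorm H (f i))\<^sup>2) summable_on I"
    using f by (intro summable_on_cmult_right) (simp add: hsum_mem)
  have sT: "(\<lambda>i. (hnorm H (T (f i)))\<^sup>2) summable_on I"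
    by (rule summable_on_comparison_test[OF sm]) (use le in auto)
  then show m: "(\<lambda>i. T (f i)) \<in> hset (hsum I H)"
    using f bop_mem[OF T] by (simp add: hsum_mem bop_zero[OF T])
  have "(hnorm (hsum I H) (\<lambda>i. T (f i)))\<^sup>2 \<le> (\<Sum>\<^sub>\<infinity>i\<in>I. k\<^sup>2 * (hnorm H (f i))\<^sup>2)"
    unfolding hsum_norm_sq[OF m] by (rule infsum_mono[OF sT sm le])
  also have "\<dots> = (k * hnorm (hsum I H) f)\<^sup>2"
    by (simp add: infsum_cmult_right' hsum_norm_sq[OF f, symmetric] power_mult_distrib)
  finally show "hnorm (hsum I H) (\<lambda>i. T (f i)) \<le> k * hnorm (hsum I H) f"
    by (rule power2_le_imp_le)
      (rule mult_nonneg_nonneg[OF k(1) semi_inner.norm_nonneg[OF hsum_semi f, folded hnorm_eq_qnorm]])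
qed

lemma amp_bop: assumes T: "T \<in> bop H H" shows "amp I T \<in> bop (hsum I H) (hsum I H)"
proof -
  interpret k: hilb "hsum I H" by (rule hsum_hilb)
  obtain k where k: "k \<ge> 0" "\<And>x. x \<in> hset H \<Longrightarrow> hnorm H (T x) \<le> k * hnorm H x" using bop_bound[OF T] by blast
  note m = amp_mem[OF T _ k]
  show ?thesis
  proof (rule bopI[where K = k])
    fix f assume f: "f \<in> hset (hsum I H)"
    show "amp I T f \<in> hset (hsum I H)" "hnorm (hsum I H) (amp I T f) \<le> k * hnorm (hsum I H) f"
      using m[OF f] f by (auto simp: amp_def)
    show "amp I T (c *\<^sub>C f) = c *\<^sub>C amp I T f" for c
      using f by (auto simp: amp_def fun_eq_iff bop_scale[OF T hsum_comp[OF f]])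
    show "amp I T (f + g) = amp I T f + amp I T g" if g: "g \<in> hset (hsum I H)" for g
      using f g by (auto simp: amp_def fun_eq_iff bop_add[OF T hsum_comp[OF f] hsum_comp[OF g]])
  qed (simp add: amp_def)
qed

lemma amp_apply: "f \<in> hset (hsum I H) \<Longrightarrow> amp I T f i = T (f i)"
  by (simp add: amp_def)

lemma amp_at: "T \<in> bop H H \<Longrightarrow> x \<in> hset H \<Longrightarrow> j \<in> I \<Longrightarrow> amp I T (inj_at j x) = inj_at j (T x)"
  by (rule ext) (simp add: amp_apply[OF at_mem], simp add: inj_at_def bop_zero)

lemma amp_ip:
  assumes T: "T \<in> bop H H" and f: "f \<in> hset (hsum I H)" and g: "g \<in> hset (hsum I H)"
  shows "hip (hsum I H) (amp I (adj H H T) g) f = hip (hsum I H) g (amp I T f)"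
proof -
  interpret hilb2 H H ..
  show ?thesis unfolding hsum_ip amp_apply[OF f] amp_apply[OF g]
    by (rule infsum_cong) (rule adj_ip[OF T hsum_comp[OF f] hsum_comp[OF g]])
qed

lemma amp_adj:
  assumes T: "T \<in> bop H H" shows "adj (hsum I H) (hsum I H) (amp I T) = amp I (adj H H T)"
proof -
  interpret hilb2 H H ..
  interpret k: hilb "hsum I H" by (rule hsum_hilb)
  interpret kk: hilb2 "hsum I H" "hsum I H" ..
  show ?thesis by (rule kk.adj_eqI[OF amp_bop[OF T] amp_bop[OF adj_bop[OF T]] amp_ip[OF T]])
qed

end

section \<open>The strong topology\<close>

lemma (in hilb) topspace_htop: "topspace (htop H) = hset H"
  unfolding htop_def using Metric_space.topspace_mtopology[OF metric] .

context hilb2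
begin

lemma topspace_strong: "topspace (strong_top G H) = bop G H"
  unfolding strong_top_def topspace_pullback_topology
  by (auto simp: H.topspace_htop bop_mem)

lemma strong_ball_open:
  assumes F: "finite F" "F \<subseteq> hset G" and y: "y \<in> bop G H"
  shows "openin (strong_top G H) {T \<in> bop G H. \<forall>g\<in>F. hnorm H (T g - y g) < e}"
proof -
  interpret M: Metric_space "hset H" "hdist H" by (rule H.metric)
  let ?X = "\<lambda>g. if g \<in> F then M.mball (y g) e else topspace (htop H)"
  have o: "openin (product_topology (\<lambda>_. htop H) (hset G)) (PiE (hset G) ?X)"
  proof (rule product_topology_basis)
    show "openin (htop H) (?X g)" for g by (simp add: htop_def)
    show "finite {g. ?X g \<noteq> topspace (htop H)}" by (rule finite_subset[OF _ F(1)]) auto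
  qed
  have "{T \<in> bop G H. \<forall>g\<in>F. hnorm H (T g - y g) < e} = (\<lambda>T. restrict T (hset G)) -` (PiE (hset G) ?X) \<inter> bop G H"
  proof (intro set_eqI iffI)
    fix T assume T: "T \<in> {T \<in> bop G H. \<forall>g\<in>F. hnorm H (T g - y g) < e}"
    then show "T \<in> (\<lambda>T. restrict T (hset G)) -` (PiE (hset G) ?X) \<inter> bop G H"
      using bop_mem[of T G H] bop_mem[OF y]
      by (auto simp: H.topspace_htop hdist_def H.norm_commute)
  next
    fix T assume T: "T \<in> (\<lambda>T. restrict T (hset G)) -` (PiE (hset G) ?X) \<inter> bop G H"
    have "hnorm H (T g - y g) < e" if g: "g \<in> F" for g
    proof -
      have "T g \<in> ?X g" using T g F by (auto simp: restrict_def PiE_iff split: if_splits)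
      then show ?thesis using g bop_mem[OF y] F H.norm_commute[of "T g" "y g"] by (auto simp: hdist_def split: if_splits)
    qed
    then show "T \<in> {T \<in> bop G H. \<forall>g\<in>F. hnorm H (T g - y g) < e}" using T by blast
  qed
  then show ?thesis unfolding strong_top_def openin_pullback_topology using o by blast
qed

lemma strong_open_ball:
  assumes U: "openin (strong_top G H) U" and y: "y \<in> U"
  shows "\<exists>F e. finite F \<and> F \<subseteq> hset G \<and> e > 0 \<and> {T \<in> bop G H. \<forall>g\<in>F. hnorm H (T g - y g) < e} \<subseteq> U"
proof -
  interpret M: Metric_space "hset H" "hdist H" by (rule H.metric)
  obtain W where W: "openin (product_topology (\<lambda>_. htop H) (hset G)) W"
    and UW: "U = (\<lambda>T. restrict T (hset G)) -` W \<inter> bop G H"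
    using U unfolding strong_top_def openin_pullback_topology by blast
  have yb: "y \<in> bop G H" using y UW by blast
  obtain X where X: "finite {g \<in> hset G. X g \<noteq> topspace (htop H)}" "\<forall>g\<in>hset G. openin (htop H) (X g)"
     "restrict y (hset G) \<in> PiE (hset G) X" "PiE (hset G) X \<subseteq> W"
    using W y UW unfolding openin_product_topology_alt by blast
  define F where "F = {g \<in> hset G. X g \<noteq> topspace (htop H)}"
  have "\<exists>r>0. M.mball (y g) r \<subseteq> X g" if g: "g \<in> hset G" for g
  proof -
    have "y g \<in> X g" using X(3) g by (auto simp: PiE_iff)
    then show ?thesis using X(2) g unfolding htop_def M.openin_mtopology by blast
  qed
  then obtain r where r: "\<And>g. g \<in> hset G \<Longrightarrow> r g > 0" "\<And>g. g \<in> hset G \<Longrightarrow> M.mball (y g) (r g) \<subseteq> X g" by metis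
  define e where "e = Min (insert 1 (r ` F))"
  have F: "finite F" "F \<subseteq> hset G" using X(1) by (auto simp: F_def)
  have e: "e > 0" unfolding e_def using F r by (subst Min_gr_iff) auto
  have "T \<in> U" if T: "T \<in> bop G H" "\<forall>g\<in>F. hnorm H (T g - y g) < e" for T
  proof -
    have "T g \<in> X g" if g: "g \<in> hset G" for g
    proof (cases "g \<in> F")
      case True
      then have "e \<le> r g" unfolding e_def using F by (intro Min_le) auto
      then have "T g \<in> M.mball (y g) (r g)"
        using T(2) True bop_mem[OF T(1) g] bop_mem[OF yb g] H.norm_commute[of "T g" "y g"] by (auto simp: hdist_def)
      then show ?thesis using r(2)[OF g] by blast
    next
      case False then show ?thesis using g bop_mem[OF T(1) g] by (simp add: F_def H.topspace_htop)
    qed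
    then have "restrict T (hset G) \<in> PiE (hset G) X" by auto
    then show ?thesis using UW X(4) T(1) by blast
  qed
  then show ?thesis using F e by blast
qed

lemma strong_closed_iff:
  "closedin (strong_top G H) M \<longleftrightarrow> M \<subseteq> bop G H \<and> 
    (\<forall>y\<in>bop G H. (\<forall>F e. finite F \<and> F \<subseteq> hset G \<and> e > 0 \<longrightarrow> (\<exists>x\<in>M. \<forall>g\<in>F. hnorm H (x g - y g) < e)) \<longrightarrow> y \<in> M)"
  (is "_ \<longleftrightarrow> _ \<and> ?R")
proof (cases "M \<subseteq> bop G H")
  case M: True
  have "openin (strong_top G H) (bop G H - M) \<longleftrightarrow> ?R"
  proof
    assume o: "openin (strong_top G H) (bop G H - M)"
    show ?R
    proof (rule ballI, rule impI, rule ccontr)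
      fix y assume y: "y \<in> bop G H" "y \<notin> M"
        and a: "\<forall>F e. finite F \<and> F \<subseteq> hset G \<and> e > 0 \<longrightarrow> (\<exists>x\<in>M. \<forall>g\<in>F. hnorm H (x g - y g) < e)"
      then have "y \<in> bop G H - M" by blast
      from strong_open_ball[OF o this] obtain F e where Fe: "finite F" "F \<subseteq> hset G" "e > 0"
        and s: "{T \<in> bop G H. \<forall>g\<in>F. hnorm H (T g - y g) < e} \<subseteq> bop G H - M" by blast
      obtain x where x: "x \<in> M" "\<forall>g\<in>F. hnorm H (x g - y g) < e" using a Fe by blast
      then show False using s M by blast
    qed
  next
    assume R: ?R
    show "openin (strong_top G H) (bop G H - M)"
    proof (subst openin_subopen, rule ballI)
      fix y assume y: "y \<in> bop G H - M"
      then have "\<not> (\<forall>F e. finite F \<and> F \<subseteq> hset G \<and> e > 0 \<longrightarrow> (\<exists>x\<in>M. \<forall>g\<in>F. hnorm H (x g - y g) < e))"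
        using R by (metis DiffD1 DiffD2)
      then obtain F and e :: real where Fe: "finite F" "F \<subseteq> hset G" "e > 0"
        and n: "\<not> (\<exists>x\<in>M. \<forall>g\<in>F. hnorm H (x g - y g) < e)"
        by (auto simp only: not_all not_imp)
      let ?T = "{T \<in> bop G H. \<forall>g\<in>F. hnorm H (T g - y g) < e}"
      have "openin (strong_top G H) ?T" using strong_ball_open[OF Fe(1,2)] y by blast
      moreover have "y \<in> ?T" using y Fe by simp
      moreover have "?T \<subseteq> bop G H - M" using n by blast
      ultimately show "\<exists>T. openin (strong_top G H) T \<and> y \<in> T \<and> T \<subseteq> bop G H - M" by blast
    qed
  qed
  then show ?thesis using M unfolding closedin_def topspace_strong by blast
qed (auto simp: closedin_def topspace_strong)

lemma strong_closed_seq: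
  assumes "closedin (strong_top G H) M" "y \<in> bop G H" "\<And>n. s n \<in> M" "\<And>g. g \<in> hset G \<Longrightarrow> hlim H (\<lambda>n. s n g) (y g)"
  shows "y \<in> M"
proof -
  have "\<exists>x\<in>M. \<forall>g\<in>F. hnorm H (x g - y g) < e" if F: "finite F" "F \<subseteq> hset G" and e: "e > 0" for F e
  proof -
    have "\<forall>\<^sub>F n in sequentially. hnorm H (s n g - y g) < e" if "g \<in> F" for g
    proof -
      have "(\<lambda>n. hnorm H (s n g - y g)) \<longlonglongrightarrow> 0" using assms(4)[of g] F that by (auto simp: hlim_def)
      then show ?thesis using e by (rule order_tendstoD(2))
    qed
    then have "\<forall>\<^sub>F n in sequentially. \<forall>g\<in>F. hnorm H (s n g - y g) < e"
      using F(1) by (simp add: eventually_ball_finite)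
    then obtain n where "\<forall>g\<in>F. hnorm H (s n g - y g) < e" by (auto simp: eventually_sequentially)
    then show ?thesis using assms(3) by blast
  qed
  then show ?thesis using assms(1,2) unfolding strong_closed_iff by blast
qed

lemma bop_limit:
  assumes s: "\<And>n. s n \<in> bop G H" and e: "e \<longlonglongrightarrow> 0" 
    and c: "\<And>N m n g. m \<ge> N \<Longrightarrow> n \<ge> N \<Longrightarrow> g \<in> hset G \<Longrightarrow> hnorm H (s m g - s n g) \<le> e N * hnorm G g"
  obtains T where "T \<in> bop G H" "\<And>n g. g \<in> hset G \<Longrightarrow> hnorm H (s n g - T g) \<le> e n * hnorm G g"
    "\<And>g. g \<in> hset G \<Longrightarrow> hlim H (\<lambda>n. s n g) (T g)"
proof -
  have "\<exists>l. hlim H (\<lambda>n. s n g) l" if g: "g \<in> hset G" for g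
  proof -
    have c': "\<exists>N. \<forall>m\<ge>N. \<forall>n\<ge>N. hnorm H (s m g - s n g) < r" if r: "r > 0" for r
    proof -
      have "(\<lambda>n. e n * hnorm G g) \<longlonglongrightarrow> 0" using e by (rule tendsto_mult_left_zero)
      then obtain N where "e N * hnorm G g < r" using LIMSEQ_real_less[OF _ r] by blast
      then show ?thesis using c[OF _ _ g] by (meson order_le_less_trans)
    qed
    show ?thesis by (rule H.complete[of "\<lambda>n. s n g", OF bop_mem[OF s g] c']) blast+
  qed
  then obtain L where L: "\<And>g. g \<in> hset G \<Longrightarrow> hlim H (\<lambda>n. s n g) (L g)" by metis
  define T where "T g = (if g \<in> hset G then L g else 0)" for g
  have T: "hlim H (\<lambda>n. s n g) (T g)" if "g \<in> hset G" for g using L that by (simp add: T_def)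
  have b: "hnorm H (s n g - T g) \<le> e n * hnorm G g" if g: "g \<in> hset G" for n g
  proof (rule LIMSEQ_le_const2)
    show "(\<lambda>m. hnorm H (s n g - s m g)) \<longlonglongrightarrow> hnorm H (s n g - T g)"
      by (rule H.hlim_norm[OF H.hlim_diff[OF H.hlim_const[OF bop_mem[OF s g]] T[OF g]]])
    show "\<exists>N. \<forall>m\<ge>N. hnorm H (s n g - s m g) \<le> e n * hnorm G g" using c[of n n _ g] g by blast
  qed
  obtain k where k: "k \<ge> 0" "\<And>x. x \<in> hset G \<Longrightarrow> hnorm H (s 0 x) \<le> k * hnorm G x" using G.bop_bound[OF s] by blast
  have "T \<in> bop G H"
  proof (rule bopI[where K = "k + e 0"])
    fix g assume g: "g \<in> hset G"
    note m = bop_mem[OF s g] H.hlim_mem(2)[OF T[OF g]]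
    show "T g \<in> hset H" by (rule m(2))
    have "hnorm H (T g) \<le> hnorm H (s 0 g) + hnorm H (s 0 g - T g)"
      using H.norm_triangle_diff[of "s 0 g" "s 0 g - T g"] m by simp
    then show "hnorm H (T g) \<le> (k + e 0) * hnorm G g" using k(2)[OF g] b[OF g, of 0] by (simp add: algebra_simps)
    show "T (c *\<^sub>C g) = c *\<^sub>C T g" for c
      using H.hlim_unique[OF T[OF G.scale_mem[OF g]]] H.hlim_scale[OF T[OF g]] bop_scale[OF s g] by simp
    show "T (g + h) = T g + T h" if h: "h \<in> hset G" for h
      using H.hlim_unique[OF T[OF G.add_mem[OF g h]]] H.hlim_add[OF T[OF g] T[OF h]] bop_add[OF s g h] by simp
  qed (simp add: T_def)
  then show thesis using b T by (rule that)
qed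

end

section \<open>Algebra of bounded operators\<close>

lemma sum_fun_apply: "sum f I x = (\<Sum>i\<in>I. f i x)"
  by (induction I rule: infinite_finite_induct) auto

lemma (in hilb) bop_comp:
  assumes T: "T \<in> bop G H" and S: "S \<in> bop H K" shows "S \<circ> T \<in> bop G K"
proof -
  obtain k where k: "k \<ge> 0" "\<And>x. x \<in> hset H \<Longrightarrow> hnorm K (S x) \<le> k * hnorm H x" using bop_bound[OF S] by blast
  obtain l where l: "\<And>x. x \<in> hset G \<Longrightarrow> hnorm H (T x) \<le> l * hnorm G x" using bop_bound_raw[OF T] by blast
  show ?thesis
  proof (rule bopI[where K = "k * l"])
    fix x assume x: "x \<in> hset G"
    show "hnorm K ((S \<circ> T) x) \<le> k * l * hnorm G x"
      using k(2)[OF bop_mem[OF T x]] mult_left_mono[OF l[OF x] k(1)] by (simp add: mult.assoc)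
  qed (auto simp: bop_mem[OF T] bop_mem[OF S] bop_out[OF T] bop_zero[OF S] bop_add[OF T] bop_add[OF S]
        bop_scale[OF T] bop_scale[OF S])
qed

lemma adj_comp:
  assumes "hilb G" "hilb H" "hilb K" and T: "T \<in> bop G H" and S: "S \<in> bop H K"
  shows "adj G K (S \<circ> T) = adj G H T \<circ> adj H K S"
proof -
  interpret GH: hilb2 G H using assms by (simp add: hilb2_def)
  interpret HK: hilb2 H K using assms by (simp add: hilb2_def)
  interpret GK: hilb2 G K using assms by (simp add: hilb2_def)
  show ?thesis
  proof (rule GK.adj_eqI[OF GH.H.bop_comp[OF T S] GH.H.bop_comp[OF HK.adj_bop[OF S] GH.adj_bop[OF T]]])
    fix x y assume "x \<in> hset G" "y \<in> hset K"
    then show "hip G ((adj G H T \<circ> adj H K S) y) x = hip K y ((S \<circ> T) x)"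
      using GH.adj_ip[OF T] HK.adj_ip[OF S] bop_mem[OF T] HK.adj_mem[OF S] by simp
  qed
qed

context hilb2
begin

lemma bop_add_closed: "S \<in> bop G H \<Longrightarrow> T \<in> bop G H \<Longrightarrow> S + T \<in> bop G H"
  by (rule complex_vector.subspace_add[OF bop_subspace])
lemma bop_diff_closed: "S \<in> bop G H \<Longrightarrow> T \<in> bop G H \<Longrightarrow> S - T \<in> bop G H"
  by (rule complex_vector.subspace_diff[OF bop_subspace])
lemma bop_scale_closed: "T \<in> bop G H \<Longrightarrow> c *\<^sub>C T \<in> bop G H"
  by (rule complex_vector.subspace_scale[OF bop_subspace])

lemma adj_add:
  assumes S: "S \<in> bop G H" and T: "T \<in> bop G H"
  shows "adj G H (S + T) = adj G H S + adj G H T"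
proof -
  interpret HG: hilb2 H G ..
  show ?thesis
    by (rule adj_eqI[OF bop_add_closed[OF S T] HG.bop_add_closed[OF adj_bop[OF S] adj_bop[OF T]]])
      (simp add: adj_ip S T adj_mem bop_mem[OF S] bop_mem[OF T] G.add_left H.add_right)
qed

lemma adj_diff:
  assumes S: "S \<in> bop G H" and T: "T \<in> bop G H"
  shows "adj G H (S - T) = adj G H S - adj G H T"
  using adj_add[OF bop_diff_closed[OF S T] T] by simp

lemma adj_scale:
  assumes T: "T \<in> bop G H"
  shows "adj G H (c *\<^sub>C T) = cnj c *\<^sub>C adj G H T"
proof -
  interpret HG: hilb2 H G ..
  show ?thesis
    by (rule adj_eqI[OF bop_scale_closed[OF T] HG.bop_scale_closed[OF adj_bop[OF T]]])
      (simp add: adj_ip T adj_mem bop_mem[OF T] G.scale_left H.scale_right)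
qed

end

lemma (in hilb) adj_id: "adj H H (id_on (hset H)) = id_on (hset H)"
proof -
  interpret hilb2 H H ..
  show ?thesis by (rule adj_eqI[OF id_on_bop id_on_bop]) (simp add: id_on_def)
qed

lemma (in hilb) id_comp [simp]: "T \<in> bop G H \<Longrightarrow> id_on (hset H) \<circ> T = T"
  by (rule ext) (simp add: id_on_def, metis bop_mem bop_out)

lemma comp_id_on [simp]: "T \<in> bop G H \<Longrightarrow> T \<circ> id_on (hset G) = T"
  by (rule ext) (simp add: id_on_def bop_out bop_zero)

lemma (in hilb) bop_hcl_inv:
  assumes T: "T \<in> bop H H" and D: "\<And>x. x \<in> D \<Longrightarrow> T x \<in> D" and x: "x \<in> hcl H D" shows "T x \<in> hcl H D"
proof -
  interpret hilb2 H H ..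
  obtain s where s: "\<And>n. s n \<in> D" "hlim H s x" using x unfolding hcl_def by blast
  show ?thesis unfolding hcl_def using bop_hlim[OF T s(2)] D[OF s(1)] by (intro CollectI exI[of _ "\<lambda>n. T (s n)"]) simp
qed

lemma (in hilb) total_perp_zero:
  assumes "X \<subseteq> hset H" "hcl H (complex_vector.span X) = hset H" "z \<in> hset H" "\<And>x. x \<in> X \<Longrightarrow> hip H x z = 0"
  shows "z = 0"
  by (rule perp_zero[OF assms(2) span_mem[OF assms(1)] assms(3)]) (rule perp_span[OF assms(1,3,4)])

lemma intertwinersI: "x \<in> bop G H \<Longrightarrow> (\<And>a. a \<in> A \<Longrightarrow> p a \<circ> x = x \<circ> a) \<Longrightarrow> x \<in> intertwiners G A H p"
  by (simp add: intertwiners_def)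

context hilb2
begin

text \<open>
  At a given \<open>g\<close> the intertwining relation for \<open>a\<close> involves \<open>y\<close> only through its values at the two vectors \<open>g\<close> and \<open>a g\<close>.
\<close>

lemma intertwiners_approx:
  assumes A: "A \<subseteq> bop G G" and r: "\<And>a. a \<in> A \<Longrightarrow> r a \<in> bop H H" and y: "y \<in> bop G H"
    and ap: "\<And>F e. finite F \<Longrightarrow> F \<subseteq> hset G \<Longrightarrow> e > 0 \<Longrightarrow> \<exists>x\<in>intertwiners G A H r. \<forall>g\<in>F. hnorm H (x g - y g) < e"
  shows "y \<in> intertwiners G A H r"
proof (rule intertwinersI[OF y])
  fix a assume a: "a \<in> A"
  then have ab: "a \<in> bop G G" using A by blast
  show "r a \<circ> y = y \<circ> a"
  proof (rule bop_eqI[OF H.bop_comp[OF y r[OF a]] G.bop_comp[OF ab y]])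
    fix g assume g: "g \<in> hset G"
    obtain k where k: "k \<ge> 0" "\<And>u. u \<in> hset H \<Longrightarrow> hnorm H (r a u) \<le> k * hnorm H u" using H.bop_bound[OF r[OF a]] by blast
    have ag: "a g \<in> hset G" by (rule bop_mem[OF ab g])
    note m = bop_mem[OF y g] bop_mem[OF y ag] bop_mem[OF r[OF a] bop_mem[OF y g]]
    have "hnorm H (r a (y g) - y (a g)) \<le> 0 + e" if e: "e > 0" for e
    proof -
      have "e / (k + 1) > 0" using e k by simp
      moreover have "finite {g, a g}" "{g, a g} \<subseteq> hset G" using g ag by auto
      ultimately obtain x where x: "x \<in> intertwiners G A H r" "\<forall>u\<in>{g, a g}. hnorm H (x u - y u) < e / (k + 1)" using ap by blast
      have xb: "x \<in> bop G H" and xa: "r a (x g) = x (a g)" using x(1) a by (auto simp: intertwiners_def fun_eq_iff)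
      note xm = bop_mem[OF xb g] bop_mem[OF xb ag]
      have eq: "r a (y g) - y (a g) = (x (a g) - y (a g)) - r a (x g - y g)"
        using H.bop_diff[OF r[OF a] xm(1) m(1)] xa by simp
      have "hnorm H (r a (y g) - y (a g)) \<le> hnorm H (x (a g) - y (a g)) + hnorm H (r a (x g - y g))"
        unfolding eq by (rule H.norm_triangle_diff) (use xm m bop_mem[OF r[OF a]] in auto)
      also have "\<dots> \<le> e / (k + 1) + k * (e / (k + 1))"
        using k(2)[of "x g - y g"] x(2) xm m mult_left_mono[OF _ k(1), of "hnorm H (x g - y g)" "e / (k + 1)"] by (intro add_mono) auto
      also have "\<dots> = (k + 1) * (e / (k + 1))" by (simp only: distrib_right mult_1 add.commute)
      also have "\<dots> = e" using k by simp
      finally show ?thesis by simp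
    qed
    then have "hnorm H (r a (y g) - y (a g)) \<le> 0" by (rule field_le_epsilon)
    then have "hnorm H (r a (y g) - y (a g)) = 0" using H.norm_nonneg[of "r a (y g) - y (a g)"] m by (intro antisym) auto
    then show "(r a \<circ> y) g = (y \<circ> a) g" using H.norm_eq_zero[of "r a (y g) - y (a g)"] m by simp
  qed
qed

end

section \<open>Self-adjoint operator algebras and their commutants\<close>

locale star_algebra = hilb G for G :: "'g::complex_vector hilbert" +
  fixes B :: "('g \<Rightarrow> 'g) set"
  assumes B_subspace: "complex_vector.subspace B" and B_bop: "b \<in> B \<Longrightarrow> b \<in> bop G G"
    and B_comp: "a \<in> B \<Longrightarrow> b \<in> B \<Longrightarrow> a \<circ> b \<in> B" and B_adj: "b \<in> B \<Longrightarrow> adj G G b \<in> B"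
    and B_nondeg: "hcl G (complex_vector.span {b g |b g. b \<in> B \<and> g \<in> hset G}) = hset G"

sublocale star_algebra \<subseteq> GG: hilb2 G G ..

context star_algebra
begin

lemma B_add: "a \<in> B \<Longrightarrow> b \<in> B \<Longrightarrow> a + b \<in> B" by (rule complex_vector.subspace_add[OF B_subspace])
lemma B_scale: "a \<in> B \<Longrightarrow> c *\<^sub>C a \<in> B" by (rule complex_vector.subspace_scale[OF B_subspace])
lemma B_diff: "a \<in> B \<Longrightarrow> b \<in> B \<Longrightarrow> a - b \<in> B" by (rule complex_vector.subspace_diff[OF B_subspace])
lemma B_mem: "b \<in> B \<Longrightarrow> x \<in> hset G \<Longrightarrow> b x \<in> hset G" using bop_mem[OF B_bop] .

lemma B_separating: 
  assumes v: "v \<in> hset G" and b: "\<And>b. b \<in> B \<Longrightarrow> b v = 0" shows "v = 0"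
proof (rule total_perp_zero[OF _ B_nondeg v])
  show "{b g |b g. b \<in> B \<and> g \<in> hset G} \<subseteq> hset G" using B_mem by auto
  fix x assume "x \<in> {b g |b g. b \<in> B \<and> g \<in> hset G}"
  then obtain a g where a: "x = a g" "a \<in> B" "g \<in> hset G" by blast
  have "hip G x v = hip G g (adj G G a v)" using GG.adj_ip'[OF B_bop[OF a(2)] a(3) v] a by simp
  then show "hip G x v = 0" using b[OF B_adj[OF a(2)]] a by simp
qed

lemma commutant_bop: "c \<in> commutant G B \<Longrightarrow> c \<in> bop G G" by (simp add: commutant_def)
lemma commutant_comm: "c \<in> commutant G B \<Longrightarrow> b \<in> B \<Longrightarrow> c (b x) = b (c x)"
  unfolding commutant_def by (auto simp: fun_eq_iff)
lemma commutantI: "c \<in> bop G G \<Longrightarrow> (\<And>b x. b \<in> B \<Longrightarrow> x \<in> hset G \<Longrightarrow> c (b x) = b (c x)) \<Longrightarrow> c \<in> commutant G B"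
  unfolding commutant_def
  by (intro CollectI conjI ballI bop_eqI[OF bop_comp[OF B_bop] bop_comp[OF _ B_bop]]) simp_all

lemma commutant_id: "id_on (hset G) \<in> commutant G B"
  unfolding commutant_def using id_on_bop id_comp[OF B_bop] comp_id_on[OF B_bop] by simp

lemma commutant_adj: assumes c: "c \<in> commutant G B" shows "adj G G c \<in> commutant G B"
proof (rule commutantI)
  note cb = commutant_bop[OF c]
  show "adj G G c \<in> bop G G" using cb by simp
  fix b x assume b: "b \<in> B"
  have "c \<circ> adj G G b = adj G G b \<circ> c" using c B_adj[OF b] unfolding commutant_def by blast
  then have "adj G G (c \<circ> adj G G b) = adj G G (adj G G b \<circ> c)" by simp
  then have "b \<circ> adj G G c = adj G G c \<circ> b"
    using adj_comp[OF hilb_axioms hilb_axioms hilb_axioms] cb B_bop[OF b] GG.adj_bop GG.adj_adj by simp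
  then show "adj G G c (b x) = b (adj G G c x)" by (simp add: fun_eq_iff)
qed

lemma commutant_vna: "von_neumann_algebra G (commutant G B)"
  unfolding von_neumann_algebra_def
proof (intro conjI ballI)
  show "complex_vector.subspace (commutant G B)"
  proof (rule complex_vector.subspaceI)
    show "0 \<in> commutant G B"
      by (rule commutantI) (simp_all add: complex_vector.subspace_0[OF GG.bop_subspace] bop_zero[OF B_bop])
    show "c + d \<in> commutant G B" if "c \<in> commutant G B" "d \<in> commutant G B" for c d
      by (rule commutantI[OF GG.bop_add_closed[OF that[THEN commutant_bop]]])
        (simp add: commutant_comm[OF that(1)] commutant_comm[OF that(2)] bop_add[OF B_bop] bop_mem[OF that(1)[THEN commutant_bop]]
          bop_mem[OF that(2)[THEN commutant_bop]])
    show "a *\<^sub>C c \<in> commutant G B" if "c \<in> commutant G B" for a c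
      by (rule commutantI[OF GG.bop_scale_closed[OF that[THEN commutant_bop]]])
        (simp add: commutant_comm[OF that] bop_scale[OF B_bop] bop_mem[OF that[THEN commutant_bop]])
  qed
  show "commutant G B \<subseteq> bop G G" using commutant_bop by blast
  show "a \<circ> b \<in> commutant G B" if "a \<in> commutant G B" "b \<in> commutant G B" for a b
    by (rule commutantI[OF bop_comp[OF that(2)[THEN commutant_bop] that(1)[THEN commutant_bop]]])
      (simp add: commutant_comm[OF that(1)] commutant_comm[OF that(2)])
  show "adj G G a \<in> commutant G B" if "a \<in> commutant G B" for a using that by (rule commutant_adj)
  show "closedin (strong_top G G) (commutant G B)" unfolding GG.strong_closed_iff
  proof (intro conjI ballI impI)
    show "commutant G B \<subseteq> bop G G" using commutant_bop by blast
    fix y assume y: "y \<in> bop G G"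
      and a: "\<forall>F e. finite F \<and> F \<subseteq> hset G \<and> e > 0 \<longrightarrow> (\<exists>x\<in>commutant G B. \<forall>g\<in>F. hnorm G (x g - y g) < e)"
    have e: "commutant G B = intertwiners G B G (\<lambda>b. b)"
      by (auto simp: commutant_def intertwiners_def)
    show "y \<in> commutant G B"
      unfolding e by (rule GG.intertwiners_approx[OF _ _ y]) (use B_bop a in \<open>auto simp: e\<close>)
  qed
qed

text \<open>
  The double commutant argument.  For \<open>F = {g\<^sub>1, \<dots>, g\<^sub>n}\<close> let \<open>P\<close> be the projection of \<open>G\<^sup>n\<close> onto the closure of
  \<open>B (g\<^sub>1, \<dots>, g\<^sub>n)\<close>.  Its entries \<open>Q i j\<close> are in \<open>B'\<close>, and \<open>P\<close> fixes \<open>(g\<^sub>1, \<dots>, g\<^sub>n)\<close>.  If \<open>\<xi>\<close> in \<open>H\<^sup>n\<close> is orthogonal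
  to all \<open>(x g\<^sub>1, \<dots>, x g\<^sub>n)\<close>, then \<open>x\<^sup>* \<xi>\<close> is orthogonal to \<open>B (g\<^sub>1, \<dots>, g\<^sub>n)\<close>, as \<open>M\<close> is right invariant, so
  that \<open>P x\<^sup>* \<xi> = 0\<close> for all \<open>x \<in> M\<close>.  By totality of \<open>M G\<close> the matrix \<open>(r (Q i j))\<close> annihilates \<open>\<xi>\<close>.  Therefore
  \<open>\<langle>\<xi>, y g\<rangle> = \<langle>\<xi>, y P g\<rangle> = \<langle>r(P) \<xi>, y g\<rangle> = 0\<close>, and \<open>y g\<close> is in the closure of \<open>M g\<close>.
\<close>

lemma density_approx:
  assumes "hilb H" and M: "complex_vector.subspace M" "M \<subseteq> bop G H" 
    and MB: "\<And>x b. x \<in> M \<Longrightarrow> b \<in> B \<Longrightarrow> x \<circ> b \<in> M"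
    and total: "hcl H (complex_vector.span {x g |x g. x \<in> M \<and> g \<in> hset G}) = hset H"
    and r: "\<And>c. c \<in> commutant G B \<Longrightarrow> r c \<in> bop H H" "\<And>c. c \<in> commutant G B \<Longrightarrow> r (adj G G c) = adj H H (r c)"
      "\<And>c x. c \<in> commutant G B \<Longrightarrow> x \<in> M \<Longrightarrow> r c \<circ> x = x \<circ> c"
    and y: "y \<in> bop G H" "\<And>c. c \<in> commutant G B \<Longrightarrow> r c \<circ> y = y \<circ> c"
    and F: "finite F" "F \<subseteq> hset G" and e: "e > 0"
  shows "\<exists>x\<in>M. \<forall>g\<in>F. hnorm H (x g - y g) < e"
proof -
  interpret H: hilb H by fact
  interpret GH: hilb2 G H ..
  interpret HH: hilb2 H H ..
  interpret GI: hilb "hsum F G" by (rule hsum_hilb)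
  interpret HI: hilb "hsum F H" by (rule H.hsum_hilb)
  interpret GIG: hilb2 "hsum F G" G ..
  note gmem = hsum_finite_mem[OF F(1)] and hmem = H.hsum_finite_mem[OF F(1)]
  have Mb: "x \<in> bop G H" if "x \<in> M" for x using that M by blast
  define gg where "gg g = (if g \<in> F then g else 0)" for g
  have gg: "gg \<in> hset (hsum F G)" unfolding gmem gg_def using F by auto
  have ggi: "gg i \<in> hset G" for i using gg by (rule hsum_comp)
  define D where "D = (\<lambda>b. amp F b gg) ` B"
  have ab: "amp F b \<in> bop (hsum F G) (hsum F G)" if "b \<in> B" for b by (rule amp_bop[OF B_bop[OF that]])
  have Dsub: "complex_vector.subspace D" unfolding D_def
    by (rule linear_image_subspace[OF B_subspace]) (auto simp: amp_def gg fun_eq_iff)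
  have DG: "D \<subseteq> hset (hsum F G)" unfolding D_def using bop_mem[OF ab gg] by auto
  let ?C = "hcl (hsum F G) D"
  have C: "GI.closed_subspace ?C" by (rule GI.closed_subspace_hcl[OF Dsub DG])
  have inv: "amp F b x \<in> ?C" if b: "b \<in> B" and x: "x \<in> ?C" for b x
  proof (rule GI.bop_hcl_inv[OF ab[OF b] _ x])
    fix z assume z: "z \<in> D"
    then obtain a where a: "a \<in> B" "z = amp F a gg" unfolding D_def by blast
    have "amp F b z = amp F (b \<circ> a) gg"
      using a gg z DG by (auto simp: amp_def fun_eq_iff)
    then show "amp F b z \<in> D" unfolding D_def using B_comp[OF b a(1)] by blast
  qed
  define P where "P = GI.proj ?C"
  have Pb: "P \<in> bop (hsum F G) (hsum F G)" unfolding P_def by (rule GI.proj_bop[OF C])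
  have Pcomm: "P (amp F b x) = amp F b (P x)" if b: "b \<in> B" and x: "x \<in> hset (hsum F G)" for b x
    unfolding P_def
    by (rule GI.proj_commute[OF C ab[OF b] ab[OF B_adj[OF b]] amp_ip[OF B_bop[OF b]]])
      (use inv b B_adj[OF b] x in auto)
  define Q where "Q i j x = (if x \<in> hset G then P (inj_at j x) i else 0)" for i j x
  have Qb: "Q i j \<in> bop G G" if j: "j \<in> F" for i j
  proof (rule bopI[where K = 1])
    fix x assume x: "x \<in> hset G"
    note m = bop_mem[OF Pb at_mem[OF x j]]
    show "Q i j x \<in> hset G" using hsum_comp[OF m] x by (simp add: Q_def)
    have "hnorm (hsum F G) (P (inj_at j x)) \<le> hnorm G x"
      using GI.proj_norm[OF C at_mem[OF x j]] at_hnorm[OF x j] by (simp add: P_def)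
    then show "hnorm G (Q i j x) \<le> 1 * hnorm G x" using hsum_comp_le[OF m, of i] x by (simp add: Q_def)
    show "Q i j (c *\<^sub>C x) = c *\<^sub>C Q i j x" for c
    proof -
      have "inj_at j (c *\<^sub>C x) = c *\<^sub>C inj_at j x" by (auto simp: inj_at_def)
      then show ?thesis using x bop_scale[OF Pb at_mem[OF x j]] by (simp add: Q_def)
    qed
    show "Q i j (x + z) = Q i j x + Q i j z" if z: "z \<in> hset G" for z
    proof -
      have "inj_at j (x + z) = inj_at j x + inj_at j z" by (auto simp: inj_at_def)
      then show ?thesis using x z bop_add[OF Pb at_mem[OF x j] at_mem[OF z j]] by (simp add: Q_def)
    qed
  qed (simp add: Q_def)
  have Qc: "Q i j \<in> commutant G B" if j: "j \<in> F" for i j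
  proof (rule commutantI[OF Qb[OF j]])
    fix b x assume b: "b \<in> B" and x: "x \<in> hset G"
    have "P (inj_at j (b x)) = amp F b (P (inj_at j x))"
      using Pcomm[OF b at_mem[OF x j]] amp_at[OF B_bop[OF b] x j] by simp
    then show "Q i j (b x) = b (Q i j x)"
      using x B_mem[OF b x] amp_apply[OF bop_mem[OF Pb at_mem[OF x j]]] by (simp add: Q_def)
  qed
  have Qadj: "adj G G (Q i j) = Q j i" if i: "i \<in> F" and j: "j \<in> F" for i j
  proof (rule GG.adj_eqI[OF Qb[OF j] Qb[OF i]])
    fix x z assume x: "x \<in> hset G" and z: "z \<in> hset G"
    have "hip G (Q j i z) x = hip (hsum F G) (P (inj_at i z)) (inj_at j x)"
      using at_ip(2)[OF x j bop_mem[OF Pb at_mem[OF z i]]] z by (simp add: Q_def)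
    also have "\<dots> = hip (hsum F G) (inj_at i z) (P (inj_at j x))"
      unfolding P_def by (rule GI.proj_ip[OF C at_mem[OF z i] at_mem[OF x j]])
    also have "\<dots> = hip G z (Q i j x)"
      using at_ip(1)[OF z i bop_mem[OF Pb at_mem[OF x j]]] x by (simp add: Q_def)
    finally show "hip G (Q j i z) x = hip G z (Q i j x)" .
  qed
  have Psum: "P u i = (\<Sum>j\<in>F. Q i j (u j))" if u: "u \<in> hset (hsum F G)" for u i
  proof -
    have "P u = P (\<Sum>j\<in>F. inj_at j (u j))" using at_decomp[OF F(1) u] by simp
    also have "\<dots> = (\<Sum>j\<in>F. P (inj_at j (u j)))" by (rule GI.bop_sum[OF Pb]) (rule at_mem[OF hsum_comp[OF u]])
    finally have "P u i = (\<Sum>j\<in>F. P (inj_at j (u j)) i)" 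
      by (simp add: sum_fun_apply)
    then show ?thesis using hsum_comp[OF u] by (simp add: Q_def)
  qed
  \<comment> \<open>That \<open>(g\<^sub>1, \<dots>, g\<^sub>n)\<close> is in the closure of \<open>B (g\<^sub>1, \<dots>, g\<^sub>n)\<close> follows from nondegeneracy; \<open>B\<close> is not known to have a unit.\<close>
  have "gg - P gg = 0"
  proof
    fix i
    have m: "gg - P gg \<in> hset (hsum F G)" using gg bop_mem[OF Pb gg] by simp
    show "(gg - P gg) i = 0 i" unfolding zero_fun_apply
    proof (rule B_separating[OF hsum_comp[OF m]])
      fix b assume b: "b \<in> B"
      have "amp F b gg \<in> ?C" by (rule GI.hcl_self[OF DG]) (use b in \<open>simp add: D_def\<close>)
      then have "P (amp F b gg) = amp F b gg" unfolding P_def by (rule GI.proj_id[OF C])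
      then have "amp F b (gg - P gg) = 0"
        using Pcomm[OF b gg] GI.bop_diff[OF ab[OF b] gg bop_mem[OF Pb gg]] by simp
      then show "b ((gg - P gg) i) = 0" using amp_apply[OF m, of b i] by simp
    qed
  qed
  then have ggQ: "gg i = (\<Sum>j\<in>F. Q i j (gg j))" for i using Psum[OF gg, of i] by simp
  define W where "W = (\<lambda>x i. x (gg i)) ` M"
  have xm: "(\<lambda>i. x (gg i)) \<in> hset (hsum F H)" if "x \<in> bop G H" for x
    unfolding hmem using bop_mem[OF that ggi] bop_zero[OF that] by (auto simp: gg_def)
  have Wsub: "complex_vector.subspace W" unfolding W_def
    by (rule linear_image_subspace[OF M(1)]) (auto simp: fun_eq_iff)
  have WH: "W \<subseteq> hset (hsum F H)" unfolding W_def using xm Mb by auto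
  have CW: "HI.closed_subspace (hcl (hsum F H) W)" by (rule HI.closed_subspace_hcl[OF Wsub WH])
  define yy where "yy i = y (gg i)" for i
  have yy: "yy \<in> hset (hsum F H)" using xm[OF y(1)] by (simp add: yy_def[abs_def])
  \<comment> \<open>The vector to be shown to vanish: the component of \<open>(y g\<^sub>1, \<dots>, y g\<^sub>n)\<close> orthogonal to \<open>M (g\<^sub>1, \<dots>, g\<^sub>n)\<close>.\<close>
  define xi where "xi = yy - HI.proj (hcl (hsum F H) W) yy"
  have xim: "xi \<in> hset (hsum F H)" unfolding xi_def using yy HI.proj_in[OF CW yy] by simp
  have xii: "xi i \<in> hset H" for i using H.hsum_comp[OF xim] .
  have xi0: "xi i = 0" if "i \<notin> F" for i using xim that unfolding hmem by blast
  have xiW: "hip (hsum F H) w xi = 0" if "w \<in> W" for w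
    unfolding xi_def by (rule HI.proj_perp[OF CW yy HI.hcl_self[OF WH that]])
  have key: "(\<Sum>j\<in>F. Q i j (adj G H x (xi j))) = 0" if x: "x \<in> M" for x i
  proof -
    note xb = Mb[OF x]
    let ?u = "\<lambda>i. adj G H x (xi i)"
    have u: "?u \<in> hset (hsum F G)" unfolding gmem
      using GH.adj_mem[OF xb xii] bop_zero[OF GH.adj_bop[OF xb]] xi0 by auto
    have "hip (hsum F G) d ?u = 0" if "d \<in> ?C" for d
    proof (rule GI.perp_hcl[OF DG u _ that])
      fix d assume "d \<in> D"
      then obtain b where b: "b \<in> B" "d = amp F b gg" unfolding D_def by blast
      have "hip (hsum F G) d ?u = (\<Sum>i\<in>F. hip G (b (gg i)) (adj G H x (xi i)))"
        using F(1) by (simp add: hsum_ip b amp_apply[OF gg])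
      also have "\<dots> = (\<Sum>i\<in>F. hip H ((x \<circ> b) (gg i)) (xi i))"
        by (rule sum.cong[OF refl]) (use GH.adj_ip'[OF xb B_mem[OF b(1) ggi] xii] in simp)
      also have "\<dots> = hip (hsum F H) (\<lambda>i. (x \<circ> b) (gg i)) xi" using F(1) by (simp add: H.hsum_ip)
      also have "\<dots> = 0" by (rule xiW, unfold W_def, rule image_eqI[OF _ MB[OF x b(1)]]) simp
      finally show "hip (hsum F G) d ?u = 0" .
    qed
    then have "P ?u = 0" unfolding P_def by (rule GI.proj_zero[OF C u])
    then show ?thesis using Psum[OF u, of i] by simp
  qed
  have xr: "adj G H x (r c h) = c (adj G H x h)" if x: "x \<in> M" and c: "c \<in> commutant G B" and h: "h \<in> hset H" for x c h
  proof -
    note cb = commutant_bop[OF c] and xb = Mb[OF x] and rb = r(1)[OF c]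
    have "adj H H (r (adj G G c)) = r c" using r(2)[OF c] HH.adj_adj[OF rb] by simp
    moreover have "adj G H (r (adj G G c) \<circ> x) = adj G H x \<circ> adj H H (r (adj G G c))"
      by (rule adj_comp[OF hilb_axioms H.hilb_axioms H.hilb_axioms xb r(1)[OF commutant_adj[OF c]]])
    moreover have "adj G H (x \<circ> adj G G c) = c \<circ> adj G H x"
      using adj_comp[OF hilb_axioms hilb_axioms H.hilb_axioms GG.adj_bop[OF cb] xb] GG.adj_adj[OF cb] by simp
    ultimately have "adj G H x \<circ> r c = c \<circ> adj G H x" using r(3)[OF commutant_adj[OF c] x] by simp
    then show ?thesis by (simp add: fun_eq_iff)
  qed
  have eta: "(\<Sum>j\<in>F. r (Q i j) (xi j)) = 0" for i
  proof (rule H.total_perp_zero[OF _ total])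
    show "{x g |x g. x \<in> M \<and> g \<in> hset G} \<subseteq> hset H" using bop_mem[OF Mb] by auto
    have m: "r (Q i j) (xi j) \<in> hset H" if "j \<in> F" for j using bop_mem[OF r(1)[OF Qc[OF that]] xii] .
    then show sm: "(\<Sum>j\<in>F. r (Q i j) (xi j)) \<in> hset H" by simp
    fix z assume "z \<in> {x g |x g. x \<in> M \<and> g \<in> hset G}"
    then obtain x g where x: "z = x g" "x \<in> M" "g \<in> hset G" by blast
    have "hip H z (\<Sum>j\<in>F. r (Q i j) (xi j)) = hip G g (adj G H x (\<Sum>j\<in>F. r (Q i j) (xi j)))"
      using GH.adj_ip'[OF Mb[OF x(2)] x(3) sm] x by simp
    also have "adj G H x (\<Sum>j\<in>F. r (Q i j) (xi j)) = (\<Sum>j\<in>F. Q i j (adj G H x (xi j)))"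
      using H.bop_sum[OF GH.adj_bop[OF Mb[OF x(2)]] m, of F] xr[OF x(2) Qc xii] by simp
    finally show "hip H z (\<Sum>j\<in>F. r (Q i j) (xi j)) = 0" using key[OF x(2)] x by simp
  qed
  have "hip (hsum F H) xi yy = (\<Sum>i\<in>F. hip H (xi i) (y (gg i)))" using F(1) by (simp add: H.hsum_ip yy_def)
  also have "\<dots> = (\<Sum>i\<in>F. \<Sum>j\<in>F. hip H (r (Q j i) (xi i)) (y (gg j)))"
  proof (rule sum.cong[OF refl])
    fix i assume i: "i \<in> F"
    have Qm: "Q i j (gg j) \<in> hset G" if "j \<in> F" for j using bop_mem[OF Qb[OF that] ggi] .
    have "y (gg i) = (\<Sum>j\<in>F. y (Q i j (gg j)))"
      using ggQ[of i] bop_sum[OF y(1) Qm, of F "\<lambda>j. j"] by simp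
    then have "hip H (xi i) (y (gg i)) = (\<Sum>j\<in>F. hip H (xi i) (y (Q i j (gg j))))"
      using H.sum_right[OF xii bop_mem[OF y(1) Qm], of F "\<lambda>j. j" i] by simp
    also have "\<dots> = (\<Sum>j\<in>F. hip H (r (Q j i) (xi i)) (y (gg j)))"
    proof (rule sum.cong[OF refl])
      fix j assume j: "j \<in> F"
      have "y (Q i j (gg j)) = r (Q i j) (y (gg j))" using y(2)[OF Qc[OF j]] by (simp add: fun_eq_iff)
      moreover have "r (Q j i) = adj H H (r (Q i j))" using r(2)[OF Qc[OF j], of i] Qadj[OF i j] by simp
      ultimately show "hip H (xi i) (y (Q i j (gg j))) = hip H (r (Q j i) (xi i)) (y (gg j))"
        using HH.adj_ip[OF r(1)[OF Qc[OF j]] bop_mem[OF y(1) ggi] xii] by simp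
    qed
    finally show "hip H (xi i) (y (gg i)) = (\<Sum>j\<in>F. hip H (r (Q j i) (xi i)) (y (gg j)))" .
  qed
  also have "\<dots> = (\<Sum>j\<in>F. \<Sum>i\<in>F. hip H (r (Q j i) (xi i)) (y (gg j)))" by (rule sum.swap)
  also have "\<dots> = (\<Sum>j\<in>F. hip H (\<Sum>i\<in>F. r (Q j i) (xi i)) (y (gg j)))"
    by (intro sum.cong refl H.sum_left[symmetric] bop_mem[OF y(1) ggi] bop_mem[OF r(1)[OF Qc] xii])
  also have "\<dots> = 0" using eta bop_mem[OF y(1) ggi] by simp
  finally have xy: "hip (hsum F H) xi yy = 0" .
  have "hip (hsum F H) (HI.proj (hcl (hsum F H) W) yy) xi = 0"
    unfolding xi_def by (rule HI.proj_perp[OF CW yy HI.proj_mem[OF CW yy]])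
  then have "hip (hsum F H) xi (HI.proj (hcl (hsum F H) W) yy) = 0"
    using HI.herm[OF HI.proj_in[OF CW yy] xim] by simp
  then have "hip (hsum F H) xi xi = 0"
    using xy HI.diff_right[OF xim yy HI.proj_in[OF CW yy]] by (simp flip: xi_def)
  then have "xi = 0" by (rule HI.definite[OF xim])
  then have "yy \<in> hcl (hsum F H) W" using HI.proj_mem[OF CW yy] by (simp add: xi_def)
  then obtain w where w: "w \<in> W" "hnorm (hsum F H) (w - yy) < e" using e unfolding HI.hcl_iff[OF WH] by blast
  then obtain x where x: "x \<in> M" "w = (\<lambda>i. x (gg i))" unfolding W_def by blast
  have "hnorm H (x g - y g) < e" if g: "g \<in> F" for g
    using H.hsum_comp_le[of "w - yy" F g] w WH yy x g by (auto simp: gg_def yy_def)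
  then show ?thesis using x(1) by blast
qed

lemma density:
  assumes "hilb H" "complex_vector.subspace M" "closedin (strong_top G H) M" 
    and "\<And>x b. x \<in> M \<Longrightarrow> b \<in> B \<Longrightarrow> x \<circ> b \<in> M"
    and "hcl H (complex_vector.span {x g |x g. x \<in> M \<and> g \<in> hset G}) = hset H"
    and "\<And>c. c \<in> commutant G B \<Longrightarrow> r c \<in> bop H H" "\<And>c. c \<in> commutant G B \<Longrightarrow> r (adj G G c) = adj H H (r c)"
      "\<And>c x. c \<in> commutant G B \<Longrightarrow> x \<in> M \<Longrightarrow> r c \<circ> x = x \<circ> c"
    and "y \<in> bop G H" "\<And>c. c \<in> commutant G B \<Longrightarrow> r c \<circ> y = y \<circ> c"
  shows "y \<in> M"
proof -
  interpret GH: hilb2 G H using assms(1) by (simp add: hilb2_def hilb_axioms)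
  have M: "M \<subseteq> bop G H" using assms(3) unfolding GH.strong_closed_iff by blast
  have "\<exists>x\<in>M. \<forall>g\<in>F. hnorm H (x g - y g) < e" if F: "finite F" "F \<subseteq> hset G" and e: "e > 0" for F e
    by (rule density_approx[where r = r, OF assms(1,2) M assms(4-10) F e])
  then show ?thesis using assms(3) \<open>y \<in> bop G H\<close> unfolding GH.strong_closed_iff by blast
qed

end

locale vna = hilb G for G :: "'g::complex_vector hilbert" +
  fixes B :: "('g \<Rightarrow> 'g) set"
  assumes vna: "von_neumann_algebra G B" and nondeg: "nondegenerate G B"

sublocale vna \<subseteq> star_algebra
proof
  show "complex_vector.subspace B" "\<And>b. b \<in> B \<Longrightarrow> b \<in> bop G G" "\<And>a b. a \<in> B \<Longrightarrow> b \<in> B \<Longrightarrow> a \<circ> b \<in> B"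
    "\<And>b. b \<in> B \<Longrightarrow> adj G G b \<in> B"
    using vna unfolding von_neumann_algebra_def by blast+
  then have "{b g |b g. b \<in> B \<and> g \<in> hset G} \<subseteq> hset G" using bop_mem by blast
  then show "hcl G (complex_vector.span {b g |b g. b \<in> B \<and> g \<in> hset G}) = hset G"
    using nondeg closure_eq_hcl[OF span_mem] unfolding nondegenerate_def by blast
qed

context vna
begin

lemma B_closed: "closedin (strong_top G G) B"
  using vna unfolding von_neumann_algebra_def by blast

lemma bicommutant: "commutant G (commutant G B) = B"
proof
  show "B \<subseteq> commutant G (commutant G B)"
    unfolding commutant_def using B_bop by auto
  show "commutant G (commutant G B) \<subseteq> B"
  proof
    fix y assume y: "y \<in> commutant G (commutant G B)"
    show "y \<in> B"
      by (rule density[where r = "\<lambda>c. c", OF hilb_axioms B_subspace B_closed B_comp B_nondeg])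
        (use y in \<open>auto simp: commutant_def\<close>)
  qed
qed

lemma B_id: "id_on (hset G) \<in> B"
proof -
  have "id_on (hset G) \<in> commutant G (commutant G B)"
    unfolding commutant_def using id_on_bop by auto
  then show ?thesis by (simp add: bicommutant)
qed

lemma vna_commutant: "vna G (commutant G B)"
proof
  show "von_neumann_algebra G (commutant G B)" by (rule commutant_vna)
  have "g \<in> {b g |b g. b \<in> commutant G B \<and> g \<in> hset G}" if "g \<in> hset G" for g
    using commutant_id that by (intro CollectI exI[of _ "id_on (hset G)"] exI[of _ g]) (simp add: id_on_def)
  moreover have "{b g |b g. b \<in> commutant G B \<and> g \<in> hset G} \<subseteq> hset G" using bop_mem commutant_bop by blast
  ultimately have e: "{b g |b g. b \<in> commutant G B \<and> g \<in> hset G} = hset G" by blast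
  have sp: "complex_vector.span (hset G) = hset G" using subspace by (simp add: complex_vector.span_eq_iff)
  have hc: "hcl G (hset G) = hset G" using hcl_self hcl_mem by blast
  show "nondegenerate G (commutant G B)"
    unfolding nondegenerate_def e sp closure_eq_hcl[OF order_refl] hc ..
qed

end

section \<open>Square roots in von Neumann algebras\<close>

context vna
begin

lemma B_limit:
  assumes s: "\<And>n. s n \<in> B" and e: "e \<longlonglongrightarrow> 0"
    and c: "\<And>N m n g. m \<ge> N \<Longrightarrow> n \<ge> N \<Longrightarrow> g \<in> hset G \<Longrightarrow> hnorm G (s m g - s n g) \<le> e N * hnorm G g"
  obtains T where "T \<in> B" "\<And>n g. g \<in> hset G \<Longrightarrow> hnorm G (s n g - T g) \<le> e n * hnorm G g"
    "\<And>g. g \<in> hset G \<Longrightarrow> hlim G (\<lambda>n. s n g) (T g)"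
proof -
  obtain T where T: "T \<in> bop G G" "\<And>n g. g \<in> hset G \<Longrightarrow> hnorm G (s n g - T g) \<le> e n * hnorm G g"
    "\<And>g. g \<in> hset G \<Longrightarrow> hlim G (\<lambda>n. s n g) (T g)"
  proof (rule GG.bop_limit[of s e])
    show "hnorm G (s m g - s n g) \<le> e N * hnorm G g" if "m \<ge> N" "n \<ge> N" "g \<in> hset G" for m n N g
      using that by (rule c)
  qed (use B_bop[OF s] e in blast)+
  have "T \<in> B" by (rule GG.strong_closed_seq[OF B_closed T(1) s T(3)])
  then show thesis using T(2,3) by (rule that)
qed

text \<open>
  Cauchy-Schwarz for the form \<open>\<langle>x, A y\<rangle>\<close>, at \<open>x = g\<close> and \<open>y = A g\<close>.
\<close>

lemma contraction_of_positive:
  assumes A: "A \<in> bop G G" "adj G G A = A"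
    and p: "\<And>g. g \<in> hset G \<Longrightarrow> hip G g (A g) \<in> \<real>\<^sub>\<ge>\<^sub>0"
    and le: "\<And>g. g \<in> hset G \<Longrightarrow> Re (hip G g (A g)) \<le> (hnorm G g)\<^sup>2" and g: "g \<in> hset G"
  shows "hnorm G (A g) \<le> hnorm G g"
proof -
  have sa: "hip G (A x) y = hip G x (A y)" if "x \<in> hset G" "y \<in> hset G" for x y
    using GG.adj_ip[OF A(1) that(2) that(1)] A(2) by simp
  interpret q: semi_inner "hset G" "\<lambda>x y. hip G x (A y)"
  proof
    fix x y z c assume x: "x \<in> hset G" and y: "y \<in> hset G"
    show "hip G y (A x) = cnj (hip G x (A y))"
      by (simp only: sa[OF y x, symmetric] herm[OF x bop_mem[OF A(1) y]])
    show "hip G x (A (c *\<^sub>C y)) = c * hip G x (A y)"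
      using x y bop_scale[OF A(1) y] bop_mem[OF A(1) y] by (simp add: scale_right)
    show "hip G x (A (y + z)) = hip G x (A y) + hip G x (A z)" if "z \<in> hset G"
      using x y that bop_add[OF A(1) y that] bop_mem[OF A(1)] by (simp add: add_right)
  qed (use p subspace in auto)
  have m: "A g \<in> hset G" by (rule bop_mem[OF A(1) g])
  have qn: "qnorm (\<lambda>x y. hip G x (A y)) x \<le> hnorm G x" if "x \<in> hset G" for x
    using le[OF that] that by (simp add: qnorm_def real_le_lsqrt)
  have "(hnorm G (A g))\<^sup>2 = Re (hip G g (A (A g)))" using sa[OF g m] m by (simp add: norm_sq)
  also have "\<dots> \<le> cmod (hip G g (A (A g)))" by (rule complex_Re_le_cmod)
  also have "\<dots> \<le> qnorm (\<lambda>x y. hip G x (A y)) g * qnorm (\<lambda>x y. hip G x (A y)) (A g)"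
    by (rule q.cauchy_schwarz[OF g m])
  also have "\<dots> \<le> hnorm G g * hnorm G (A g)"
    using qn[OF g] qn[OF m] q.norm_nonneg[OF g] q.norm_nonneg[OF m] g by (intro mult_mono) auto
  finally have "hnorm G (A g) * hnorm G (A g) \<le> hnorm G g * hnorm G (A g)" by (simp add: power2_eq_square)
  then show ?thesis
    by (cases "hnorm G (A g) = 0") (use norm_nonneg[OF m] g in \<open>auto simp: mult_le_cancel_right\<close>)
qed

text \<open>
  For \<open>0 \<le> C \<le> 1\<close> the iterates converge to \<open>1 - \<surd>(1 - C)\<close>, the smaller solution of \<open>2 T = C + T\<^sup>2\<close>.
\<close>

primrec sqrt_iter :: "('g \<Rightarrow> 'g) \<Rightarrow> nat \<Rightarrow> 'g \<Rightarrow> 'g" where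
  "sqrt_iter A 0 = 0"
| "sqrt_iter A (Suc n) = (1/2) *\<^sub>C (A + (sqrt_iter A n \<circ> sqrt_iter A n))"

text \<open>
  The scalar iteration at \<open>C = 1\<close>.  As the iterates are polynomials in \<open>C\<close> with nonnegative coefficients that increase
  with \<open>n\<close>, its increments dominate the norms of the increments of \<open>sqrt_iter C\<close> for every contraction \<open>C\<close>.
\<close>

primrec sqrt_bound :: "nat \<Rightarrow> real" where
  "sqrt_bound 0 = 0"
| "sqrt_bound (Suc n) = (1 + (sqrt_bound n)\<^sup>2) / 2"

lemma sqrt_bound_props: "0 \<le> sqrt_bound n \<and> sqrt_bound n \<le> 1 \<and> sqrt_bound n \<le> sqrt_bound (Suc n)"
proof (induction n)
  case (Suc n)
  have "(sqrt_bound n)\<^sup>2 \<le> 1" using Suc by (simp add: power_le_one)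
  moreover have "(sqrt_bound n)\<^sup>2 \<le> (sqrt_bound (Suc n))\<^sup>2" using Suc by (intro power_mono) auto
  ultimately show ?case by simp
qed simp

text \<open>
  With \<open>C = 1 - A\<close> the limit \<open>T\<close> of the iterates satisfies \<open>2 T = C + T\<^sup>2\<close>, that is, \<open>(1 - T)\<^sup>2 = A\<close>.  Convergence is
  in norm, by the scalar majorant, so that \<open>T\<close> stays in \<open>B\<close>.
\<close>

lemma square_root_contraction:
  assumes A: "A \<in> B" "adj G G A = A"
    and p: "\<And>g. g \<in> hset G \<Longrightarrow> hip G g (A g) \<in> \<real>\<^sub>\<ge>\<^sub>0"
    and le: "\<And>g. g \<in> hset G \<Longrightarrow> Re (hip G g (A g)) \<le> (hnorm G g)\<^sup>2"
  obtains S where "S \<in> B" "adj G G S = S" "S \<circ> S = A"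
proof -
  let ?I = "id_on (hset G)"
  define C where "C = ?I - A"
  have CB: "C \<in> B" unfolding C_def by (rule B_diff[OF B_id A(1)])
  have Cadj: "adj G G C = C" unfolding C_def using GG.adj_diff[OF id_on_bop B_bop[OF A(1)]] adj_id A(2) by simp
  have Capp: "C g = g - A g" if "g \<in> hset G" for g using that by (simp add: C_def id_on_def)
  have Cip: "hip G g (C g) = complex_of_real ((hnorm G g)\<^sup>2 - Re (hip G g (A g)))" if g: "g \<in> hset G" for g
    using nonneg_complex_eq[OF p[OF g]] self_eq[OF g] B_mem[OF A(1) g] g by (simp add: Capp diff_right)
  have Cle: "hnorm G (C g) \<le> hnorm G g" if g: "g \<in> hset G" for g
  proof (rule contraction_of_positive[OF B_bop[OF CB] Cadj _ _ g])
    fix h assume h: "h \<in> hset G"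
    show "hip G h (C h) \<in> \<real>\<^sub>\<ge>\<^sub>0" unfolding Cip[OF h] using le[OF h] by (simp add: complex_nonneg_Reals_iff)
    show "Re (hip G h (C h)) \<le> (hnorm G h)\<^sup>2"
      unfolding Cip[OF h] using nonneg_complex_Re[OF p[OF h]] by simp
  qed
  define Y where "Y = sqrt_iter C"
  have YB: "Y n \<in> B" for n
    unfolding Y_def
    by (induction n; simp only: sqrt_iter.simps) (intro B_scale B_add B_comp CB complex_vector.subspace_0[OF B_subspace]; assumption)+
  have Yadj: "adj G G (Y n) = Y n" for n
  proof (induction n)
    case 0 
    have "adj G G 0 = 0" using GG.adj_scale[OF B_bop[OF CB], of 0] by simp
    then show ?case unfolding Y_def by (simp only: sqrt_iter.simps)
  next
    case (Suc n)
    have m: "Y n \<circ> Y n \<in> bop G G" by (rule B_bop[OF B_comp[OF YB YB]])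
    have "adj G G (Y n \<circ> Y n) = Y n \<circ> Y n"
      using adj_comp[OF hilb_axioms hilb_axioms hilb_axioms B_bop[OF YB] B_bop[OF YB], of n n] Suc by simp
    then have "adj G G ((1/2) *\<^sub>C (C + (Y n \<circ> Y n))) = (1/2) *\<^sub>C (C + (Y n \<circ> Y n))"
      using GG.adj_scale[OF GG.bop_add_closed[OF B_bop[OF CB] m]] GG.adj_add[OF B_bop[OF CB] m] Cadj by simp
    then show ?case unfolding Y_def by (simp only: sqrt_iter.simps)
  qed
  have Ym: "Y n g \<in> hset G" if "g \<in> hset G" for n g using B_mem[OF YB that] .
  have Cm: "C g \<in> hset G" if "g \<in> hset G" for g using B_mem[OF CB that] .
  have YS: "Y (Suc n) g = (1/2) *\<^sub>C (C g + Y n (Y n g))" for n g by (simp add: Y_def)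
  have Ybound: "hnorm G (Y n g) \<le> sqrt_bound n * hnorm G g" if g: "g \<in> hset G" for n g
    using g
  proof (induction n arbitrary: g)
    case (Suc n)
    have "hnorm G (Y n (Y n g)) \<le> sqrt_bound n * hnorm G (Y n g)" by (rule Suc.IH[OF Ym[OF Suc.prems]])
    also have "\<dots> \<le> sqrt_bound n * (sqrt_bound n * hnorm G g)"
      using Suc.IH[OF Suc.prems] sqrt_bound_props by (intro mult_left_mono) auto
    finally have "hnorm G (C g + Y n (Y n g)) \<le> hnorm G g + (sqrt_bound n)\<^sup>2 * hnorm G g"
      using norm_triangle[OF Cm Ym[OF Ym], OF Suc.prems Suc.prems, of n n] Cle[OF Suc.prems] by (simp add: power2_eq_square)
    moreover have "hnorm G (Y (Suc n) g) = hnorm G (C g + Y n (Y n g)) / 2"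
      using Suc.prems Cm Ym by (simp add: YS norm_scale)
    ultimately show ?case by (simp add: algebra_simps)
  qed (simp add: Y_def)
  have Ystep: "hnorm G (Y (Suc n) g - Y n g) \<le> (sqrt_bound (Suc n) - sqrt_bound n) * hnorm G g"
    if g: "g \<in> hset G" for n g
    using g
  proof (induction n arbitrary: g)
    case 0 then show ?case using Ybound[of g 1] by (simp add: Y_def)
  next
    case (Suc n)
    let ?d = "sqrt_bound (Suc n) - sqrt_bound n"
    have d0: "?d \<ge> 0" using sqrt_bound_props[of n] by simp
    note g = Suc.prems
    let ?a = "Y (Suc n) (Y (Suc n) g - Y n g)" and ?b = "Y (Suc n) (Y n g) - Y n (Y n g)"
    have "Y (Suc (Suc n)) g - Y (Suc n) g = (1/2) *\<^sub>C (C g + Y (Suc n) (Y (Suc n) g)) - (1/2) *\<^sub>C (C g + Y n (Y n g))"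
      by (rule arg_cong2[where f = minus, OF YS YS])
    also have "\<dots> = (1/2) *\<^sub>C (?a + ?b)"
      unfolding complex_vector.scale_right_diff_distrib[symmetric] bop_diff[OF B_bop[OF YB] Ym[OF g] Ym[OF g]] by simp
    finally have "hnorm G (Y (Suc (Suc n)) g - Y (Suc n) g) = hnorm G (?a + ?b) / 2"
      using Ym g by (simp add: norm_scale)
    also have "hnorm G (?a + ?b) \<le> hnorm G ?a + hnorm G ?b" by (rule norm_triangle) (use Ym g in auto)
    also have "hnorm G ?a \<le> sqrt_bound (Suc n) * hnorm G (Y (Suc n) g - Y n g)" by (rule Ybound) (use Ym g in auto)
    also have "\<dots> \<le> sqrt_bound (Suc n) * (?d * hnorm G g)"
      using Suc.IH[OF g] sqrt_bound_props by (intro mult_left_mono) blast+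
    also have "hnorm G ?b \<le> ?d * hnorm G (Y n g)" by (rule Suc.IH[OF Ym[OF g]])
    also have "\<dots> \<le> ?d * (sqrt_bound n * hnorm G g)" by (rule mult_left_mono[OF Ybound[OF g] d0])
    also have "(sqrt_bound (Suc n) * (?d * hnorm G g) + ?d * (sqrt_bound n * hnorm G g)) / 2
        = ((sqrt_bound (Suc n))\<^sup>2 - (sqrt_bound n)\<^sup>2) / 2 * hnorm G g"
    proof -
      have "(s * ((s - t) * h) + (s - t) * (t * h)) / 2 = (s\<^sup>2 - t\<^sup>2) / 2 * h" for s t h :: real
        by (simp add: power2_eq_square algebra_simps)
      then show ?thesis .
    qed
    also have "((sqrt_bound (Suc n))\<^sup>2 - (sqrt_bound n)\<^sup>2) / 2 = sqrt_bound (Suc (Suc n)) - sqrt_bound (Suc n)"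
      by (simp only: sqrt_bound.simps) (simp add: diff_divide_distrib add_divide_distrib)
    finally show ?case by (simp del: sqrt_bound.simps)
  qed
  have mono: "sqrt_bound m \<le> sqrt_bound n" if "m \<le> n" for m n
    using that by (rule lift_Suc_mono_le[rotated]) (use sqrt_bound_props in blast)
  obtain L where L: "sqrt_bound \<longlonglongrightarrow> L" "\<And>n. sqrt_bound n \<le> L"
    using incseq_convergent[of sqrt_bound 1] mono sqrt_bound_props by (metis incseq_def)
  have Ydiff: "hnorm G (Y m g - Y n g) \<le> (sqrt_bound m - sqrt_bound n) * hnorm G g" if mn: "n \<le> m" and g: "g \<in> hset G" for m n g
    using mn
  proof (induction m rule: dec_induct)
    case (step m)
    have "hnorm G (Y (Suc m) g - Y n g) \<le> hnorm G (Y (Suc m) g - Y m g) + hnorm G (Y m g - Y n g)"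
      by (rule norm_triangle3) (use Ym g in auto)
    then show ?case using Ystep[OF g, of m] step.IH by (simp add: algebra_simps del: sqrt_bound.simps)
  qed simp
  have "(\<lambda>n. L - sqrt_bound n) \<longlonglongrightarrow> L - L" by (intro tendsto_intros L)
  then have e0: "(\<lambda>n. L - sqrt_bound n) \<longlonglongrightarrow> 0" by simp
  have Ycau: "hnorm G (Y m g - Y n g) \<le> (L - sqrt_bound N) * hnorm G g" if "m \<ge> N" "n \<ge> N" and g: "g \<in> hset G" for m n N g
  proof -
    have "hnorm G (Y i g - Y j g) \<le> (L - sqrt_bound N) * hnorm G g" if "N \<le> j" "j \<le> i" for i j
    proof -
      have "(sqrt_bound i - sqrt_bound j) * hnorm G g \<le> (L - sqrt_bound N) * hnorm G g"
        using L(2)[of i] mono[OF that(1)] g by (intro mult_right_mono) auto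
      then show ?thesis using Ydiff[OF that(2) g] by linarith
    qed
    then show ?thesis using that(1,2) norm_commute[OF Ym Ym, OF g g, of m n] by (metis nat_le_linear)
  qed
  obtain T where T: "T \<in> B" "\<And>n g. g \<in> hset G \<Longrightarrow> hnorm G (Y n g - T g) \<le> (L - sqrt_bound n) * hnorm G g"
    "\<And>g. g \<in> hset G \<Longrightarrow> hlim G (\<lambda>n. Y n g) (T g)"
  proof (rule B_limit[of Y "\<lambda>n. L - sqrt_bound n"])
    show "hnorm G (Y m g - Y n g) \<le> (L - sqrt_bound N) * hnorm G g" if "m \<ge> N" "n \<ge> N" "g \<in> hset G" for m n N g
      using that by (rule Ycau)
  qed (use YB e0 in blast)+
  have Tm: "T g \<in> hset G" if "g \<in> hset G" for g using B_mem[OF T(1) that] .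
  have Tadj: "adj G G T = T"
  proof (rule GG.adj_eqI[OF B_bop[OF T(1)] B_bop[OF T(1)]])
    fix x y assume x: "x \<in> hset G" and y: "y \<in> hset G"
    have "hip G (Y n y) x = hip G y (Y n x)" for n using GG.adj_ip[OF B_bop[OF YB] x y, of n] Yadj by simp
    then have "(\<lambda>n. hip G y (Y n x)) \<longlonglongrightarrow> hip G (T y) x" using hlim_ip_left[OF T(3)[OF y] x] by simp
    then show "hip G (T y) x = hip G y (T x)" using hlim_ip_right[OF T(3)[OF x] y] LIMSEQ_unique by blast
  qed
  have Teq: "2 *\<^sub>C T g = C g + T (T g)" if g: "g \<in> hset G" for g
  proof -
    have YY: "hlim G (\<lambda>n. Y n (Y n g)) (T (T g))"
    proof (rule hlimI)
      fix n
      have "hnorm G (Y n (Y n g) - T (T g)) \<le> hnorm G (Y n (Y n g) - Y n (T g)) + hnorm G (Y n (T g) - T (T g))"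
        by (rule norm_triangle3) (use Ym Tm g in auto)
      also have "hnorm G (Y n (Y n g) - Y n (T g)) = hnorm G (Y n (Y n g - T g))"
        using bop_diff[OF B_bop[OF YB] Ym[OF g] Tm[OF g], of n n] by simp
      also have "\<dots> \<le> sqrt_bound n * hnorm G (Y n g - T g)" by (rule Ybound) (use Ym Tm g in auto)
      also have "\<dots> \<le> 1 * hnorm G (Y n g - T g)"
        using sqrt_bound_props Ym Tm g by (intro mult_right_mono) auto
      finally show "hnorm G (Y n (Y n g) - T (T g)) \<le> (L - sqrt_bound n) * (hnorm G g + hnorm G (T g))"
        using T(2)[OF g, of n] T(2)[OF Tm[OF g], of n] by (simp add: algebra_simps)
    next
      show "(\<lambda>n. (L - sqrt_bound n) * (hnorm G g + hnorm G (T g))) \<longlonglongrightarrow> 0" by (rule tendsto_mult_left_zero[OF e0])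
    qed (use Ym Tm g in auto)
    have "hlim G (\<lambda>n. Y (Suc n) g) (T g)"
      using T(3)[OF g] LIMSEQ_Suc[of "\<lambda>n. hnorm G (Y n g - T g)" 0] unfolding hlim_def by blast
    moreover have "hlim G (\<lambda>n. Y (Suc n) g) ((1/2) *\<^sub>C (C g + T (T g)))"
      unfolding YS by (rule hlim_scale[OF hlim_add[OF hlim_const[OF Cm[OF g]] YY]])
    ultimately have "T g = (1/2) *\<^sub>C (C g + T (T g))" by (rule hlim_unique)
    then have "2 *\<^sub>C T g = 2 *\<^sub>C (1/2) *\<^sub>C (C g + T (T g))" by simp
    then show ?thesis by (simp only: scaleC_scaleC) (simp add: scaleC_one)
  qed
  define S where "S = ?I - T"
  show thesis
  proof
    show SB: "S \<in> B" unfolding S_def by (rule B_diff[OF B_id T(1)])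
    show "adj G G S = S" unfolding S_def using GG.adj_diff[OF id_on_bop B_bop[OF T(1)]] adj_id Tadj by simp
    show "S \<circ> S = A"
    proof (rule bop_eqI[OF B_bop[OF B_comp[OF SB SB]] B_bop[OF A(1)]])
      fix g assume g: "g \<in> hset G"
      have Sapp: "S h = h - T h" if "h \<in> hset G" for h using that by (simp add: S_def id_on_def)
      have "S (S g) = g - 2 *\<^sub>C T g + T (T g)"
        using g Tm bop_diff[OF B_bop[OF T(1)] g Tm[OF g]]
        by (simp add: Sapp algebra_simps) (metis add.assoc one_add_one scaleC_add_left scaleC_one)
      also have "\<dots> = A g" unfolding Teq[OF g] Capp[OF g] by simp
      finally show "(S \<circ> S) g = A g" by simp
    qed
  qed
qed

lemma square_root:
  assumes A: "A \<in> B" "adj G G A = A"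
    and p: "\<And>g. g \<in> hset G \<Longrightarrow> hip G g (A g) \<in> \<real>\<^sub>\<ge>\<^sub>0"
  obtains S where "S \<in> B" "adj G G S = S" "S \<circ> S = A"
proof -
  obtain k where k: "k \<ge> 0" "\<And>x. x \<in> hset G \<Longrightarrow> hnorm G (A x) \<le> k * hnorm G x" using bop_bound[OF B_bop[OF A(1)]] by blast
  define r where "r = k + 1"
  have r: "r > 0" using k by (simp add: r_def)
  define A' where "A' = complex_of_real (1 / r) *\<^sub>C A"
  have A'B: "A' \<in> B" unfolding A'_def by (rule B_scale[OF A(1)])
  have "adj G G A' = A'" unfolding A'_def using GG.adj_scale[OF B_bop[OF A(1)]] A(2) by simp
  moreover have ip: "hip G g (A' g) = complex_of_real (1 / r) * hip G g (A g)" if "g \<in> hset G" for g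
    using that B_mem[OF A(1)] by (simp add: A'_def scale_right)
  moreover have "hip G g (A' g) \<in> \<real>\<^sub>\<ge>\<^sub>0" if g: "g \<in> hset G" for g
    unfolding ip[OF g] using r p[OF g] by (intro nonneg_Reals_mult_I) auto
  moreover have "Re (hip G g (A' g)) \<le> (hnorm G g)\<^sup>2" if g: "g \<in> hset G" for g
  proof -
    have "Re (hip G g (A g)) \<le> hnorm G g * hnorm G (A g)"
      using cauchy_schwarz[OF g B_mem[OF A(1) g]] complex_Re_le_cmod order_trans by blast
    also have "\<dots> \<le> hnorm G g * (r * hnorm G g)"
      using k(2)[OF g] g mult_right_mono[of k r "hnorm G g"] by (intro mult_left_mono) (auto simp: r_def)
    finally have "Re (hip G g (A g)) \<le> r * (hnorm G g)\<^sup>2" by (simp add: power2_eq_square mult_ac)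
    then show ?thesis unfolding ip[OF g] using r by (simp add: divide_le_eq mult.commute flip: of_real_divide)
  qed
  ultimately obtain S where S: "S \<in> B" "adj G G S = S" "S \<circ> S = A'" using square_root_contraction[OF A'B] by blast
  show thesis
  proof
    show "complex_of_real (sqrt r) *\<^sub>C S \<in> B" by (rule B_scale[OF S(1)])
    show "adj G G (complex_of_real (sqrt r) *\<^sub>C S) = complex_of_real (sqrt r) *\<^sub>C S"
      using GG.adj_scale[OF B_bop[OF S(1)]] S(2) by simp
    show "complex_of_real (sqrt r) *\<^sub>C S \<circ> complex_of_real (sqrt r) *\<^sub>C S = A"
    proof (rule bop_eqI[OF B_bop[OF B_comp[OF B_scale[OF S(1)] B_scale[OF S(1)]]] B_bop[OF A(1)]])
      fix g assume g: "g \<in> hset G"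
      have "S (S g) = complex_of_real (1 / r) *\<^sub>C A g" using S(3) by (simp add: fun_eq_iff A'_def)
      moreover have "complex_of_real (sqrt r) * complex_of_real (sqrt r) * complex_of_real (1 / r) = 1"
        using r by (simp flip: of_real_mult)
      ultimately show "(complex_of_real (sqrt r) *\<^sub>C S \<circ> complex_of_real (sqrt r) *\<^sub>C S) g = A g"
        using bop_scale[OF B_bop[OF S(1)] B_mem[OF S(1) g]] by (simp add: scaleC_scaleC scaleC_one flip: mult.assoc)
    qed
  qed
qed

text \<open>
  This turns the boundedness of \<open>b\<close> into an equation with an element of \<open>B\<close>: an estimate by \<open>K\<close> of a quantity formed with
  \<open>b\<close> becomes the positivity of the same quantity formed with \<open>c\<close>.
\<close>

lemma complement_root:
  assumes b: "b \<in> B"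
  obtains K c where "K \<ge> 0" "c \<in> B" 
    "\<And>g h. g \<in> hset G \<Longrightarrow> h \<in> hset G \<Longrightarrow> hip G (c g) (c h) = complex_of_real (K\<^sup>2) * hip G g h - hip G (b g) (b h)"
    "adj G G c \<circ> c = complex_of_real (K\<^sup>2) *\<^sub>C id_on (hset G) - (adj G G b \<circ> b)"
proof -
  obtain k where k: "k \<ge> 0" "\<And>x. x \<in> hset G \<Longrightarrow> hnorm G (b x) \<le> k * hnorm G x" using bop_bound[OF B_bop[OF b]] by blast
  let ?A = "complex_of_real (k\<^sup>2) *\<^sub>C id_on (hset G) - (adj G G b \<circ> b)"
  have bb: "adj G G b \<circ> b \<in> B" by (rule B_comp[OF B_adj[OF b] b])
  have AB: "?A \<in> B" by (intro B_diff B_scale B_id bb)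
  have "adj G G (adj G G b \<circ> b) = adj G G b \<circ> b"
    using adj_comp[OF hilb_axioms hilb_axioms hilb_axioms B_bop[OF b] B_bop[OF B_adj[OF b]]] GG.adj_adj[OF B_bop[OF b]] by simp
  then have "adj G G ?A = ?A"
    using GG.adj_diff[OF B_bop[OF B_scale[OF B_id]] B_bop[OF bb]] GG.adj_scale[OF id_on_bop] adj_id by simp
  moreover have ip: "hip G g (?A h) = complex_of_real (k\<^sup>2) * hip G g h - hip G (b g) (b h)" if g: "g \<in> hset G" "h \<in> hset G" for g h
    using that GG.adj_ip'[OF B_bop[OF b] g(1) B_mem[OF b g(2)]] B_mem[OF b] B_mem[OF bb] B_mem[OF B_adj[OF b]]
    by (simp add: id_on_def diff_right scale_right)
  moreover have "hip G g (?A g) \<in> \<real>\<^sub>\<ge>\<^sub>0" if g: "g \<in> hset G" for g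
  proof -
    have "(hnorm G (b g))\<^sup>2 \<le> (k * hnorm G g)\<^sup>2" using k(2)[OF g] B_mem[OF b g] by (intro power_mono) auto
    then show ?thesis unfolding ip[OF g g] self_eq[OF g] self_eq[OF B_mem[OF b g]]
      by (simp add: power_mult_distrib complex_nonneg_Reals_iff flip: of_real_mult of_real_diff of_real_power)
  qed
  ultimately obtain S where S: "S \<in> B" "adj G G S = S" "S \<circ> S = ?A" using square_root[OF AB] by blast
  show thesis
  proof
    show "k \<ge> 0" by fact
    show "S \<in> B" by fact
    fix g h assume g: "g \<in> hset G" "h \<in> hset G"
    have "hip G (S g) (S h) = hip G g ((S \<circ> S) h)"
      using GG.adj_ip[OF B_bop[OF S(1)] B_mem[OF S(1) g(2)] g(1)] S(2) by simp
    then show "hip G (S g) (S h) = complex_of_real (k\<^sup>2) * hip G g h - hip G (b g) (b h)" using S(3) ip[OF g] by simp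
  next
    show "adj G G S \<circ> S = ?A" using S by simp
  qed
qed

section \<open>Positivity of module kernels\<close>

text \<open>
  The kernel is assumed to be positive only on the diagonal, one module element and one vector at a time.  In the
  induction, the vectors are split along the cyclic subspace \<open>C\<close> of one of them, \<open>g\<^sub>a\<close>, which is invariant under \<open>B\<close>, so
  that mixed terms vanish.  The components orthogonal to \<open>C\<close> form a smaller family, because that of \<open>g\<^sub>a\<close> is zero.  The components
  in \<open>C\<close> are approximated by \<open>b\<^sub>i g\<^sub>a\<close>, and for these the double sum is the diagonal value at \<open>\<Sum>i. x\<^sub>i b\<^sub>i\<close> and \<open>g\<^sub>a\<close>.
\<close>

lemma kernel_positive:
  fixes F :: "'e::complex_vector \<Rightarrow> 'e \<Rightarrow> 'g \<Rightarrow> 'g"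
  assumes E: "complex_vector.subspace E" and rE: "\<And>x b. x \<in> E \<Longrightarrow> b \<in> B \<Longrightarrow> r x b \<in> E"
    and FB: "\<And>x y. x \<in> E \<Longrightarrow> y \<in> E \<Longrightarrow> F x y \<in> B"
    and Fadd: "\<And>x y z. x \<in> E \<Longrightarrow> y \<in> E \<Longrightarrow> z \<in> E \<Longrightarrow> F x (y + z) = F x y + F x z"
      "\<And>x y z. x \<in> E \<Longrightarrow> y \<in> E \<Longrightarrow> z \<in> E \<Longrightarrow> F (x + y) z = F x z + F y z"
    and Fr: "\<And>x y a b. x \<in> E \<Longrightarrow> y \<in> E \<Longrightarrow> a \<in> B \<Longrightarrow> b \<in> B \<Longrightarrow> F (r x a) (r y b) = adj G G a \<circ> F x y \<circ> b"
    and Fpos: "\<And>x g. x \<in> E \<Longrightarrow> g \<in> hset G \<Longrightarrow> hip G g (F x x g) \<in> \<real>\<^sub>\<ge>\<^sub>0"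
    and I: "finite I" and x: "\<And>i. i \<in> I \<Longrightarrow> x i \<in> E" and g: "\<And>i. i \<in> I \<Longrightarrow> g i \<in> hset G"
  shows "(\<Sum>i\<in>I. \<Sum>j\<in>I. hip G (g i) (F (x i) (x j) (g j))) \<in> \<real>\<^sub>\<ge>\<^sub>0"
  using I x g
proof (induction I arbitrary: g rule: finite_induct)
  case (insert a I)
  let ?J = "insert a I"
  note x = insert.prems(1) and g = insert.prems(2)
  have ga: "g a \<in> hset G" using g by simp
  define D where "D = (\<lambda>b. b (g a)) ` B"
  have D: "complex_vector.subspace D" unfolding D_def by (rule linear_image_subspace[OF B_subspace]) auto
  have DG: "D \<subseteq> hset G" unfolding D_def using B_mem ga by auto
  let ?C = "hcl G D"
  have C: "closed_subspace ?C" by (rule closed_subspace_hcl[OF D DG])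
  have inv: "b z \<in> ?C" if b: "b \<in> B" and z: "z \<in> ?C" for b z
  proof (rule bop_hcl_inv[OF B_bop[OF b] _ z])
    fix w assume "w \<in> D"
    then obtain a' where "a' \<in> B" "w = a' (g a)" unfolding D_def by blast
    then show "b w \<in> D" unfolding D_def using B_comp[OF b] by (intro image_eqI[of _ _ "b \<circ> a'"]) auto
  qed
  define p where "p i = proj ?C (g i)" for i
  define z where "z i = g i - p i" for i
  have pm: "p i \<in> hset G" "p i \<in> ?C" if "i \<in> ?J" for i unfolding p_def using proj_in[OF C g[OF that]] proj_mem[OF C g[OF that]] by auto
  have zm: "z i \<in> hset G" if "i \<in> ?J" for i unfolding z_def using g[OF that] pm(1)[OF that] by simp
  have perp: "hip G c (z i) = 0" if "c \<in> ?C" "i \<in> ?J" for c i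
    unfolding z_def p_def by (rule proj_perp[OF C g[OF that(2)] that(1)])
  have FBJ: "F (x i) (x j) \<in> B" if "i \<in> ?J" "j \<in> ?J" for i j using FB x that by blast
  have cross1: "hip G (z i) (F (x i) (x j) (p j)) = 0" if "i \<in> ?J" "j \<in> ?J" for i j
    using perp[OF inv[OF FBJ[OF that] pm(2)[OF that(2)]] that(1)] 
      herm[OF B_mem[OF FBJ[OF that] pm(1)[OF that(2)]] zm[OF that(1)]] by simp
  have cross2: "hip G (p i) (F (x i) (x j) (z j)) = 0" if "i \<in> ?J" "j \<in> ?J" for i j
    using GG.adj_ip[OF B_bop[OF FBJ[OF that]] zm[OF that(2)] pm(1)[OF that(1)]]
      perp[OF inv[OF B_adj[OF FBJ[OF that]] pm(2)[OF that(1)]] that(2)] by simp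
  have split: "hip G (g i) (F (x i) (x j) (g j)) =
      hip G (p i) (F (x i) (x j) (p j)) + hip G (z i) (F (x i) (x j) (z j))" if "i \<in> ?J" "j \<in> ?J" for i j
  proof -
    note m = pm(1)[OF that(1)] pm(1)[OF that(2)] zm[OF that(1)] zm[OF that(2)]
    note fm = B_mem[OF FBJ[OF that] m(2)] B_mem[OF FBJ[OF that] m(4)]
    have "g i = p i + z i" "g j = p j + z j" by (simp_all add: z_def)
    then have "hip G (g i) (F (x i) (x j) (g j)) = hip G (p i + z i) (F (x i) (x j) (p j) + F (x i) (x j) (z j))"
      using bop_add[OF B_bop[OF FBJ[OF that]] m(2) m(4)] by simp
    then show ?thesis using m fm cross1[OF that] cross2[OF that] by (simp add: bilin)
  qed
  have "g a \<in> ?C"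
    by (rule hcl_self[OF DG]) (use B_id ga in \<open>auto simp: D_def id_on_def intro!: image_eqI[of _ _ "id_on (hset G)"]\<close>)
  then have za: "z a = 0" unfolding z_def p_def using proj_id[OF C] by simp
  have "(\<Sum>i\<in>?J. \<Sum>j\<in>?J. hip G (z i) (F (x i) (x j) (z j))) = (\<Sum>i\<in>I. \<Sum>j\<in>I. hip G (z i) (F (x i) (x j) (z j)))"
  proof -
    have "F (x i) (x a) (z a) = 0" if "i \<in> ?J" for i using bop_zero[OF B_bop[OF FBJ[OF that]]] za by simp
    moreover have "hip G (z a) (F (x a) (x j) (z j)) = 0" if "j \<in> ?J" for j
      unfolding za using zero_left[OF B_mem[OF FBJ zm]] that by simp
    ultimately show ?thesis using insert.hyps zm by simp
  qed
  also have "\<dots> \<in> \<real>\<^sub>\<ge>\<^sub>0" by (rule insert.IH) (use x zm in auto)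
  finally have zpos: "(\<Sum>i\<in>?J. \<Sum>j\<in>?J. hip G (z i) (F (x i) (x j) (z j))) \<in> \<real>\<^sub>\<ge>\<^sub>0" .
  have "\<exists>b. (\<forall>n. b n \<in> B) \<and> hlim G (\<lambda>n. b n (g a)) (p i)" if i: "i \<in> ?J" for i
  proof -
    obtain s where s: "\<And>n. s n \<in> D" "hlim G s (p i)" using pm(2)[OF i] unfolding hcl_def by blast
    then have "\<forall>n. \<exists>b\<in>B. s n = b (g a)" unfolding D_def by blast
    then obtain b where b: "\<And>n. b n \<in> B" "\<And>n. s n = b n (g a)" by metis
    then show ?thesis using s(2) by (intro exI[of _ b]) (simp flip: b(2))
  qed
  then obtain b where b: "\<And>i n. i \<in> ?J \<Longrightarrow> b i n \<in> B" "\<And>i. i \<in> ?J \<Longrightarrow> hlim G (\<lambda>n. b i n (g a)) (p i)" by metis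
  have F0: "F 0 y = 0" "F y 0 = 0" if "y \<in> E" for y
    using Fadd(2)[of 0 0 y] Fadd(1)[of y 0 0] that complex_vector.subspace_0[OF E] by auto
  have Fsum: "F (sum u ?J) (sum v ?J) = (\<Sum>i\<in>?J. \<Sum>j\<in>?J. F (u i) (v j))" if "\<And>i. i \<in> ?J \<Longrightarrow> u i \<in> E" "\<And>i. i \<in> ?J \<Longrightarrow> v i \<in> E" for u v
  proof -
    have r: "F y (sum v K) = (\<Sum>j\<in>K. F y (v j))" if "finite K" "y \<in> E" "\<And>i. i \<in> K \<Longrightarrow> v i \<in> E" for K y
      using that by (induction K rule: finite_induct) (auto simp: F0 Fadd complex_vector.subspace_sum[OF E])
    have l: "F (sum u K) y = (\<Sum>j\<in>K. F (u j) y)" if "finite K" "y \<in> E" "\<And>i. i \<in> K \<Longrightarrow> u i \<in> E" for K y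
      using that by (induction K rule: finite_induct) (auto simp: F0 Fadd complex_vector.subspace_sum[OF E])
    have fin: "finite ?J" using insert.hyps by simp
    have "F (sum u ?J) (sum v ?J) = (\<Sum>i\<in>?J. F (u i) (sum v ?J))"
      by (rule l[OF fin complex_vector.subspace_sum[OF E]]) (use that in auto)
    also have "\<dots> = (\<Sum>i\<in>?J. \<Sum>j\<in>?J. F (u i) (v j))" by (intro sum.cong refl r[OF fin]) (use that in auto)
    finally show ?thesis .
  qed
  have approx: "(\<Sum>i\<in>?J. \<Sum>j\<in>?J. hip G (b i n (g a)) (F (x i) (x j) (b j n (g a)))) \<in> \<real>\<^sub>\<ge>\<^sub>0" for n
  proof -
    let ?X = "\<Sum>i\<in>?J. r (x i) (b i n)"
    have m: "r (x i) (b i n) \<in> E" if "i \<in> ?J" for i using rE[OF x[OF that] b(1)[OF that]] .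
    have X: "?X \<in> E" by (rule complex_vector.subspace_sum[OF E m])
    have "hip G (g a) (F ?X ?X (g a)) = hip G (g a) (\<Sum>i\<in>?J. \<Sum>j\<in>?J. F (r (x i) (b i n)) (r (x j) (b j n)) (g a))"
      by (simp only: Fsum[OF m m] sum_fun_apply)
    also have "\<dots> = (\<Sum>i\<in>?J. \<Sum>j\<in>?J. hip G (g a) (F (r (x i) (b i n)) (r (x j) (b j n)) (g a)))"
      by (subst sum_right[OF ga], (rule sum_mem B_mem FB m ga | assumption)+, intro sum.cong refl sum_right[OF ga])
        (rule B_mem FB m ga | assumption)+
    also have "\<dots> = (\<Sum>i\<in>?J. \<Sum>j\<in>?J. hip G (b i n (g a)) (F (x i) (x j) (b j n (g a))))"
    proof (intro sum.cong refl)
      fix i j assume ij: "i \<in> ?J" "j \<in> ?J"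
      show "hip G (g a) (F (r (x i) (b i n)) (r (x j) (b j n)) (g a)) = hip G (b i n (g a)) (F (x i) (x j) (b j n (g a)))"
        using Fr[OF x[OF ij(1)] x[OF ij(2)] b(1)[OF ij(1)] b(1)[OF ij(2)], of n n]
          GG.adj_ip'[OF B_bop[OF b(1)[OF ij(1)]] ga B_mem[OF FBJ[OF ij] B_mem[OF b(1)[OF ij(2)] ga]], of n n] by simp
    qed
    finally show ?thesis using Fpos[OF X ga] by simp
  qed
  have "(\<lambda>n. \<Sum>i\<in>?J. \<Sum>j\<in>?J. hip G (b i n (g a)) (F (x i) (x j) (b j n (g a))))
      \<longlonglongrightarrow> (\<Sum>i\<in>?J. \<Sum>j\<in>?J. hip G (p i) (F (x i) (x j) (p j)))"
    by (intro tendsto_sum hlim_ip b(2) GG.bop_hlim[OF B_bop[OF FBJ]]) 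
  then have "(\<Sum>i\<in>?J. \<Sum>j\<in>?J. hip G (p i) (F (x i) (x j) (p j))) \<in> \<real>\<^sub>\<ge>\<^sub>0"
    by (rule closed_sequentially[OF closed_nonneg_Reals_complex approx])
  moreover have "(\<Sum>i\<in>?J. \<Sum>j\<in>?J. hip G (g i) (F (x i) (x j) (g j))) =
     (\<Sum>i\<in>?J. \<Sum>j\<in>?J. hip G (p i) (F (x i) (x j) (p j))) + (\<Sum>i\<in>?J. \<Sum>j\<in>?J. hip G (z i) (F (x i) (x j) (z j)))"
    unfolding sum.distrib[symmetric] by (intro sum.cong refl split)
  ultimately show ?case using nonneg_Reals_add_I[OF _ zpos] by simp
qed simp

end

section \<open>Operator norms\<close>

context hilb2
begin

lemma opnorm_bdd: assumes T: "T \<in> bop G H" shows "bdd_above {hnorm H (T x) |x. x \<in> hset G \<and> hnorm G x \<le> 1}"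
proof -
  obtain k where k: "k \<ge> 0" "\<And>x. x \<in> hset G \<Longrightarrow> hnorm H (T x) \<le> k * hnorm G x" using G.bop_bound[OF T] by blast
  have "hnorm H (T x) \<le> k" if "x \<in> hset G" "hnorm G x \<le> 1" for x
    using k(2)[OF that(1)] mult_left_mono[OF that(2) k(1)] by simp
  then show ?thesis by (intro bdd_aboveI[of _ k]) auto
qed

lemma opnorm_nonneg: assumes T: "T \<in> bop G H" shows "0 \<le> opnorm G H T"
  unfolding opnorm_def
  by (rule cSup_upper2[OF _ _ opnorm_bdd[OF T], of "hnorm H (T 0)"])
    (auto intro!: exI[of _ 0] simp: bop_zero[OF T])

lemma opnorm_bound: assumes T: "T \<in> bop G H" and x: "x \<in> hset G" shows "hnorm H (T x) \<le> opnorm G H T * hnorm G x"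
proof (cases "hnorm G x = 0")
  case True
  then show ?thesis using G.norm_eq_zero[OF x] by (simp add: bop_zero[OF T])
next
  case False
  then have p: "hnorm G x > 0" using G.norm_nonneg[OF x] by linarith
  let ?y = "complex_of_real (1 / hnorm G x) *\<^sub>C x"
  have "hnorm G ?y = 1" using p x by (simp add: G.norm_scale norm_divide)
  then have "hnorm H (T ?y) \<le> opnorm G H T" unfolding opnorm_def
    by (intro cSup_upper[OF _ opnorm_bdd[OF T]]) (use x in auto)
  moreover have "hnorm H (T ?y) = hnorm H (T x) / hnorm G x"
    using p x bop_mem[OF T x] by (simp add: bop_scale[OF T x] H.norm_scale norm_divide)
  ultimately show ?thesis using p by (simp add: divide_le_eq)
qed

lemma opnorm_le:
  assumes "\<And>x. x \<in> hset G \<Longrightarrow> hnorm H (T x) \<le> C * hnorm G x" and C: "0 \<le> C"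
  shows "opnorm G H T \<le> C"
  unfolding opnorm_def
proof (rule cSup_least)
  show "{hnorm H (T x) |x. x \<in> hset G \<and> hnorm G x \<le> 1} \<noteq> {}" by (auto intro!: exI[of _ 0])
  fix r assume "r \<in> {hnorm H (T x) |x. x \<in> hset G \<and> hnorm G x \<le> 1}"
  then obtain x where x: "r = hnorm H (T x)" "x \<in> hset G" "hnorm G x \<le> 1" by blast
  then show "r \<le> C" using assms(1)[OF x(2)] mult_left_mono[OF x(3) C] by simp
qed

end

section \<open>Interior tensor products\<close>

locale hmod = vna G B for G :: "'g::complex_vector hilbert" and B +
  fixes E :: "('e::complex_vector, 'g, 'z) hmodule_scheme"
  assumes hilbert_module: "hilbert_module G B E"
begin

lemmas hm = hilbert_module[unfolded hilbert_module_def]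

lemma E_subspace: "complex_vector.subspace (mset E)" using hm by (rule conjunct1)
lemma E_zero [simp]: "0 \<in> mset E" by (rule complex_vector.subspace_0[OF E_subspace])
lemma E_add [simp]: "x \<in> mset E \<Longrightarrow> y \<in> mset E \<Longrightarrow> x + y \<in> mset E" by (rule complex_vector.subspace_add[OF E_subspace])
lemma E_diff [simp]: "x \<in> mset E \<Longrightarrow> y \<in> mset E \<Longrightarrow> x - y \<in> mset E" by (rule complex_vector.subspace_diff[OF E_subspace])
lemma E_scale [simp]: "x \<in> mset E \<Longrightarrow> c *\<^sub>C x \<in> mset E" by (rule complex_vector.subspace_scale[OF E_subspace])

lemma ract_mem: "x \<in> mset E \<Longrightarrow> b \<in> B \<Longrightarrow> ract E x b \<in> mset E"
  by (rule hm[THEN conjunct2, THEN conjunct1, rule_format])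
lemma mip_B: "x \<in> mset E \<Longrightarrow> y \<in> mset E \<Longrightarrow> mip E x y \<in> B"
  by (rule hm[THEN conjunct2, THEN conjunct2, THEN conjunct2, THEN conjunct2, THEN conjunct2, THEN conjunct2, THEN conjunct1, rule_format])
lemma mip_add: "x \<in> mset E \<Longrightarrow> y \<in> mset E \<Longrightarrow> z \<in> mset E \<Longrightarrow> mip E x (y + z) = mip E x y + mip E x z"
  by (rule hm[THEN conjunct2, THEN conjunct2, THEN conjunct2, THEN conjunct2, THEN conjunct2, THEN conjunct2, THEN conjunct2, THEN conjunct1, rule_format])
lemma mip_scale: "x \<in> mset E \<Longrightarrow> y \<in> mset E \<Longrightarrow> mip E x (c *\<^sub>C y) = c *\<^sub>C mip E x y"
  by (rule hm[THEN conjunct2, THEN conjunct2, THEN conjunct2, THEN conjunct2, THEN conjunct2, THEN conjunct2, THEN conjunct2, THEN conjunct2, THEN conjunct1, rule_format])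
lemma mip_ract: "x \<in> mset E \<Longrightarrow> y \<in> mset E \<Longrightarrow> b \<in> B \<Longrightarrow> mip E x (ract E y b) = mip E x y \<circ> b"
  by (rule hm[THEN conjunct2, THEN conjunct2, THEN conjunct2, THEN conjunct2, THEN conjunct2, THEN conjunct2, THEN conjunct2, THEN conjunct2, THEN conjunct2, THEN conjunct1, rule_format])
lemma mip_adj: "x \<in> mset E \<Longrightarrow> y \<in> mset E \<Longrightarrow> adj G G (mip E x y) = mip E y x"
  by (rule hm[THEN conjunct2, THEN conjunct2, THEN conjunct2, THEN conjunct2, THEN conjunct2, THEN conjunct2, THEN conjunct2, THEN conjunct2, THEN conjunct2, THEN conjunct2, THEN conjunct1, rule_format, symmetric])
lemma mip_pos: "x \<in> mset E \<Longrightarrow> g \<in> hset G \<Longrightarrow> hip G g (mip E x x g) \<in> \<real>\<^sub>\<ge>\<^sub>0"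
  by (rule hm[THEN conjunct2, THEN conjunct2, THEN conjunct2, THEN conjunct2, THEN conjunct2, THEN conjunct2, THEN conjunct2, THEN conjunct2, THEN conjunct2, THEN conjunct2, THEN conjunct2, THEN conjunct1, rule_format])
lemma mip_definite: "x \<in> mset E \<Longrightarrow> mip E x x = 0 \<Longrightarrow> x = 0"
  by (rule hm[THEN conjunct2, THEN conjunct2, THEN conjunct2, THEN conjunct2, THEN conjunct2, THEN conjunct2, THEN conjunct2, THEN conjunct2, THEN conjunct2, THEN conjunct2, THEN conjunct2, THEN conjunct2, THEN conjunct1, rule_format])

lemma mip_bop: "x \<in> mset E \<Longrightarrow> y \<in> mset E \<Longrightarrow> mip E x y \<in> bop G G"
  using B_bop[OF mip_B] .
lemma mip_mem: "x \<in> mset E \<Longrightarrow> y \<in> mset E \<Longrightarrow> g \<in> hset G \<Longrightarrow> mip E x y g \<in> hset G"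
  using B_mem[OF mip_B] .
lemma mip_add_left: "x \<in> mset E \<Longrightarrow> y \<in> mset E \<Longrightarrow> z \<in> mset E \<Longrightarrow> mip E (x + y) z = mip E x z + mip E y z"
  using mip_adj[of z "x + y"] GG.adj_add[OF mip_bop mip_bop, of z x z y] by (simp add: mip_add mip_adj)
lemma mip_diff: "x \<in> mset E \<Longrightarrow> y \<in> mset E \<Longrightarrow> z \<in> mset E \<Longrightarrow> mip E x (y - z) = mip E x y - mip E x z"
  using mip_add[of x "y - z" z] by simp
lemma mip_ract_left: 
  assumes "x \<in> mset E" "y \<in> mset E" "b \<in> B" shows "mip E (ract E x b) y = adj G G b \<circ> mip E x y"
proof -
  have "mip E (ract E x b) y = adj G G (mip E y x \<circ> b)"
    using mip_adj[OF assms(2) ract_mem[OF assms(1,3)]] mip_ract[OF assms(2,1,3)] by simp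
  also have "\<dots> = adj G G b \<circ> adj G G (mip E y x)"
    by (rule adj_comp[OF hilb_axioms hilb_axioms hilb_axioms B_bop[OF assms(3)] mip_bop[OF assms(2,1)]])
  finally show ?thesis using mip_adj assms by simp
qed
lemma mip_adj_ip: "x \<in> mset E \<Longrightarrow> y \<in> mset E \<Longrightarrow> g \<in> hset G \<Longrightarrow> h \<in> hset G \<Longrightarrow> hip G (mip E x y g) h = hip G g (mip E y x h)"
  using GG.adj_ip[OF mip_bop[of y x], of h g] by (simp add: mip_adj)

lemma mip_eqI: 
  assumes "u \<in> mset E" "v \<in> mset E" "\<And>y. y \<in> mset E \<Longrightarrow> mip E y u = mip E y v" shows "u = v"
  using mip_definite[of "u - v"] mip_diff[of "u - v" u v] assms by simp

lemma mip_positive: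
  assumes "finite I" "\<And>i. i \<in> I \<Longrightarrow> x i \<in> mset E" "\<And>i. i \<in> I \<Longrightarrow> g i \<in> hset G"
  shows "(\<Sum>i\<in>I. \<Sum>j\<in>I. hip G (g i) (mip E (x i) (x j) (g j))) \<in> \<real>\<^sub>\<ge>\<^sub>0"
proof (rule kernel_positive[where r = "ract E", OF E_subspace _ _ _ _ _ _ assms])
  fix x y a b assume "x \<in> mset E" "y \<in> mset E" "a \<in> B" "b \<in> B"
  then show "mip E (ract E x a) (ract E y b) = adj G G a \<circ> mip E x y \<circ> b"
    by (simp add: mip_ract mip_ract_left ract_mem comp_assoc)
qed (auto simp: ract_mem mip_B mip_add mip_add_left mip_pos)

lemma tensor_exists: "\<exists>(H :: ('e \<times> 'g \<Rightarrow> complex) hilbert) t. is_interior_tensor G E H t"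
proof -
  let ?P = "mset E \<times> hset G" and ?K = "\<lambda>p r. hip G (snd p) (mip E (fst p) (fst r) (snd r))"
  interpret k: psd_kernel ?P ?K
  proof
    fix p r assume pr: "p \<in> ?P" "r \<in> ?P"
    then have m: "fst p \<in> mset E" "fst r \<in> mset E" "snd p \<in> hset G" "snd r \<in> hset G" by auto
    show "?K r p = cnj (?K p r)"
      using mip_adj_ip[OF m(1,2) m(4,3)] herm[OF m(3) mip_mem[OF m(1,2,4)]] by simp
  next
    fix I and c :: "_ \<Rightarrow> complex" assume I: "finite I" "I \<subseteq> ?P"
    have "(\<Sum>p\<in>I. \<Sum>r\<in>I. cnj (c p) * c r * ?K p r)
       = (\<Sum>p\<in>I. \<Sum>r\<in>I. hip G (c p *\<^sub>C snd p) (mip E (fst p) (fst r) (c r *\<^sub>C snd r)))"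
    proof (intro sum.cong refl)
      fix p r assume "p \<in> I" "r \<in> I"
      then have m: "fst p \<in> mset E" "fst r \<in> mset E" "snd p \<in> hset G" "snd r \<in> hset G" using I by auto
      show "cnj (c p) * c r * ?K p r = hip G (c p *\<^sub>C snd p) (mip E (fst p) (fst r) (c r *\<^sub>C snd r))"
        using m mip_mem[OF m(1,2,4)] by (simp add: bop_scale[OF mip_bop[OF m(1,2)] m(4)] bilin)
    qed
    also have "\<dots> \<in> \<real>\<^sub>\<ge>\<^sub>0" by (rule mip_positive) (use I in auto)
    finally show "(\<Sum>p\<in>I. \<Sum>r\<in>I. cnj (c p) * c r * ?K p r) \<in> \<real>\<^sub>\<ge>\<^sub>0" .
  qed
  obtain H :: "('e \<times> 'g \<Rightarrow> complex) hilbert" and k where H: "is_hilbert H" "\<forall>p\<in>?P. k p \<in> hset H"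
    "\<forall>p\<in>?P. \<forall>r\<in>?P. hip H (k p) (k r) = ?K p r" "hcl H (complex_vector.span (k ` ?P)) = hset H"
    using k.kernel_space_exists by blast
  interpret H: hilb H by standard (rule H(1))
  have e: "{k (x, g) |x g. x \<in> mset E \<and> g \<in> hset G} = k ` ?P" by auto
  have sub: "k ` ?P \<subseteq> hset H" using H(2) by blast
  have "is_interior_tensor G E H (\<lambda>x g. k (x, g))" unfolding is_interior_tensor_def
  proof (intro conjI ballI)
    show "htop H closure_of complex_vector.span {k (x, g) |x g. x \<in> mset E \<and> g \<in> hset G} = hset H"
      unfolding e by (simp add: H.closure_eq_hcl[OF H.span_mem[OF sub]] H(4))
  qed (use H in auto)
  then show ?thesis by blast
qed

abbreviation "HH \<equiv> tspace G E"
abbreviation "tn \<equiv> tens G E"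
abbreviation "elem \<equiv> {tn x g |x g. x \<in> mset E \<and> g \<in> hset G}"

lemma interior_tensor: "is_interior_tensor G E HH tn"
proof -
  have "\<exists>p. case p of (H, t) \<Rightarrow> is_interior_tensor G E (H :: ('e \<times> 'g \<Rightarrow> complex) hilbert) t"
    using tensor_exists by auto
  then have "case interior_tensor G E of (H, t) \<Rightarrow> is_interior_tensor G E H t"
    unfolding interior_tensor_def by (rule someI_ex)
  then show ?thesis by (simp add: tspace_def tens_def case_prod_unfold)
qed

end

sublocale hmod \<subseteq> H: hilb "tspace G E"
  using interior_tensor by unfold_locales (simp add: is_interior_tensor_def)
sublocale hmod \<subseteq> GH: hilb2 G "tspace G E" ..
sublocale hmod \<subseteq> HH: hilb2 "tspace G E" "tspace G E" ..

context hmod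
begin

lemma tens_mem: "x \<in> mset E \<Longrightarrow> g \<in> hset G \<Longrightarrow> tn x g \<in> hset HH"
  using interior_tensor unfolding is_interior_tensor_def by blast
lemma tens_ip: "x \<in> mset E \<Longrightarrow> y \<in> mset E \<Longrightarrow> g \<in> hset G \<Longrightarrow> h \<in> hset G \<Longrightarrow> hip HH (tn x g) (tn y h) = hip G g (mip E x y h)"
  using interior_tensor unfolding is_interior_tensor_def by blast
lemma elem_mem: "elem \<subseteq> hset HH" using tens_mem by auto
lemma tens_total: "hcl HH (complex_vector.span elem) = hset HH"
  using interior_tensor H.closure_eq_hcl[OF H.span_mem[OF elem_mem]] unfolding is_interior_tensor_def by simp

lemma tens_eqI:
  assumes u: "u \<in> hset HH" and v: "v \<in> hset HH"
    and e: "\<And>y h. y \<in> mset E \<Longrightarrow> h \<in> hset G \<Longrightarrow> hip HH (tn y h) u = hip HH (tn y h) v"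
  shows "u = v"
proof -
  have "u - v = 0"
  proof (rule H.total_perp_zero[OF elem_mem tens_total])
    show "u - v \<in> hset HH" using u v by simp
    fix w assume "w \<in> elem"
    then obtain y h where "w = tn y h" "y \<in> mset E" "h \<in> hset G" by blast
    then show "hip HH w (u - v) = 0" using e u v tens_mem by (simp add: H.diff_right)
  qed
  then show ?thesis by simp
qed

lemma tens_add_right: "x \<in> mset E \<Longrightarrow> g \<in> hset G \<Longrightarrow> h \<in> hset G \<Longrightarrow> tn x (g + h) = tn x g + tn x h"
  by (rule tens_eqI) (auto simp: tens_mem tens_ip H.add_right bop_add[OF mip_bop] mip_mem add_right)
lemma tens_scale_right: "x \<in> mset E \<Longrightarrow> g \<in> hset G \<Longrightarrow> tn x (c *\<^sub>C g) = c *\<^sub>C tn x g"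
  by (rule tens_eqI) (auto simp: tens_mem tens_ip H.scale_right bop_scale[OF mip_bop] mip_mem scale_right)
lemma tens_add_left: "x \<in> mset E \<Longrightarrow> y \<in> mset E \<Longrightarrow> g \<in> hset G \<Longrightarrow> tn (x + y) g = tn x g + tn y g"
  by (rule tens_eqI) (auto simp: tens_mem tens_ip H.add_right mip_add mip_mem add_right)
lemma tens_scale_left: "x \<in> mset E \<Longrightarrow> g \<in> hset G \<Longrightarrow> tn (c *\<^sub>C x) g = c *\<^sub>C tn x g"
  by (rule tens_eqI) (auto simp: tens_mem tens_ip H.scale_right mip_scale mip_mem scale_right)
lemma tens_ract: "x \<in> mset E \<Longrightarrow> b \<in> B \<Longrightarrow> g \<in> hset G \<Longrightarrow> tn (ract E x b) g = tn x (b g)"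
  by (rule tens_eqI) (auto simp: tens_mem tens_ip ract_mem B_mem mip_ract)

lemma tens_sum_norm:
  assumes "\<And>i. i \<in> I \<Longrightarrow> x i \<in> mset E" "\<And>i. i \<in> I \<Longrightarrow> g i \<in> hset G"
  shows "(hnorm HH (\<Sum>i\<in>I. tn (x i) (g i)))\<^sup>2 = Re (\<Sum>i\<in>I. \<Sum>j\<in>I. hip G (g i) (mip E (x i) (x j) (g j)))"
proof -
  have m: "tn (x i) (g i) \<in> hset HH" if "i \<in> I" for i using assms tens_mem that by blast
  have "(hnorm HH (\<Sum>i\<in>I. tn (x i) (g i)))\<^sup>2 = Re (hip HH (\<Sum>i\<in>I. tn (x i) (g i)) (\<Sum>i\<in>I. tn (x i) (g i)))"
    by (rule H.norm_sq[OF H.sum_mem]) (rule m)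
  also have "hip HH (\<Sum>i\<in>I. tn (x i) (g i)) (\<Sum>i\<in>I. tn (x i) (g i)) = (\<Sum>i\<in>I. \<Sum>j\<in>I. hip HH (tn (x i) (g i)) (tn (x j) (g j)))"
    by (subst H.sum_left[OF H.sum_mem[OF m] m]; (assumption)?) (intro sum.cong refl H.sum_right m)
  also have "\<dots> = (\<Sum>i\<in>I. \<Sum>j\<in>I. hip G (g i) (mip E (x i) (x j) (g j)))"
    by (intro sum.cong refl tens_ip assms)
  finally show ?thesis .
qed

lemma tens_norm: "x \<in> mset E \<Longrightarrow> g \<in> hset G \<Longrightarrow> (hnorm HH (tn x g))\<^sup>2 = Re (hip G g (mip E x x g))"
  by (simp add: H.norm_sq tens_mem tens_ip)

lemma tensor_extension:
  assumes "hilb K" and f: "\<And>x g. x \<in> mset E \<Longrightarrow> g \<in> hset G \<Longrightarrow> f x g \<in> hset K"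
    "\<And>x g c. x \<in> mset E \<Longrightarrow> g \<in> hset G \<Longrightarrow> f x (c *\<^sub>C g) = c *\<^sub>C f x g"
    and k: "k \<ge> 0" and bound: "\<And>(I :: ('e \<times> 'g) set) x g. finite I \<Longrightarrow> (\<And>i. i \<in> I \<Longrightarrow> x i \<in> mset E) \<Longrightarrow> (\<And>i. i \<in> I \<Longrightarrow> g i \<in> hset G) \<Longrightarrow>
       hnorm K (\<Sum>i\<in>I. f (x i) (g i)) \<le> k * hnorm HH (\<Sum>i\<in>I. tn (x i) (g i))"
  obtains T where "T \<in> bop HH K" "\<And>x g. x \<in> mset E \<Longrightarrow> g \<in> hset G \<Longrightarrow> T (tn x g) = f x g"
    "\<And>u. u \<in> hset HH \<Longrightarrow> hnorm K (T u) \<le> k * hnorm HH u"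
proof -
  interpret K: hilb K by fact
  interpret HK: hilb2 HH K ..
  let ?P = "mset E \<times> hset G"
  let ?A = "lincomb (\<lambda>p. tn (fst p) (snd p))" and ?F = "lincomb (\<lambda>p. f (fst p) (snd p))"
  have lm: "c *\<^sub>C tn (fst p) (snd p) \<in> hset HH" "c *\<^sub>C f (fst p) (snd p) \<in> hset K" if "p \<in> ?P" for c p
    using that tens_mem f by auto
  have A: "?A c \<in> hset HH" "?F c \<in> hset K" if "c \<in> fsupp ?P" for c
    unfolding lincomb_def
    by (rule H.sum_mem, rule lm(1), use that in \<open>auto simp: fsupp_def\<close>)
      (rule K.sum_mem, rule lm(2), use that in \<open>auto simp: fsupp_def\<close>)
  have b: "hnorm K (?F c) \<le> k * hnorm HH (?A c)" if c: "c \<in> fsupp ?P" for c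
  proof -
    let ?I = "{p. c p \<noteq> 0}"
    have I: "finite ?I" "?I \<subseteq> ?P" using c by (auto simp: fsupp_def)
    have "?F c = (\<Sum>p\<in>?I. f (fst p) (c p *\<^sub>C snd p))" unfolding lincomb_def
      by (rule sum.cong[OF refl]) (use I f(2) in force)
    moreover have "?A c = (\<Sum>p\<in>?I. tn (fst p) (c p *\<^sub>C snd p))" unfolding lincomb_def
      by (rule sum.cong[OF refl]) (use I tens_scale_right in force)
    ultimately show ?thesis using bound[OF I(1), of fst "\<lambda>p. c p *\<^sub>C snd p"] I by force
  qed
  obtain T where T: "T \<in> bop HH K" "\<And>c. c \<in> fsupp ?P \<Longrightarrow> T (?A c) = ?F c"
    "\<And>x. x \<in> hset HH \<Longrightarrow> (\<And>v. v \<in> fsupp ?P \<Longrightarrow> hip HH (?A v) x = 0) \<Longrightarrow> T x = 0"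
    "\<And>x. x \<in> hset HH \<Longrightarrow> hnorm K (T x) \<le> k * hnorm HH x"
  proof (rule HK.extension[of "fsupp ?P" ?A ?F k, OF fsupp_subspace])
    show "\<And>v w. v \<in> fsupp ?P \<Longrightarrow> w \<in> fsupp ?P \<Longrightarrow> ?A (v + w) = ?A v + ?A w" by (rule lincomb_add)
    show "\<And>v w. v \<in> fsupp ?P \<Longrightarrow> w \<in> fsupp ?P \<Longrightarrow> ?F (v + w) = ?F v + ?F w" by (rule lincomb_add)
    show "\<And>v c. v \<in> fsupp ?P \<Longrightarrow> ?A (c *\<^sub>C v) = c *\<^sub>C ?A v" by (rule lincomb_scale)
    show "\<And>v c. v \<in> fsupp ?P \<Longrightarrow> ?F (c *\<^sub>C v) = c *\<^sub>C ?F v" by (rule lincomb_scale)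
    show "\<And>v. v \<in> fsupp ?P \<Longrightarrow> ?A v \<in> hset HH" by (rule A(1))
    show "\<And>v. v \<in> fsupp ?P \<Longrightarrow> ?F v \<in> hset K" by (rule A(2))
    show "\<And>v. v \<in> fsupp ?P \<Longrightarrow> hnorm K (?F v) \<le> k * hnorm HH (?A v)" by (rule b)
  qed (rule k | (rule that; blast))+
  have "T (tn x g) = f x g" if "x \<in> mset E" "g \<in> hset G" for x g
    using T(2)[OF single_fsupp[of "(x, g)" ?P]] that by simp
  then show thesis using that T(1,4) by blast
qed

lemma bop_agree_tens:
  assumes "hilb K" "S \<in> bop HH K" "T \<in> bop HH K" "\<And>x g. x \<in> mset E \<Longrightarrow> g \<in> hset G \<Longrightarrow> S (tn x g) = T (tn x g)"
  shows "S = T"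
proof -
  interpret HK: hilb2 HH K using assms(1) by (simp add: hilb2_def H.hilb_axioms)
  show ?thesis by (rule HK.bop_agree_total[OF assms(2,3) elem_mem _ tens_total]) (use assms(4) in blast)
qed

lemma the_tens_op:
  assumes "hilb K" "T \<in> bop HH K" "\<And>x g. x \<in> mset E \<Longrightarrow> g \<in> hset G \<Longrightarrow> T (tn x g) = f x g"
  shows "(THE T. T \<in> bop HH K \<and> (\<forall>x\<in>mset E. \<forall>g\<in>hset G. T (tn x g) = f x g)) = T"
  by (rule the_equality) (use assms bop_agree_tens[OF assms(1)] in auto)

subsection \<open>The commutant acts on the right tensor factor\<close>

text \<open>
  With \<open>d \<in> B'\<close> such that \<open>c\<^sup>* c + d\<^sup>* d = k\<^sup>2\<close>, the bound by \<open>k\<close> on sums of elementary tensors says that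
  \<open>\<parallel>\<Sum>i. x\<^sub>i \<odot> d g\<^sub>i\<parallel>\<^sup>2 \<ge> 0\<close>, as \<open>c\<close> and \<open>d\<close> commute with the inner products of \<open>E\<close>.
\<close>

lemma tens_right_exists:
  assumes c: "c \<in> commutant G B"
  shows "tens_right G E c \<in> bop HH HH \<and> (\<forall>x\<in>mset E. \<forall>g\<in>hset G. tens_right G E c (tn x g) = tn x (c g))"
proof -
  interpret C: vna G "commutant G B" by (rule vna_commutant)
  obtain k d where d: "k \<ge> 0" "d \<in> commutant G B"
    "\<And>g h. g \<in> hset G \<Longrightarrow> h \<in> hset G \<Longrightarrow> hip G (d g) (d h) = complex_of_real (k\<^sup>2) * hip G g h - hip G (c g) (c h)"
    using C.complement_root[OF c] by metis
  obtain T where T: "T \<in> bop HH HH" "\<And>x g. x \<in> mset E \<Longrightarrow> g \<in> hset G \<Longrightarrow> T (tn x g) = tn x (c g)"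
  proof (rule tensor_extension[OF H.hilb_axioms _ _ d(1), of "\<lambda>x g. tn x (c g)"])
    fix I :: "('e \<times> 'g) set" and x g
    assume I: "finite I" and x: "\<And>i. i \<in> I \<Longrightarrow> x i \<in> mset E" and g: "\<And>i. i \<in> I \<Longrightarrow> g i \<in> hset G"
    have e: "hip G (d (g i)) (mip E (x i) (x j) (d (g j))) = complex_of_real (k\<^sup>2) * hip G (g i) (mip E (x i) (x j) (g j))
      - hip G (c (g i)) (mip E (x i) (x j) (c (g j)))" if ij: "i \<in> I" "j \<in> I" for i j
      using d(3)[OF g[OF ij(1)] mip_mem[OF x[OF ij(1)] x[OF ij(2)] g[OF ij(2)]]]
        commutant_comm[OF d(2) mip_B[OF x[OF ij(1)] x[OF ij(2)]]] commutant_comm[OF c mip_B[OF x[OF ij(1)] x[OF ij(2)]]] by simp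
    have "(\<Sum>i\<in>I. \<Sum>j\<in>I. hip G (d (g i)) (mip E (x i) (x j) (d (g j)))) \<in> \<real>\<^sub>\<ge>\<^sub>0"
      by (rule mip_positive[OF I x]) (use C.B_mem[OF d(2)] g in auto)
    also have "(\<Sum>i\<in>I. \<Sum>j\<in>I. hip G (d (g i)) (mip E (x i) (x j) (d (g j)))) =
      complex_of_real (k\<^sup>2) * (\<Sum>i\<in>I. \<Sum>j\<in>I. hip G (g i) (mip E (x i) (x j) (g j)))
      - (\<Sum>i\<in>I. \<Sum>j\<in>I. hip G (c (g i)) (mip E (x i) (x j) (c (g j))))"
      by (simp add: e sum_subtractf sum_distrib_left)
    finally have "Re (\<Sum>i\<in>I. \<Sum>j\<in>I. hip G (c (g i)) (mip E (x i) (x j) (c (g j)))) 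
       \<le> k\<^sup>2 * Re (\<Sum>i\<in>I. \<Sum>j\<in>I. hip G (g i) (mip E (x i) (x j) (g j)))"
      using nonneg_complex_Re by fastforce
    then have "(hnorm HH (\<Sum>i\<in>I. tn (x i) (c (g i))))\<^sup>2 \<le> (k * hnorm HH (\<Sum>i\<in>I. tn (x i) (g i)))\<^sup>2"
      using tens_sum_norm[of I x "\<lambda>i. c (g i)"] tens_sum_norm[of I x g] x g C.B_mem[OF c] by (simp add: power_mult_distrib)
    then show "hnorm HH (\<Sum>i\<in>I. tn (x i) (c (g i))) \<le> k * hnorm HH (\<Sum>i\<in>I. tn (x i) (g i))"
      by (rule power2_le_imp_le) (use d(1) x g tens_mem in auto)
  qed (use tens_mem tens_scale_right C.B_mem[OF c] bop_scale[OF C.B_bop[OF c]] in auto)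
  have "tens_right G E c = T" unfolding tens_right_def by (rule the_tens_op[OF H.hilb_axioms T])
  then show ?thesis using T by simp
qed

lemma tens_right_bop: "c \<in> commutant G B \<Longrightarrow> tens_right G E c \<in> bop HH HH"
  using tens_right_exists by blast
lemma tens_right_apply: "c \<in> commutant G B \<Longrightarrow> x \<in> mset E \<Longrightarrow> g \<in> hset G \<Longrightarrow> tens_right G E c (tn x g) = tn x (c g)"
  using tens_right_exists by blast

lemma tens_right_adj:
  assumes c: "c \<in> commutant G B" shows "tens_right G E (adj G G c) = adj HH HH (tens_right G E c)"
proof (rule bop_agree_tens[OF H.hilb_axioms tens_right_bop[OF commutant_adj[OF c]] HH.adj_bop[OF tens_right_bop[OF c]]])
  fix x g assume x: "x \<in> mset E" and g: "g \<in> hset G"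
  have cm: "c h \<in> hset G" "adj G G c h \<in> hset G" if "h \<in> hset G" for h
    using bop_mem[OF commutant_bop[OF c] that] bop_mem[OF commutant_bop[OF commutant_adj[OF c]] that] by auto
  show "tens_right G E (adj G G c) (tn x g) = adj HH HH (tens_right G E c) (tn x g)"
    unfolding tens_right_apply[OF commutant_adj[OF c] x g]
  proof (rule tens_eqI[OF tens_mem[OF x cm(2)[OF g]] HH.adj_mem[OF tens_right_bop[OF c] tens_mem[OF x g]]])
    fix y h assume y: "y \<in> mset E" and h: "h \<in> hset G"
    have "hip HH (tn y h) (adj HH HH (tens_right G E c) (tn x g)) = hip G (c h) (mip E y x g)"
      using HH.adj_ip'[OF tens_right_bop[OF c] tens_mem[OF y h] tens_mem[OF x g]] c x y g h cm
      by (simp add: tens_right_apply tens_ip)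
    also have "\<dots> = hip G h (adj G G c (mip E y x g))"
      using GG.adj_ip'[OF commutant_bop[OF c] h mip_mem[OF y x g]] by simp
    also have "\<dots> = hip G h (mip E y x (adj G G c g))" using commutant_comm[OF commutant_adj[OF c] mip_B[OF y x]] by simp
    finally show "hip HH (tn y h) (tn x (adj G G c g)) = hip HH (tn y h) (adj HH HH (tens_right G E c) (tn x g))"
      using x y g h cm by (simp add: tens_ip)
  qed
qed

subsection \<open>The operators of a module\<close>

lemma Lop_apply: "g \<in> hset G \<Longrightarrow> Lop G E x g = tn x g" by (simp add: Lop_def)

lemma mnorm_bound: assumes x: "x \<in> mset E" and g: "g \<in> hset G" shows "hnorm HH (tn x g) \<le> mnorm G E x * hnorm G g"
proof -
  have o: "0 \<le> opnorm G G (mip E x x)" by (rule GG.opnorm_nonneg[OF mip_bop[OF x x]])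
  have "(hnorm HH (tn x g))\<^sup>2 \<le> hnorm G g * hnorm G (mip E x x g)"
    unfolding tens_norm[OF x g]
    using cauchy_schwarz[OF g mip_mem[OF x x g]] complex_Re_le_cmod order_trans by blast
  also have "\<dots> \<le> hnorm G g * (opnorm G G (mip E x x) * hnorm G g)"
    using GG.opnorm_bound[OF mip_bop[OF x x] g] g by (intro mult_left_mono) auto
  also have "\<dots> = (mnorm G E x * hnorm G g)\<^sup>2"
    using o by (simp add: mnorm_def power_mult_distrib power2_eq_square mult_ac)
  finally show ?thesis by (rule power2_le_imp_le) (use o g in \<open>simp add: mnorm_def\<close>)
qed

lemma mnorm_le:
  assumes x: "x \<in> mset E" and b: "\<And>g. g \<in> hset G \<Longrightarrow> hnorm HH (tn x g) \<le> C * hnorm G g" and C: "0 \<le> C"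
  shows "mnorm G E x \<le> C"
proof -
  have "opnorm G G (mip E x x) \<le> C\<^sup>2"
  proof (rule GG.opnorm_le)
    fix g assume g: "g \<in> hset G"
    let ?m = "mip E x x g"
    have m: "?m \<in> hset G" by (rule mip_mem[OF x x g])
    have "(hnorm G ?m)\<^sup>2 = Re (hip HH (tn x ?m) (tn x g))" using m x g by (simp add: norm_sq tens_ip)
    also have "\<dots> \<le> hnorm HH (tn x ?m) * hnorm HH (tn x g)"
      using H.cauchy_schwarz[OF tens_mem[OF x m] tens_mem[OF x g]] complex_Re_le_cmod order_trans by blast
    also have "\<dots> \<le> (C * hnorm G ?m) * (C * hnorm G g)"
      using b[OF m] b[OF g] C m g x tens_mem by (intro mult_mono) auto
    finally have e: "hnorm G ?m * hnorm G ?m \<le> (C\<^sup>2 * hnorm G g) * hnorm G ?m" by (simp add: power2_eq_square mult_ac)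
    show "hnorm G ?m \<le> C\<^sup>2 * hnorm G g"
      by (cases "hnorm G ?m = 0") (use e norm_nonneg[OF m] norm_nonneg[OF g] in \<open>auto simp: mult_le_cancel_right\<close>)
  qed simp
  then show ?thesis unfolding mnorm_def using C by (simp add: real_le_lsqrt)
qed

lemma mnorm_nonneg: "x \<in> mset E \<Longrightarrow> 0 \<le> mnorm G E x"
  unfolding mnorm_def using GG.opnorm_nonneg[OF mip_bop] by simp

lemma Lop_bop: assumes x: "x \<in> mset E" shows "Lop G E x \<in> bop G HH"
  by (rule bopI[where K = "mnorm G E x"])
    (use x in \<open>auto simp: Lop_def tens_mem tens_add_right tens_scale_right mnorm_bound\<close>)

lemma Lop_adj: assumes x: "x \<in> mset E" and y: "y \<in> mset E" shows "adj G HH (Lop G E x) \<circ> Lop G E y = mip E x y"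
proof (rule bop_eqI[OF H.bop_comp[OF Lop_bop[OF y] GH.adj_bop[OF Lop_bop[OF x]]] mip_bop[OF x y]])
  fix g assume g: "g \<in> hset G"
  let ?u = "adj G HH (Lop G E x) (tn y g)" 
  have u: "?u \<in> hset G" by (rule GH.adj_mem[OF Lop_bop[OF x] tens_mem[OF y g]])
  have m: "mip E x y g \<in> hset G" by (rule mip_mem[OF x y g])
  have "hip G h ?u = hip G h (mip E x y g)" if h: "h \<in> hset G" for h
    using GH.adj_ip'[OF Lop_bop[OF x] h tens_mem[OF y g]] x y g h by (simp add: Lop_apply tens_ip)
  then have "hip G (?u - mip E x y g) (?u - mip E x y g) = 0" using u m by (simp add: diff_right)
  then have "?u = mip E x y g" using definite[of "?u - mip E x y g"] u m by simp
  then show "(adj G HH (Lop G E x) \<circ> Lop G E y) g = mip E x y g" using g by (simp add: Lop_apply)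
qed

lemma Lop_inj: 
  assumes x: "x \<in> mset E" and y: "y \<in> mset E" and e: "\<And>g. g \<in> hset G \<Longrightarrow> tn x g = tn y g" shows "x = y"
proof (rule mip_eqI[OF x y])
  fix z assume z: "z \<in> mset E"
  have "Lop G E x = Lop G E y" using e by (auto simp: Lop_def)
  then show "mip E z x = mip E z y" using Lop_adj[OF z x] Lop_adj[OF z y] by simp
qed

lemma Lop_add: "x \<in> mset E \<Longrightarrow> y \<in> mset E \<Longrightarrow> Lop G E (x + y) = Lop G E x + Lop G E y"
  by (auto simp: Lop_def fun_eq_iff tens_add_left)
lemma Lop_scale: "x \<in> mset E \<Longrightarrow> Lop G E (c *\<^sub>C x) = c *\<^sub>C Lop G E x"
  by (auto simp: Lop_def fun_eq_iff tens_scale_left)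
lemma Lop_ract: "x \<in> mset E \<Longrightarrow> b \<in> B \<Longrightarrow> Lop G E (ract E x b) = Lop G E x \<circ> b"
  by (rule bop_eqI[OF Lop_bop[OF ract_mem] bop_comp[OF B_bop Lop_bop]]) (auto simp: Lop_apply tens_ract B_mem)
lemma Lop_right: "x \<in> mset E \<Longrightarrow> c \<in> commutant G B \<Longrightarrow> tens_right G E c \<circ> Lop G E x = Lop G E x \<circ> c"
  by (rule bop_eqI[OF H.bop_comp[OF Lop_bop tens_right_bop] bop_comp[OF commutant_bop Lop_bop]])
    (auto simp: Lop_apply tens_right_apply bop_mem[OF commutant_bop])

end

subsection \<open>Operators on the left tensor factor\<close>

text \<open>
  It suffices to bound \<open>a \<odot> id\<close> on single elementary tensors: then the kernel
  \<open>k\<^sup>2 \<langle>x, y\<rangle> - \<langle>a x, a y\<rangle>\<close> is positive on the diagonal and \<open>kernel_positive\<close> extends the bound to sums.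
\<close>

lemma tens_left_exists:
  assumes "hmod G B E1" "hmod G B E2"
    and a: "\<And>x. x \<in> mset E1 \<Longrightarrow> a x \<in> mset E2" "\<And>x y. x \<in> mset E1 \<Longrightarrow> y \<in> mset E1 \<Longrightarrow> a (x + y) = a x + a y"
      "\<And>x b. x \<in> mset E1 \<Longrightarrow> b \<in> B \<Longrightarrow> a (ract E1 x b) = ract E2 (a x) b"
    and k: "k \<ge> 0" and bd: "\<And>x g. x \<in> mset E1 \<Longrightarrow> g \<in> hset G \<Longrightarrow> hnorm (tspace G E2) (tens G E2 (a x) g) \<le> k * hnorm (tspace G E1) (tens G E1 x g)"
  shows "tens_left G E1 E2 a \<in> bop (tspace G E1) (tspace G E2)"
    "\<And>x g. x \<in> mset E1 \<Longrightarrow> g \<in> hset G \<Longrightarrow> tens_left G E1 E2 a (tens G E1 x g) = tens G E2 (a x) g"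
proof -
  interpret E1: hmod G B E1 by fact
  interpret E2: hmod G B E2 by fact
  obtain T where T: "T \<in> bop (tspace G E1) (tspace G E2)"
    "\<And>x g. x \<in> mset E1 \<Longrightarrow> g \<in> hset G \<Longrightarrow> T (tens G E1 x g) = tens G E2 (a x) g"
  proof (rule E1.tensor_extension[OF E2.H.hilb_axioms _ _ k, of "\<lambda>x g. tens G E2 (a x) g"])
    fix I :: "('b \<times> 'a) set" and x g
    assume I: "finite I" and x: "\<And>i. i \<in> I \<Longrightarrow> x i \<in> mset E1" and g: "\<And>i. i \<in> I \<Longrightarrow> g i \<in> hset G"
    let ?F = "\<lambda>x y. complex_of_real (k\<^sup>2) *\<^sub>C mip E1 x y - mip E2 (a x) (a y)"
    have Fapp: "hip G g (?F x y h) = complex_of_real (k\<^sup>2) * hip G g (mip E1 x y h) - hip G g (mip E2 (a x) (a y) h)"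
      if "x \<in> mset E1" "y \<in> mset E1" "g \<in> hset G" "h \<in> hset G" for x y g h
      using that E1.mip_mem E2.mip_mem a(1) by (simp add: E1.diff_right E1.scale_right)
    have "(\<Sum>i\<in>I. \<Sum>j\<in>I. hip G (g i) (?F (x i) (x j) (g j))) \<in> \<real>\<^sub>\<ge>\<^sub>0"
    proof (rule E1.kernel_positive[where r = "ract E1", OF E1.E_subspace _ _ _ _ _ _ I x g])
      fix x y z a' b
      assume x: "x \<in> mset E1" 
      show "b \<in> B \<Longrightarrow> ract E1 x b \<in> mset E1" by (rule E1.ract_mem[OF x])
      assume y: "y \<in> mset E1"
      show "?F x y \<in> B" using x y a(1) by (intro E1.B_diff E1.B_scale E1.mip_B E2.mip_B) auto
      show "z \<in> mset E1 \<Longrightarrow> ?F x (y + z) = ?F x y + ?F x z"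
        using x y a by (simp add: E1.mip_add E2.mip_add scaleC_add_right)
      show "z \<in> mset E1 \<Longrightarrow> ?F (x + y) z = ?F x z + ?F y z"
        using x y a by (simp add: E1.mip_add_left E2.mip_add_left scaleC_add_right)
      assume ab: "a' \<in> B" "b \<in> B"
      have m: "mip E1 x y \<in> bop G G" "mip E2 (a x) (a y) \<in> bop G G" using E1.mip_bop E2.mip_bop x y a(1) by auto
      show "?F (ract E1 x a') (ract E1 y b) = adj G G a' \<circ> ?F x y \<circ> b"
      proof
        fix g
        have ad: "adj G G a' \<in> bop G G" using E1.B_bop[OF E1.B_adj[OF ab(1)]] .
        have bm: "mip E1 x y (b g) \<in> hset G" "mip E2 (a x) (a y) (b g) \<in> hset G"
          using bop_mem[OF m(1)] bop_mem[OF m(2)] E1.B_mem[OF ab(2)] bop_out[OF E1.B_bop[OF ab(2)], of g] bop_zero m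
          by (cases "g \<in> hset G"; simp add: bop_zero)+
        show "?F (ract E1 x a') (ract E1 y b) g = (adj G G a' \<circ> ?F x y \<circ> b) g"
          using x y a ab bm by (simp add: E1.mip_ract E1.mip_ract_left E2.mip_ract E2.mip_ract_left E1.ract_mem E2.ract_mem
              E1.bop_diff[OF ad] bop_scale[OF ad])
      qed
    next
      fix x g assume x: "x \<in> mset E1" and g: "g \<in> hset G"
      have r1: "hip G g (mip E1 x x g) = complex_of_real ((hnorm (tspace G E1) (tens G E1 x g))\<^sup>2)"
        using nonneg_complex_eq[OF E1.mip_pos[OF x g]] E1.tens_norm[OF x g] by simp
      have r2: "hip G g (mip E2 (a x) (a x) g) = complex_of_real ((hnorm (tspace G E2) (tens G E2 (a x) g))\<^sup>2)"
        using nonneg_complex_eq[OF E2.mip_pos[OF a(1)[OF x] g]] E2.tens_norm[OF a(1)[OF x] g] by simp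
      have "(hnorm (tspace G E2) (tens G E2 (a x) g))\<^sup>2 \<le> (k * hnorm (tspace G E1) (tens G E1 x g))\<^sup>2"
        by (rule power_mono[OF bd[OF x g]]) (use E2.tens_mem a(1) x g in auto)
      then show "hip G g (?F x x g) \<in> \<real>\<^sub>\<ge>\<^sub>0"
        unfolding Fapp[OF x x g g] r1 r2
        by (simp add: complex_nonneg_Reals_iff power_mult_distrib flip: of_real_mult of_real_diff of_real_power)
    qed
    also have "(\<Sum>i\<in>I. \<Sum>j\<in>I. hip G (g i) (?F (x i) (x j) (g j))) =
        complex_of_real (k\<^sup>2) * (\<Sum>i\<in>I. \<Sum>j\<in>I. hip G (g i) (mip E1 (x i) (x j) (g j)))
         - (\<Sum>i\<in>I. \<Sum>j\<in>I. hip G (g i) (mip E2 (a (x i)) (a (x j)) (g j)))"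
      unfolding sum_distrib_left sum_subtractf[symmetric] by (intro sum.cong refl Fapp x g)
    finally have "Re (\<Sum>i\<in>I. \<Sum>j\<in>I. hip G (g i) (mip E2 (a (x i)) (a (x j)) (g j)))
       \<le> k\<^sup>2 * Re (\<Sum>i\<in>I. \<Sum>j\<in>I. hip G (g i) (mip E1 (x i) (x j) (g j)))"
      using nonneg_complex_Re by fastforce
    then have "(hnorm (tspace G E2) (\<Sum>i\<in>I. tens G E2 (a (x i)) (g i)))\<^sup>2 \<le> (k * hnorm (tspace G E1) (\<Sum>i\<in>I. tens G E1 (x i) (g i)))\<^sup>2"
      using E1.tens_sum_norm[of I x g] E2.tens_sum_norm[of I "\<lambda>i. a (x i)" g] x g a(1) by (simp add: power_mult_distrib)
    then show "hnorm (tspace G E2) (\<Sum>i\<in>I. tens G E2 (a (x i)) (g i)) \<le> k * hnorm (tspace G E1) (\<Sum>i\<in>I. tens G E1 (x i) (g i))"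
      by (rule power2_le_imp_le) (use k x g E1.tens_mem in auto)
  qed (use E2.tens_mem E2.tens_scale_right a(1) in auto)
  have "tens_left G E1 E2 a = T" unfolding tens_left_def by (rule E1.the_tens_op[OF E2.H.hilb_axioms T])
  then show "tens_left G E1 E2 a \<in> bop (tspace G E1) (tspace G E2)"
    "\<And>x g. x \<in> mset E1 \<Longrightarrow> g \<in> hset G \<Longrightarrow> tens_left G E1 E2 a (tens G E1 x g) = tens G E2 (a x) g" using T by auto
qed

section \<open>Von Neumann modules\<close>

locale vnmod = hmod G B E for G :: "'g::complex_vector hilbert" and B and E :: "('e::complex_vector, 'g, 'z) hmodule_scheme" +
  assumes strong_closed: "closedin (strong_top G (tspace G E)) (Lop G E ` mset E)"
begin

lemma intertwiner_in_module:
  assumes y: "y \<in> bop G HH" and c: "\<And>c. c \<in> commutant G B \<Longrightarrow> tens_right G E c \<circ> y = y \<circ> c"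
  shows "y \<in> Lop G E ` mset E"
proof (rule density[where r = "tens_right G E", OF H.hilb_axioms _ strong_closed _ _ tens_right_bop tens_right_adj _ y c])
  show "complex_vector.subspace (Lop G E ` mset E)"
    by (rule linear_image_subspace[OF E_subspace Lop_add Lop_scale])
  show "x \<circ> b \<in> Lop G E ` mset E" if "x \<in> Lop G E ` mset E" "b \<in> B" for x b
    using that Lop_ract ract_mem by (auto simp: Lop_ract[symmetric])
  have "{x g |x g. x \<in> Lop G E ` mset E \<and> g \<in> hset G} = elem"
  proof (intro set_eqI iffI)
    fix u assume "u \<in> {x g |x g. x \<in> Lop G E ` mset E \<and> g \<in> hset G}" then show "u \<in> elem" using Lop_apply by force
  next
    fix u assume "u \<in> elem"
    then obtain x g where "u = tn x g" "x \<in> mset E" "g \<in> hset G" by blast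
    then show "u \<in> {x g |x g. x \<in> Lop G E ` mset E \<and> g \<in> hset G}"
      using Lop_apply[of g x] by (intro CollectI exI[of _ "Lop G E x"] exI[of _ g]) auto
  qed
  then show "hcl HH (complex_vector.span {x g |x g. x \<in> Lop G E ` mset E \<and> g \<in> hset G}) = hset HH"
    using tens_total by simp
  show "tens_right G E c \<circ> x = x \<circ> c" if "c \<in> commutant G B" "x \<in> Lop G E ` mset E" for c x
    using that Lop_right by auto
qed

text \<open>
  The operator \<open>|x| g \<mapsto> x \<odot> g\<close> is an isometry on the range of \<open>|x| = \<langle>x, x\<rangle>\<^sup>1\<^sup>/\<^sup>2\<close>.  It intertwines the actions of \<open>B'\<close>,
  and hence is an element of the module.
\<close>

lemma polar_decomposition:
  assumes x: "x \<in> mset E"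
  obtains v z where "v \<in> mset E" "z \<in> B" "x = ract E v z" "mnorm G E v \<le> 1"
    "\<And>g. g \<in> hset G \<Longrightarrow> hnorm G (z g) = hnorm HH (tn x g)"
proof -
  obtain z where z: "z \<in> B" "adj G G z = z" "z \<circ> z = mip E x x"
    using square_root[OF mip_B[OF x x] mip_adj[OF x x] mip_pos[OF x]] by blast
  have zn: "hnorm G (z g) = hnorm HH (tn x g)" if g: "g \<in> hset G" for g
  proof -
    have "hip G (z g) (z g) = hip G g ((z \<circ> z) g)" using GG.adj_ip[OF B_bop[OF z(1)] B_mem[OF z(1) g] g] z(2) by simp
    then have "(hnorm G (z g))\<^sup>2 = (hnorm HH (tn x g))\<^sup>2"
      using tens_norm[OF x g] norm_sq[OF B_mem[OF z(1) g]] z(3) by simp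
    then show ?thesis using norm_nonneg[OF B_mem[OF z(1) g]] H.norm_nonneg[OF tens_mem[OF x g]] by simp
  qed
  have zadd: "z (g + h) = z g + z h" if "g \<in> hset G" "h \<in> hset G" for g h using bop_add[OF B_bop[OF z(1)]] that .
  have zscale: "z (c *\<^sub>C g) = c *\<^sub>C z g" if "g \<in> hset G" for g c using bop_scale[OF B_bop[OF z(1)] that] .
  obtain T where T: "T \<in> bop G HH" "\<And>g. g \<in> hset G \<Longrightarrow> T (z g) = tn x g"
    "\<And>h. h \<in> hset G \<Longrightarrow> (\<And>g. g \<in> hset G \<Longrightarrow> hip G (z g) h = 0) \<Longrightarrow> T h = 0"
    "\<And>h. h \<in> hset G \<Longrightarrow> hnorm HH (T h) \<le> 1 * hnorm G h"
  proof (rule GH.extension[of "hset G" z "tn x" 1, OF subspace B_mem[OF z(1)] zadd zscale])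
    show "\<And>g. g \<in> hset G \<Longrightarrow> hnorm HH (tn x g) \<le> 1 * hnorm G (z g)" using zn by simp
  qed (use x tens_mem tens_add_right tens_scale_right in auto)
  have "tens_right G E c \<circ> T = T \<circ> c" if c: "c \<in> commutant G B" for c
  proof (rule GH.extension_commute[OF subspace B_mem[OF z(1)] zadd zscale T(1,3) commutant_bop[OF c] tens_right_bop[OF c], symmetric])
    fix g assume g: "g \<in> hset G"
    have cg: "c g \<in> hset G" "adj G G c g \<in> hset G"
      using bop_mem[OF commutant_bop[OF c] g] bop_mem[OF commutant_bop[OF commutant_adj[OF c]] g] by auto
    show "T (c (z g)) = tens_right G E c (T (z g))"
      using commutant_comm[OF c z(1)] T(2)[OF g] T(2)[OF cg(1)] tens_right_apply[OF c x g] by simp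
    show "adj G G c (z g) \<in> z ` hset G" using commutant_comm[OF commutant_adj[OF c] z(1)] cg(2) by simp
  qed
  then obtain v where v: "v \<in> mset E" "T = Lop G E v" using intertwiner_in_module[OF T(1)] by blast
  have "x = ract E v z"
    by (rule Lop_inj[OF x ract_mem[OF v(1) z(1)]])
      (use T(2) v Lop_apply[OF B_mem[OF z(1)]] tens_ract[OF v(1) z(1)] in simp)
  moreover have "mnorm G E v \<le> 1"
    by (rule mnorm_le[OF v(1)]) (use T(4) v(2) Lop_apply in auto)
  ultimately show thesis using that v(1) z(1) zn by blast
qed

text \<open>
  In the polar decomposition \<open>x = v z\<close> right linearity gives \<open>a x \<odot> g = a v \<odot> z g\<close>, where \<open>\<parallel>z g\<parallel> = \<parallel>x \<odot> g\<parallel>\<close> and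
  \<open>\<parallel>a v\<parallel> \<le> k\<close>.  The constant \<open>k\<close> may be negative if the module is trivial.
\<close>

lemma bounded_module_map:
  assumes "hmod G B E2"
    and a: "\<And>x. x \<in> mset E \<Longrightarrow> a x \<in> mset E2" "\<And>x b. x \<in> mset E \<Longrightarrow> b \<in> B \<Longrightarrow> a (ract E x b) = ract E2 (a x) b"
    and bd: "\<And>x. x \<in> mset E \<Longrightarrow> mnorm G E2 (a x) \<le> k * mnorm G E x" and x: "x \<in> mset E" and g: "g \<in> hset G"
  shows "hnorm (tspace G E2) (tens G E2 (a x) g) \<le> max k 0 * hnorm HH (tn x g)"
proof -
  interpret E2: hmod G B E2 by fact
  obtain v z where v: "v \<in> mset E" "z \<in> B" "x = ract E v z" "mnorm G E v \<le> 1"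
    "\<And>g. g \<in> hset G \<Longrightarrow> hnorm G (z g) = hnorm HH (tn x g)" using polar_decomposition[OF x] by blast
  have zg: "z g \<in> hset G" by (rule B_mem[OF v(2) g])
  have "tens G E2 (a x) g = tens G E2 (a v) (z g)" using v a E2.tens_ract[OF a(1)[OF v(1)] v(2) g] by simp
  then have "hnorm (tspace G E2) (tens G E2 (a x) g) \<le> mnorm G E2 (a v) * hnorm G (z g)"
    using E2.mnorm_bound[OF a(1)[OF v(1)] zg] by simp
  moreover have "mnorm G E2 (a v) \<le> max k 0 * mnorm G E v"
    using bd[OF v(1)] mult_right_mono[of k "max k 0" "mnorm G E v"] mnorm_nonneg[OF v(1)] by linarith
  moreover have "max k 0 * mnorm G E v \<le> max k 0" using mult_left_mono[OF v(4), of "max k 0"] by simp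
  ultimately have "hnorm (tspace G E2) (tens G E2 (a x) g) \<le> mnorm G E2 (a v) * hnorm G (z g)"
    and "mnorm G E2 (a v) \<le> max k 0" by linarith+
  note this(1)
  also have "mnorm G E2 (a v) * hnorm G (z g) \<le> max k 0 * hnorm G (z g)"
    by (rule mult_right_mono[OF \<open>mnorm G E2 (a v) \<le> max k 0\<close> norm_nonneg[OF zg]])
  finally show ?thesis unfolding v(5)[OF g] .
qed

end

section \<open>The sigma-weak topology\<close>

abbreviation sw_fun :: "'a hilbert \<Rightarrow> (nat \<Rightarrow> 'a) \<Rightarrow> (nat \<Rightarrow> 'a) \<Rightarrow> ('a \<Rightarrow> 'a) \<Rightarrow> complex" where
  "sw_fun H h k T \<equiv> \<Sum>n. hip H (h n) (T (k n))"

context hilb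
begin

lemma square_summable_zero: "square_summable H (\<lambda>_. 0)"
  by (simp add: square_summable_def)
lemma square_summable_mem: "square_summable H h \<Longrightarrow> h n \<in> hset H"
  by (auto simp: square_summable_def)

lemma square_summable_hsum: "square_summable H h \<longleftrightarrow> h \<in> hset (hsum UNIV H)"
  unfolding square_summable_def hsum_mem by (auto simp: summable_on_UNIV_nonneg_real_iff)

lemma square_summable_single: "x \<in> hset H \<Longrightarrow> square_summable H (inj_at 0 x)"
  unfolding square_summable_hsum by (rule at_mem) simp_all

lemma hsum_ip_sums:
  assumes h: "h \<in> hset (hsum UNIV H)" and k: "k \<in> hset (hsum UNIV H)"
  shows "(\<lambda>n. hip H (h n) (k n)) sums hip (hsum UNIV H) h k"
  unfolding hsum_ip using hsum_ip_summable[OF h k] by (rule has_sum_imp_sums[OF has_sum_infsum])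

lemma sw_fun_hsum:
  assumes h: "square_summable H h" and k: "square_summable H k" and T: "T \<in> bop H H"
  shows "(\<lambda>n. hip H (h n) (T (k n))) sums hip (hsum UNIV H) h (amp UNIV T k)"
  using hsum_ip_sums[of h "amp UNIV T k"] h k bop_mem[OF amp_bop[OF T], of k UNIV]
  by (simp add: square_summable_hsum amp_apply)

lemma topspace_sigma_weak: "topspace (sigma_weak_top H) = bop H H"
proof
  show "topspace (sigma_weak_top H) \<subseteq> bop H H"
    unfolding sigma_weak_top_def topology_generated_by_topspace by auto
  have "bop H H = {T \<in> bop H H. sw_fun H (\<lambda>_. 0) (\<lambda>_. 0) T \<in> UNIV}" by simp
  then have "bop H H \<in> {{T \<in> bop H H. sw_fun H h k T \<in> U} |h k U. square_summable H h \<and> square_summable H k \<and> open U}"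
    using square_summable_zero open_UNIV by blast
  then show "bop H H \<subseteq> topspace (sigma_weak_top H)"
    unfolding sigma_weak_top_def topology_generated_by_topspace by blast
qed

lemma sw_fun_continuous:
  assumes h: "square_summable H h" "square_summable H k"
  shows "continuous_map (sigma_weak_top H) euclidean (sw_fun H h k)"
  unfolding continuous_map_def topspace_sigma_weak
proof (intro conjI allI impI)
  fix U :: "complex set" assume "openin euclidean U"
  then have "open U" by simp
  then show "openin (sigma_weak_top H) {T \<in> bop H H. sw_fun H h k T \<in> U}"
    unfolding sigma_weak_top_def by (intro topology_generated_by_Basis) (use h in blast)
qed simp

end

lemma normal_map_iff:
  assumes "hilb K" "hilb H" and A: "A \<subseteq> bop K K" and p: "\<And>a. a \<in> A \<Longrightarrow> p a \<in> bop H H"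
  shows "normal_map K A H p \<longleftrightarrow> (\<forall>h k. square_summable H h \<and> square_summable H k \<longrightarrow>
     continuous_map (subtopology (sigma_weak_top K) A) euclidean (\<lambda>a. sw_fun H h k (p a)))"
proof -
  interpret K: hilb K by fact
  interpret H: hilb H by fact
  have ts: "topspace (subtopology (sigma_weak_top K) A) = A" using A by (auto simp: K.topspace_sigma_weak)
  show ?thesis
  proof (intro iffI allI impI)
    fix h k assume n: "normal_map K A H p" and hk: "square_summable H h \<and> square_summable H k"
    have "continuous_map (subtopology (sigma_weak_top K) A) euclidean (sw_fun H h k \<circ> p)"
      using n hk H.sw_fun_continuous unfolding normal_map_def by (blast intro: continuous_map_compose)
    then show "continuous_map (subtopology (sigma_weak_top K) A) euclidean (\<lambda>a. sw_fun H h k (p a))"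
      by (simp add: comp_def)
  next
    assume c: "\<forall>h k. square_summable H h \<and> square_summable H k \<longrightarrow>
       continuous_map (subtopology (sigma_weak_top K) A) euclidean (\<lambda>a. sw_fun H h k (p a))"
    show "normal_map K A H p" unfolding normal_map_def sigma_weak_top_def[of H]
    proof (rule continuous_on_generated_topo)
      fix U assume "U \<in> {{T \<in> bop H H. sw_fun H h k T \<in> U} |h k U. square_summable H h \<and> square_summable H k \<and> open U}"
      then obtain h k V where U: "U = {T \<in> bop H H. sw_fun H h k T \<in> V}" "square_summable H h" "square_summable H k" "open V" by blast
      have "openin (subtopology (sigma_weak_top K) A) {a \<in> topspace (subtopology (sigma_weak_top K) A). sw_fun H h k (p a) \<in> V}"
        using c U by (intro openin_continuous_map_preimage[where Y = euclidean]) auto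
      also have "{a \<in> topspace (subtopology (sigma_weak_top K) A). sw_fun H h k (p a) \<in> V} = p -` U \<inter> topspace (subtopology (sigma_weak_top K) A)"
        using p unfolding ts U(1) by auto
      finally show "openin (subtopology (sigma_weak_top K) A) (p -` U \<inter> topspace (subtopology (sigma_weak_top K) A))" .
    next
      have "p ` A \<subseteq> topspace (sigma_weak_top H)" using p by (auto simp: H.topspace_sigma_weak)
      moreover have "topspace (sigma_weak_top H)
          = \<Union> {{T \<in> bop H H. sw_fun H h k T \<in> U} |h k U. square_summable H h \<and> square_summable H k \<and> open U}"
        unfolding sigma_weak_top_def topology_generated_by_topspace ..
      ultimately show "p ` topspace (subtopology (sigma_weak_top K) A)
          \<subseteq> \<Union> {{T \<in> bop H H. sw_fun H h k T \<in> U} |h k U. square_summable H h \<and> square_summable H k \<and> open U}"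
        unfolding ts by simp
    qed
  qed
qed

lemma (in hilb) sigma_weak_nhd_zero:
  assumes W: "openin (sigma_weak_top H) W" and 0: "0 \<in> W"
  shows "\<exists>P e. finite P \<and> e > 0 \<and> (\<forall>(h, k)\<in>P. square_summable H h \<and> square_summable H k) \<and>
     (\<forall>T\<in>bop H H. (\<forall>(h, k)\<in>P. cmod (sw_fun H h k T) < e) \<longrightarrow> T \<in> W)"
proof -
  have "generate_topology_on {{T \<in> bop H H. sw_fun H h k T \<in> U} |h k U. square_summable H h \<and> square_summable H k \<and> open U} W"
    using W unfolding sigma_weak_top_def by (rule openin_topology_generated_by)
  then show ?thesis using 0
  proof (induction rule: generate_topology_on.induct)
    case (Int a b)
    from Int.prems have "0 \<in> a" "0 \<in> b" by (simp_all only: Int_iff)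
    from Int.IH(1)[OF this(1)] obtain P and e :: real where P: "finite P" "e > 0"
        "\<forall>(h, k)\<in>P. square_summable H h \<and> square_summable H k"
        "\<forall>T\<in>bop H H. (\<forall>(h, k)\<in>P. cmod (sw_fun H h k T) < e) \<longrightarrow> T \<in> a" by (elim exE conjE)
    from Int.IH(2)[OF \<open>0 \<in> b\<close>] obtain Q and r :: real where Q: "finite Q" "r > 0"
        "\<forall>(h, k)\<in>Q. square_summable H h \<and> square_summable H k"
        "\<forall>T\<in>bop H H. (\<forall>(h, k)\<in>Q. cmod (sw_fun H h k T) < r) \<longrightarrow> T \<in> b" by (elim exE conjE)
    show ?case
    proof (rule exI[of _ "P \<union> Q"], rule exI[of _ "min e r"], intro conjI ballI impI)
      fix T assume T: "T \<in> bop H H" "\<forall>(h, k)\<in>P \<union> Q. cmod (sw_fun H h k T) < min e r"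
      have "\<forall>(h, k)\<in>P. cmod (sw_fun H h k T) < e" "\<forall>(h, k)\<in>Q. cmod (sw_fun H h k T) < r" using T(2) by fastforce+
      then show "T \<in> a \<inter> b" using P(4) Q(4) T(1) by blast
    qed (use P(1,2,3) Q(1,2,3) in auto)
  next
    case (UN K)
    then obtain k where k: "k \<in> K" "0 \<in> k" by blast
    from UN.IH[OF k] obtain P and e :: real where P: "finite P" "e > 0"
      "\<forall>(h, k)\<in>P. square_summable H h \<and> square_summable H k"
      "\<forall>T\<in>bop H H. (\<forall>(h, k)\<in>P. cmod (sw_fun H h k T) < e) \<longrightarrow> T \<in> k" by (elim exE conjE)
    show ?case
      by (rule exI[of _ P], rule exI[of _ e], intro conjI P(1,2,3)) (use P(4) k(1) in blast)
  next
    case (Basis s)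
    then obtain h k U where s: "s = {T \<in> bop H H. sw_fun H h k T \<in> U}" "square_summable H h" "square_summable H k" "open U" by blast
    have "0 \<in> U" using Basis.prems s(2) unfolding s(1) by (simp add: square_summable_mem)
    then obtain e where e: "e > 0" "ball 0 e \<subseteq> U" using s(4) open_contains_ball by blast
    show ?case
      by (rule exI[of _ "{(h, k)}"], rule exI[of _ e]) (use s e in \<open>auto simp: subset_iff\<close>)
  qed simp
qed

section \<open>Intertwiners out of a normal representation\<close>

text \<open>
  Every \<open>\<xi>\<close> in \<open>H\<close> is approximated by sums of vectors \<open>x g\<close>.  By continuity at \<open>0\<close> and homogeneity, \<open>\<langle>\<xi>, r a \<xi>\<rangle>\<close> is
  bounded by finitely many \<open>\<sigma>\<close>-weak seminorms of \<open>a\<close>.  At \<open>a = b\<^sup>* b\<close> these are estimated by the norms of \<open>b\<close> applied to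
  the square summable sequences, which are assembled into one vector \<open>w\<close> of a multiple \<open>?K\<close> of \<open>G\<close>.
\<close>

lemma (in star_algebra) intertwiners_total:
  assumes "hilb H" and id: "id_on (hset G) \<in> B" and r: "normal_unital_rep G B H r"
  shows "hcl H (complex_vector.span {x g |x g. x \<in> intertwiners G B H r \<and> g \<in> hset G}) = hset H"
proof -
  interpret H: hilb H by fact
  interpret HH: hilb2 H H ..
  note r = r[unfolded normal_unital_rep_def]
  have rb: "r b \<in> bop H H" if "b \<in> B" for b using r that by blast
  have radd: "r (a + b) = r a + r b" if "a \<in> B" "b \<in> B" for a b using r that by blast
  have rscale: "r (c *\<^sub>C a) = c *\<^sub>C r a" if "a \<in> B" for a c using r that by blast
  have rcomp: "r (a \<circ> b) = r a \<circ> r b" if "a \<in> B" "b \<in> B" for a b using r that by blast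
  have radj: "r (adj G G a) = adj H H (r a)" if "a \<in> B" for a using r that by blast
  have rid: "r (id_on (hset G)) = id_on (hset H)" using r by blast
  have rn: "normal_map G B H r" using r by blast
  define X where "X = {x g |x g. x \<in> intertwiners G B H r \<and> g \<in> hset G}"
  have XH: "X \<subseteq> hset H" unfolding X_def intertwiners_def using bop_mem by fastforce
  have "xi \<in> hcl H (complex_vector.span X)" if xi: "xi \<in> hset H" for xi
  proof -
    let ?f = "\<lambda>a. hip H xi (r a xi)"
    have fsw: "sw_fun H (inj_at 0 xi) (inj_at 0 xi) (r a) = ?f a" if "a \<in> B" for a
    proof -
      have "(\<Sum>n. hip H (inj_at 0 xi n) (r a (inj_at 0 xi n))) = (\<Sum>n\<in>{0::nat}. hip H (inj_at 0 xi n) (r a (inj_at 0 xi n)))"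
        by (rule suminf_finite) (simp_all add: inj_at_def bop_zero[OF rb[OF that]])
      then show ?thesis by (simp add: inj_at_def)
    qed
    have cm: "continuous_map (subtopology (sigma_weak_top G) B) euclidean (\<lambda>a. sw_fun H (inj_at 0 xi) (inj_at 0 xi) (r a))"
      by (rule iffD1[OF normal_map_iff[OF hilb_axioms H.hilb_axioms subsetI[OF B_bop] rb] rn, rule_format])
        (use H.square_summable_single[OF xi] in simp_all)
    have ts: "topspace (subtopology (sigma_weak_top G) B) = B" using B_bop by (auto simp: topspace_sigma_weak)
    have "openin (subtopology (sigma_weak_top G) B)
      {a \<in> topspace (subtopology (sigma_weak_top G) B). sw_fun H (inj_at 0 xi) (inj_at 0 xi) (r a) \<in> ball 0 1}"
      by (rule openin_continuous_map_preimage[OF cm]) simp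
    then obtain W where W: "openin (sigma_weak_top G) W" "{a \<in> B. sw_fun H (inj_at 0 xi) (inj_at 0 xi) (r a) \<in> ball 0 1} = W \<inter> B"
      unfolding ts openin_subtopology by blast
    have B0: "0 \<in> B" by (rule complex_vector.subspace_0[OF B_subspace])
    have "r 0 = 0" using rscale[OF B0, of 0] by simp
    then have "0 \<in> {a \<in> B. sw_fun H (inj_at 0 xi) (inj_at 0 xi) (r a) \<in> ball 0 1}" using fsw[OF B0] B0 xi by simp
    then have "0 \<in> W" using W(2) by blast
    from sigma_weak_nhd_zero[OF W(1) this] obtain P and e :: real where P12: "finite P" "e > 0"
      and P3: "\<forall>(h, k)\<in>P. square_summable G h \<and> square_summable G k"
      and P4: "\<forall>T\<in>bop G G. (\<forall>(h, k)\<in>P. cmod (sw_fun G h k T) < e) \<longrightarrow> T \<in> W" by (elim exE conjE)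
    have P34: "square_summable G h \<and> square_summable G k" if "(h, k) \<in> P" for h k using P3 that by auto
    have "T \<in> W" if T: "T \<in> bop G G" "\<And>h k. (h, k) \<in> P \<Longrightarrow> cmod (sw_fun G h k T) < e" for T
      by (rule P4[rule_format, OF T(1)]) (use T(2) in auto)
    note P = P12 P34 this
    have small: "cmod (?f a) < 1" if a: "a \<in> B" "\<And>h k. (h, k) \<in> P \<Longrightarrow> cmod (sw_fun G h k a) < e" for a
    proof -
      have "a \<in> W \<inter> B" using P(4)[OF B_bop[OF a(1)] a(2)] a(1) by blast
      then show ?thesis using fsw[OF a(1)] by (simp flip: W(2))
    qed
    define s where "s a = (\<Sum>(h, k)\<in>P. cmod (sw_fun G h k a))" for a
    have s0: "0 \<le> s a" for a unfolding s_def by (rule sum_nonneg) auto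
    \<comment> \<open>Homogeneity: the factor \<open>2\<close> absorbs the strictness of the inequalities.\<close>
    have fle: "cmod (?f a) \<le> 2 / e * s a" if a: "a \<in> B" for a
    proof -
      have scal: "t * cmod (?f a) < 1" if t: "t > 0" "t * s a < e" for t
      proof -
        have "cmod (?f (complex_of_real t *\<^sub>C a)) < 1"
        proof (rule small[OF B_scale[OF a]])
          fix h k assume hk: "(h, k) \<in> P"
          have "(\<Sum>n. hip G (h n) ((complex_of_real t *\<^sub>C a) (k n))) = complex_of_real t * sw_fun G h k a"
            using sums_summable[OF sw_fun_hsum[OF _ _ B_bop[OF a]], of h k] P(3)[OF hk] square_summable_mem B_mem[OF a]
            by (simp add: scale_right suminf_mult)
          then have "cmod (sw_fun G h k (complex_of_real t *\<^sub>C a)) = t * cmod (sw_fun G h k a)"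
            using t(1) by (simp add: norm_mult)
          also have "cmod (sw_fun G h k a) \<le> s a" unfolding s_def
            using member_le_sum[OF hk, of "\<lambda>(h, k). cmod (sw_fun G h k a)"] P(1) by auto
          finally show "cmod (sw_fun G h k (complex_of_real t *\<^sub>C a)) < e" using t by (simp add: order_le_less_trans)
        qed
        then show ?thesis using t xi bop_mem[OF rb[OF a] xi] by (simp add: rscale[OF a] H.scale_right norm_mult)
      qed
      show ?thesis
      proof (cases "s a = 0")
        case True
        have "\<not> cmod (?f a) > 0"
        proof
          assume p: "cmod (?f a) > 0"
          then show False using scal[of "1 / cmod (?f a)"] P(2) True by simp
        qed
        then show ?thesis using s0[of a] True by simp
      next
        case False
        then have p: "s a > 0" using s0[of a] by simp
        then have "e / (2 * s a) * cmod (?f a) < 1" using P(2) by (intro scal) auto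
        then show ?thesis using p P(2) by (simp add: field_simps)
      qed
    qed
    \<comment> \<open>Each pair of sequences contributes two components, selected by the Boolean index, because
       \<open>|\<langle>h, b\<^sup>* b k\<rangle>| \<le> \<parallel>b h\<parallel>\<^sup>2 + \<parallel>b k\<parallel>\<^sup>2\<close>.\<close>
    let ?L = "hsum (UNIV :: nat set) G" and ?J = "P \<times> (UNIV :: bool set)"
    let ?K = "hsum ?J ?L"
    interpret L: hilb ?L by (rule hsum_hilb)
    interpret LL: hilb2 ?L ?L ..
    interpret K: hilb ?K by (rule L.hsum_hilb)
    interpret KH: hilb2 ?K H ..
    interpret KK: hilb2 ?K ?K ..
    have J: "finite ?J" using P(1) by simp
    define m where "m = complex_of_real (sqrt (2 / e))"
    define w where "w j = (if j \<in> ?J then m *\<^sub>C (if snd j then fst (fst j) else snd (fst j)) else 0)" for j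
    have wL: "w j \<in> hset ?L" for j 
      using P(3)[of "fst (fst j)" "snd (fst j)"] unfolding w_def by (auto simp: square_summable_hsum)
    have w: "w \<in> hset ?K" unfolding L.hsum_finite_mem[OF J] using wL by (auto simp: w_def)
    define aL where "aL b = amp (UNIV :: nat set) b" for b :: "'g \<Rightarrow> 'g"
    define aK where "aK b = L.amp ?J (aL b)" for b :: "'g \<Rightarrow> 'g"
    have aLb: "aL b \<in> bop ?L ?L" if "b \<in> B" for b unfolding aL_def by (rule amp_bop[OF B_bop[OF that]])
    have aKb: "aK b \<in> bop ?K ?K" if "b \<in> B" for b unfolding aK_def by (rule L.amp_bop[OF aLb[OF that]])
    have aL_apply: "aL b h n = b (h n)" if "h \<in> hset ?L" for b h n unfolding aL_def by (rule amp_apply[OF that])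
    have aK_apply: "aK b u j = aL b (u j)" if "u \<in> hset ?K" for b u j unfolding aK_def by (rule L.amp_apply[OF that])
    have bound: "hnorm H (r b xi) \<le> 1 * hnorm ?K (aK b w)" if b: "b \<in> B" for b
    proof -
      have bb: "adj G G b \<circ> b \<in> B" by (rule B_comp[OF B_adj[OF b] b])
      have e1: "?f (adj G G b \<circ> b) = complex_of_real ((hnorm H (r b xi))\<^sup>2)"
        using HH.adj_ip'[OF rb[OF b] xi bop_mem[OF rb[OF b] xi]] H.self_eq[OF bop_mem[OF rb[OF b] xi]]
        by (simp add: rcomp[OF B_adj[OF b] b] radj[OF b])
      have e2: "cmod (sw_fun G h k (adj G G b \<circ> b)) \<le> (hnorm ?L (aL b h))\<^sup>2 + (hnorm ?L (aL b k))\<^sup>2" if hk: "(h, k) \<in> P" for h k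
      proof -
        have q: "square_summable G h" "square_summable G k" using P(3)[OF hk] by auto
        then have qL: "h \<in> hset ?L" "k \<in> hset ?L" by (auto simp: square_summable_hsum)
        note am = bop_mem[OF aLb[OF b] qL(1)] bop_mem[OF aLb[OF b] qL(2)]
        have "sw_fun G h k (adj G G b \<circ> b) = (\<Sum>n. hip G (aL b h n) (aL b k n))"
          using GG.adj_ip'[OF B_bop[OF b] square_summable_mem[OF q(1)] B_mem[OF b square_summable_mem[OF q(2)]]]
          by (simp add: aL_apply[OF qL(1)] aL_apply[OF qL(2)])
        also have "\<dots> = hip ?L (aL b h) (aL b k)" by (rule sums_unique[OF hsum_ip_sums[OF am], symmetric])
        finally have "cmod (sw_fun G h k (adj G G b \<circ> b)) \<le> hnorm ?L (aL b h) * hnorm ?L (aL b k)"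
          using L.cauchy_schwarz[OF am] by simp
        moreover have "hnorm ?L (aL b h) * hnorm ?L (aL b k) \<le> (hnorm ?L (aL b h))\<^sup>2 + (hnorm ?L (aL b k))\<^sup>2"
          using sum_squares_bound[of "hnorm ?L (aL b h)" "hnorm ?L (aL b k)"] mult_nonneg_nonneg[OF L.norm_nonneg[OF am(1)] L.norm_nonneg[OF am(2)]]
          by linarith
        ultimately show ?thesis by linarith
      qed
      have wj: "(hnorm ?L (aL b (w ((h, k), t))))\<^sup>2 = 2 / e * (hnorm ?L (aL b (if t then h else k)))\<^sup>2" if hk: "(h, k) \<in> P" for h k t
      proof -
        have qL: "h \<in> hset ?L" "k \<in> hset ?L" using P(3)[OF hk] by (auto simp: square_summable_hsum)
        then have q: "(if t then h else k) \<in> hset ?L" by simp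
        have "w ((h, k), t) = m *\<^sub>C (if t then h else k)" using hk by (simp add: w_def)
        then have "aL b (w ((h, k), t)) = m *\<^sub>C aL b (if t then h else k)" using bop_scale[OF aLb[OF b] q] by simp
        then have "(hnorm ?L (aL b (w ((h, k), t))))\<^sup>2 = (cmod m * hnorm ?L (aL b (if t then h else k)))\<^sup>2"
          using L.norm_scale[OF bop_mem[OF aLb[OF b] q]] by simp
        moreover have "(cmod m)\<^sup>2 = 2 / e" unfolding m_def using P(2) by simp
        ultimately show ?thesis by (simp only: power_mult_distrib)
      qed
      have "(hnorm H (r b xi))\<^sup>2 \<le> 2 / e * s (adj G G b \<circ> b)" using fle[OF bb] unfolding e1 norm_of_real by simp
      also have "\<dots> \<le> 2 / e * (\<Sum>(h, k)\<in>P. (hnorm ?L (aL b h))\<^sup>2 + (hnorm ?L (aL b k))\<^sup>2)"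
        unfolding s_def by (rule mult_left_mono[OF sum_mono]) (use e2 P(2) in auto)
      also have "\<dots> = (\<Sum>p\<in>P. \<Sum>t\<in>UNIV. (hnorm ?L (aL b (w (p, t))))\<^sup>2)"
        unfolding sum_distrib_left
      proof (rule sum.cong[OF refl])
        fix p assume "p \<in> P"
        then show "2 / e * (case p of (h, k) \<Rightarrow> (hnorm ?L (aL b h))\<^sup>2 + (hnorm ?L (aL b k))\<^sup>2) = (\<Sum>t\<in>UNIV. (hnorm ?L (aL b (w (p, t))))\<^sup>2)"
          using wj[of "fst p" "snd p"] by (cases p) (simp add: UNIV_bool distrib_left add_divide_distrib)
      qed
      also have "\<dots> = (\<Sum>j\<in>?J. (hnorm ?L (aL b (w j)))\<^sup>2)" by (simp add: sum.cartesian_product)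
      also have "\<dots> = (hnorm ?K (aK b w))\<^sup>2"
        using L.hsum_norm_sq[OF bop_mem[OF aKb[OF b] w]] J by (simp add: aK_apply[OF w])
      finally show ?thesis using power2_le_imp_le[OF _ K.norm_nonneg[OF bop_mem[OF aKb[OF b] w]]] by simp
    qed
    let ?A = "\<lambda>b. aK b w" and ?F = "\<lambda>b. r b xi"
    have A: "?A b \<in> hset ?K" if "b \<in> B" for b by (rule bop_mem[OF aKb[OF that] w])
    have Aadd: "?A (a + b) = ?A a + ?A b" for a b
      by (intro ext) (simp add: aK_apply[OF w] aL_apply[OF wL])
    have Ascale: "?A (c *\<^sub>C b) = c *\<^sub>C ?A b" for c b
      by (intro ext) (simp add: aK_apply[OF w] aL_apply[OF wL])
    have Acomp: "aK a (?A b) = ?A (a \<circ> b)" if "b \<in> B" for a b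
      by (intro ext) (simp add: aK_apply[OF A[OF that]] aK_apply[OF w] aL_apply[OF wL] aL_apply[OF bop_mem[OF aLb[OF that] wL]])
    obtain T where T: "T \<in> bop ?K H" "\<And>b. b \<in> B \<Longrightarrow> T (?A b) = ?F b"
      "\<And>x. x \<in> hset ?K \<Longrightarrow> (\<And>b. b \<in> B \<Longrightarrow> hip ?K (?A b) x = 0) \<Longrightarrow> T x = 0"
    proof (rule KH.extension[of B ?A ?F 1, OF B_subspace A Aadd Ascale])
      show "\<And>b. b \<in> B \<Longrightarrow> ?F b \<in> hset H" using bop_mem[OF rb xi] .
      show "\<And>a b. a \<in> B \<Longrightarrow> b \<in> B \<Longrightarrow> ?F (a + b) = ?F a + ?F b" by (simp add: radd)
      show "\<And>b c. b \<in> B \<Longrightarrow> ?F (c *\<^sub>C b) = c *\<^sub>C ?F b" by (simp add: rscale)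
      show "\<And>b. b \<in> B \<Longrightarrow> hnorm H (?F b) \<le> 1 * hnorm ?K (?A b)" by (rule bound)
    qed (simp | (rule that; blast))+
    have comm: "T \<circ> aK c = r c \<circ> T" if c: "c \<in> B" for c
    proof (rule KH.extension_commute[of B ?A T "aK c" "r c", OF B_subspace A Aadd Ascale T(1,3) aKb[OF c] rb[OF c]])
      fix b assume b: "b \<in> B"
      show "T (aK c (?A b)) = r c (T (?A b))"
        using T(2)[OF b] T(2)[OF B_comp[OF c b]] Acomp[OF b] rcomp[OF c b] by simp
      have "adj ?L ?L (aL c) = aL (adj G G c)" unfolding aL_def by (rule amp_adj[OF B_bop[OF c]])
      then have "adj ?K ?K (aK c) = aK (adj G G c)" unfolding aK_def L.amp_adj[OF aLb[OF c]] by simp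
      then show "adj ?K ?K (aK c) (?A b) \<in> ?A ` B" using Acomp[OF b] B_comp[OF B_adj[OF c] b] by auto
    qed
    have "aK (id_on (hset G)) w = w"
      by (intro ext) (simp add: aK_apply[OF w] aL_apply[OF wL], simp add: id_on_def hsum_comp[OF wL])
    then have Tw: "T w = xi" using T(2)[OF id] rid xi by (simp add: id_on_def)
    \<comment> \<open>The restriction of \<open>T\<close> to a single copy of \<open>G\<close> is an intertwiner.\<close>
    have el: "T (inj_at j (inj_at n g)) \<in> X" if j: "j \<in> ?J" and g: "g \<in> hset G" for j n g
    proof -
      let ?x = "T \<circ> ((\<lambda>u. if u \<in> hset ?L then inj_at j u else 0) \<circ> (\<lambda>u. if u \<in> hset G then inj_at n u else 0))"
      have x: "?x \<in> bop G H"
        by (rule K.bop_comp[OF L.bop_comp[OF at_bop L.at_bop[OF j]] T(1)]) simp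
      have xa: "?x u = T (inj_at j (inj_at n u))" if "u \<in> hset G" for u using that at_mem[OF that, of n UNIV] by simp
      have "r c \<circ> ?x = ?x \<circ> c" if c: "c \<in> B" for c
      proof (rule bop_eqI[OF H.bop_comp[OF x rb[OF c]] bop_comp[OF B_bop[OF c] x]])
        fix u assume u: "u \<in> hset G"
        have nL: "inj_at n u \<in> hset ?L" by (rule at_mem[OF u]) simp
        have "aK c (inj_at j (inj_at n u)) = inj_at j (inj_at n (c u))"
          unfolding aK_def L.amp_at[OF aLb[OF c] nL j] unfolding aL_def amp_at[OF B_bop[OF c] u UNIV_I] ..
        then have "r c (?x u) = T (inj_at j (inj_at n (c u)))" using comm[OF c] xa[OF u] by (metis comp_apply)
        then show "(r c \<circ> ?x) u = (?x \<circ> c) u" using xa[OF B_mem[OF c u]] by simp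
      qed
      then have "?x \<in> intertwiners G B H r" by (rule intertwinersI[OF x])
      then show ?thesis unfolding X_def using xa[OF g] g by (intro CollectI exI[of _ ?x] exI[of _ g]) simp
    qed
    have SX: "complex_vector.span X \<subseteq> hset H" by (rule H.span_mem[OF XH])
    have closed_subspace: "H.closed_subspace (hcl H (complex_vector.span X))" by (rule H.closed_subspace_hcl[OF complex_vector.subspace_span SX])
    have comp: "T (inj_at j (w j)) \<in> hcl H (complex_vector.span X)" if j: "j \<in> ?J" for j
    proof -
      let ?t = "T \<circ> (\<lambda>u. if u \<in> hset ?L then inj_at j u else 0)"
      interpret LH: hilb2 ?L H ..
      have t: "?t \<in> bop ?L H" by (rule K.bop_comp[OF L.at_bop[OF j] T(1)])
      let ?Y = "{inj_at n g |n g. n \<in> (UNIV :: nat set) \<and> g \<in> hset G}"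
      obtain y where y: "\<And>n. y n \<in> complex_vector.span ?Y" "hlim ?L y (w j)"
        using wL[of j] at_total[of "UNIV :: nat set"] unfolding hcl_def by blast
      have YL: "?Y \<subseteq> hset ?L" by (auto intro!: at_mem)
      have "?t z \<in> complex_vector.span X" if z: "z \<in> complex_vector.span ?Y" for z
      proof -
        have "z \<in> {z \<in> hset ?L. ?t z \<in> complex_vector.span X}"
        proof (rule complex_vector.span_subspace_induct[OF z])
          show "complex_vector.subspace {z \<in> hset ?L. ?t z \<in> complex_vector.span X}"
            by (rule complex_vector.subspaceI)
              (simp_all only: mem_Collect_eq bop_zero[OF t] bop_add[OF t] bop_scale[OF t] L.zero_mem L.add_mem L.scale_mem
                complex_vector.span_zero complex_vector.span_add complex_vector.span_scale simp_thms)
          show "z \<in> {z \<in> hset ?L. ?t z \<in> complex_vector.span X}" if "z \<in> ?Y" for z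
            using that el[OF j] YL by (auto intro!: complex_vector.span_base at_mem)
        qed
        then show ?thesis by auto
      qed
      then have "?t (w j) \<in> hcl H (complex_vector.span X)" unfolding hcl_def
        using LH.bop_hlim[OF t y(2)] y(1) by (intro CollectI exI[of _ "\<lambda>n. ?t (y n)"]) blast
      then show ?thesis using wL[of j] by simp
    qed
    have "T w = (\<Sum>j\<in>?J. T (inj_at j (w j)))"
      by (subst L.at_decomp[OF J w], rule K.bop_sum[OF T(1)], rule L.at_mem[OF wL])
    also have "\<dots> \<in> hcl H (complex_vector.span X)"
      using closed_subspace comp unfolding H.closed_subspace_def by (intro complex_vector.subspace_sum) auto
    finally show ?thesis using Tw by simp
  qed
  then show ?thesis using H.hcl_mem unfolding X_def by blast
qed

section \<open>Normality of the commutant action\<close>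

lemma id_on_apply: "x \<in> S \<Longrightarrow> id_on S x = x" by (simp add: id_on_def)

text \<open>
  Fubini for a countable family of series, with the double series enumerated as a single one.
\<close>

lemma double_sums:
  fixes f :: "nat \<Rightarrow> nat \<Rightarrow> complex" and g :: "nat \<Rightarrow> nat \<Rightarrow> real"
  assumes le: "\<And>n m. cmod (f n m) \<le> C * g n m" and g0: "\<And>n m. 0 \<le> g n m"
    and g: "\<And>n. g n sums a n" and a: "summable a" and f: "\<And>n. f n sums F n"
  shows "summable (\<lambda>N. g (fst (prod_decode N)) (snd (prod_decode N)))"
    "(\<lambda>N. f (fst (prod_decode N)) (snd (prod_decode N))) sums (\<Sum>n. F n)"
proof -
  let ?g = "\<lambda>p. g (fst p) (snd p)" and ?f = "\<lambda>p. f (fst p) (snd p)"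
  have bij: "bij_betw prod_decode UNIV (UNIV :: (nat \<times> nat) set)" by (rule bij_prod_decode)
  have a0: "0 \<le> a n" for n using sums_le[OF _ sums_zero g, of n] g0 by simp
  have gs: "?g summable_on Sigma UNIV (\<lambda>_. UNIV)"
  proof (rule summable_on_SigmaI)
    show "((\<lambda>y. ?g (n, y)) has_sum a n) UNIV" for n
      using norm_summable_imp_has_sum[of "g n" "a n"] g g0 sums_summable[OF g] by simp
    show "a summable_on UNIV" using a a0 summable_on_UNIV_nonneg_real_iff by blast
  qed (use g0 in auto)
  then have "(\<lambda>N. ?g (prod_decode N)) summable_on UNIV"
    using summable_on_reindex_bij_betw[OF bij, of ?g] by simp
  then show "summable (\<lambda>N. g (fst (prod_decode N)) (snd (prod_decode N)))"
    using summable_on_imp_summable by blast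
  have "(\<lambda>p. C * ?g p) summable_on Sigma UNIV (\<lambda>_. UNIV)" by (rule summable_on_cmult_right[OF gs])
  then have "(\<lambda>p. norm (?f p)) summable_on Sigma UNIV (\<lambda>_. UNIV)"
    by (rule summable_on_comparison_test) (use le in auto)
  then have fs: "(?f has_sum infsum ?f (Sigma UNIV (\<lambda>_. UNIV))) (Sigma UNIV (\<lambda>_. UNIV))"
    by (rule has_sum_infsum[OF Infinite_Sum.abs_summable_summable])
  have "((\<lambda>y. ?f (n, y)) has_sum F n) UNIV" for n
  proof -
    have "summable (\<lambda>m. norm (f n m))"
      by (rule summable_comparison_test'[of "\<lambda>m. C * g n m" 0]) (use le sums_summable[OF g] in \<open>auto intro: summable_mult\<close>)
    then show ?thesis using norm_summable_imp_has_sum[OF _ f, of n] by simp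
  qed
  then have "(F has_sum infsum ?f (Sigma UNIV (\<lambda>_. UNIV))) UNIV" by (rule has_sum_SigmaD[OF fs])
  then have "F sums infsum ?f (Sigma UNIV (\<lambda>_. UNIV))" by (rule has_sum_imp_sums)
  moreover have "(\<lambda>N. ?f (prod_decode N)) sums infsum ?f (Sigma UNIV (\<lambda>_. UNIV))"
    using fs has_sum_reindex_bij_betw[OF bij, of ?f] by (intro has_sum_imp_sums) simp
  ultimately show "(\<lambda>N. f (fst (prod_decode N)) (snd (prod_decode N))) sums (\<Sum>n. F n)"
    by (simp add: sums_iff)
qed

lemma (in hilb) polarization:
  assumes T: "T \<in> bop H H" and h: "h \<in> hset H" and k: "k \<in> hset H"
  shows "hip H h (T k) = (hip H (h + 1 *\<^sub>C k) (T (h + 1 *\<^sub>C k)) - hip H (h + (-1) *\<^sub>C k) (T (h + (-1) *\<^sub>C k))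
     + (- \<i>) * hip H (h + \<i> *\<^sub>C k) (T (h + \<i> *\<^sub>C k)) + \<i> * hip H (h + (-\<i>) *\<^sub>C k) (T (h + (-\<i>) *\<^sub>C k))) / 4"
proof -
  have e: "hip H (h + w *\<^sub>C k) (T (h + w *\<^sub>C k)) = hip H h (T h) + w * hip H h (T k) + cnj w * hip H k (T h) + cnj w * w * hip H k (T k)" for w
    using h k bop_mem[OF T] by (simp add: bop_add[OF T] bop_scale[OF T] bilin algebra_simps)
  show ?thesis unfolding e by (simp add: algebra_simps)
qed

text \<open>
  A \<open>\<sigma>\<close>-weak functional given by a square summable sequence in \<open>H\<close> pulls back to a countable sum of such functionals on
  \<open>K\<close>, which is a single one by \<open>double_sums\<close>; the value at the identity shows that the combined sequence is square
  summable.  Polarization takes care of functionals with two different sequences.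
\<close>

lemma normal_map_vector_states:
  assumes "hilb K" "hilb H" and A: "A \<subseteq> bop K K" "id_on (hset K) \<in> A"
    and p: "\<And>a. a \<in> A \<Longrightarrow> p a \<in> bop H H" "p (id_on (hset K)) = id_on (hset H)"
    and vs: "\<And>h. h \<in> hset H \<Longrightarrow> \<exists>u. (\<forall>m. u m \<in> hset K) \<and> (\<forall>a\<in>A. (\<lambda>m. hip K (u m) (a (u m))) sums hip H h (p a h))"
  shows "normal_map K A H p"
proof -
  interpret K: hilb K by fact
  interpret H: hilb H by fact
  interpret L: hilb "hsum (UNIV :: nat set) H" by (rule H.hsum_hilb)
  have ts: "topspace (subtopology (sigma_weak_top K) A) = A" using A by (auto simp: K.topspace_sigma_weak)
  have diag: "continuous_map (subtopology (sigma_weak_top K) A) euclidean (\<lambda>a. hip (hsum UNIV H) h (H.amp UNIV (p a) h))"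
    if h: "h \<in> hset (hsum (UNIV :: nat set) H)" for h
  proof -
    have hm: "h n \<in> hset H" for n by (rule H.hsum_comp[OF h])
    have "\<forall>n. \<exists>u. (\<forall>m. u m \<in> hset K) \<and> (\<forall>a\<in>A. (\<lambda>m. hip K (u m) (a (u m))) sums hip H (h n) (p a (h n)))"
      using vs hm by blast
    then obtain u where u: "\<And>n m. u n m \<in> hset K" "\<And>n a. a \<in> A \<Longrightarrow> (\<lambda>m. hip K (u n m) (a (u n m))) sums hip H (h n) (p a (h n))"
      by metis
    define v where "v N = u (fst (prod_decode N)) (snd (prod_decode N))" for N
    have us: "(\<lambda>m. (hnorm K (u n m))\<^sup>2) sums (hnorm H (h n))\<^sup>2" for n
    proof -
      have "(\<lambda>m. complex_of_real ((hnorm K (u n m))\<^sup>2)) sums complex_of_real ((hnorm H (h n))\<^sup>2)"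
        using u(2)[OF A(2), of n] K.self_eq[OF u(1)] H.self_eq[OF hm] by (simp add: p(2) id_on_apply u(1) hm)
      then show ?thesis by (simp only: sums_of_real_iff)
    qed
    have hs: "summable (\<lambda>n. (hnorm H (h n))\<^sup>2)" using h H.square_summable_hsum unfolding square_summable_def by blast
    have key: "summable (\<lambda>N. (hnorm K (v N))\<^sup>2) \<and> (\<lambda>N. hip K (v N) (a (v N))) sums hip (hsum UNIV H) h (H.amp UNIV (p a) h)"
      if a: "a \<in> A" for a
    proof -
      have ab: "a \<in> bop K K" using A a by blast
      obtain k where k: "k \<ge> 0" "\<And>x. x \<in> hset K \<Longrightarrow> hnorm K (a x) \<le> k * hnorm K x" using K.bop_bound[OF ab] by blast
      have le: "cmod (hip K (u n m) (a (u n m))) \<le> k * (hnorm K (u n m))\<^sup>2" for n m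
        using K.cauchy_schwarz[OF u(1) bop_mem[OF ab u(1)], of n m n m]
          mult_left_mono[OF k(2)[OF u(1)[of n m]] K.norm_nonneg[OF u(1)[of n m]]] by (simp add: power2_eq_square mult_ac)
      note d = double_sums[of "\<lambda>n m. hip K (u n m) (a (u n m))" k, OF le _ us hs u(2)[OF a]]
      have hq: "square_summable H h" using h H.square_summable_hsum by blast
      have "(\<Sum>n. hip H (h n) (p a (h n))) = hip (hsum UNIV H) h (H.amp UNIV (p a) h)"
        by (rule sums_unique[OF H.sw_fun_hsum[OF hq hq p(1)[OF a]], symmetric])
      then show ?thesis using d by (simp add: v_def)
    qed
    have "square_summable K v" unfolding square_summable_def using key[OF A(2)] u(1) by (auto simp: v_def)
    then have "continuous_map (subtopology (sigma_weak_top K) A) euclidean (sw_fun K v v)"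
      by (intro continuous_map_from_subtopology K.sw_fun_continuous)
    then show ?thesis
      by (rule continuous_map_eq) (use key sums_unique ts in metis)
  qed
  have mc: "continuous_map (subtopology (sigma_weak_top K) A) euclidean (\<lambda>a. c * f a)"
    if "continuous_map (subtopology (sigma_weak_top K) A) euclidean f" for c :: complex and f
  proof -
    have "continuous_map euclidean euclidean (\<lambda>z. c * z)" by (simp add: continuous_on_mult_left)
    from continuous_map_compose[OF that this] show ?thesis by (simp add: comp_def)
  qed
  show ?thesis
  proof (subst normal_map_iff[OF assms(1,2) A(1) p(1)], assumption, intro allI impI)
    fix h k assume hk: "square_summable H h \<and> square_summable H k"
    then have L: "h \<in> hset (hsum UNIV H)" "k \<in> hset (hsum UNIV H)" using H.square_summable_hsum by auto
    let ?d = "\<lambda>w a. hip (hsum UNIV H) (h + w *\<^sub>C k) (H.amp UNIV (p a) (h + w *\<^sub>C k))"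
    have d: "continuous_map (subtopology (sigma_weak_top K) A) euclidean (?d w)" for w
      by (rule diag) (use L in simp)
    have "continuous_map (subtopology (sigma_weak_top K) A) euclidean
       (\<lambda>a. (1/4) * (?d 1 a + (-1) * ?d (-1) a + (- \<i>) * ?d \<i> a + \<i> * ?d (-\<i>) a))"
      by (intro mc continuous_map_add d)
    then show "continuous_map (subtopology (sigma_weak_top K) A) euclidean (\<lambda>a. sw_fun H h k (p a))"
    proof (rule continuous_map_eq)
      fix a assume "a \<in> topspace (subtopology (sigma_weak_top K) A)"
      then have a: "a \<in> A" using ts by simp
      have "sw_fun H h k (p a) = hip (hsum UNIV H) h (H.amp UNIV (p a) k)"
        using sums_unique[OF H.sw_fun_hsum[OF _ _ p(1)[OF a]], of h k] hk by simp
      also have "\<dots> = (?d 1 a - ?d (-1) a + (- \<i>) * ?d \<i> a + \<i> * ?d (-\<i>) a) / 4"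
        by (rule L.polarization[OF H.amp_bop[OF p(1)[OF a]] L])
      finally show "(1/4) * (?d 1 a + (-1) * ?d (-1) a + (- \<i>) * ?d \<i> a + \<i> * ?d (-\<i>) a) = sw_fun H h k (p a)"
        by simp
    qed
  qed
qed

context hmod
begin

lemma commutant_mem: "c \<in> commutant G B \<Longrightarrow> g \<in> hset G \<Longrightarrow> c g \<in> hset G"
  using bop_mem[OF commutant_bop] .

lemma tens_right_add:
  assumes "c \<in> commutant G B" "d \<in> commutant G B" shows "tens_right G E (c + d) = tens_right G E c + tens_right G E d"
proof -
  interpret C: vna G "commutant G B" by (rule vna_commutant)
  show ?thesis
    by (rule bop_agree_tens[OF H.hilb_axioms tens_right_bop[OF C.B_add[OF assms]] HH.bop_add_closed[OF assms[THEN tens_right_bop]]])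
      (simp add: tens_right_apply C.B_add assms commutant_mem tens_add_right)
qed

lemma tens_right_scale:
  assumes "c \<in> commutant G B" shows "tens_right G E (z *\<^sub>C c) = z *\<^sub>C tens_right G E c"
proof -
  interpret C: vna G "commutant G B" by (rule vna_commutant)
  show ?thesis
    by (rule bop_agree_tens[OF H.hilb_axioms tens_right_bop[OF C.B_scale[OF assms]] HH.bop_scale_closed[OF tens_right_bop[OF assms]]])
      (simp add: tens_right_apply C.B_scale assms commutant_mem tens_scale_right)
qed

lemma tens_right_comp:
  assumes "c \<in> commutant G B" "d \<in> commutant G B" shows "tens_right G E (c \<circ> d) = tens_right G E c \<circ> tens_right G E d"
proof -
  interpret C: vna G "commutant G B" by (rule vna_commutant)
  show ?thesis
    by (rule bop_agree_tens[OF H.hilb_axioms tens_right_bop[OF C.B_comp[OF assms]] H.bop_comp[OF assms(2,1)[THEN tens_right_bop]]])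
      (simp add: tens_right_apply C.B_comp assms commutant_mem)
qed

lemma tens_right_id: "tens_right G E (id_on (hset G)) = id_on (hset HH)"
  by (rule bop_agree_tens[OF H.hilb_axioms tens_right_bop[OF commutant_id] H.id_on_bop])
    (simp add: tens_right_apply commutant_id id_on_apply tens_mem)

text \<open>
  The map \<open>c w \<mapsto> (id \<odot> c) \<xi>\<close> is isometric, so that a sequence with \<open>(id \<odot> c\<^sub>n) \<xi> \<longlonglongrightarrow> h\<close> yields a convergent
  sequence \<open>c\<^sub>n w\<close> in \<open>G\<close>, whose limit is the vector \<open>u\<close>.
\<close>

lemma state_of_limit:
  assumes xi: "xi \<in> hset HH" and w: "w \<in> hset G"
    and e: "\<And>c. c \<in> commutant G B \<Longrightarrow> hip G w (c w) = hip HH xi (tens_right G E c xi)"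
    and h: "h \<in> hcl HH ((\<lambda>c. tens_right G E c xi) ` commutant G B)"
  shows "\<exists>u\<in>hset G. \<forall>c\<in>commutant G B. hip G u (c u) = hip HH h (tens_right G E c h)"
proof -
  interpret C: vna G "commutant G B" by (rule vna_commutant)
  let ?R = "tens_right G E"
  obtain s where s: "\<And>n. s n \<in> (\<lambda>c. ?R c xi) ` commutant G B" "hlim HH s h" using h unfolding hcl_def by blast
  then have "\<forall>n. \<exists>c\<in>commutant G B. s n = ?R c xi" by blast
  then obtain c where c: "\<And>n. c n \<in> commutant G B" "\<And>n. s n = ?R (c n) xi" by metis
  have lim: "hlim HH (\<lambda>n. ?R (c n) xi) h" using s(2) by (simp flip: c(2))
  have cm: "d w \<in> hset G" if "d \<in> commutant G B" for d using commutant_mem[OF that w] .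
  have Rm: "?R d xi \<in> hset HH" if "d \<in> commutant G B" for d using bop_mem[OF tens_right_bop[OF that] xi] .
  have ip: "hip G (a w) (d (b w)) = hip HH (?R a xi) (?R d (?R b xi))"
    if "a \<in> commutant G B" "d \<in> commutant G B" "b \<in> commutant G B" for a b d
  proof -
    note ad = C.B_adj[OF that(1)] and db = C.B_comp[OF that(2,3)]
    have "hip G (a w) (d (b w)) = hip G w ((adj G G a \<circ> (d \<circ> b)) w)"
      using GG.adj_ip'[OF C.B_bop[OF that(1)] w cm[OF db]] by simp
    also have "\<dots> = hip HH xi (?R (adj G G a \<circ> (d \<circ> b)) xi)" by (rule e[OF C.B_comp[OF ad db]])
    also have "\<dots> = hip HH xi (adj HH HH (?R a) (?R d (?R b xi)))"
      by (simp add: tens_right_comp[OF ad db] tens_right_comp[OF that(2,3)] tens_right_adj[OF that(1)])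
    also have "\<dots> = hip HH (?R a xi) (?R d (?R b xi))"
      using HH.adj_ip'[OF tens_right_bop[OF that(1)] xi bop_mem[OF tens_right_bop[OF that(2)] Rm[OF that(3)]]] .
    finally show ?thesis .
  qed
  have nrm: "hnorm G (d w) = hnorm HH (?R d xi)" if d: "d \<in> commutant G B" for d
    using ip[OF d commutant_id d] cm[OF d] Rm[OF d] by (simp add: hnorm_def tens_right_id id_on_apply xi w)
  obtain u where u: "hlim G (\<lambda>n. c n w) u"
  proof (rule complete)
    show "c n w \<in> hset G" for n by (rule cm[OF c(1)])
    fix r :: real assume r: "r > 0"
    have "(\<lambda>n. hnorm HH (?R (c n) xi - h)) \<longlonglongrightarrow> 0" using lim by (simp add: hlim_def)
    then obtain N where N: "\<And>n. n \<ge> N \<Longrightarrow> hnorm HH (?R (c n) xi - h) < r / 2" using LIMSEQ_real_less[of _ "r / 2"] r by (metis half_gt_zero)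
    have "hnorm G (c m w - c n w) < r" if mn: "m \<ge> N" "n \<ge> N" for m n
    proof -
      have "c m - c n = c m + (-1) *\<^sub>C c n" by (simp add: complex_vector.scale_minus_left)
      then have "?R (c m - c n) xi = ?R (c m) xi - ?R (c n) xi"
        using tens_right_add[OF c(1) C.B_scale[OF c(1)], of m "-1" n] tens_right_scale[OF c(1), of "-1" n]
        by (simp add: complex_vector.scale_minus_left)
      then have "hnorm G (c m w - c n w) = hnorm HH (?R (c m) xi - ?R (c n) xi)"
        using nrm[OF C.B_diff[OF c(1) c(1)], of m n] by simp
      moreover have "hnorm HH (?R (c m) xi - ?R (c n) xi) \<le> hnorm HH (?R (c m) xi - h) + hnorm HH (h - ?R (c n) xi)"
        by (rule H.norm_triangle3[OF Rm[OF c(1)] H.hlim_mem(2)[OF lim] Rm[OF c(1)]])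
      moreover have "hnorm HH (h - ?R (c n) xi) = hnorm HH (?R (c n) xi - h)"
        by (rule H.norm_commute[OF H.hlim_mem(2)[OF lim] Rm[OF c(1)]])
      ultimately show ?thesis using N[OF mn(1)] N[OF mn(2)] by linarith
    qed
    then show "\<exists>N. \<forall>m\<ge>N. \<forall>n\<ge>N. hnorm G (c m w - c n w) < r" by blast
  qed blast
  have "hip G u (d u) = hip HH h (?R d h)" if d: "d \<in> commutant G B" for d
  proof (rule LIMSEQ_unique)
    show "(\<lambda>n. hip G (c n w) (d (c n w))) \<longlonglongrightarrow> hip G u (d u)"
      by (rule hlim_ip[OF u GG.bop_hlim[OF commutant_bop[OF d] u]])
    show "(\<lambda>n. hip G (c n w) (d (c n w))) \<longlonglongrightarrow> hip HH h (?R d h)"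
      unfolding ip[OF c(1) d c(1)] by (rule H.hlim_ip[OF lim HH.bop_hlim[OF tens_right_bop[OF d] lim]])
  qed
  then show ?thesis using hlim_mem(2)[OF u] by blast
qed

text \<open>
  With \<open>N = 1 - P\<close> the operator \<open>A = L\<^sub>x\<^sup>* N L\<^sub>x\<close> commutes with \<open>B'\<close> and so is a positive element of \<open>B\<close>.  Then
  \<open>w = \<surd>A g\<close>, since \<open>\<langle>\<surd>A g, c \<surd>A g\<rangle> = \<langle>g, A c g\<rangle> = \<langle>N (x \<odot> g), (id \<odot> c) N (x \<odot> g)\<rangle>\<close> for \<open>c \<in> B'\<close>.
\<close>

lemma state_of_compression:
  assumes C: "H.closed_subspace C" and inv: "\<And>c z. c \<in> commutant G B \<Longrightarrow> z \<in> C \<Longrightarrow> tens_right G E c z \<in> C"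
    and x: "x \<in> mset E" and g: "g \<in> hset G"
  shows "\<exists>w\<in>hset G. \<forall>c\<in>commutant G B.
    hip G w (c w) = hip HH (tn x g - H.proj C (tn x g)) (tens_right G E c (tn x g - H.proj C (tn x g)))"
proof -
  interpret HG: hilb2 HH G ..
  let ?R = "tens_right G E" and ?L = "Lop G E x" and ?P = "H.proj C"
  define N where "N = id_on (hset HH) - ?P"
  have Nb: "N \<in> bop HH HH" unfolding N_def by (rule HH.bop_diff_closed[OF H.id_on_bop H.proj_bop[OF C]])
  have Napp: "N z = z - ?P z" if "z \<in> hset HH" for z using that by (simp add: N_def id_on_def)
  have Nm: "N z \<in> hset HH" if "z \<in> hset HH" for z by (rule bop_mem[OF Nb that])
  have Nsa: "hip HH (N y) z = hip HH y (N z)" if "y \<in> hset HH" "z \<in> hset HH" for y z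
    using H.proj_ip[OF C that] that H.proj_in[OF C] by (simp add: Napp H.bilin)
  have NN: "N (N z) = N z" if z: "z \<in> hset HH" for z
  proof -
    have "?P (N z) = 0" unfolding Napp[OF z]
      by (rule H.proj_zero[OF C]) (use z H.proj_in[OF C z] H.proj_perp[OF C z] in auto)
    then show ?thesis using Napp[OF Nm[OF z]] by simp
  qed
  have NR: "N (?R c z) = ?R c (N z)" if c: "c \<in> commutant G B" and z: "z \<in> hset HH" for c z
  proof -
    note Rb = tens_right_bop[OF c] and Rb' = tens_right_bop[OF commutant_adj[OF c]]
    have "?P (?R c z) = ?R c (?P z)"
      by (rule H.proj_commute[OF C Rb Rb' _ inv[OF c] inv[OF commutant_adj[OF c]] z])
        (simp add: tens_right_adj[OF c] HH.adj_ip[OF Rb])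
    then show ?thesis using Napp[OF z] Napp[OF bop_mem[OF Rb z]] H.bop_diff[OF Rb z H.proj_in[OF C z]] by simp
  qed
  note Lb = Lop_bop[OF x]
  have Lm: "?L h \<in> hset HH" if "h \<in> hset G" for h by (rule bop_mem[OF Lb that])
  define A where "A = adj G HH ?L \<circ> (N \<circ> ?L)"
  have Ab: "A \<in> bop G G" unfolding A_def by (intro H.bop_comp[OF H.bop_comp[OF Lb Nb]] GH.adj_bop Lb)
  have Aip: "hip G h (A k) = hip HH (?L h) (N (?L k))" if "h \<in> hset G" "k \<in> hset G" for h k
    using GH.adj_ip'[OF Lb that(1) Nm[OF Lm[OF that(2)]]] by (simp add: A_def)
  have "A \<in> commutant G (commutant G B)" unfolding commutant_def
  proof (intro CollectI conjI ballI Ab)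
    fix c assume "c \<in> {T \<in> bop G G. \<forall>b\<in>B. T \<circ> b = b \<circ> T}"
    then have c: "c \<in> commutant G B" by (simp add: commutant_def)
    show "A \<circ> c = c \<circ> A"
    proof (rule bop_eqI[OF bop_comp[OF commutant_bop[OF c] Ab] bop_comp[OF Ab commutant_bop[OF c]]])
      fix k assume k: "k \<in> hset G"
      have Lc: "?L (d h) = ?R d (?L h)" if "d \<in> commutant G B" for d h using Lop_right[OF x that] by (simp add: fun_eq_iff)
      have "hip G h (A (c k)) = hip G h (c (A k))" if h: "h \<in> hset G" for h
      proof -
        have "hip G h (A (c k)) = hip HH (?L h) (?R c (N (?L k)))"
          using Aip[OF h commutant_mem[OF c k]] NR[OF c Lm[OF k]] Lc[OF c] by simp
        also have "\<dots> = hip HH (?L (adj G G c h)) (N (?L k))"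
          using HH.adj_ip[OF tens_right_bop[OF c] Nm[OF Lm[OF k]] Lm[OF h]] tens_right_adj[OF c] Lc[OF commutant_adj[OF c]] by simp
        also have "\<dots> = hip G (adj G G c h) (A k)" using Aip[OF commutant_mem[OF commutant_adj[OF c] h] k] by simp
        also have "\<dots> = hip G h (c (A k))" by (rule GG.adj_ip[OF commutant_bop[OF c] bop_mem[OF Ab k] h])
        finally show ?thesis .
      qed
      then have "hip G (A (c k) - c (A k)) (A (c k) - c (A k)) = 0"
        using bop_mem[OF Ab] commutant_mem[OF c] k by (simp add: diff_right)
      then show "(A \<circ> c) k = (c \<circ> A) k"
        using definite[of "A (c k) - c (A k)"] bop_mem[OF Ab] commutant_mem[OF c] k by simp
    qed
  qed
  then have AB: "A \<in> B" by (simp add: bicommutant)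
  have Aadj: "adj G G A = A"
  proof (rule GG.adj_eqI[OF Ab Ab])
    fix h k assume h: "h \<in> hset G" and k: "k \<in> hset G"
    have "hip G (A k) h = cnj (hip G h (A k))" by (rule herm[OF h bop_mem[OF Ab k]])
    also have "\<dots> = hip HH (N (?L k)) (?L h)" using Aip[OF h k] H.herm[OF Lm[OF h] Nm[OF Lm[OF k]]] by simp
    also have "\<dots> = hip G k (A h)" using Nsa[OF Lm[OF k] Lm[OF h]] Aip[OF k h] by simp
    finally show "hip G (A k) h = hip G k (A h)" .
  qed
  have "hip G h (A h) \<in> \<real>\<^sub>\<ge>\<^sub>0" if h: "h \<in> hset G" for h
    using Aip[OF h h] Nsa[OF Lm[OF h] Nm[OF Lm[OF h]]] NN[OF Lm[OF h]] H.pos[OF Nm[OF Lm[OF h]]] by simp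
  then obtain z where z: "z \<in> B" "adj G G z = z" "z \<circ> z = A" using square_root[OF AB Aadj] by blast
  let ?w = "z g" and ?t = "tn x g"
  have t: "?t \<in> hset HH" "?L g = ?t" using tens_mem[OF x g] Lop_apply[OF g] by auto
  have "hip G ?w (c ?w) = hip HH (N ?t) (?R c (N ?t))" if c: "c \<in> commutant G B" for c
  proof -
    have "hip G ?w (c ?w) = hip G (z g) (z (c g))" using commutant_comm[OF c z(1)] by simp
    also have "\<dots> = hip G g (A (c g))"
      using GG.adj_ip[OF B_bop[OF z(1)] B_mem[OF z(1) commutant_mem[OF c g]] g] z(2,3) by (simp add: fun_eq_iff)
    also have "\<dots> = hip HH ?t (N (?R c ?t))"
      using Aip[OF g commutant_mem[OF c g]] tens_right_apply[OF c x g] Lop_apply commutant_mem[OF c g] t by simp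
    also have "\<dots> = hip HH ?t (N (N (?R c ?t)))" using NN[OF bop_mem[OF tens_right_bop[OF c] t(1)]] by simp
    also have "\<dots> = hip HH (N ?t) (N (?R c ?t))" using Nsa[OF t(1) Nm[OF bop_mem[OF tens_right_bop[OF c] t(1)]]] by simp
    also have "\<dots> = hip HH (N ?t) (?R c (N ?t))" using NR[OF c t(1)] by simp
    finally show ?thesis .
  qed
  then show ?thesis unfolding Napp[OF t(1)] using B_mem[OF z(1) g] by blast
qed

text \<open>
  Countably many elementary tensors \<open>e m\<close> suffice to approximate \<open>h\<close>.  Let \<open>K n\<close> be the closed invariant subspace
  generated by the first \<open>n\<close> of them, and \<open>d n\<close> the component of \<open>h\<close> in \<open>K (Suc n)\<close> orthogonal to \<open>K n\<close>.  The functional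
  of \<open>h\<close> is the sum of those of the \<open>d n\<close>, as distinct components are orthogonal even after the action of \<open>B'\<close>; and
  \<open>d n\<close> is in the closure of the cyclic subspace of \<open>e n - P n (e n)\<close>, so that \<open>state_of_compression\<close> and \<open>state_of_limit\<close>
  apply.
\<close>

lemma vector_state:
  assumes h: "h \<in> hset HH"
  shows "\<exists>u. (\<forall>m. u m \<in> hset G) \<and> (\<forall>c\<in>commutant G B. (\<lambda>m. hip G (u m) (c (u m))) sums hip HH h (tens_right G E c h))"
proof -
  interpret C: vna G "commutant G B" by (rule vna_commutant)
  let ?R = "tens_right G E" and ?B' = "commutant G B"
  obtain s where s: "\<And>n. s n \<in> complex_vector.span elem" "hlim HH s h" using h tens_total unfolding hcl_def by blast
  have "\<forall>n. \<exists>F. finite F \<and> F \<subseteq> elem \<and> s n \<in> complex_vector.span F"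
  proof
    fix n
    obtain c where c: "c \<in> fsupp elem" "s n = lincomb (\<lambda>x. x) c" using s(1)[of n] lincomb_span[of "\<lambda>x. x" elem] by auto
    have "s n \<in> complex_vector.span {p. c p \<noteq> 0}" unfolding c(2) lincomb_def
      by (intro complex_vector.span_sum complex_vector.span_scale complex_vector.span_base)
    then show "\<exists>F. finite F \<and> F \<subseteq> elem \<and> s n \<in> complex_vector.span F" using c(1) unfolding fsupp_def by blast
  qed
  from choice[OF this] obtain F where F': "\<forall>n. finite (F n) \<and> F n \<subseteq> elem \<and> s n \<in> complex_vector.span (F n)" ..
  then have F: "finite (F n)" "F n \<subseteq> elem" "s n \<in> complex_vector.span (F n)" for n by (simp_all only: simp_thms)
  \<comment> \<open>The zero vector \<open>tn 0 0\<close> is added to have a nonempty set to enumerate.\<close>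
  define X where "X = insert (tn 0 0) (\<Union>n. F n)"
  have "tn 0 0 \<in> elem" by (rule CollectI, rule exI[of _ 0], rule exI[of _ 0]) simp
  then have X3: "X \<subseteq> elem" unfolding X_def insert_subset UN_subset_iff using F(2) by (intro conjI ballI)
  have X12: "countable X" "X \<noteq> {}" unfolding X_def
    by (intro countable_insert countable_UN countable_finite[OF F(1)]) simp_all
  note X = X12 X3
  define e where "e = from_nat_into X"
  have re: "range e = X" unfolding e_def by (rule range_from_nat_into[OF X(2,1)])
  have eelem: "e m \<in> elem" for m using re X(3) by blast
  have em: "e m \<in> hset HH" for m using eelem elem_mem by blast
  have "s n \<in> complex_vector.span (range e)" for n
    using F(3)[of n] complex_vector.span_mono[of "F n" "range e"] unfolding re X_def by blast
  then have hX: "h \<in> hcl HH (complex_vector.span (range e))" using s(2) unfolding hcl_def by blast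
  define S where "S n = {?R c (e m) |m c. m < n \<and> c \<in> ?B'}" for n
  have SH: "S n \<subseteq> hset HH" for n unfolding S_def using bop_mem[OF tens_right_bop em] by auto
  define K where "K n = hcl HH (complex_vector.span (S n))" for n
  have spH: "complex_vector.span (S n) \<subseteq> hset HH" for n by (rule H.span_mem[OF SH])
  have K: "H.closed_subspace (K n)" for n unfolding K_def by (rule H.closed_subspace_hcl[OF complex_vector.subspace_span spH])
  have KH: "K n \<subseteq> hset HH" for n using K unfolding H.closed_subspace_def by blast
  have Kmono: "K m \<subseteq> K n" if "m \<le> n" for m n
  proof -
    have "S m \<subseteq> S n"
    proof
      fix y assume "y \<in> S m"
      then obtain k c where "y = ?R c (e k)" "k < m" "c \<in> ?B'" unfolding S_def by blast
      then show "y \<in> S n" unfolding S_def using that by (intro CollectI exI[of _ k] exI[of _ c]) simp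
    qed
    then show ?thesis unfolding K_def by (intro H.hcl_mono complex_vector.span_mono)
  qed
  have inv: "?R c z \<in> K n" if c: "c \<in> ?B'" and z: "z \<in> K n" for c z n
    unfolding K_def
  proof (rule H.bop_hcl_inv[OF tens_right_bop[OF c] _ z[unfolded K_def]])
    fix y assume y: "y \<in> complex_vector.span (S n)"
    have "y \<in> {y \<in> hset HH. ?R c y \<in> complex_vector.span (S n)}"
    proof (rule complex_vector.span_subspace_induct[OF y])
      show "complex_vector.subspace {y \<in> hset HH. ?R c y \<in> complex_vector.span (S n)}"
        by (rule complex_vector.subspaceI)
          (simp_all only: mem_Collect_eq bop_zero[OF tens_right_bop[OF c]] bop_add[OF tens_right_bop[OF c]] bop_scale[OF tens_right_bop[OF c]]
            H.zero_mem H.add_mem H.scale_mem complex_vector.span_zero complex_vector.span_add complex_vector.span_scale simp_thms)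
      fix y assume y: "y \<in> S n"
      then obtain m d where d: "y = ?R d (e m)" "m < n" "d \<in> ?B'" unfolding S_def by blast
      have "?R c y = ?R (c \<circ> d) (e m)" using d tens_right_comp[OF c d(3)] by simp
      then have "?R c y \<in> S n" unfolding S_def using d C.B_comp[OF c d(3)] by blast
      then show "y \<in> {y \<in> hset HH. ?R c y \<in> complex_vector.span (S n)}"
        using complex_vector.span_base y SH by blast
    qed
    then show "?R c y \<in> complex_vector.span (S n)" by simp
  qed
  define P where "P n = H.proj (K n)" for n
  have Pm: "P n z \<in> hset HH" "P n z \<in> K n" if "z \<in> hset HH" for n z
    unfolding P_def using H.proj_in[OF K that] H.proj_mem[OF K that] by auto
  have Pp: "hip HH w (z - P n z) = 0" if "z \<in> hset HH" "w \<in> K n" for n z w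
    unfolding P_def by (rule H.proj_perp[OF K that])
  define d where "d n = P (Suc n) h - P n h" for n
  have dm: "d n \<in> hset HH" for n unfolding d_def using Pm(1)[OF h] by simp
  have Ksub: "complex_vector.subspace (K n)" for n using K unfolding H.closed_subspace_def by blast
  have dK: "d n \<in> K (Suc n)" for n unfolding d_def
    by (rule complex_vector.subspace_diff[OF Ksub Pm(2)[OF h] subsetD[OF Kmono Pm(2)[OF h]]]) simp
  have dp: "hip HH w (d n) = 0" if w: "w \<in> K n" for w n
  proof -
    have "w \<in> K (Suc n)" using w Kmono[of n "Suc n"] by auto
    then have "hip HH w (h - P n h) = 0" "hip HH w (h - P (Suc n) h) = 0" using Pp[OF h] w by auto
    then show ?thesis using w KH h Pm(1)[OF h] by (auto simp: d_def H.diff_right subset_iff)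
  qed
  have P0: "P 0 h = 0"
  proof -
    have "K 0 = {0}"
    proof -
      have "S 0 = {}" by (simp add: S_def)
      have "z = 0" if z: "z \<in> K 0" for z
      proof -
        obtain s where s: "\<And>n. s n \<in> complex_vector.span (S 0)" "hlim HH s z" using z unfolding K_def hcl_def by blast
        have "s = (\<lambda>_. 0)" using s(1) \<open>S 0 = {}\<close> by (intro ext[of s]) (simp add: complex_vector.span_empty)
        then show ?thesis using H.hlim_unique[OF s(2)] H.hlim_const[OF H.zero_mem] by simp
      qed
      moreover have "0 \<in> K 0" by (rule complex_vector.subspace_0[OF Ksub])
      ultimately show ?thesis by blast
    qed
    then show ?thesis using Pm(2)[OF h, of 0] by simp
  qed
  have lim: "hlim HH (\<lambda>n. P n h) h" unfolding hlim_def
  proof (intro conjI allI Pm(1)[OF h] h, rule LIMSEQ_I)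
    fix r :: real assume r: "r > 0"
    have "range e \<subseteq> hset HH" using em by auto
    then obtain w where w: "w \<in> complex_vector.span (range e)" "hnorm HH (w - h) < r"
      using hX r H.hcl_iff[OF H.span_mem] by blast
    obtain c where c: "c \<in> fsupp UNIV" "w = lincomb e c" using w(1) lincomb_span[of e UNIV] by auto
    have fc: "finite {m. c m \<noteq> 0}" using c(1) by (simp add: fsupp_def)
    then obtain N where N: "\<And>m. c m \<noteq> 0 \<Longrightarrow> m < N" using finite_nat_set_iff_bounded by auto
    have "hnorm HH (P n h - h) < r" if n: "n \<ge> N" for n
    proof -
      have eS: "e m \<in> S n" if "c m \<noteq> 0" for m
      proof -
        have "e m = ?R (id_on (hset G)) (e m)" using em by (simp add: tens_right_id id_on_apply)
        then show ?thesis unfolding S_def using N[OF that] n commutant_id by force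
      qed
      have "w \<in> complex_vector.span (S n)" unfolding c(2) lincomb_def
        by (intro complex_vector.span_sum complex_vector.span_scale complex_vector.span_base) (use eS in simp)
      then have wK: "w \<in> K n" unfolding K_def by (rule H.hcl_self[OF spH])
      then have wH: "w \<in> hset HH" using KH by blast
      have "P n h - w \<in> K n" by (rule complex_vector.subspace_diff[OF Ksub Pm(2)[OF h] wK])
      from Pp[OF h this] have "hip HH (P n h - w) (h - P n h) = 0" .
      then have "(hnorm HH ((P n h - w) + (h - P n h)))\<^sup>2 = (hnorm HH (P n h - w))\<^sup>2 + (hnorm HH (h - P n h))\<^sup>2"
        using H.norm_add_sq[of "P n h - w" "h - P n h"] Pm(1)[OF h] wH h by simp
      then have "(hnorm HH (h - P n h))\<^sup>2 \<le> (hnorm HH (h - w))\<^sup>2" by simp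
      then have "hnorm HH (h - P n h) \<le> hnorm HH (h - w)" by (rule power2_le_imp_le) (use h wH in simp)
      then show ?thesis using w(2) H.norm_commute[OF wH h] H.norm_commute[OF Pm(1)[OF h] h] by simp
    qed
    then show "\<exists>N. \<forall>n\<ge>N. norm (hnorm HH (P n h - h) - 0) < r" using Pm(1)[OF h] h by auto
  qed
  have Rd: "hip HH (d n) (?R c (d n)) = hip HH h (?R c (d n))" if c: "c \<in> ?B'" for c n
  proof -
    have Rm: "?R c (d n) \<in> hset HH" by (rule bop_mem[OF tens_right_bop[OF c] dm])
    have "hip HH (?R c (d n)) (h - P (Suc n) h) = 0" by (rule Pp[OF h inv[OF c dK]])
    then have 1: "hip HH (h - P (Suc n) h) (?R c (d n)) = 0" 
      using H.herm[OF Rm] h Pm(1)[OF h] by simp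
    have "hip HH (P n h) (?R c (d n)) = hip HH (adj HH HH (?R c) (P n h)) (d n)"
      using HH.adj_ip[OF tens_right_bop[OF c] dm Pm(1)[OF h]] by simp
    also have "\<dots> = 0" unfolding tens_right_adj[OF c, symmetric] by (rule dp[OF inv[OF commutant_adj[OF c] Pm(2)[OF h]]])
    finally have 2: "hip HH (P n h) (?R c (d n)) = 0" .
    have "d n = h - ((h - P (Suc n) h) + P n h)" by (simp add: d_def)
    then have "hip HH (d n) (?R c (d n)) = hip HH h (?R c (d n)) - (hip HH (h - P (Suc n) h) (?R c (d n)) + hip HH (P n h) (?R c (d n)))"
      using Rm h Pm(1)[OF h] by (metis H.add_left H.add_mem H.diff_left H.diff_mem)
    then show ?thesis using 1 2 by simp
  qed
  have sums: "(\<lambda>n. hip HH (d n) (?R c (d n))) sums hip HH h (?R c h)" if c: "c \<in> ?B'" for c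
  proof -
    have "(\<Sum>n<N. hip HH (d n) (?R c (d n))) = hip HH h (?R c (P N h))" for N
    proof -
      have "P N h = (\<Sum>n<N. d n)" unfolding d_def using sum_lessThan_telescope[of "\<lambda>n. P n h" N] P0 by simp
      then have "hip HH h (?R c (P N h)) = (\<Sum>n<N. hip HH h (?R c (d n)))"
        using H.bop_sum[OF tens_right_bop[OF c], of "{..<N}" d] dm H.sum_right[OF h, of "{..<N}" "\<lambda>n. ?R c (d n)"]
          bop_mem[OF tens_right_bop[OF c] dm] by simp
      then show ?thesis using Rd[OF c] by simp
    qed
    moreover have "(\<lambda>N. hip HH h (?R c (P N h))) \<longlonglongrightarrow> hip HH h (?R c h)"
      by (rule H.hlim_ip_right[OF HH.bop_hlim[OF tens_right_bop[OF c] lim] h])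
    ultimately show ?thesis unfolding sums_def by simp
  qed
  have "\<exists>u\<in>hset G. \<forall>c\<in>?B'. hip G u (c u) = hip HH (d n) (?R c (d n))" for n
  proof -
    obtain x g where x: "x \<in> mset E" "g \<in> hset G" "e n = tn x g" using eelem[of n] by blast
    let ?xi = "e n - P n (e n)"
    have xi: "?xi \<in> hset HH" using em Pm(1)[OF em] by simp
    obtain w where w: "w \<in> hset G" "\<And>c. c \<in> ?B' \<Longrightarrow> hip G w (c w) = hip HH ?xi (?R c ?xi)"
      using state_of_compression[OF K inv x(1,2), of n] unfolding x(3) P_def by blast
    let ?O = "(\<lambda>c. ?R c ?xi) ` ?B'"
    have O: "complex_vector.subspace ?O"
      by (rule linear_image_subspace[OF C.B_subspace]) (simp_all add: tens_right_add tens_right_scale)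
    have OH: "?O \<subseteq> hset HH" using bop_mem[OF tens_right_bop xi] by auto
    have Pb: "P n \<in> bop HH HH" unfolding P_def by (rule H.proj_bop[OF K])
    have PR: "P n (?R c z) = ?R c (P n z)" if c: "c \<in> ?B'" and z: "z \<in> hset HH" for c z
      unfolding P_def
      by (rule H.proj_commute[OF K tens_right_bop[OF c] tens_right_bop[OF commutant_adj[OF c]] _ inv[OF c] inv[OF commutant_adj[OF c]] z])
        (simp add: tens_right_adj[OF c] HH.adj_ip[OF tens_right_bop[OF c]])
    have O_of_span: "y - P n y \<in> ?O" if y: "y \<in> complex_vector.span (S (Suc n))" for y
    proof -
      have "y \<in> {y \<in> hset HH. y - P n y \<in> ?O}"
      proof (rule complex_vector.span_subspace_induct[OF y])
        show "complex_vector.subspace {y \<in> hset HH. y - P n y \<in> ?O}"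
        proof (rule complex_vector.subspaceI)
          show "0 \<in> {y \<in> hset HH. y - P n y \<in> ?O}" using complex_vector.subspace_0[OF O] by (simp add: bop_zero[OF Pb])
          fix y z :: "'e \<times> 'g \<Rightarrow> complex" and k :: complex assume y: "y \<in> {y \<in> hset HH. y - P n y \<in> ?O}"
          have "k *\<^sub>C y - P n (k *\<^sub>C y) = k *\<^sub>C (y - P n y)"
            using y bop_scale[OF Pb] by (simp add: complex_vector.scale_right_diff_distrib)
          then show "k *\<^sub>C y \<in> {y \<in> hset HH. y - P n y \<in> ?O}" using y complex_vector.subspace_scale[OF O] by simp
          assume z: "z \<in> {y \<in> hset HH. y - P n y \<in> ?O}"
          have e: "(y + z) - P n (y + z) = (y - P n y) + (z - P n z)" using y z bop_add[OF Pb] by simp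
          show "y + z \<in> {y \<in> hset HH. y - P n y \<in> ?O}"
            unfolding mem_Collect_eq e
            by (rule conjI[OF H.add_mem complex_vector.subspace_add[OF O]]) (use y z in \<open>simp_all only: mem_Collect_eq\<close>)
        qed
        fix y assume y: "y \<in> S (Suc n)"
        then obtain m c where c: "y = ?R c (e m)" "m < Suc n" "c \<in> ?B'" unfolding S_def by blast
        have yH: "y \<in> hset HH" using y SH by blast
        have "y - P n y \<in> ?O"
        proof (cases "m = n")
          case True
          have "y - P n y = ?R c ?xi"
            using c True PR[OF c(3) em] H.bop_diff[OF tens_right_bop[OF c(3)] em Pm(1)[OF em]] by simp
          then show ?thesis using c(3) by blast
        next
          case False
          then have "y \<in> S n" using c unfolding S_def by force
          then have "y \<in> K n" unfolding K_def by (intro H.hcl_self[OF spH] complex_vector.span_base)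
          then have "P n y = y" unfolding P_def by (rule H.proj_id[OF K])
          then show ?thesis using complex_vector.subspace_0[OF O] by simp
        qed
        then show "y \<in> {y \<in> hset HH. y - P n y \<in> ?O}" using yH by simp
      qed
      then show ?thesis by simp
    qed
    obtain y where y: "\<And>j. y j \<in> complex_vector.span (S (Suc n))" "hlim HH y (P (Suc n) h)"
      using Pm(2)[OF h, of "Suc n"] unfolding K_def hcl_def by blast
    have "P n (P (Suc n) h) = P n h"
      unfolding P_def[of n]
    proof (rule H.proj_eqI[OF K Pm(1)[OF h]])
      show "H.proj (K n) h \<in> K n" by (rule H.proj_mem[OF K h])
      show "hip HH w (P (Suc n) h - H.proj (K n) h) = 0" if "w \<in> K n" for w using dp[OF that] by (simp add: d_def P_def)
    qed
    then have "hlim HH (\<lambda>j. y j - P n (y j)) (d n)"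
      using H.hlim_diff[OF y(2) HH.bop_hlim[OF Pb y(2)]] by (simp add: d_def)
    then have "d n \<in> hcl HH ?O" unfolding hcl_def using O_of_span[OF y(1)] by (intro CollectI exI[of _ "\<lambda>j. y j - P n (y j)"]) blast
    then show ?thesis using state_of_limit[OF xi w] by blast
  qed
  then obtain u where u: "\<And>n. u n \<in> hset G" "\<And>n c. c \<in> ?B' \<Longrightarrow> hip G (u n) (c (u n)) = hip HH (d n) (?R c (d n))" by metis
  show ?thesis by (rule exI[of _ u]) (use u sums in simp)
qed

lemma tens_right_rep: "normal_unital_rep G (commutant G B) HH (tens_right G E)"
  unfolding normal_unital_rep_def
proof (intro conjI ballI allI)
  show "normal_map G (commutant G B) HH (tens_right G E)"
    by (rule normal_map_vector_states[OF hilb_axioms H.hilb_axioms _ commutant_id tens_right_bop tens_right_id vector_state])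
      (use commutant_bop in auto)
qed (auto simp: tens_right_bop tens_right_add tens_right_scale tens_right_comp tens_right_adj tens_right_id)

end

section \<open>From bimodules to triples\<close>

locale vnbimod = vna G B for G :: "'g::complex_vector hilbert" and B +
  fixes E :: "('e::complex_vector, 'g, 'g) bimodule"
  assumes bimodule: "von_neumann_bimodule G B G B E"

sublocale vnbimod \<subseteq> vnmod G B E
  using bimodule by unfold_locales (simp_all add: von_neumann_bimodule_def von_neumann_module_def)

context vnbimod
begin

lemmas la = bimodule[unfolded von_neumann_bimodule_def unital_left_action_def, THEN conjunct2, THEN conjunct1]

lemma lact_mem: "a \<in> B \<Longrightarrow> x \<in> mset E \<Longrightarrow> lact E a x \<in> mset E"
  by (rule la[THEN conjunct1, rule_format])
lemma lact_adj: "a \<in> B \<Longrightarrow> x \<in> mset E \<Longrightarrow> y \<in> mset E \<Longrightarrow> mip E x (lact E a y) = mip E (lact E (adj G G a) x) y"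
  by (rule la[THEN conjunct2, THEN conjunct1, rule_format])
lemma lact_add_alg: "a \<in> B \<Longrightarrow> b \<in> B \<Longrightarrow> x \<in> mset E \<Longrightarrow> lact E (a + b) x = lact E a x + lact E b x"
  by (rule la[THEN conjunct2, THEN conjunct2, THEN conjunct1, rule_format])
lemma lact_scale_alg: "a \<in> B \<Longrightarrow> x \<in> mset E \<Longrightarrow> lact E (c *\<^sub>C a) x = c *\<^sub>C lact E a x"
  by (rule la[THEN conjunct2, THEN conjunct2, THEN conjunct2, THEN conjunct1, rule_format])
lemma lact_comp: "a \<in> B \<Longrightarrow> b \<in> B \<Longrightarrow> x \<in> mset E \<Longrightarrow> lact E (a \<circ> b) x = lact E a (lact E b x)"
  by (rule la[THEN conjunct2, THEN conjunct2, THEN conjunct2, THEN conjunct2, THEN conjunct1, rule_format])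
lemma lact_id: "x \<in> mset E \<Longrightarrow> lact E (id_on (hset G)) x = x"
  by (rule la[THEN conjunct2, THEN conjunct2, THEN conjunct2, THEN conjunct2, THEN conjunct2, rule_format])

lemma lact_add: "a \<in> B \<Longrightarrow> x \<in> mset E \<Longrightarrow> y \<in> mset E \<Longrightarrow> lact E a (x + y) = lact E a x + lact E a y"
  by (rule mip_eqI) (simp_all add: lact_mem lact_adj mip_add B_adj)
lemma lact_ract: "a \<in> B \<Longrightarrow> x \<in> mset E \<Longrightarrow> b \<in> B \<Longrightarrow> lact E a (ract E x b) = ract E (lact E a x) b"
  by (rule mip_eqI) (simp_all add: lact_mem lact_adj mip_ract ract_mem B_adj)

text \<open>
  With \<open>b\<^sup>* b + c\<^sup>* c = k\<^sup>2\<close> the difference \<open>k\<^sup>2 \<langle>x, x\<rangle> - \<langle>b x, b x\<rangle>\<close> is \<open>\<langle>c x, c x\<rangle>\<close>.  So the left action is bounded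
  although this is not among the axioms.
\<close>

lemma lact_bound:
  assumes b: "b \<in> B"
  obtains k where "k \<ge> 0" "\<And>x g. x \<in> mset E \<Longrightarrow> g \<in> hset G \<Longrightarrow> hnorm HH (tn (lact E b x) g) \<le> k * hnorm HH (tn x g)"
proof -
  obtain k c where k: "k \<ge> 0" and c: "c \<in> B" 
    "adj G G c \<circ> c = complex_of_real (k\<^sup>2) *\<^sub>C id_on (hset G) - (adj G G b \<circ> b)" using complement_root[OF b] by metis
  have sq: "mip E (lact E a x) (lact E a x) = mip E x (lact E (adj G G a \<circ> a) x)" if "a \<in> B" "x \<in> mset E" for a x
    using lact_adj[OF B_adj[OF that(1)] that(2) lact_mem[OF that]] GG.adj_adj[OF B_bop[OF that(1)]] that
    by (simp add: lact_comp B_adj)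
  have bb: "adj G G b \<circ> b \<in> B" by (rule B_comp[OF B_adj[OF b] b])
  have cb: "lact E (adj G G c \<circ> c) x = complex_of_real (k\<^sup>2) *\<^sub>C x + (-1) *\<^sub>C lact E (adj G G b \<circ> b) x" if x: "x \<in> mset E" for x
  proof -
    have "adj G G c \<circ> c = complex_of_real (k\<^sup>2) *\<^sub>C id_on (hset G) + (-1) *\<^sub>C (adj G G b \<circ> b)"
      unfolding c(2) by (simp add: complex_vector.scale_minus_left)
    then show ?thesis
      using x bb B_id by (simp only: lact_add_alg lact_scale_alg B_scale lact_id)
  qed
  have "hnorm HH (tn (lact E b x) g) \<le> k * hnorm HH (tn x g)" if x: "x \<in> mset E" and g: "g \<in> hset G" for x g
  proof -
    have "0 \<le> Re (hip G g (mip E (lact E c x) (lact E c x) g))"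
      by (rule nonneg_complex_Re[OF mip_pos[OF lact_mem[OF c(1) x] g]])
    also have "mip E (lact E c x) (lact E c x) = complex_of_real (k\<^sup>2) *\<^sub>C mip E x x + (-1) *\<^sub>C mip E (lact E b x) (lact E b x)"
      unfolding sq[OF c(1) x] sq[OF b x] cb[OF x] using x lact_mem[OF bb x] by (simp only: mip_add mip_scale E_scale)
    also have "hip G g ((complex_of_real (k\<^sup>2) *\<^sub>C mip E x x + (-1) *\<^sub>C mip E (lact E b x) (lact E b x)) g)
        = complex_of_real (k\<^sup>2) * hip G g (mip E x x g) - hip G g (mip E (lact E b x) (lact E b x) g)"
      using g mip_mem[OF x x g] mip_mem[OF lact_mem[OF b x] lact_mem[OF b x] g]
      by (simp add: add_right diff_right scale_right neg_right complex_vector.scale_minus_left)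
    finally have "(hnorm HH (tn (lact E b x) g))\<^sup>2 \<le> (k * hnorm HH (tn x g))\<^sup>2"
      unfolding tens_norm[OF lact_mem[OF b x] g] power_mult_distrib tens_norm[OF x g] by simp
    then show ?thesis by (rule power2_le_imp_le) (use k x g tens_mem in simp)
  qed
  then show thesis using that k by blast
qed

abbreviation "lrep b \<equiv> tens_left G E E (lact E b)"

lemma lrep_props:
  assumes b: "b \<in> B"
  shows lrep_bop: "lrep b \<in> bop HH HH"
    and lrep_apply: "\<And>x g. x \<in> mset E \<Longrightarrow> g \<in> hset G \<Longrightarrow> lrep b (tn x g) = tn (lact E b x) g"
proof -
  obtain k where k: "k \<ge> 0" "\<And>x g. x \<in> mset E \<Longrightarrow> g \<in> hset G \<Longrightarrow> hnorm HH (tn (lact E b x) g) \<le> k * hnorm HH (tn x g)"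
    using lact_bound[OF b] by blast
  note ex = tens_left_exists[of G B E E "lact E b", OF hmod_axioms hmod_axioms lact_mem[OF b] lact_add[OF b] lact_ract[OF b] k]
  show "lrep b \<in> bop HH HH" by (rule ex(1))
  show "\<And>x g. x \<in> mset E \<Longrightarrow> g \<in> hset G \<Longrightarrow> lrep b (tn x g) = tn (lact E b x) g" by (rule ex(2))
qed

lemma lrep_rep: "normal_unital_rep G B HH (\<lambda>b. lrep b)"
  unfolding normal_unital_rep_def
proof (intro conjI ballI allI)
  fix a b c assume a: "a \<in> B"
  show "lrep a \<in> bop HH HH" by (rule lrep_bop[OF a])
  show "lrep (c *\<^sub>C a) = c *\<^sub>C lrep a"
    by (rule bop_agree_tens[OF H.hilb_axioms lrep_bop[OF B_scale[OF a]] HH.bop_scale_closed[OF lrep_bop[OF a]]])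
      (simp add: lrep_apply a B_scale lact_scale_alg lact_mem tens_scale_left)
  show "lrep (adj G G a) = adj HH HH (lrep a)"
  proof (rule bop_agree_tens[OF H.hilb_axioms lrep_bop[OF B_adj[OF a]] HH.adj_bop[OF lrep_bop[OF a]]])
    fix x g assume x: "x \<in> mset E" and g: "g \<in> hset G"
    show "lrep (adj G G a) (tn x g) = adj HH HH (lrep a) (tn x g)"
    proof (rule tens_eqI[OF bop_mem[OF lrep_bop[OF B_adj[OF a]] tens_mem[OF x g]] HH.adj_mem[OF lrep_bop[OF a] tens_mem[OF x g]]])
      fix y h assume y: "y \<in> mset E" and h: "h \<in> hset G"
      have "mip E y (lact E (adj G G a) x) = mip E (lact E a y) x"
        using lact_adj[OF B_adj[OF a] y x] GG.adj_adj[OF B_bop[OF a]] by simp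
      then show "hip HH (tn y h) (lrep (adj G G a) (tn x g)) = hip HH (tn y h) (adj HH HH (lrep a) (tn x g))"
        using HH.adj_ip'[OF lrep_bop[OF a] tens_mem[OF y h] tens_mem[OF x g]] x y g h a
        by (simp add: lrep_apply B_adj tens_ip lact_mem)
    qed
  qed
  assume b: "b \<in> B"
  show "lrep (a + b) = lrep a + lrep b"
    by (rule bop_agree_tens[OF H.hilb_axioms lrep_bop[OF B_add[OF a b]] HH.bop_add_closed[OF lrep_bop[OF a] lrep_bop[OF b]]])
      (simp add: lrep_apply a b B_add lact_add_alg lact_mem tens_add_left)
  show "lrep (a \<circ> b) = lrep a \<circ> lrep b"
    by (rule bop_agree_tens[OF H.hilb_axioms lrep_bop[OF B_comp[OF a b]] H.bop_comp[OF lrep_bop[OF b] lrep_bop[OF a]]])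
      (simp add: lrep_apply a b B_comp lact_comp lact_mem)
next
  show "lrep (id_on (hset G)) = id_on (hset HH)"
    by (rule bop_agree_tens[OF H.hilb_axioms lrep_bop[OF B_id] H.id_on_bop])
      (simp add: lrep_apply B_id lact_id id_on_apply tens_mem)
  show "normal_map G B HH (\<lambda>b. lrep b)" using bimodule by (simp add: von_neumann_bimodule_def)
qed

lemma triple_of_module_is_triple: "is_triple G B (triple_of_module G E)"
proof -
  have "lrep b \<circ> tens_right G E c = tens_right G E c \<circ> lrep b" if "b \<in> B" "c \<in> commutant G B" for b c
    by (rule bop_agree_tens[OF H.hilb_axioms H.bop_comp H.bop_comp])
      (use that in \<open>auto simp: lrep_bop lrep_apply tens_right_bop tens_right_apply lact_mem commutant_mem\<close>)
  then show ?thesis using lrep_rep tens_right_rep H.hilbert by (simp add: is_triple_def triple_of_module_def)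
qed

end

lemma tens_left_id:
  assumes "hmod G B E" shows "tens_left G E E (id_on (mset E)) = id_on (hset (tspace G E))"
proof -
  interpret hmod G B E by fact
  show ?thesis unfolding tens_left_def
    by (rule the_tens_op[OF H.hilb_axioms H.id_on_bop]) (simp add: id_on_apply tens_mem)
qed

subsection \<open>Morphisms\<close>

lemma bilinear_mapsD:
  assumes "f \<in> bilinear_maps A G B E1 E2"
  shows "\<And>x. x \<notin> mset E1 \<Longrightarrow> f x = 0" "\<And>x. x \<in> mset E1 \<Longrightarrow> f x \<in> mset E2"
    "\<And>x y. x \<in> mset E1 \<Longrightarrow> y \<in> mset E1 \<Longrightarrow> f (x + y) = f x + f y"
    "\<And>x b. x \<in> mset E1 \<Longrightarrow> b \<in> B \<Longrightarrow> f (ract E1 x b) = ract E2 (f x) b"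
    "\<And>x a. x \<in> mset E1 \<Longrightarrow> a \<in> A \<Longrightarrow> f (lact E1 a x) = lact E2 a (f x)"
    "\<exists>K. \<forall>x\<in>mset E1. mnorm G E2 (f x) \<le> K * mnorm G E1 x"
  using assms unfolding bilinear_maps_def lin_maps_def by blast+

lemma tens_left_bilinear:
  assumes E1: "vnbimod G B E1" and E2: "vnbimod G B E2" and a: "a \<in> bilinear_maps B G B E1 E2"
  shows "tens_left G E1 E2 a \<in> bop (tspace G E1) (tspace G E2)"
    "\<And>x g. x \<in> mset E1 \<Longrightarrow> g \<in> hset G \<Longrightarrow> tens_left G E1 E2 a (tens G E1 x g) = tens G E2 (a x) g"
proof -
  interpret E1: vnbimod G B E1 by fact
  interpret E2: vnbimod G B E2 by fact
  note d = bilinear_mapsD[OF a]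
  obtain k where k: "\<And>x. x \<in> mset E1 \<Longrightarrow> mnorm G E2 (a x) \<le> k * mnorm G E1 x" using d(6) by blast
  note bd = E1.bounded_module_map[of E2 a, OF E2.hmod_axioms d(2) d(4) k]
  note ex = tens_left_exists[of G B E1 E2 a, OF E1.hmod_axioms E2.hmod_axioms d(2,3,4) max.cobounded2 bd]
  show "tens_left G E1 E2 a \<in> bop (tspace G E1) (tspace G E2)" by (rule ex(1))
  show "\<And>x g. x \<in> mset E1 \<Longrightarrow> g \<in> hset G \<Longrightarrow> tens_left G E1 E2 a (tens G E1 x g) = tens G E2 (a x) g" by (rule ex(2))
qed

lemma tens_left_triple_maps:
  assumes E1: "vnbimod G B E1" and E2: "vnbimod G B E2" and a: "a \<in> bilinear_maps B G B E1 E2"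
  shows "tens_left G E1 E2 a \<in> triple_maps G B (triple_of_module G E1) (triple_of_module G E2)"
proof -
  interpret E1: vnbimod G B E1 by fact
  interpret E2: vnbimod G B E2 by fact
  note d = bilinear_mapsD[OF a] and t = tens_left_bilinear[OF assms]
  have "tens_left G E1 E2 a \<circ> E1.lrep b = E2.lrep b \<circ> tens_left G E1 E2 a" if b: "b \<in> B" for b
    by (rule E1.bop_agree_tens[OF E2.H.hilb_axioms E1.H.bop_comp[OF E1.lrep_bop[OF b] t(1)] E2.H.bop_comp[OF t(1) E2.lrep_bop[OF b]]])
      (use b in \<open>simp add: t(2) E1.lrep_apply E2.lrep_apply E1.lact_mem d(2) d(5)\<close>)
  moreover have "tens_left G E1 E2 a \<circ> tens_right G E1 c = tens_right G E2 c \<circ> tens_left G E1 E2 a" if c: "c \<in> commutant G B" for c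
    by (rule E1.bop_agree_tens[OF E2.H.hilb_axioms E1.H.bop_comp[OF E1.tens_right_bop[OF c] t(1)] E2.H.bop_comp[OF t(1) E2.tens_right_bop[OF c]]])
      (use c in \<open>simp add: t(2) E1.tens_right_apply E2.tens_right_apply E1.commutant_mem d(2)\<close>)
  ultimately show ?thesis using t(1) by (simp add: triple_maps_def triple_of_module_def)
qed

lemma tens_left_comp:
  assumes E1: "vnbimod G B E1" and E2: "vnbimod G B E2" and E3: "vnbimod G B E3"
    and a: "a \<in> bilinear_maps B G B E1 E2" and c: "c \<in> bilinear_maps B G B E2 E3"
  shows "tens_left G E1 E3 (c \<circ> a) = tens_left G E2 E3 c \<circ> tens_left G E1 E2 a"
proof -
  interpret E1: vnbimod G B E1 by fact
  interpret E2: vnbimod G B E2 by fact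
  interpret E3: vnbimod G B E3 by fact
  note t = tens_left_bilinear[OF E1 E2 a] and u = tens_left_bilinear[OF E2 E3 c]
  show ?thesis unfolding tens_left_def[of G E1 E3]
    by (rule E1.the_tens_op[OF E3.H.hilb_axioms E2.H.bop_comp[OF t(1) u(1)]])
      (simp add: t(2) u(2) bilinear_mapsD(2)[OF a])
qed

section \<open>From triples to bimodules\<close>

context hilb2
begin

lemma sqrt_opnorm_bound:
  assumes x: "x \<in> bop G H" and g: "g \<in> hset G"
  shows "hnorm H (x g) \<le> sqrt (opnorm G G (adj G H x \<circ> x)) * hnorm G g"
proof -
  interpret GG: hilb2 G G ..
  have xx: "adj G H x \<circ> x \<in> bop G G" by (rule H.bop_comp[OF x adj_bop[OF x]])
  have o: "0 \<le> opnorm G G (adj G H x \<circ> x)" by (rule GG.opnorm_nonneg[OF xx])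
  have "(hnorm H (x g))\<^sup>2 = Re (hip G g ((adj G H x \<circ> x) g))"
    using adj_ip'[OF x g bop_mem[OF x g]] H.norm_sq[OF bop_mem[OF x g]] by simp
  also have "\<dots> \<le> hnorm G g * hnorm G ((adj G H x \<circ> x) g)"
    using G.cauchy_schwarz[OF g bop_mem[OF xx g]] complex_Re_le_cmod order_trans by blast
  also have "\<dots> \<le> hnorm G g * (opnorm G G (adj G H x \<circ> x) * hnorm G g)"
    using GG.opnorm_bound[OF xx g] g by (intro mult_left_mono) auto
  also have "\<dots> = (sqrt (opnorm G G (adj G H x \<circ> x)) * hnorm G g)\<^sup>2"
    using o by (simp add: power_mult_distrib power2_eq_square mult_ac)
  finally show ?thesis by (rule power2_le_imp_le) (use o g in simp)
qed

lemma sqrt_opnorm_le: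
  assumes x: "x \<in> bop G H" and b: "\<And>g. g \<in> hset G \<Longrightarrow> hnorm H (x g) \<le> C * hnorm G g" and C: "0 \<le> C"
  shows "sqrt (opnorm G G (adj G H x \<circ> x)) \<le> C"
proof -
  interpret GG: hilb2 G G ..
  have ab: "hnorm G (adj G H x u) \<le> C * hnorm H u" if u: "u \<in> hset H" for u
  proof -
    let ?v = "adj G H x u"
    have v: "?v \<in> hset G" by (rule adj_mem[OF x u])
    have "(hnorm G ?v)\<^sup>2 = Re (hip H u (x ?v))" using adj_ip[OF x v u] G.norm_sq[OF v] by simp
    also have "\<dots> \<le> hnorm H u * hnorm H (x ?v)"
      using H.cauchy_schwarz[OF u bop_mem[OF x v]] complex_Re_le_cmod order_trans by blast
    also have "\<dots> \<le> hnorm H u * (C * hnorm G ?v)" using b[OF v] u by (intro mult_left_mono) auto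
    finally have e: "hnorm G ?v * hnorm G ?v \<le> (C * hnorm H u) * hnorm G ?v" by (simp add: power2_eq_square mult_ac)
    show ?thesis
    proof (cases "hnorm G ?v = 0")
      case True then show ?thesis using C u by simp
    next
      case False
      then have "hnorm G ?v > 0" using G.norm_nonneg[OF v] by linarith
      then show ?thesis using e by (simp add: mult_le_cancel_right)
    qed
  qed
  have "opnorm G G (adj G H x \<circ> x) \<le> C\<^sup>2"
  proof (rule GG.opnorm_le)
    fix g assume g: "g \<in> hset G"
    show "hnorm G ((adj G H x \<circ> x) g) \<le> C\<^sup>2 * hnorm G g"
      using ab[OF bop_mem[OF x g]] mult_left_mono[OF b[OF g] C] by (simp add: power2_eq_square mult.assoc)
  qed simp
  then show ?thesis using C by (simp add: real_le_lsqrt)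
qed

lemma bop_complete:
  fixes s :: "nat \<Rightarrow> 'g \<Rightarrow> 'h"
  assumes s: "\<And>n. s n \<in> bop G H"
    and c: "\<And>e. e > 0 \<Longrightarrow> \<exists>N. \<forall>m\<ge>N. \<forall>n\<ge>N. \<forall>g\<in>hset G. hnorm H (s m g - s n g) \<le> e * hnorm G g"
  obtains T where "T \<in> bop G H" "\<And>e. e > 0 \<Longrightarrow> \<exists>N. \<forall>n\<ge>N. \<forall>g\<in>hset G. hnorm H (s n g - T g) \<le> e * hnorm G g"
proof -
  have "\<exists>N. \<forall>m\<ge>N. \<forall>n\<ge>N. \<forall>g\<in>hset G. hnorm H (s m g - s n g) \<le> 1 / real (Suc k) * hnorm G g" for k
    by (rule c) simp
  then obtain M :: "nat \<Rightarrow> nat" where M: "\<And>k m n g. m \<ge> M k \<Longrightarrow> n \<ge> M k \<Longrightarrow> g \<in> hset G \<Longrightarrow>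
      hnorm H (s m g - s n g) \<le> 1 / real (Suc k) * hnorm G g" by metis
  define N where "N k = (\<Sum>j\<le>k. M j)" for k
  have NM: "M k \<le> N k" for k unfolding N_def by (rule member_le_sum) auto
  have Nmono: "N k \<le> N l" if "k \<le> l" for k l unfolding N_def by (rule sum_mono2) (use that in auto)
  have e: "(\<lambda>k. 1 / real (Suc k)) \<longlonglongrightarrow> 0" using LIMSEQ_inverse_real_of_nat by (simp add: inverse_eq_divide)
  obtain T where T: "T \<in> bop G H" "\<And>k g. g \<in> hset G \<Longrightarrow> hnorm H (s (N k) g - T g) \<le> 1 / real (Suc k) * hnorm G g"
  proof (rule bop_limit[of "\<lambda>k. s (N k)" "\<lambda>k. 1 / real (Suc k)", OF s e])
    fix k m n :: nat and g assume "k \<le> m" "k \<le> n" and g: "g \<in> hset G"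
    then show "hnorm H (s (N m) g - s (N n) g) \<le> 1 / real (Suc k) * hnorm G g"
      using M[of k "N m" "N n" g] NM[of k] Nmono[of k m] Nmono[of k n] by linarith
  qed blast
  have "\<exists>N. \<forall>n\<ge>N. \<forall>g\<in>hset G. hnorm H (s n g - T g) \<le> r * hnorm G g" if r: "r > 0" for r
  proof -
    obtain k where k: "1 / real (Suc k) < r / 2" using nat_approx_posE[of "r / 2"] r by auto
    have "hnorm H (s n g - T g) \<le> r * hnorm G g" if n: "n \<ge> N k" and g: "g \<in> hset G" for n g
    proof -
      have "hnorm H (s n g - T g) \<le> hnorm H (s n g - s (N k) g) + hnorm H (s (N k) g - T g)"
        by (rule H.norm_triangle3) (use bop_mem[OF s g] bop_mem[OF T(1) g] in auto)
      also have "\<dots> \<le> (1 / real (Suc k)) * hnorm G g + (1 / real (Suc k)) * hnorm G g"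
        using M[of k n "N k" g] NM[of k] n g T(2)[OF g, of k] by (intro add_mono) auto
      also have "\<dots> = 2 * (1 / real (Suc k)) * hnorm G g" by simp
      also have "\<dots> \<le> r * hnorm G g" using k g by (intro mult_right_mono) auto
      finally show ?thesis .
    qed
    then show ?thesis by blast
  qed
  then show thesis using that T(1) by blast
qed

end

lemma (in hilb) bop_mem_all: "T \<in> bop G H \<Longrightarrow> T g \<in> hset H"
  by (cases "g \<in> hset G") (auto simp: bop_mem bop_out)

locale rep_triple = vna G B for G :: "'g::complex_vector hilbert" and B +
  fixes T :: "('g, 'h::complex_vector) triple"
  assumes triple: "is_triple G B T"

sublocale rep_triple \<subseteq> K: hilb "sp T"
  using triple by unfold_locales (simp add: is_triple_def)
sublocale rep_triple \<subseteq> GK: hilb2 G "sp T" ..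
sublocale rep_triple \<subseteq> KK: hilb2 "sp T" "sp T" ..

context rep_triple
begin

abbreviation "M \<equiv> module_of_triple G B T"

lemma rho_rep: "normal_unital_rep G B (sp T) (rho T)" and rho'_rep: "normal_unital_rep G (commutant G B) (sp T) (rho' T)"
  and rho_commute: "b \<in> B \<Longrightarrow> c \<in> commutant G B \<Longrightarrow> rho T b (rho' T c u) = rho' T c (rho T b u)"
  using triple unfolding is_triple_def by (auto simp: fun_eq_iff)

lemma rho_bop: "b \<in> B \<Longrightarrow> rho T b \<in> bop (sp T) (sp T)" and rho_add: "a \<in> B \<Longrightarrow> b \<in> B \<Longrightarrow> rho T (a + b) = rho T a + rho T b"
  and rho_scale: "b \<in> B \<Longrightarrow> rho T (z *\<^sub>C b) = z *\<^sub>C rho T b" and rho_comp: "a \<in> B \<Longrightarrow> b \<in> B \<Longrightarrow> rho T (a \<circ> b) = rho T a \<circ> rho T b"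
  and rho_adj: "b \<in> B \<Longrightarrow> rho T (adj G G b) = adj (sp T) (sp T) (rho T b)" and rho_id: "rho T (id_on (hset G)) = id_on (hset (sp T))"
  and rho_normal: "normal_map G B (sp T) (rho T)"
  using rho_rep unfolding normal_unital_rep_def by blast+

lemma rho'_bop: "c \<in> commutant G B \<Longrightarrow> rho' T c \<in> bop (sp T) (sp T)"
  and rho'_adj: "c \<in> commutant G B \<Longrightarrow> rho' T (adj G G c) = adj (sp T) (sp T) (rho' T c)"
  using rho'_rep unfolding normal_unital_rep_def by blast+

lemma M_simps [simp]: "mset M = intertwiners G (commutant G B) (sp T) (rho' T)" "mip M x y = adj G (sp T) x \<circ> y"
  "ract M x b = x \<circ> b" "lact M b x = rho T b \<circ> x"
  by (simp_all add: module_of_triple_def)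

lemma M_bop: "x \<in> mset M \<Longrightarrow> x \<in> bop G (sp T)" and M_rho': "x \<in> mset M \<Longrightarrow> c \<in> commutant G B \<Longrightarrow> rho' T c (x g) = x (c g)"
  unfolding M_simps intertwiners_def by (auto simp: fun_eq_iff)
lemma M_I: "x \<in> bop G (sp T) \<Longrightarrow> (\<And>c g. c \<in> commutant G B \<Longrightarrow> g \<in> hset G \<Longrightarrow> rho' T c (x g) = x (c g)) \<Longrightarrow> x \<in> mset M"
  unfolding M_simps
  by (rule intertwinersI) (auto intro!: bop_eqI[OF K.bop_comp[OF _ rho'_bop] bop_comp[OF commutant_bop]])

text \<open>
  Adjoints of intertwiners intertwine as well, which puts \<open>x\<^sup>* y\<close> into \<open>B'' = B\<close> (\<open>M_mip\<close>).
\<close>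

lemma M_adj: assumes x: "x \<in> mset M" and c: "c \<in> commutant G B" shows "adj G (sp T) x \<circ> rho' T c = c \<circ> adj G (sp T) x"
proof -
  note ca = commutant_adj[OF c]
  have "rho' T (adj G G c) \<circ> x = x \<circ> adj G G c" using M_rho'[OF x ca] by (simp add: fun_eq_iff)
  then have "adj G (sp T) x \<circ> adj (sp T) (sp T) (rho' T (adj G G c)) = adj G G (adj G G c) \<circ> adj G (sp T) x"
    using adj_comp[OF hilb_axioms K.hilb_axioms K.hilb_axioms M_bop[OF x] rho'_bop[OF ca]]
      adj_comp[OF hilb_axioms hilb_axioms K.hilb_axioms commutant_bop[OF ca] M_bop[OF x]] by simp
  then show ?thesis
    using rho'_adj[OF c] KK.adj_adj[OF rho'_bop[OF c]] GG.adj_adj[OF commutant_bop[OF c]] by simp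
qed

lemma M_subspace: "complex_vector.subspace (mset M)"
proof (rule complex_vector.subspaceI)
  show "0 \<in> mset M" by (rule M_I) (simp_all add: complex_vector.subspace_0[OF GK.bop_subspace] bop_zero[OF rho'_bop])
  show "x + y \<in> mset M" if x: "x \<in> mset M" and y: "y \<in> mset M" for x y
    by (rule M_I[OF GK.bop_add_closed[OF M_bop[OF x] M_bop[OF y]]])
      (simp add: bop_add[OF rho'_bop] bop_mem[OF M_bop[OF x]] bop_mem[OF M_bop[OF y]] M_rho'[OF x] M_rho'[OF y] del: M_simps)
  show "z *\<^sub>C x \<in> mset M" if x: "x \<in> mset M" for z x
    by (rule M_I[OF GK.bop_scale_closed[OF M_bop[OF x]]])
      (simp add: bop_scale[OF rho'_bop] bop_mem[OF M_bop[OF x]] M_rho'[OF x] del: M_simps)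
qed

lemma M_ract: "x \<in> mset M \<Longrightarrow> b \<in> B \<Longrightarrow> x \<circ> b \<in> mset M"
proof (rule M_I[OF bop_comp[OF B_bop M_bop]])
  fix c g assume x: "x \<in> mset M" and b: "b \<in> B" and c: "c \<in> commutant G B" and g: "g \<in> hset G"
  show "rho' T c ((x \<circ> b) g) = (x \<circ> b) (c g)"
    using M_rho'[OF x c, of "b g"] commutant_comm[OF c b, of g] by simp
qed
lemma M_lact: "x \<in> mset M \<Longrightarrow> b \<in> B \<Longrightarrow> rho T b \<circ> x \<in> mset M"
  by (rule M_I[OF K.bop_comp[OF M_bop rho_bop]]) (simp_all add: M_rho' flip: rho_commute del: M_simps)

lemma M_mip: assumes x: "x \<in> mset M" and y: "y \<in> mset M" shows "adj G (sp T) x \<circ> y \<in> B"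
proof -
  have "adj G (sp T) x \<circ> y \<in> commutant G (commutant G B)" unfolding commutant_def[of G "commutant G B"]
  proof (intro CollectI conjI ballI K.bop_comp[OF M_bop[OF y] GK.adj_bop[OF M_bop[OF x]]])
    fix c assume c: "c \<in> commutant G B"
    have "adj G (sp T) x (rho' T c v) = c (adj G (sp T) x v)" for v using fun_cong[OF M_adj[OF x c], of v] by simp
    then show "adj G (sp T) x \<circ> y \<circ> c = c \<circ> (adj G (sp T) x \<circ> y)"
      unfolding fun_eq_iff comp_apply M_rho'[OF y c, symmetric] by simp
  qed
  then show ?thesis by (simp add: bicommutant)
qed

lemma M_mnorm: "mnorm G M x = sqrt (opnorm G G (adj G (sp T) x \<circ> x))"
  by (simp add: mnorm_def)
lemma M_mnorm_bound: "x \<in> mset M \<Longrightarrow> g \<in> hset G \<Longrightarrow> hnorm (sp T) (x g) \<le> mnorm G M x * hnorm G g"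
  unfolding M_mnorm by (rule GK.sqrt_opnorm_bound[OF M_bop])
lemma M_mnorm_le: "x \<in> mset M \<Longrightarrow> (\<And>g. g \<in> hset G \<Longrightarrow> hnorm (sp T) (x g) \<le> C * hnorm G g) \<Longrightarrow> 0 \<le> C \<Longrightarrow> mnorm G M x \<le> C"
  unfolding M_mnorm by (rule GK.sqrt_opnorm_le[OF M_bop])
lemma M_mnorm_nonneg: "x \<in> mset M \<Longrightarrow> 0 \<le> mnorm G M x"
  unfolding M_mnorm using GG.opnorm_nonneg[OF B_bop[OF M_mip]] by simp

lemma M_diff: "x \<in> mset M \<Longrightarrow> y \<in> mset M \<Longrightarrow> x - y \<in> mset M"
  by (rule complex_vector.subspace_diff[OF M_subspace])

lemma M_metric: "Metric_space (mset M) (mdist G M)"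
proof
  fix x y
  show "0 \<le> mdist G M x y" using M_mnorm_nonneg[OF M_diff] by (simp add: mdist_def del: M_simps)
  have "mnorm G M (x - y) \<le> mnorm G M (y - x)" if "x \<in> mset M" "y \<in> mset M" for x y
  proof (rule M_mnorm_le[OF M_diff[OF that] _ M_mnorm_nonneg[OF M_diff[OF that(2,1)]]])
    fix g assume g: "g \<in> hset G"
    show "hnorm (sp T) ((x - y) g) \<le> mnorm G M (y - x) * hnorm G g"
      using M_mnorm_bound[OF M_diff[OF that(2,1)] g] K.norm_commute[OF bop_mem[OF M_bop[OF that(1)] g] bop_mem[OF M_bop[OF that(2)] g]]
      by (simp del: M_simps)
  qed
  then show "mdist G M x y = mdist G M y x" by (auto simp: mdist_def antisym simp del: M_simps)
next
  fix x y assume xy: "x \<in> mset M" "y \<in> mset M"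
  show "mdist G M x y = 0 \<longleftrightarrow> x = y"
  proof
    assume "mdist G M x y = 0"
    then have z: "mnorm G M (x - y) = 0" using xy by (simp add: mdist_def del: M_simps)
    show "x = y"
    proof (rule bop_eqI[OF M_bop[OF xy(1)] M_bop[OF xy(2)]])
      fix g assume g: "g \<in> hset G"
      note m = bop_mem[OF M_bop[OF xy(1)] g] bop_mem[OF M_bop[OF xy(2)] g]
      have "hnorm (sp T) (x g - y g) \<le> 0" using M_mnorm_bound[OF M_diff[OF xy] g] z by (simp del: M_simps)
      then have "hnorm (sp T) (x g - y g) = 0" using K.norm_nonneg[OF K.diff_mem[OF m]] by linarith
      then show "x g = y g" using K.norm_eq_zero[of "x g - y g"] m by simp
    qed
  next
    assume "x = y"
    moreover have "mnorm G M 0 \<le> 0"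
      by (rule M_mnorm_le[OF complex_vector.subspace_0[OF M_subspace]]) simp_all
    ultimately show "mdist G M x y = 0"
      using M_mnorm_nonneg[OF complex_vector.subspace_0[OF M_subspace]] xy by (simp add: mdist_def del: M_simps)
  qed
next
  fix x y z assume x: "x \<in> mset M" and y: "y \<in> mset M" and z: "z \<in> mset M"
  have "mnorm G M (x - z) \<le> mnorm G M (x - y) + mnorm G M (y - z)"
  proof (rule M_mnorm_le[OF M_diff[OF x z]])
    fix g assume g: "g \<in> hset G"
    show "hnorm (sp T) ((x - z) g) \<le> (mnorm G M (x - y) + mnorm G M (y - z)) * hnorm G g"
      using M_mnorm_bound[OF M_diff[OF x y] g] M_mnorm_bound[OF M_diff[OF y z] g]
        K.norm_triangle3[OF bop_mem[OF M_bop[OF x] g] bop_mem[OF M_bop[OF y] g] bop_mem[OF M_bop[OF z] g]]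
      by (simp add: distrib_right del: M_simps)
  qed (use M_mnorm_nonneg[OF M_diff] x y z in \<open>simp del: M_simps\<close>)
  then show "mdist G M x z \<le> mdist G M x y + mdist G M y z" using x y z by (simp add: mdist_def del: M_simps)
qed

lemma M_strong_approx:
  assumes y: "y \<in> bop G (sp T)"
    and ap: "\<And>F e. finite F \<Longrightarrow> F \<subseteq> hset G \<Longrightarrow> e > 0 \<Longrightarrow> \<exists>x\<in>mset M. \<forall>g\<in>F. hnorm (sp T) (x g - y g) < e"
  shows "y \<in> mset M"
  unfolding M_simps
  by (rule GK.intertwiners_approx[OF _ rho'_bop y]) (use commutant_bop ap in auto)

lemma M_complete: "Metric_space.mcomplete (mset M) (mdist G M)"
proof -
  interpret D: Metric_space "mset M" "mdist G M" by (rule M_metric)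
  show ?thesis unfolding D.mcomplete_def
  proof (intro allI impI)
    fix s assume s: "D.MCauchy s"
    have sm: "s n \<in> mset M" for n using s unfolding D.MCauchy_def by blast
    have "\<exists>N. \<forall>m\<ge>N. \<forall>n\<ge>N. \<forall>g\<in>hset G. hnorm (sp T) (s m g - s n g) \<le> e * hnorm G g" if e: "e > 0" for e
    proof -
      obtain N where N: "\<And>m n. N \<le> m \<Longrightarrow> N \<le> n \<Longrightarrow> mdist G M (s m) (s n) < e" using s e unfolding D.MCauchy_def by blast
      have "hnorm (sp T) (s m g - s n g) \<le> e * hnorm G g" if "m \<ge> N" "n \<ge> N" "g \<in> hset G" for m n g
      proof -
        have "mnorm G M (s m - s n) < e" using N[OF that(1,2)] sm by (simp add: mdist_def del: M_simps)
        then show ?thesis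
          using M_mnorm_bound[OF M_diff[OF sm sm] that(3), of m n] mult_right_mono[of "mnorm G M (s m - s n)" e "hnorm G g"] that(3)
          by (simp del: M_simps)
      qed
      then show ?thesis by blast
    qed
    then obtain y where y: "y \<in> bop G (sp T)" "\<And>e. e > 0 \<Longrightarrow> \<exists>N. \<forall>n\<ge>N. \<forall>g\<in>hset G. hnorm (sp T) (s n g - y g) \<le> e * hnorm G g"
      using GK.bop_complete[of s] M_bop[OF sm] by blast
    have yM: "y \<in> mset M"
    proof (rule M_strong_approx[OF y(1)])
      fix F and e :: real assume F: "finite F" "F \<subseteq> hset G" and e: "e > 0"
      define R where "R = (\<Sum>g\<in>F. hnorm G g) + 1"
      have S0: "0 \<le> (\<Sum>g\<in>F. hnorm G g)" by (rule sum_nonneg) (use F in auto)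
      have R: "R > 0" "hnorm G g < R" if "g \<in> F" for g
        using member_le_sum[OF that, of "hnorm G"] F S0 unfolding R_def by (auto simp: subset_iff)
      have R0: "R > 0" using S0 by (simp add: R_def)
      obtain N where N: "\<forall>n\<ge>N. \<forall>g\<in>hset G. hnorm (sp T) (s n g - y g) \<le> e / R * hnorm G g" using y(2)[of "e / R"] e R0 by auto
      have "hnorm (sp T) (s N g - y g) < e" if g: "g \<in> F" for g
      proof -
        have "hnorm (sp T) (s N g - y g) \<le> e / R * hnorm G g" using N g F by blast
        also have "\<dots> < e / R * R" using R(2)[OF g] e R0 by (intro mult_strict_left_mono) auto
        finally show ?thesis using R0 by simp
      qed
      then show "\<exists>x\<in>mset M. \<forall>g\<in>F. hnorm (sp T) (x g - y g) < e" using sm by blast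
    qed
    have "(\<lambda>n. mdist G M (s n) y) \<longlonglongrightarrow> 0"
    proof (rule LIMSEQ_I)
      fix e :: real assume e: "e > 0"
      obtain N where N: "\<forall>n\<ge>N. \<forall>g\<in>hset G. hnorm (sp T) (s n g - y g) \<le> e / 2 * hnorm G g" using y(2)[of "e / 2"] e by auto
      have "mnorm G M (s n - y) \<le> e / 2" if "n \<ge> N" for n
        by (rule M_mnorm_le[OF M_diff[OF sm yM]]) (use N that e in auto)
      then have "mdist G M (s n) y < e" if "n \<ge> N" for n using that e sm yM by (fastforce simp: mdist_def simp del: M_simps)
      then show "\<exists>no. \<forall>n\<ge>no. norm (mdist G M (s n) y - 0) < e" using D.nonneg by auto
    qed
    then have "limitin D.mtopology s y sequentially" using sm yM by (simp add: D.limitin_metric_dist_null del: M_simps)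
    then show "\<exists>x. limitin D.mtopology s x sequentially" by blast
  qed
qed

lemma M_hilbert_module: "hilbert_module G B M"
  unfolding hilbert_module_def
proof (intro conjI ballI allI impI M_subspace M_complete)
  fix x assume x: "x \<in> mset M"
  note xb = M_bop[OF x] and xa = GK.adj_bop[OF M_bop[OF x]]
  show "ract M x b \<in> mset M" if "b \<in> B" for b using M_ract[OF x that] by (simp only: M_simps)
  show "ract M (x + y) b = ract M x b + ract M y b" for y b by (simp add: fun_eq_iff)
  show "ract M x (a + b) = ract M x a + ract M x b" if "a \<in> B" "b \<in> B" for a b
    using bop_add[OF xb] bop_mem_all[OF B_bop[OF that(1)]] bop_mem_all[OF B_bop[OF that(2)]] by (simp add: fun_eq_iff)
  show "ract M (z *\<^sub>C x) b = z *\<^sub>C ract M x b" "ract M x (z *\<^sub>C b) = z *\<^sub>C ract M x b" if "b \<in> B" for z b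
    using bop_scale[OF xb] bop_mem_all[OF B_bop[OF that]] by (simp_all add: fun_eq_iff)
  show "ract M (ract M x a) b = ract M x (a \<circ> b)" for a b by (simp add: comp_assoc)
  show "hip G g (mip M x x g) \<in> \<real>\<^sub>\<ge>\<^sub>0" if g: "g \<in> hset G" for g
    using GK.adj_ip'[OF xb g bop_mem[OF xb g]] K.pos[OF bop_mem[OF xb g]] by simp
  show "x = 0" if z: "mip M x x = 0"
  proof
    fix g show "x g = 0 g"
    proof (cases "g \<in> hset G")
      case True
      have "hip (sp T) (x g) (x g) = hip G g (mip M x x g)" using GK.adj_ip'[OF xb True bop_mem[OF xb True]] by simp
      then have "hip (sp T) (x g) (x g) = 0" unfolding z using True by simp
      then show ?thesis using K.definite[OF bop_mem[OF xb True]] by simp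
    qed (simp add: bop_out[OF xb])
  qed
  fix y assume y: "y \<in> mset M"
  note yb = M_bop[OF y]
  show "mip M x y \<in> B" using M_mip[OF x y] by (simp only: M_simps)
  show "mip M x (y + z) = mip M x y + mip M x z" if z: "z \<in> mset M" for z
    using bop_add[OF xa] K.bop_mem_all[OF yb] K.bop_mem_all[OF M_bop[OF z]] by (simp add: fun_eq_iff)
  show "mip M x (z *\<^sub>C y) = z *\<^sub>C mip M x y" for z
    using bop_scale[OF xa] K.bop_mem_all[OF yb] by (simp add: fun_eq_iff)
  show "mip M x (ract M y b) = mip M x y \<circ> b" for b by (simp add: comp_assoc)
  show "mip M y x = adj G G (mip M x y)"
    using adj_comp[OF hilb_axioms K.hilb_axioms hilb_axioms yb xa] GK.adj_adj[OF xb] by simp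
qed

end

sublocale rep_triple \<subseteq> M: hmod G B "module_of_triple G B T"
  by unfold_locales (rule M_hilbert_module)

context rep_triple
begin

abbreviation "U \<equiv> evalop G M (sp T)"
abbreviation "V \<equiv> adj M.HH (sp T) U"

interpretation MK: hilb2 M.HH "sp T" ..
interpretation KM: hilb2 "sp T" M.HH ..

lemma evalop_props: "U \<in> bop M.HH (sp T) \<and> (\<forall>x\<in>mset M. \<forall>g\<in>hset G. U (M.tn x g) = x g)"
proof -
  obtain W where W: "W \<in> bop M.HH (sp T)" "\<And>x g. x \<in> mset M \<Longrightarrow> g \<in> hset G \<Longrightarrow> W (M.tn x g) = x g"
  proof (rule M.tensor_extension[OF K.hilb_axioms, of "\<lambda>x g. x g" 1])
    show "x g \<in> hset (sp T)" "x (c *\<^sub>C g) = c *\<^sub>C x g" if "x \<in> mset M" "g \<in> hset G" for x g c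
      using bop_mem[OF M_bop] bop_scale[OF M_bop] that by auto
    fix I :: "(('g \<Rightarrow> 'h) \<times> 'g) set" and x g
    assume I: "finite I" and x: "\<And>i. i \<in> I \<Longrightarrow> x i \<in> mset M" and g: "\<And>i. i \<in> I \<Longrightarrow> g i \<in> hset G"
    have m: "x i (g i) \<in> hset (sp T)" if "i \<in> I" for i using bop_mem[OF M_bop[OF x[OF that]] g[OF that]] .
    have "(hnorm (sp T) (\<Sum>i\<in>I. x i (g i)))\<^sup>2 = Re (hip (sp T) (\<Sum>i\<in>I. x i (g i)) (\<Sum>i\<in>I. x i (g i)))"
      by (rule K.norm_sq[OF K.sum_mem]) (rule m)
    moreover have "hip (sp T) (\<Sum>i\<in>I. x i (g i)) (\<Sum>i\<in>I. x i (g i)) = (\<Sum>i\<in>I. \<Sum>j\<in>I. hip (sp T) (x i (g i)) (x j (g j)))"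
      by (subst K.sum_left[OF K.sum_mem[OF m] m]; (assumption)?) (intro sum.cong refl K.sum_right m)
    moreover have "(\<Sum>i\<in>I. \<Sum>j\<in>I. hip (sp T) (x i (g i)) (x j (g j))) = (\<Sum>i\<in>I. \<Sum>j\<in>I. hip G (g i) (mip M (x i) (x j) (g j)))"
      by (intro sum.cong refl) (simp add: GK.adj_ip' M_bop x g m del: M_simps(1))
    ultimately have "(hnorm (sp T) (\<Sum>i\<in>I. x i (g i)))\<^sup>2 = (hnorm M.HH (\<Sum>i\<in>I. M.tn (x i) (g i)))\<^sup>2"
      using M.tens_sum_norm[of I x g] x g by simp
    then show "hnorm (sp T) (\<Sum>i\<in>I. x i (g i)) \<le> 1 * hnorm M.HH (\<Sum>i\<in>I. M.tn (x i) (g i))"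
      using power2_le_imp_le[of "hnorm (sp T) (\<Sum>i\<in>I. x i (g i))" "hnorm M.HH (\<Sum>i\<in>I. M.tn (x i) (g i))"]
        M.H.norm_nonneg[OF M.H.sum_mem[of I "\<lambda>i. M.tn (x i) (g i)"]] M.tens_mem x g by simp
  qed (simp | (rule that; blast))+
  have "U = W" unfolding evalop_def by (rule M.the_tens_op[OF K.hilb_axioms W])
  then show ?thesis using W by simp
qed

lemma U_bop: "U \<in> bop M.HH (sp T)" and U_apply: "x \<in> mset M \<Longrightarrow> g \<in> hset G \<Longrightarrow> U (M.tn x g) = x g"
  using evalop_props by blast+

lemma V_bop: "V \<in> bop (sp T) M.HH" by (rule MK.adj_bop[OF U_bop])

lemma VU: "V \<circ> U = id_on (hset M.HH)"
proof (rule M.bop_agree_tens[OF M.H.hilb_axioms K.bop_comp[OF U_bop V_bop] M.H.id_on_bop])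
  fix x g assume x: "x \<in> mset M" and g: "g \<in> hset G"
  note t = M.tens_mem[OF x g]
  have "V (U (M.tn x g)) = M.tn x g"
  proof (rule M.tens_eqI[OF bop_mem[OF V_bop bop_mem[OF U_bop t]] t])
    fix y h assume y: "y \<in> mset M" and h: "h \<in> hset G"
    have "hip M.HH (M.tn y h) (V (U (M.tn x g))) = hip (sp T) (y h) (x g)"
      using MK.adj_ip'[OF U_bop M.tens_mem[OF y h] bop_mem[OF U_bop t]] U_apply[OF x g] U_apply[OF y h] by simp
    also have "\<dots> = hip M.HH (M.tn y h) (M.tn x g)"
      using GK.adj_ip'[OF M_bop[OF y] h bop_mem[OF M_bop[OF x] g]] M.tens_ip[OF y x h g] by simp
    finally show "hip M.HH (M.tn y h) (V (U (M.tn x g))) = hip M.HH (M.tn y h) (M.tn x g)" .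
  qed
  then show "(V \<circ> U) (M.tn x g) = id_on (hset M.HH) (M.tn x g)" using t by (simp add: id_on_apply)
qed

lemma VU_apply: "u \<in> hset M.HH \<Longrightarrow> V (U u) = u"
  using VU by (simp add: fun_eq_iff id_on_apply)
lemma V_apply: "x \<in> mset M \<Longrightarrow> g \<in> hset G \<Longrightarrow> V (x g) = M.tn x g"
  using VU_apply[OF M.tens_mem] U_apply by simp

text \<open>
  The range of the evaluation is dense because the intertwiners of the normal representation \<open>\<rho>'\<close> are total.
\<close>

lemma UV: "U \<circ> V = id_on (hset (sp T))"
proof -
  interpret C: vna G "commutant G B" by (rule vna_commutant)
  let ?X = "{x g |x g. x \<in> intertwiners G (commutant G B) (sp T) (rho' T) \<and> g \<in> hset G}"
  have X: "?X \<subseteq> hset (sp T)" using bop_mem[OF M_bop] by auto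
  have t: "hcl (sp T) (complex_vector.span ?X) = hset (sp T)"
    by (rule C.intertwiners_total[OF K.hilb_axioms commutant_id rho'_rep])
  show ?thesis
  proof (rule KK.bop_agree_total[OF M.H.bop_comp[OF V_bop U_bop] K.id_on_bop X _ t])
    fix u assume "u \<in> ?X"
    then obtain x g where x: "u = x g" "x \<in> mset M" "g \<in> hset G" by auto
    then show "(U \<circ> V) u = id_on (hset (sp T)) u"
      using V_apply[OF x(2,3)] U_apply[OF x(2,3)] bop_mem[OF M_bop[OF x(2)] x(3)] by (simp add: id_on_apply)
  qed
qed

lemma UV_apply: "u \<in> hset (sp T) \<Longrightarrow> U (V u) = u"
  using UV by (simp add: fun_eq_iff id_on_apply)

lemma U_ip: "u \<in> hset M.HH \<Longrightarrow> v \<in> hset M.HH \<Longrightarrow> hip (sp T) (U u) (U v) = hip M.HH u v"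
  using MK.adj_ip'[OF U_bop _ bop_mem[OF U_bop]] VU_apply by simp
lemma U_norm: "u \<in> hset M.HH \<Longrightarrow> hnorm (sp T) (U u) = hnorm M.HH u"
  by (simp add: hnorm_def U_ip)

lemma U_unitary: "unitary_op M.HH (sp T) U"
  unfolding unitary_op_def
proof (intro conjI ballI U_bop)
  show "bij_betw U (hset M.HH) (hset (sp T))"
    by (rule bij_betwI[where g = V]) (use bop_mem[OF U_bop] bop_mem[OF V_bop] VU_apply UV_apply in auto)
qed (rule U_ip)

text \<open>
  Evaluation identifies \<open>L\<^sub>x\<close> with \<open>x\<close>, so that closedness of the module is closedness of the intertwining relation.
\<close>

lemma M_von_neumann_module: "von_neumann_module G B M"
  unfolding von_neumann_module_def
proof (intro conjI M_hilbert_module, subst M.GH.strong_closed_iff, intro conjI ballI impI)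
  show "Lop G M ` mset M \<subseteq> bop G M.HH" using M.Lop_bop by blast
  fix y assume y: "y \<in> bop G M.HH"
    and a: "\<forall>F e. finite F \<and> F \<subseteq> hset G \<and> e > 0 \<longrightarrow> (\<exists>x\<in>Lop G M ` mset M. \<forall>g\<in>F. hnorm M.HH (x g - y g) < e)"
  have Uy: "U \<circ> y \<in> bop G (sp T)" by (rule M.H.bop_comp[OF y U_bop])
  have "U \<circ> y \<in> mset M"
  proof (rule M_strong_approx[OF Uy])
    fix F and e :: real assume F: "finite F" "F \<subseteq> hset G" and e: "e > 0"
    then obtain x where x: "x \<in> mset M" "\<forall>g\<in>F. hnorm M.HH (Lop G M x g - y g) < e" using a by blast
    have "hnorm (sp T) (x g - (U \<circ> y) g) < e" if g: "g \<in> F" for g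
    proof -
      have gG: "g \<in> hset G" using g F by blast
      have "x g - (U \<circ> y) g = U (M.tn x g - y g)"
        using M.H.bop_diff[OF U_bop M.tens_mem[OF x(1) gG] bop_mem[OF y gG]] U_apply[OF x(1) gG] by simp
      moreover have "hnorm M.HH (M.tn x g - y g) < e" using x(2)[rule_format, OF g] unfolding M.Lop_apply[OF gG] .
      ultimately show ?thesis using U_norm[OF M.H.diff_mem[OF M.tens_mem[OF x(1) gG] bop_mem[OF y gG]]] by simp
    qed
    then show "\<exists>x\<in>mset M. \<forall>g\<in>F. hnorm (sp T) (x g - (U \<circ> y) g) < e" using x(1) by blast
  qed
  moreover have "y = Lop G M (U \<circ> y)"
  proof (rule bop_eqI[OF y M.Lop_bop[OF calculation]])
    fix g assume g: "g \<in> hset G"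
    show "y g = Lop G M (U \<circ> y) g"
      using V_apply[OF \<open>U \<circ> y \<in> mset M\<close> g] VU_apply[OF bop_mem[OF y g]] M.Lop_apply[OF g] by simp
  qed
  ultimately show "y \<in> Lop G M ` mset M" by blast
qed

text \<open>
  The action of \<open>B\<close> on \<open>M \<odot> G\<close> is conjugate to \<open>\<rho>\<close> by the evaluation, and in particular normal.
\<close>

lemma M_left: assumes b: "b \<in> B" shows "tens_left G M M (lact M b) = V \<circ> (rho T b \<circ> U)"
  unfolding tens_left_def
proof (rule M.the_tens_op[OF M.H.hilb_axioms K.bop_comp[OF K.bop_comp[OF U_bop rho_bop[OF b]] V_bop]])
  fix x g assume x: "x \<in> mset M" and g: "g \<in> hset G"
  show "(V \<circ> (rho T b \<circ> U)) (M.tn x g) = M.tn (lact M b x) g"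
    using U_apply[OF x g] V_apply[OF M_lact[OF x b] g] by (simp del: M_simps(1))
qed

lemma M_bimodule: "von_neumann_bimodule G B G B M"
  unfolding von_neumann_bimodule_def
proof (intro conjI M_von_neumann_module)
  show "unital_left_action G B M" unfolding unital_left_action_def
  proof (intro conjI ballI allI)
    fix a x assume a: "a \<in> B" and x: "x \<in> mset M"
    show "lact M a x \<in> mset M" using M_lact[OF x a] by (simp only: M_simps)
    show "mip M x (lact M a y) = mip M (lact M (adj G G a) x) y" for y
      using adj_comp[OF hilb_axioms K.hilb_axioms K.hilb_axioms M_bop[OF x] rho_bop[OF B_adj[OF a]]] rho_adj[OF a] KK.adj_adj[OF rho_bop[OF a]]
      by (simp add: comp_assoc)
    show "lact M (z *\<^sub>C a) x = z *\<^sub>C lact M a x" for z by (simp add: rho_scale[OF a] fun_eq_iff)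
    show "lact M (a + b) x = lact M a x + lact M b x" "lact M (a \<circ> b) x = lact M a (lact M b x)" if "b \<in> B" for b
      by (simp_all add: rho_add[OF a that] rho_comp[OF a that] fun_eq_iff)
  next
    fix x assume x: "x \<in> mset M"
    show "lact M (id_on (hset G)) x = x" using K.id_comp[OF M_bop[OF x]] by (simp add: rho_id)
  qed
  have lb: "tens_left G M M (lact M b) \<in> bop M.HH M.HH" if "b \<in> B" for b
    unfolding M_left[OF that] by (rule K.bop_comp[OF K.bop_comp[OF U_bop rho_bop[OF that]] V_bop])
  show "normal_map G B M.HH (\<lambda>a. tens_left G M M (lact M a))"
  proof (subst normal_map_iff[OF hilb_axioms M.H.hilb_axioms subsetI[OF B_bop] lb], assumption+, intro allI impI)
    fix h k assume hk: "square_summable M.HH h \<and> square_summable M.HH k"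
    have hm: "h n \<in> hset M.HH" "k n \<in> hset M.HH" for n using hk M.H.square_summable_mem by auto
    have ss: "square_summable (sp T) (\<lambda>n. U (h n))" "square_summable (sp T) (\<lambda>n. U (k n))"
      using hk bop_mem[OF U_bop hm(1)] bop_mem[OF U_bop hm(2)] unfolding square_summable_def by (auto simp: U_norm hm)
    have "continuous_map (subtopology (sigma_weak_top G) B) euclidean (\<lambda>a. sw_fun (sp T) (\<lambda>n. U (h n)) (\<lambda>n. U (k n)) (rho T a))"
      by (rule iffD1[OF normal_map_iff[OF hilb_axioms K.hilb_axioms subsetI[OF B_bop] rho_bop] rho_normal, rule_format])
        (use ss in simp_all)
    then show "continuous_map (subtopology (sigma_weak_top G) B) euclidean (\<lambda>a. sw_fun M.HH h k (tens_left G M M (lact M a)))"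
    proof (rule continuous_map_eq)
      fix a assume "a \<in> topspace (subtopology (sigma_weak_top G) B)"
      then have a: "a \<in> B" by simp
      have "hip (sp T) (U (h n)) (rho T a (U (k n))) = hip M.HH (h n) (tens_left G M M (lact M a) (k n))" for n
        unfolding M_left[OF a] using MK.adj_ip'[OF U_bop hm(1) bop_mem[OF rho_bop[OF a] bop_mem[OF U_bop hm(2)]]] by simp
      then show "sw_fun (sp T) (\<lambda>n. U (h n)) (\<lambda>n. U (k n)) (rho T a) = sw_fun M.HH h k (tens_left G M M (lact M a))" by simp
    qed
  qed
qed

lemma evalop_triple_iso: "triple_iso G B (triple_of_module G M) T U"
proof -
  have "U \<circ> tens_left G M M (lact M b) = rho T b \<circ> U" if b: "b \<in> B" for b
    unfolding M_left[OF b]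
    by (rule bop_eqI[OF M.H.bop_comp[OF K.bop_comp[OF K.bop_comp[OF U_bop rho_bop[OF b]] V_bop] U_bop] K.bop_comp[OF U_bop rho_bop[OF b]]])
      (simp add: UV_apply bop_mem[OF rho_bop[OF b]] bop_mem[OF U_bop])
  moreover have "U \<circ> tens_right G M c = rho' T c \<circ> U" if c: "c \<in> commutant G B" for c
    by (rule M.bop_agree_tens[OF K.hilb_axioms M.H.bop_comp[OF M.tens_right_bop[OF c] U_bop] K.bop_comp[OF U_bop rho'_bop[OF c]]])
      (simp add: M.tens_right_apply[OF c] U_apply M.commutant_mem[OF c] M_rho'[OF _ c] del: M_simps)
  ultimately show ?thesis using U_unitary U_bop by (simp add: triple_iso_def triple_maps_def triple_of_module_def)
qed

end

section \<open>The equivalence\<close>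

lemma triple_mapsD:
  assumes "U \<in> triple_maps G B T1 T2"
  shows "U \<in> bop (sp T1) (sp T2)" "\<And>b u. b \<in> B \<Longrightarrow> U (rho T1 b u) = rho T2 b (U u)"
    "\<And>c u. c \<in> commutant G B \<Longrightarrow> U (rho' T1 c u) = rho' T2 c (U u)"
  using assms by (auto simp: triple_maps_def fun_eq_iff)

lemma post_comp_id:
  assumes "rep_triple G B T"
  shows "post_comp (mset (module_of_triple G B T)) (id_on (hset (sp T))) = id_on (mset (module_of_triple G B T))"
proof -
  interpret rep_triple G B T by fact
  have "id_on (hset (sp T)) \<circ> x = x" if "x \<in> mset M" for x by (rule K.id_comp[OF M_bop[OF that]])
  then show ?thesis unfolding post_comp_def id_on_def[of "mset M"] by (intro ext if_cong refl) (simp del: M_simps)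
qed

lemma post_comp_mem:
  assumes T1: "rep_triple G B T1" and T2: "rep_triple G B T2" and U: "U \<in> triple_maps G B T1 T2"
    and x: "x \<in> mset (module_of_triple G B T1)"
  shows "U \<circ> x \<in> mset (module_of_triple G B T2)"
proof -
  interpret A: rep_triple G B T1 by fact
  interpret C: rep_triple G B T2 by fact
  note u = triple_mapsD[OF U]
  show ?thesis
    by (rule C.M_I[OF A.K.bop_comp[OF A.M_bop[OF x] u(1)]]) (simp add: A.M_rho'[OF x] flip: u(3))
qed

lemma post_comp_bilinear:
  assumes T1: "rep_triple G B T1" and T2: "rep_triple G B T2" and U: "U \<in> triple_maps G B T1 T2"
  shows "post_comp (mset (module_of_triple G B T1)) U
    \<in> bilinear_maps B G B (module_of_triple G B T1) (module_of_triple G B T2)"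
proof -
  interpret A: rep_triple G B T1 by fact
  interpret C: rep_triple G B T2 by fact
  note u = triple_mapsD[OF U] and m = post_comp_mem[OF T1 T2 U]
  let ?f = "post_comp (mset A.M) U"
  have f: "?f x = U \<circ> x" if "x \<in> mset A.M" for x using that unfolding post_comp_def by (rule if_P)
  have f0: "?f x = 0" if "x \<notin> mset A.M" for x using that unfolding post_comp_def by (rule if_not_P)
  obtain k where k: "k \<ge> 0" "\<And>v. v \<in> hset (sp T1) \<Longrightarrow> hnorm (sp T2) (U v) \<le> k * hnorm (sp T1) v"
    using A.K.bop_bound[OF u(1)] by blast
  have "mnorm G C.M (?f x) \<le> k * mnorm G A.M x" if x: "x \<in> mset A.M" for x
    unfolding f[OF x]
  proof (rule C.M_mnorm_le[OF m[OF x]])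
    fix g assume g: "g \<in> hset G"
    show "hnorm (sp T2) ((U \<circ> x) g) \<le> k * mnorm G A.M x * hnorm G g"
      using k(2)[OF bop_mem[OF A.M_bop[OF x] g]] mult_left_mono[OF A.M_mnorm_bound[OF x g] k(1)] by (simp add: mult.assoc)
  qed (use k A.M_mnorm_nonneg[OF x] in simp)
  moreover have "?f (x + y) = ?f x + ?f y" if x: "x \<in> mset A.M" and y: "y \<in> mset A.M" for x y
    unfolding f[OF x] f[OF y] f[OF complex_vector.subspace_add[OF A.M_subspace x y]]
    by (simp add: fun_eq_iff bop_add[OF u(1)] A.K.bop_mem_all[OF A.M_bop[OF x]] A.K.bop_mem_all[OF A.M_bop[OF y]])
  moreover have "?f (z *\<^sub>C x) = z *\<^sub>C ?f x" if x: "x \<in> mset A.M" for x z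
    unfolding f[OF x] f[OF complex_vector.subspace_scale[OF A.M_subspace x]]
    by (simp add: fun_eq_iff bop_scale[OF u(1)] A.K.bop_mem_all[OF A.M_bop[OF x]])
  moreover have "?f (ract A.M x b) = ract C.M (?f x) b" if x: "x \<in> mset A.M" and b: "b \<in> B" for x b
    unfolding A.M_simps(3) C.M_simps(3) f[OF x] f[OF A.M_ract[OF x b]] by (simp add: comp_assoc)
  moreover have "?f (lact A.M b x) = lact C.M b (?f x)" if x: "x \<in> mset A.M" and b: "b \<in> B" for x b
    unfolding A.M_simps(4) C.M_simps(4) f[OF x] f[OF A.M_lact[OF x b]] by (simp add: fun_eq_iff u(2)[OF b])
  moreover have "?f x \<in> mset C.M" if "x \<in> mset A.M" for x unfolding f[OF that] by (rule m[OF that])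
  ultimately show ?thesis unfolding bilinear_maps_def lin_maps_def using f0 by blast
qed

lemma post_comp_comp:
  assumes T1: "rep_triple G B T1" and T2: "rep_triple G B T2" and U: "U \<in> triple_maps G B T1 T2" and V: "V 0 = 0"
  shows "post_comp (mset (module_of_triple G B T1)) (V \<circ> U)
    = post_comp (mset (module_of_triple G B T2)) V \<circ> post_comp (mset (module_of_triple G B T1)) U"
proof
  interpret C: rep_triple G B T2 by fact
  fix x
  have "V \<circ> 0 = 0" using V by (simp add: fun_eq_iff)
  then show "post_comp (mset (module_of_triple G B T1)) (V \<circ> U) x
    = (post_comp (mset (module_of_triple G B T2)) V \<circ> post_comp (mset (module_of_triple G B T1)) U) x"
    using post_comp_mem[OF T1 T2 U, of x] complex_vector.subspace_0[OF C.M_subspace]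
    by (cases "x \<in> mset (module_of_triple G B T1)") (simp_all add: post_comp_def comp_assoc del: C.M_simps)
qed

lemma (in vnbimod) Lmap_iso: "bimodule_iso B G B E (module_of_triple G B (triple_of_module G E)) (Lmap G E)"
proof -
  interpret R: rep_triple G B "triple_of_module G E"
    by unfold_locales (rule triple_of_module_is_triple)
  have T: "sp (triple_of_module G E) = HH" "rho (triple_of_module G E) b = lrep b" "rho' (triple_of_module G E) = tens_right G E" for b
    by (simp_all add: triple_of_module_def)
  have L: "Lmap G E x = Lop G E x" if "x \<in> mset E" for x using that by (simp add: Lmap_def)
  have m: "mset R.M = Lop G E ` mset E"
  proof (intro equalityI subsetI)
    fix y assume y: "y \<in> mset R.M"
    show "y \<in> Lop G E ` mset E"
      by (rule intertwiner_in_module) (use R.M_bop[OF y] R.M_rho'[OF y] in \<open>auto simp: T fun_eq_iff\<close>)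
  next
    fix y assume "y \<in> Lop G E ` mset E"
    then show "y \<in> mset R.M"
      using Lop_bop Lop_right by (auto simp: T intertwiners_def)
  qed
  have ip: "mip R.M (Lop G E x) (Lop G E y) = mip E x y" if "x \<in> mset E" "y \<in> mset E" for x y
    unfolding R.M_simps(2) T by (rule Lop_adj[OF that])
  have "Lmap G E x = 0" if "x \<notin> mset E" for x using that by (simp add: Lmap_def)
  moreover have "Lmap G E x \<in> mset R.M" if "x \<in> mset E" for x unfolding m L[OF that] using that by blast
  moreover have "Lmap G E (x + y) = Lmap G E x + Lmap G E y" if "x \<in> mset E" "y \<in> mset E" for x y
    using that by (simp add: L Lop_add)
  moreover have "Lmap G E (c *\<^sub>C x) = c *\<^sub>C Lmap G E x" if "x \<in> mset E" for x c
    using that by (simp add: L Lop_scale)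
  moreover have "Lmap G E (ract E x b) = ract R.M (Lmap G E x) b" if "x \<in> mset E" "b \<in> B" for x b
    using that by (simp add: L ract_mem Lop_ract)
  moreover have "Lmap G E (lact E b x) = lact R.M b (Lmap G E x)" if x: "x \<in> mset E" and b: "b \<in> B" for x b
    unfolding R.M_simps(4) T L[OF x] L[OF lact_mem[OF b x]]
    by (rule bop_eqI[OF Lop_bop[OF lact_mem[OF b x]] H.bop_comp[OF Lop_bop[OF x] lrep_bop[OF b]]])
      (simp add: Lop_apply lrep_apply[OF b x])
  moreover have "mnorm G R.M (Lmap G E x) \<le> 1 * mnorm G E x" if "x \<in> mset E" for x
    unfolding mnorm_def L[OF that] ip[OF that that] by simp
  ultimately have "Lmap G E \<in> bilinear_maps B G B E R.M"
    unfolding bilinear_maps_def lin_maps_def by blast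
  moreover have "bij_betw (Lmap G E) (mset E) (mset R.M)"
  proof (rule bij_betw_imageI)
    show "inj_on (Lmap G E) (mset E)"
    proof (rule inj_onI)
      fix x y assume x: "x \<in> mset E" and y: "y \<in> mset E" and e: "Lmap G E x = Lmap G E y"
      have "tn x g = tn y g" if "g \<in> hset G" for g
        using fun_cong[OF e, of g] unfolding L[OF x] L[OF y] Lop_apply[OF that] .
      then show "x = y" by (rule Lop_inj[OF x y])
    qed
    show "Lmap G E ` mset E = mset R.M" unfolding m using L by (intro image_cong) auto
  qed
  moreover have "mip R.M (Lmap G E x) (Lmap G E y) = mip E x y" if "x \<in> mset E" "y \<in> mset E" for x y
    unfolding L[OF that(1)] L[OF that(2)] by (rule ip[OF that])
  ultimately show ?thesis unfolding bimodule_iso_def by blast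
qed

lemma Lmap_natural:
  assumes E1: "vnbimod G B E1" and E2: "vnbimod G B E2" and a: "a \<in> bilinear_maps B G B E1 E2"
  shows "Lmap G E2 \<circ> a
    = post_comp (mset (module_of_triple G B (triple_of_module G E1))) (tens_left G E1 E2 a) \<circ> Lmap G E1"
proof
  interpret E1: vnbimod G B E1 by fact
  interpret E2: vnbimod G B E2 by fact
  interpret R: rep_triple G B "triple_of_module G E1"
    by unfold_locales (rule E1.triple_of_module_is_triple)
  note d = bilinear_mapsD[OF a] and t = tens_left_bilinear[OF assms]
  have iso: "bij_betw (Lmap G E1) (mset E1) (mset R.M)" using E1.Lmap_iso unfolding bimodule_iso_def by blast
  fix x
  show "(Lmap G E2 \<circ> a) x = (post_comp (mset R.M) (tens_left G E1 E2 a) \<circ> Lmap G E1) x"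
  proof (cases "x \<in> mset E1")
    case True
    note ax = d(2)[OF True]
    have "Lop G E2 (a x) = tens_left G E1 E2 a \<circ> Lop G E1 x"
      by (rule bop_eqI[OF E2.Lop_bop[OF ax] E1.H.bop_comp[OF E1.Lop_bop[OF True] t(1)]])
        (simp add: E1.Lop_apply E2.Lop_apply t(2) True)
    moreover have "Lmap G E1 x \<in> mset R.M" using bij_betwE[OF iso] True by blast
    ultimately show ?thesis using True ax by (simp add: post_comp_def Lmap_def del: R.M_simps)
  next
    case False
    have "post_comp (mset R.M) (tens_left G E1 E2 a) 0 = 0"
      using bop_zero[OF t(1)] unfolding post_comp_def by (simp add: fun_eq_iff del: R.M_simps)
    moreover have "Lmap G E2 0 = 0" using E2.Lop_scale[OF complex_vector.subspace_0[OF E2.E_subspace], of 0] by (simp add: Lmap_def)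
    moreover have "Lmap G E1 x = 0" using False by (simp add: Lmap_def)
    ultimately show ?thesis using d(1)[OF False] by (simp del: R.M_simps)
  qed
qed

lemma evalop_natural:
  assumes T1: "rep_triple G B T1" and T2: "rep_triple G B T2" and U: "U \<in> triple_maps G B T1 T2"
  shows "U \<circ> evalop G (module_of_triple G B T1) (sp T1)
    = evalop G (module_of_triple G B T2) (sp T2) \<circ>
      tens_left G (module_of_triple G B T1) (module_of_triple G B T2) (post_comp (mset (module_of_triple G B T1)) U)"
proof -
  interpret A: rep_triple G B T1 by fact
  interpret C: rep_triple G B T2 by fact
  have A: "vnbimod G B A.M" by (intro vnbimod.intro A.vna_axioms vnbimod_axioms.intro A.M_bimodule)
  have C: "vnbimod G B C.M" by (intro vnbimod.intro A.vna_axioms vnbimod_axioms.intro C.M_bimodule)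
  note u = triple_mapsD[OF U] and m = post_comp_mem[OF T1 T2 U]
  note t = tens_left_bilinear[OF A C post_comp_bilinear[OF T1 T2 U]]
  show ?thesis
  proof (rule A.M.bop_agree_tens[OF C.K.hilb_axioms A.K.bop_comp[OF A.U_bop u(1)] C.M.H.bop_comp[OF t(1) C.U_bop]])
    fix x g assume x: "x \<in> mset A.M" and g: "g \<in> hset G"
    have "post_comp (mset A.M) U x = U \<circ> x" using x unfolding post_comp_def by (rule if_P)
    then show "(U \<circ> A.U) (tens G A.M x g) = (C.U \<circ> tens_left G A.M C.M (post_comp (mset A.M) U)) (tens G A.M x g)"
      using A.U_apply[OF x g] C.U_apply[OF m[OF x] g] t(2)[OF x g] by simp
  qed
qed

subsection \<open>Exchanging the roles of an algebra and its commutant\<close>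

definition swap :: "('g, 'h) triple \<Rightarrow> ('g, 'h) triple" where
  "swap T = \<lparr>sp = sp T, rho = rho' T, rho' = rho T\<rparr>"

lemma sp_swap [simp]: "sp (swap T) = sp T"
  by (simp add: swap_def)

lemma rho_swap: "rho (swap T) = rho' T" "rho' (swap T) = rho T"
  by (simp_all add: swap_def)

lemma triple_of_module'_swap: "triple_of_module' G E = swap (triple_of_module G E)"
  by (simp add: swap_def triple_of_module'_def triple_of_module_def)

lemma swap_swap: "swap (swap T) = T"
  by (simp add: swap_def)

context vna
begin

lemma module'_of_triple_swap: "module'_of_triple G B T = module_of_triple G (commutant G B) (swap T)"
  by (simp add: swap_def module'_of_triple_def module_of_triple_def bicommutant)

lemma is_triple_swap: "is_triple G (commutant G B) (swap T) \<longleftrightarrow> is_triple G B T"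
  unfolding is_triple_def bicommutant swap_def by auto

lemma triple_maps_swap: "triple_maps G (commutant G B) (swap T1) (swap T2) = triple_maps G B T1 T2"
  unfolding triple_maps_def bicommutant swap_def by auto

lemma triple_iso_swap: "triple_iso G (commutant G B) (swap T1) (swap T2) U \<longleftrightarrow> triple_iso G B T1 T2 U"
  unfolding triple_iso_def triple_maps_swap by simp

lemma vnbimodI: "von_neumann_bimodule G B G B E \<Longrightarrow> vnbimod G B E"
  by (intro vnbimod.intro vna_axioms vnbimod_axioms.intro)
lemma rep_tripleI: "is_triple G B T \<Longrightarrow> rep_triple G B T"
  by (intro rep_triple.intro vna_axioms rep_triple_axioms.intro)

lemma module_to_triple:
  assumes "von_neumann_bimodule G B G B E"
  shows "is_interior_tensor G E (tspace G E) (tens G E) \<and>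
        is_triple G B (triple_of_module G E) \<and>
        (\<forall>x\<in>mset E. \<forall>g\<in>hset G.
          (\<forall>b\<in>B. rho (triple_of_module G E) b (tens G E x g) = tens G E (lact E b x) g) \<and>
          (\<forall>b'\<in>commutant G B. rho' (triple_of_module G E) b' (tens G E x g) = tens G E x (b' g))) \<and>
        tens_left G E E (id_on (mset E)) = id_on (hset (tspace G E))"
proof -
  interpret vnbimod G B E by (rule vnbimodI[OF assms])
  show ?thesis
    using interior_tensor triple_of_module_is_triple tens_left_id[OF hmod_axioms]
    by (simp add: triple_of_module_def lrep_apply tens_right_apply)
qed

lemma module_to_triple_map:
  assumes "von_neumann_bimodule G B G B E1 \<and> von_neumann_bimodule G B G B E2" "a \<in> bilinear_maps B G B E1 E2"
  shows "tens_left G E1 E2 a \<in> triple_maps G B (triple_of_module G E1) (triple_of_module G E2) \<and>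
          (\<forall>x\<in>mset E1. \<forall>g\<in>hset G. tens_left G E1 E2 a (tens G E1 x g) = tens G E2 (a x) g)"
proof -
  have "vnbimod G B E1" "vnbimod G B E2" using assms(1) by (auto intro: vnbimodI)
  from tens_left_triple_maps[OF this assms(2)] tens_left_bilinear(2)[OF this assms(2)] show ?thesis by blast
qed

lemma triple_to_module:
  assumes "is_triple G B T"
  shows "von_neumann_bimodule G B G B (module_of_triple G B T) \<and>
        post_comp (mset (module_of_triple G B T)) (id_on (hset (sp T))) = id_on (mset (module_of_triple G B T))"
  using rep_triple.M_bimodule[OF rep_tripleI[OF assms]] post_comp_id[OF rep_tripleI[OF assms]] by blast

lemma triple_to_module_to_triple:
  assumes "is_triple G B T"
  shows "triple_iso G B (triple_of_module G (module_of_triple G B T)) T (evalop G (module_of_triple G B T) (sp T)) \<and>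
        (\<forall>x\<in>mset (module_of_triple G B T). \<forall>g\<in>hset G.
          evalop G (module_of_triple G B T) (sp T) (tens G (module_of_triple G B T) x g) = x g)"
  using rep_triple.evalop_triple_iso[OF rep_tripleI[OF assms]] rep_triple.U_apply[OF rep_tripleI[OF assms]] by blast

end

theorem mainTheorem1:
  fixes G :: "'g::complex_vector hilbert" and B B' :: "('g \<Rightarrow> 'g) set"
  assumes "is_hilbert G" and "von_neumann_algebra G B" and "nondegenerate G B"
    and "B' = commutant G B"
  shows
    \<comment> \<open>the functor from B-B-modules to triples\<close>
    "(\<forall>E :: ('e1::complex_vector, 'g, 'g) bimodule. von_neumann_bimodule G B G B E \<longrightarrow>
        is_interior_tensor G E (tspace G E) (tens G E) \<and>
        is_triple G B (triple_of_module G E) \<and>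
        (\<forall>x\<in>mset E. \<forall>g\<in>hset G.
          (\<forall>b\<in>B. rho (triple_of_module G E) b (tens G E x g) = tens G E (lact E b x) g) \<and>
          (\<forall>b'\<in>B'. rho' (triple_of_module G E) b' (tens G E x g) = tens G E x (b' g))) \<and>
        tens_left G E E (id_on (mset E)) = id_on (hset (tspace G E))) \<and>
     (\<forall>(E1 :: ('e1, 'g, 'g) bimodule) (E2 :: ('e2::complex_vector, 'g, 'g) bimodule).
        von_neumann_bimodule G B G B E1 \<and> von_neumann_bimodule G B G B E2 \<longrightarrow>
        (\<forall>a\<in>bilinear_maps B G B E1 E2.
          tens_left G E1 E2 a \<in> triple_maps G B (triple_of_module G E1) (triple_of_module G E2) \<and>
          (\<forall>x\<in>mset E1. \<forall>g\<in>hset G. tens_left G E1 E2 a (tens G E1 x g) = tens G E2 (a x) g))) \<and>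
     (\<forall>(E1 :: ('e1, 'g, 'g) bimodule) (E2 :: ('e2, 'g, 'g) bimodule)
        (E3 :: ('e3::complex_vector, 'g, 'g) bimodule).
        von_neumann_bimodule G B G B E1 \<and> von_neumann_bimodule G B G B E2 \<and>
        von_neumann_bimodule G B G B E3 \<longrightarrow>
        (\<forall>a\<in>bilinear_maps B G B E1 E2. \<forall>c\<in>bilinear_maps B G B E2 E3.
          tens_left G E1 E3 (c \<circ> a) = tens_left G E2 E3 c \<circ> tens_left G E1 E2 a)) \<and>
    \<comment> \<open>the functor from triples to B-B-modules\<close>
     (\<forall>T :: ('g, 'h1::complex_vector) triple. is_triple G B T \<longrightarrow>
        von_neumann_bimodule G B G B (module_of_triple G B T) \<and>
        post_comp (mset (module_of_triple G B T)) (id_on (hset (sp T)))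
          = id_on (mset (module_of_triple G B T))) \<and>
     (\<forall>(T1 :: ('g, 'h1) triple) (T2 :: ('g, 'h2::complex_vector) triple).
        is_triple G B T1 \<and> is_triple G B T2 \<longrightarrow>
        (\<forall>U\<in>triple_maps G B T1 T2.
          post_comp (mset (module_of_triple G B T1)) U
            \<in> bilinear_maps B G B (module_of_triple G B T1) (module_of_triple G B T2))) \<and>
     (\<forall>(T1 :: ('g, 'h1) triple) (T2 :: ('g, 'h2) triple) (T3 :: ('g, 'h3::complex_vector) triple).
        is_triple G B T1 \<and> is_triple G B T2 \<and> is_triple G B T3 \<longrightarrow>
        (\<forall>U\<in>triple_maps G B T1 T2. \<forall>V\<in>triple_maps G B T2 T3.
          post_comp (mset (module_of_triple G B T1)) (V \<circ> U)
            = post_comp (mset (module_of_triple G B T2)) V \<circ> post_comp (mset (module_of_triple G B T1)) U)) \<and>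
    \<comment> \<open>these two functors are mutually inverse up to natural isomorphism\<close>
     (\<forall>E :: ('e1, 'g, 'g) bimodule. von_neumann_bimodule G B G B E \<longrightarrow>
        bimodule_iso B G B E (module_of_triple G B (triple_of_module G E)) (Lmap G E)) \<and>
     (\<forall>(E1 :: ('e1, 'g, 'g) bimodule) (E2 :: ('e2, 'g, 'g) bimodule).
        von_neumann_bimodule G B G B E1 \<and> von_neumann_bimodule G B G B E2 \<longrightarrow>
        (\<forall>a\<in>bilinear_maps B G B E1 E2.
          Lmap G E2 \<circ> a
            = post_comp (mset (module_of_triple G B (triple_of_module G E1))) (tens_left G E1 E2 a) \<circ> Lmap G E1)) \<and>
     (\<forall>T :: ('g, 'h1) triple. is_triple G B T \<longrightarrow>
        triple_iso G B (triple_of_module G (module_of_triple G B T)) T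
          (evalop G (module_of_triple G B T) (sp T)) \<and>
        (\<forall>x\<in>mset (module_of_triple G B T). \<forall>g\<in>hset G.
          evalop G (module_of_triple G B T) (sp T) (tens G (module_of_triple G B T) x g) = x g)) \<and>
     (\<forall>(T1 :: ('g, 'h1) triple) (T2 :: ('g, 'h2) triple). is_triple G B T1 \<and> is_triple G B T2 \<longrightarrow>
        (\<forall>U\<in>triple_maps G B T1 T2.
          U \<circ> evalop G (module_of_triple G B T1) (sp T1)
            = evalop G (module_of_triple G B T2) (sp T2) \<circ>
              tens_left G (module_of_triple G B T1) (module_of_triple G B T2)
                (post_comp (mset (module_of_triple G B T1)) U))) \<and>
    \<comment> \<open>the functor from B'-B'-modules to triples\<close>
     (\<forall>E' :: ('e1, 'g, 'g) bimodule. von_neumann_bimodule G B' G B' E' \<longrightarrow>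
        is_interior_tensor G E' (tspace G E') (tens G E') \<and>
        is_triple G B (triple_of_module' G E') \<and>
        (\<forall>x\<in>mset E'. \<forall>g\<in>hset G.
          (\<forall>b'\<in>B'. rho' (triple_of_module' G E') b' (tens G E' x g) = tens G E' (lact E' b' x) g) \<and>
          (\<forall>b\<in>B. rho (triple_of_module' G E') b (tens G E' x g) = tens G E' x (b g))) \<and>
        tens_left G E' E' (id_on (mset E')) = id_on (hset (tspace G E'))) \<and>
     (\<forall>(E1 :: ('e1, 'g, 'g) bimodule) (E2 :: ('e2, 'g, 'g) bimodule).
        von_neumann_bimodule G B' G B' E1 \<and> von_neumann_bimodule G B' G B' E2 \<longrightarrow>
        (\<forall>a\<in>bilinear_maps B' G B' E1 E2.
          tens_left G E1 E2 a \<in> triple_maps G B (triple_of_module' G E1) (triple_of_module' G E2) \<and>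
          (\<forall>x\<in>mset E1. \<forall>g\<in>hset G. tens_left G E1 E2 a (tens G E1 x g) = tens G E2 (a x) g))) \<and>
     (\<forall>(E1 :: ('e1, 'g, 'g) bimodule) (E2 :: ('e2, 'g, 'g) bimodule) (E3 :: ('e3, 'g, 'g) bimodule).
        von_neumann_bimodule G B' G B' E1 \<and> von_neumann_bimodule G B' G B' E2 \<and>
        von_neumann_bimodule G B' G B' E3 \<longrightarrow>
        (\<forall>a\<in>bilinear_maps B' G B' E1 E2. \<forall>c\<in>bilinear_maps B' G B' E2 E3.
          tens_left G E1 E3 (c \<circ> a) = tens_left G E2 E3 c \<circ> tens_left G E1 E2 a)) \<and>
    \<comment> \<open>the functor from triples to B'-B'-modules\<close>
     (\<forall>T :: ('g, 'h1) triple. is_triple G B T \<longrightarrow>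
        von_neumann_bimodule G B' G B' (module'_of_triple G B T) \<and>
        post_comp (mset (module'_of_triple G B T)) (id_on (hset (sp T)))
          = id_on (mset (module'_of_triple G B T))) \<and>
     (\<forall>(T1 :: ('g, 'h1) triple) (T2 :: ('g, 'h2) triple). is_triple G B T1 \<and> is_triple G B T2 \<longrightarrow>
        (\<forall>U\<in>triple_maps G B T1 T2.
          post_comp (mset (module'_of_triple G B T1)) U
            \<in> bilinear_maps B' G B' (module'_of_triple G B T1) (module'_of_triple G B T2))) \<and>
     (\<forall>(T1 :: ('g, 'h1) triple) (T2 :: ('g, 'h2) triple) (T3 :: ('g, 'h3) triple).
        is_triple G B T1 \<and> is_triple G B T2 \<and> is_triple G B T3 \<longrightarrow>
        (\<forall>U\<in>triple_maps G B T1 T2. \<forall>V\<in>triple_maps G B T2 T3.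
          post_comp (mset (module'_of_triple G B T1)) (V \<circ> U)
            = post_comp (mset (module'_of_triple G B T2)) V \<circ> post_comp (mset (module'_of_triple G B T1)) U)) \<and>
    \<comment> \<open>these two functors are mutually inverse up to natural isomorphism\<close>
     (\<forall>E' :: ('e1, 'g, 'g) bimodule. von_neumann_bimodule G B' G B' E' \<longrightarrow>
        bimodule_iso B' G B' E' (module'_of_triple G B (triple_of_module' G E')) (Lmap G E')) \<and>
     (\<forall>(E1 :: ('e1, 'g, 'g) bimodule) (E2 :: ('e2, 'g, 'g) bimodule).
        von_neumann_bimodule G B' G B' E1 \<and> von_neumann_bimodule G B' G B' E2 \<longrightarrow>
        (\<forall>a\<in>bilinear_maps B' G B' E1 E2.
          Lmap G E2 \<circ> a
            = post_comp (mset (module'_of_triple G B (triple_of_module' G E1))) (tens_left G E1 E2 a) \<circ> Lmap G E1)) \<and>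
     (\<forall>T :: ('g, 'h1) triple. is_triple G B T \<longrightarrow>
        triple_iso G B (triple_of_module' G (module'_of_triple G B T)) T
          (evalop G (module'_of_triple G B T) (sp T)) \<and>
        (\<forall>x\<in>mset (module'_of_triple G B T). \<forall>g\<in>hset G.
          evalop G (module'_of_triple G B T) (sp T) (tens G (module'_of_triple G B T) x g) = x g)) \<and>
     (\<forall>(T1 :: ('g, 'h1) triple) (T2 :: ('g, 'h2) triple). is_triple G B T1 \<and> is_triple G B T2 \<longrightarrow>
        (\<forall>U\<in>triple_maps G B T1 T2.
          U \<circ> evalop G (module'_of_triple G B T1) (sp T1)
            = evalop G (module'_of_triple G B T2) (sp T2) \<circ>
              tens_left G (module'_of_triple G B T1) (module'_of_triple G B T2)
                (post_comp (mset (module'_of_triple G B T1)) U)))"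
proof -
  have "vna G B" using assms(1-3) by (intro vna.intro hilb.intro vna_axioms.intro)
  then interpret B: vna G B .
  interpret C: vna G "commutant G B" by (rule B.vna_commutant)
  note to_commutant = triple_of_module'_swap B.module'_of_triple_swap B.is_triple_swap[symmetric]
    B.triple_maps_swap[symmetric] B.triple_iso_swap[symmetric] swap_swap
  show ?thesis unfolding assms(4)
    apply (intro conjI)
                       apply (intro allI impI, erule B.module_to_triple)
                      apply (intro allI impI ballI, erule (1) B.module_to_triple_map)
                     apply (intro allI impI ballI, elim conjE, rule tens_left_comp; (rule B.vnbimodI)?; assumption)
                    apply (intro allI impI, erule B.triple_to_module)
                   apply (intro allI impI ballI, elim conjE, rule post_comp_bilinear; (rule B.rep_tripleI)?; assumption)
                  apply (intro allI impI ballI, elim conjE, rule post_comp_comp[OF _ _ _ bop_zero[OF triple_mapsD(1)]]; (rule B.rep_tripleI)?; assumption)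
                 apply (intro allI impI, erule vnbimod.Lmap_iso[OF B.vnbimodI])
                apply (intro allI impI ballI, elim conjE, rule Lmap_natural; (rule B.vnbimodI)?; assumption)
               apply (intro allI impI, erule B.triple_to_module_to_triple)
              apply (intro allI impI ballI, elim conjE, rule evalop_natural; (rule B.rep_tripleI)?; assumption)
    \<comment> \<open>The other half of the statement is the same for the algebra \<open>B'\<close>, with the representations of each triple exchanged.\<close>
    unfolding to_commutant
             apply (intro allI impI, drule C.module_to_triple, unfold B.bicommutant rho_swap, assumption)
            apply (intro allI impI ballI, erule (1) C.module_to_triple_map)
           apply (intro allI impI ballI, elim conjE, rule tens_left_comp; (rule C.vnbimodI)?; assumption)
          apply (intro allI impI, erule C.triple_to_module[of "swap T" for T, unfolded sp_swap])
         apply (intro allI impI ballI, elim conjE, rule post_comp_bilinear; (rule C.rep_tripleI)?; assumption)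
        apply (intro allI impI ballI, elim conjE, rule post_comp_comp[OF _ _ _ bop_zero[OF triple_mapsD(1)]]; (rule C.rep_tripleI)?; assumption)
       apply (intro allI impI, erule vnbimod.Lmap_iso[OF C.vnbimodI])
      apply (intro allI impI ballI, elim conjE, rule Lmap_natural; (rule C.vnbimodI)?; assumption)
     apply (intro allI impI, erule C.triple_to_module_to_triple[of "swap T" for T, unfolded sp_swap])
    apply (intro allI impI ballI, elim conjE, rule evalop_natural[of G "commutant G B" "swap T1" "swap T2" for T1 T2, unfolded sp_swap]; (rule C.rep_tripleI)?; assumption)
    done
qed

end
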